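(* Let $\epsilon>0$ be given. Then there is a family of partial Boolean functions $F$ on $\{-1,1\}^N\times\{-1,1\}^N$ (for infinitely many $N$) with $Q^{\mathrm{cc}}_{1/3}(F)=O(\log N)$ and $R^{\mathrm{cc}}_{1/3}(F)=\Omega(N^{1-\epsilon})$.
   Context: A partial Boolean function on $\{-1,1\}^N\times\{-1,1\}^N$ is a map $F\colon\{-1,1\}^N\times\{-1,1\}^N\to\{0,1,*\}$. A two-party communication protocol (Alice holding $x$, Bob holding $y$) computes $F$ with error $\epsilon$ if on every $(x,y)$ with $F(x,y)\in\{0,1\}$ it outputs $F(x,y)$ with probability at least $1-\epsilon$. $R^{\mathrm{cc}}_\epsilon(F)$ and $Q^{\mathrm{cc}}_\epsilon(F)$ denote the minimum communication cost of a randomized (public- or private-coin, classical) protocol and of a quantum protocol, respectively, computing $F$ with error $\epsilon$. *)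

theory Defs
  imports
    "HOL-Library.Landau_Symbols"
    "HOL-Library.FuncSet"
    "HOL-Probability.Probability_Mass_Function"
    "Jordan_Normal_Form.Schur_Decomposition"
begin

section \<open>Partial Boolean functions on the sign cube\<close>

type_synonym point = "nat \<Rightarrow> int"

definition cube :: "nat \<Rightarrow> point set" where
  "cube N = {..<N} \<rightarrow>\<^sub>E {-1, 1}"

text \<open>
  The value \<open>*\<close> is \<^const>\<open>None\<close>, and 0, 1 are \<^term>\<open>Some False\<close>, \<^term>\<open>Some True\<close>.  Only the
  values on \<^term>\<open>cube N \<times> cube N\<close> matter.
\<close>

type_synonym partial_fun = "point \<Rightarrow> point \<Rightarrow> bool option"

text \<open>\<open>p x y v\<close> is the probability that the protocol outputs \<open>v\<close> on the input pair \<open>(x, y)\<close>.\<close>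

definition computes ::
    "nat \<Rightarrow> real \<Rightarrow> partial_fun \<Rightarrow> (point \<Rightarrow> point \<Rightarrow> bool \<Rightarrow> real) \<Rightarrow> bool" where
  "computes N \<epsilon> F p \<longleftrightarrow>
     (\<forall>x\<in>cube N. \<forall>y\<in>cube N. \<forall>v. F x y = Some v \<longrightarrow> p x y v \<ge> 1 - \<epsilon>)"

section \<open>Classical randomized communication\<close>

text \<open>
  In \<open>Alice a t0 t1\<close>, Alice sends the bit \<open>a x\<close> and the protocol continues with \<open>t1\<close> or \<open>t0\<close>.
\<close>

datatype tree =
    Out bool
  | Alice "point \<Rightarrow> bool" tree tree
  | Bob "point \<Rightarrow> bool" tree tree

primrec run :: "tree \<Rightarrow> point \<Rightarrow> point \<Rightarrow> bool" where
  "run (Out b) x y = b"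
| "run (Alice a t0 t1) x y = (if a x then run t1 x y else run t0 x y)"
| "run (Bob b t0 t1) x y = (if b y then run t1 x y else run t0 x y)"

primrec depth :: "tree \<Rightarrow> nat" where
  "depth (Out b) = 0"
| "depth (Alice a t0 t1) = Suc (max (depth t0) (depth t1))"
| "depth (Bob b t0 t1) = Suc (max (depth t0) (depth t1))"

text \<open>
  A randomized protocol is a distribution on deterministic protocol trees.  This is the public-coin
  model; private-coin protocols are the special case in which the random choices
  used at Alice's and at Bob's nodes are independent.
\<close>

definition R_cc :: "real \<Rightarrow> nat \<Rightarrow> partial_fun \<Rightarrow> nat" where
  "R_cc \<epsilon> N F = Inf {c. \<exists>P :: tree pmf.
     (\<forall>t\<in>set_pmf P. depth t \<le> c) \<and>
     computes N \<epsilon> F (\<lambda>x y v. pmf (map_pmf (\<lambda>t. run t x y) P) v)}"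

section \<open>Quantum communication\<close>

definition tensor_mat :: "complex mat \<Rightarrow> complex mat \<Rightarrow> complex mat"  (infixl \<open>\<otimes>\<^sub>m\<close> 70) where
  "A \<otimes>\<^sub>m B = mat (dim_row A * dim_row B) (dim_col A * dim_col B)
     (\<lambda>(i, j). A $$ (i div dim_row B, j div dim_col B) * B $$ (i mod dim_row B, j mod dim_col B))"

definition unitary_mats :: "nat \<Rightarrow> complex mat set" where
  "unitary_mats d = {U \<in> carrier_mat d d. mat_adjoint U * U = 1\<^sub>m d \<and> U * mat_adjoint U = 1\<^sub>m d}"

text \<open>
  The model is Yao's, without prior entanglement.  There are \<open>n\<close> qubits on a line, all
  initially \<open>|0\<rangle>\<close>.  At each moment Alice holds the leftmost \<open>k\<close> of them and Bob the remaining
  \<open>n - k\<close>.  In a move \<open>Alice_move U m\<close>, Alice applies the unitary \<open>U x\<close> to all her qubits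
  and then sends her rightmost \<open>m\<close> qubits to Bob; \<open>Bob_move V m\<close> is the mirror image.  The cost is the
  number of qubits sent.  Since \<open>U x\<close> is an arbitrary unitary, which qubits are sent
  is no restriction.
\<close>

datatype qmove =
    Alice_move "point \<Rightarrow> complex mat" nat
  | Bob_move "point \<Rightarrow> complex mat" nat

primrec qvalid :: "nat \<Rightarrow> nat \<Rightarrow> qmove list \<Rightarrow> bool" where
  "qvalid n k [] \<longleftrightarrow> k \<le> n"
| "qvalid n k (mv # mvs) \<longleftrightarrow> k \<le> n \<and>
     (case mv of
        Alice_move U m \<Rightarrow> (\<forall>x. U x \<in> unitary_mats (2 ^ k)) \<and> m \<le> k \<and> qvalid n (k - m) mvs
      | Bob_move V m \<Rightarrow> (\<forall>y. V y \<in> unitary_mats (2 ^ (n - k))) \<and> m \<le> n - k \<and> qvalid n (k + m) mvs)"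

primrec qrun :: "nat \<Rightarrow> nat \<Rightarrow> qmove list \<Rightarrow> point \<Rightarrow> point \<Rightarrow> complex vec \<Rightarrow> complex vec" where
  "qrun n k [] x y \<psi> = \<psi>"
| "qrun n k (mv # mvs) x y \<psi> =
     (case mv of
        Alice_move U m \<Rightarrow> qrun n (k - m) mvs x y ((U x \<otimes>\<^sub>m 1\<^sub>m (2 ^ (n - k))) *\<^sub>v \<psi>)
      | Bob_move V m \<Rightarrow> qrun n (k + m) mvs x y ((1\<^sub>m (2 ^ k) \<otimes>\<^sub>m V y) *\<^sub>v \<psi>))"

primrec qubits_sent :: "qmove \<Rightarrow> nat" where
  "qubits_sent (Alice_move U m) = m"
| "qubits_sent (Bob_move V m) = m"

definition qcost :: "qmove list \<Rightarrow> nat" where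
  "qcost mvs = sum_list (map qubits_sent mvs)"

text \<open>
  The output is the result of measuring one designated qubit of the final state (by whichever
  player holds it).  Basis states are numbered by binary expansions with the leftmost
  qubit as the most significant digit; the designated qubit is given by its digit position \<open>j\<close>.
\<close>

definition qoutput_prob ::
    "nat \<Rightarrow> nat \<Rightarrow> qmove list \<Rightarrow> nat \<Rightarrow> point \<Rightarrow> point \<Rightarrow> bool \<Rightarrow> real" where
  "qoutput_prob n k mvs j x y v =
     (\<Sum>i | i < 2 ^ n \<and> bit i j = v. (cmod (vec_index (qrun n k mvs x y (unit_vec (2 ^ n) 0)) i))\<^sup>2)"

definition Q_cc :: "real \<Rightarrow> nat \<Rightarrow> partial_fun \<Rightarrow> nat" where
  "Q_cc \<epsilon> N F = Inf {c. \<exists>n k mvs j.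
     qvalid n k mvs \<and> j < n \<and> qcost mvs \<le> c \<and> computes N \<epsilon> F (qoutput_prob n k mvs j)}"


section \<open>The sets of attainable costs are nonempty\<close>

text \<open>Hence the infima in \<^const>\<open>R_cc\<close> and \<^const>\<open>Q_cc\<close> are attained minima.\<close>

lemma nat_Inf_mem: "(c :: nat) \<in> S \<Longrightarrow> Inf S \<in> S"
  by (metis Inf_nat_def1 empty_iff)

primrec reveal_tree :: "partial_fun \<Rightarrow> nat \<Rightarrow> point \<Rightarrow> tree" where
  "reveal_tree F 0 w = Bob (\<lambda>y. F w y = Some True) (Out False) (Out True)"
| "reveal_tree F (Suc k) w =
     Alice (\<lambda>x. x k = 1) (reveal_tree F k (w(k := -1))) (reveal_tree F k (w(k := 1)))"

lemma depth_reveal_tree: "depth (reveal_tree F k w) = Suc k"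
  by (induction k arbitrary: w) auto

lemma run_reveal_tree:
  assumes "x \<in> cube N" "k \<le> N"
  shows "run (reveal_tree F k w) x y \<longleftrightarrow> F (\<lambda>i. if i < k then x i else w i) y = Some True"
  using assms(2)
proof (induction k arbitrary: w)
  case (Suc k)
  have "x k = 1 \<or> x k = -1"
    using assms(1) Suc.prems by (fastforce simp: cube_def PiE_iff)
  then have "run (reveal_tree F (Suc k) w) x y = run (reveal_tree F k (w(k := x k))) x y"
    by (elim disjE) simp_all
  moreover have "(\<lambda>i. if i < k then x i else (w(k := x k)) i) =
      (\<lambda>i. if i < Suc k then x i else w i)"
    by (auto simp: fun_eq_iff less_Suc_eq)
  ultimately show ?case
    using Suc.IH[of "w(k := x k)"] Suc_leD[OF Suc.prems] by (simp only:)
qed auto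

lemma R_cc_attained:
  assumes "\<epsilon> \<ge> 0"
  shows "\<exists>P. (\<forall>t\<in>set_pmf P. depth t \<le> R_cc \<epsilon> N F) \<and>
           computes N \<epsilon> F (\<lambda>x y v. pmf (map_pmf (\<lambda>t. run t x y) P) v)"
proof -
  let ?t = "reveal_tree F N (\<lambda>_. undefined)"
  let ?S = "{c. \<exists>P. (\<forall>t\<in>set_pmf P. depth t \<le> c) \<and>
     computes N \<epsilon> F (\<lambda>x y v. pmf (map_pmf (\<lambda>t. run t x y) P) v)}"
  have "run ?t x y \<longleftrightarrow> F x y = Some True" if "x \<in> cube N" for x y
  proof -
    have "(\<lambda>i. if i < N then x i else undefined) = x"
      using that PiE_arb[of x "{..<N}" "\<lambda>_. {-1, 1}"] unfolding cube_def by (intro ext) simp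
    then show ?thesis
      using run_reveal_tree[OF that order_refl, of F "\<lambda>_. undefined" y] by (simp only:)
  qed
  then have "computes N \<epsilon> F (\<lambda>x y v. pmf (map_pmf (\<lambda>t. run t x y) (return_pmf ?t)) v)"
    using assms by (auto simp: computes_def pmf_return)
  then have "Suc N \<in> ?S"
    by (intro CollectI exI[of _ "return_pmf ?t"]) (auto simp: depth_reveal_tree)
  then have "Inf ?S \<in> ?S" by (rule nat_Inf_mem)
  then show ?thesis unfolding R_cc_def by simp
qed

definition invol_mat :: "nat \<Rightarrow> (nat \<Rightarrow> nat) \<Rightarrow> complex mat" where
  "invol_mat d s = mat d d (\<lambda>(i, j). if i = s j then 1 else 0)"

lemma invol_mat_unitary:
  assumes "\<And>i. i < d \<Longrightarrow> s i < d" "\<And>i. i < d \<Longrightarrow> s (s i) = i"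
  shows "invol_mat d s \<in> unitary_mats d"
proof -
  have adj: "mat_adjoint (invol_mat d s) = invol_mat d s"
    using assms by (intro eq_matI) (auto simp: mat_adjoint_def invol_mat_def mat_of_rows_def)
  have "invol_mat d s * invol_mat d s = 1\<^sub>m d"
  proof (intro eq_matI)
    fix i j assume ij: "i < dim_row (1\<^sub>m d :: complex mat)" "j < dim_col (1\<^sub>m d :: complex mat)"
    have "(invol_mat d s * invol_mat d s) $$ (i, j)
            = (\<Sum>l\<in>{0..<d}. (if i = s l then 1 else 0) * (if l = s j then 1 else 0))"
      using ij by (simp add: invol_mat_def scalar_prod_def)
    also have "\<dots> = (\<Sum>l\<in>{0..<d}. if l = s j then (if i = s l then 1 else 0) else 0)"
      by (intro sum.cong) auto
    also have "\<dots> = (1\<^sub>m d :: complex mat) $$ (i, j)"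
      using ij assms by (simp add: sum.delta)
    finally show "(invol_mat d s * invol_mat d s) $$ (i, j) = 1\<^sub>m d $$ (i, j)" .
  qed (auto simp: invol_mat_def)
  then show ?thesis
    unfolding unitary_mats_def by (simp add: adj) (simp add: invol_mat_def)
qed

lemma invol_mat_mult_unit_vec:
  assumes "i < d" "s i < d"
  shows "invol_mat d s *\<^sub>v unit_vec d i = unit_vec d (s i)"
  using assms by (intro eq_vecI) (auto simp: invol_mat_def)

lemma tensor_invol_mat_right:
  assumes "e > 0"
  shows "invol_mat d s \<otimes>\<^sub>m 1\<^sub>m e = invol_mat (d * e) (\<lambda>i. s (i div e) * e + i mod e)"
proof (intro eq_matI)
  fix i j
  assume ij: "i < dim_row (invol_mat (d * e) (\<lambda>i. s (i div e) * e + i mod e))"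
             "j < dim_col (invol_mat (d * e) (\<lambda>i. s (i div e) * e + i mod e))"
  have "i div e < d" "j div e < d" "i mod e < e" "j mod e < e"
    using ij assms by (auto simp: invol_mat_def less_mult_imp_div_less)
  moreover have "i div e = s (j div e) \<and> i mod e = j mod e \<longleftrightarrow> i = s (j div e) * e + j mod e"
    using assms div_mult_mod_eq[of i e]
    by (metis div_mult_self3 div_less mod_less mod_mult_self3 \<open>j mod e < e\<close> add_0_right less_numeral_extra(3))
  ultimately show "(invol_mat d s \<otimes>\<^sub>m 1\<^sub>m e) $$ (i, j)
      = invol_mat (d * e) (\<lambda>i. s (i div e) * e + i mod e) $$ (i, j)"
    using ij by (auto simp: tensor_mat_def invol_mat_def)
qed (auto simp: tensor_mat_def invol_mat_def)

lemma tensor_one_left: "1\<^sub>m 1 \<otimes>\<^sub>m A = A"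
  by (intro eq_matI) (auto simp: tensor_mat_def)

lemma Q_cc_attained:
  assumes "\<epsilon> \<ge> 0"
  shows "\<exists>n k mvs j. qvalid n k mvs \<and> j < n \<and> qcost mvs \<le> Q_cc \<epsilon> N F \<and>
           computes N \<epsilon> F (qoutput_prob n k mvs j)"
proof -
  let ?S = "{c. \<exists>n k mvs j. qvalid n k mvs \<and> j < n \<and> qcost mvs \<le> c \<and>
     computes N \<epsilon> F (qoutput_prob n k mvs j)}"
  have "finite (cube N)" "card (cube N) = (2 :: nat) ^ N"
    by (auto simp: cube_def card_PiE numeral_2_eq_2 intro!: finite_PiE)
  then obtain enc where enc: "bij_betw enc (cube N) {0..<2 ^ N :: nat}"
    using ex_bij_betw_finite_nat by metis
  define dec where "dec = inv_into (cube N) enc"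
  have dec: "dec (enc x) = x" "enc x < 2 ^ N" if "x \<in> cube N" for x
    using enc that unfolding dec_def bij_betw_def by (auto simp: inv_into_f_f)
  define s where "s x = (if x \<in> cube N then Transposition.transpose 0 (enc x) else id)" for x
  define r where "r y i = (if F (dec (i div 2)) y = Some True
                           then if even i then i + 1 else i - 1 else i)" for y and i :: nat
  define U where "U x = invol_mat (2 ^ N) (s x)" for x
  define V where "V y = invol_mat (2 ^ Suc N) (r y)" for y
  let ?mvs = "[Alice_move U N, Bob_move V 0]"
  have s: "s x i < 2 ^ N" "s x (s x i) = i" if "i < 2 ^ N" for x i
    using that dec by (auto simp: s_def Transposition.transpose_def)
  have r: "r y i < 2 ^ Suc N" "r y (r y i) = i" if "i < 2 ^ Suc N" for y i
    using that by (auto simp: r_def elim!: evenE oddE)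
  have "qvalid (Suc N) N ?mvs"
    using s r by (auto simp: U_def V_def intro!: invol_mat_unitary)
  moreover have "qcost ?mvs \<le> N" by (simp add: qcost_def)
  moreover have "computes N \<epsilon> F (qoutput_prob (Suc N) N ?mvs 0)"
    unfolding computes_def
  proof (intro ballI allI impI)
    fix x y v assume x: "x \<in> cube N" and y: "y \<in> cube N" and F: "F x y = Some v"
    define i where "i = 2 * enc x + of_bool v"
    have i: "i < 2 ^ Suc N" "bit i 0 = v"
      using dec[OF x] by (auto simp: i_def bit_0)
    have "(U x \<otimes>\<^sub>m 1\<^sub>m (2 ^ (Suc N - N))) *\<^sub>v unit_vec (2 ^ Suc N) 0
            = unit_vec (2 ^ Suc N) (2 * enc x)"
      using dec[OF x] x invol_mat_mult_unit_vec[of 0 "2 ^ Suc N" "\<lambda>i. s x (i div 2) * 2 + i mod 2"]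
      by (simp add: U_def tensor_invol_mat_right s_def mult.commute)
    moreover have "(1\<^sub>m (2 ^ (N - N)) \<otimes>\<^sub>m V y) *\<^sub>v unit_vec (2 ^ Suc N) (2 * enc x)
            = unit_vec (2 ^ Suc N) i"
      using dec[OF x] invol_mat_mult_unit_vec[of "2 * enc x" "2 ^ Suc N" "r y"] i F
      by (cases v) (auto simp: V_def tensor_one_left[unfolded One_nat_def] r_def i_def)
    ultimately have "qrun (Suc N) N ?mvs x y (unit_vec (2 ^ Suc N) 0) = unit_vec (2 ^ Suc N) i"
      by simp
    then have "qoutput_prob (Suc N) N ?mvs 0 x y v
        = (\<Sum>l | l < 2 ^ Suc N \<and> bit l 0 = v. if l = i then 1 else 0)"
      unfolding qoutput_prob_def by (intro sum.cong) (auto simp: unit_vec_def simp del: qrun.simps)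
    also have "\<dots> = 1" using i by (simp add: sum.delta)
    finally show "qoutput_prob (Suc N) N ?mvs 0 x y v \<ge> 1 - \<epsilon>" using assms by simp
  qed
  ultimately have "qvalid (Suc N) N ?mvs \<and> 0 < Suc N \<and> qcost ?mvs \<le> N \<and>
      computes N \<epsilon> F (qoutput_prob (Suc N) N ?mvs 0)"
    by (intro conjI zero_less_Suc)
  then have "N \<in> ?S" by (intro CollectI exI)
  then have "Inf ?S \<in> ?S" by (rule nat_Inf_mem)
  then show ?thesis unfolding Q_cc_def by simp
qed

end

theory Submission
  imports Defs "HOL-Probability.Probability" "HOL-Real_Asymp.Real_Asymp"
begin

text \<open>
  The function is a lifted k-fold forrelation.  Let \<open>M\<close> be a multiple of a random symmetric sign
  matrix, scaled to be a contraction all of whose small minors have tiny norm.  For \<open>2k + 1\<close> layers of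
  signs \<open>z\<close>, the form \<open>ph\<close> is \<open>u\<^sup>T Z\<^sub>2\<^sub>k M \<dots> M Z\<^sub>0 u\<close> with \<open>u\<close> the
  uniform unit vector and \<open>Z\<^sub>p\<close> diagonal.  It is an amplitude of a short sequence of unitaries, so amplitude
  amplification decides with \<open>O(log N)\<close> qubits whether it is near 0 or near a fixed positive constant.

  Signs of Gaussian vectors with correlation \<open>M\<close> yield a density \<open>dens\<close> on sign strings under which
  \<open>ph\<close> concentrates at that constant, whereas under the uniform distribution it concentrates at 0.  Entropy
  decay along the layers (each step contracts by the squared norm of a minor) shows that the density has average
  almost 1 on every subcube of small codimension.  Each sign is finally encoded as the inner product of two
  blocks of bits.  A rectangle of inputs is split into pieces on which the unfixed blocks are dense, so that the
  gadget outputs are almost uniform on a subcube; hence no large rectangle distinguishes the two distributions.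
\<close>

section \<open>Finite averages and entropy\<close>

text \<open>Entropy controls a layer only on average over its fixed coordinates, whereas the lifting
  argument needs a lower bound for every fixing. Hence the path is generated from both ends and
  closed at the middle layer: a subcube average of the density becomes a convolution of two
  densities of mean 1, and \<open>x * y \<ge> 1 - max 0 (1 - x) - max 0 (1 - y)\<close> turns two
  small mean deficits into a bound valid for every fixing. One-sided bounds suffice, since a
  rectangle only has to receive not much less weight from the density than from the uniform law.

  For codimension about \<open>n powr (1 - \<delta>)\<close>, a minor has squared norm about
  \<open>n powr (- \<delta>)\<close> up to a logarithm, so \<open>k\<close> steps with
  \<open>k * \<delta> \<ge> 2\<close> beat an initial entropy of order \<open>n\<close>. As
  \<open>k\<close> depends on \<epsilon> alone, the planted value \<open>cc ^ (2 * k)\<close> stays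
  away from 0 and the number of amplification rounds stays bounded.

  Signs whose means are sines of Gaussians, instead of hard signs, make every expectation a finite
  combination of Gaussian characteristic functions.\<close>

definition avg :: "'a set \<Rightarrow> ('a \<Rightarrow> real) \<Rightarrow> real" where
  "avg A f = (\<Sum>a\<in>A. f a) / real (card A)"

lemma avg_add: "avg A (\<lambda>x. f x + g x) = avg A f + avg A g"
  by (simp add: avg_def sum.distrib add_divide_distrib)

lemma avg_diff: "avg A (\<lambda>x. f x - g x) = avg A f - avg A g"
  by (simp add: avg_def sum_subtractf diff_divide_distrib)

lemma avg_cmult: "avg A (\<lambda>x. c * f x) = c * avg A f"
  by (simp add: avg_def sum_distrib_left)

lemma avg_multc: "avg A (\<lambda>x. f x * c) = avg A f * c"
  by (simp add: avg_def sum_distrib_right)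

lemma avg_divide: "avg A (\<lambda>x. f x / c) = avg A f / c"
  by (simp add: avg_def sum_divide_distrib[symmetric])

lemma avg_sum: "avg A (\<lambda>x. \<Sum>i\<in>I. f i x) = (\<Sum>i\<in>I. avg A (f i))"
  unfolding avg_def by (subst sum.swap) (simp add: sum_divide_distrib)

lemma avg_swap: "avg A (\<lambda>x. avg B (f x)) = avg B (\<lambda>y. avg A (\<lambda>x. f x y))"
  unfolding avg_def by (simp add: sum_divide_distrib[symmetric]) (subst sum.swap, simp add: mult.commute)

lemma avg_cong: "(\<And>x. x \<in> A \<Longrightarrow> f x = g x) \<Longrightarrow> avg A f = avg A g"
  unfolding avg_def by (metis (mono_tags, lifting) sum.cong)

lemma avg_mono: "(\<And>x. x \<in> A \<Longrightarrow> f x \<le> g x) \<Longrightarrow> avg A f \<le> avg A g"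
  unfolding avg_def by (intro divide_right_mono sum_mono) auto

lemma avg_nonneg: "(\<And>x. x \<in> A \<Longrightarrow> 0 \<le> f x) \<Longrightarrow> 0 \<le> avg A f"
  unfolding avg_def by (intro divide_nonneg_nonneg sum_nonneg) auto

lemma avg_const: "finite A \<Longrightarrow> A \<noteq> {} \<Longrightarrow> avg A (\<lambda>_. c) = c"
  by (simp add: avg_def)

lemma avg_singleton [simp]: "avg {a} f = f a"
  by (simp add: avg_def)

lemma avg_bij: "bij_betw \<pi> A B \<Longrightarrow> avg A (\<lambda>x. f (\<pi> x)) = avg B f"
  unfolding avg_def using sum.reindex_bij_betw[of \<pi> A B f] bij_betw_same_card[of \<pi> A B] by simp

section \<open>Sign cubes and their translations\<close>

definition cb :: "nat \<Rightarrow> (nat \<Rightarrow> real) set" where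
  "cb n = {..<n} \<rightarrow>\<^sub>E {-1, 1}"

lemma finite_cb [simp]: "finite (cb n)"
  by (auto simp: cb_def intro!: finite_PiE)

lemma card_cb: "card (cb n) = 2 ^ n"
  by (simp add: cb_def card_PiE numeral_2_eq_2)

lemma cb_nonempty [simp]: "cb n \<noteq> {}"
  by (simp add: cb_def PiE_eq_empty_iff)

lemma cb_values: "s \<in> cb n \<Longrightarrow> i < n \<Longrightarrow> s i = -1 \<or> s i = 1"
  unfolding cb_def by (drule PiE_mem[of _ _ _ i]) auto

lemma cb_sq: "s \<in> cb n \<Longrightarrow> i < n \<Longrightarrow> s i * s i = 1"
  using cb_values[of s n i] by auto

lemma cb_abs: "s \<in> cb n \<Longrightarrow> i < n \<Longrightarrow> \<bar>s i\<bar> = 1"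
  using cb_values[of s n i] by auto

lemma avg_cb_Suc:
  "avg (cb (Suc n)) f = avg (cb n) (\<lambda>s. (f (s(n := 1)) + f (s(n := -1))) / 2)"
proof -
  have eq: "cb (Suc n) = (\<lambda>(y, g). g(n := y)) ` ({-1, 1} \<times> cb n)"
    unfolding cb_def by (simp add: lessThan_Suc PiE_insert_eq)
  have inj: "inj_on (\<lambda>(y, g). g(n := y)) ({-1, 1 :: real} \<times> cb n)"
  proof (rule inj_onI, clarify)
    fix y y' :: real and g g' :: "nat \<Rightarrow> real"
    assume g: "g \<in> cb n" "g' \<in> cb n" and e: "g(n := y) = g'(n := y')"
    have "y = y'" using fun_cong[OF e, of n] by simp
    moreover have "g i = g' i" for i
      using fun_cong[OF e, of i] g PiE_arb[of g "{..<n}" _ n] PiE_arb[of g' "{..<n}" _ n]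
      by (cases "i = n") (auto simp: cb_def)
    ultimately show "y = y' \<and> g = g'" by auto
  qed
  have "(\<Sum>s\<in>cb (Suc n). f s) = (\<Sum>(y, g)\<in>{-1, 1} \<times> cb n. f (g(n := y)))"
    unfolding eq by (subst sum.reindex[OF inj]) (simp add: case_prod_unfold)
  also have "\<dots> = (\<Sum>g\<in>cb n. f (g(n := -1))) + (\<Sum>g\<in>cb n. f (g(n := 1)))"
    by (simp add: sum.cartesian_product[symmetric])
  finally show ?thesis
    by (simp add: avg_def card_cb sum.distrib sum_divide_distrib[symmetric] add.commute)
qed

lemma avg_cb_prod:
  "avg (cb n) (\<lambda>s. \<Prod>i<n. f i (s i)) = (\<Prod>i<n. (f i 1 + f i (-1)) / 2)"
proof -
  have "(\<Sum>s\<in>cb n. \<Prod>i<n. f i (s i)) = (\<Prod>i<n. \<Sum>x\<in>{-1, 1}. f i x)"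
    unfolding cb_def by (subst prod_sum_PiE) auto
  then show ?thesis
    by (simp add: avg_def card_cb prod_dividef add.commute)
qed

text \<open>The group law of the cube, cut to \<open>{..<n}\<close> so that products stay
  extensional and can be compared as functions.\<close>

definition sm :: "nat \<Rightarrow> (nat \<Rightarrow> real) \<Rightarrow> (nat \<Rightarrow> real) \<Rightarrow> nat \<Rightarrow> real" where
  "sm n z s = (\<lambda>i\<in>{..<n}. z i * s i)"

lemma sm_apply [simp]: "i < n \<Longrightarrow> sm n z s i = z i * s i"
  by (simp add: sm_def)

lemma sm_cb: "z \<in> cb n \<Longrightarrow> s \<in> cb n \<Longrightarrow> sm n z s \<in> cb n"
proof -
  assume zs: "z \<in> cb n" "s \<in> cb n"
  have "z i * s i \<in> {-1, 1}" if "i < n" for i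
    using cb_values[OF zs(1) that] cb_values[OF zs(2) that] by auto
  then show ?thesis by (auto simp: cb_def sm_def)
qed

lemma sm_sm: "z \<in> cb n \<Longrightarrow> s \<in> cb n \<Longrightarrow> sm n z (sm n z s) = s"
proof (rule ext)
  fix i assume "z \<in> cb n" "s \<in> cb n"
  then show "sm n z (sm n z s) i = s i"
    using cb_sq[of z n i] PiE_arb[of s "{..<n}" _ i]
    by (cases "i < n") (auto simp: sm_def cb_def simp flip: mult.assoc)
qed

lemma sm_commute: "sm n z s = sm n s z"
  by (simp add: sm_def mult.commute)

lemma avg_sm:
  assumes "z \<in> cb n"
  shows "avg (cb n) (\<lambda>s. f (sm n z s)) = avg (cb n) f"
proof (rule avg_bij)
  show "bij_betw (sm n z) (cb n) (cb n)"
    by (rule bij_betw_byWitness[of _ "sm n z"]) (auto simp: sm_sm sm_cb assms)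
qed

text \<open>Multiplication by \<open>z\<close> is a measure-preserving involution. This is the
  substitution that trades a layer for the input of the next kernel.\<close>

lemma avg_sm2:
  assumes "z \<in> cb n"
  shows "avg (cb n) (\<lambda>s. f s (sm n z s)) = avg (cb n) (\<lambda>u. f (sm n z u) u)"
proof -
  have "avg (cb n) (\<lambda>s. f s (sm n z s)) = avg (cb n) (\<lambda>s. f (sm n z (sm n z s)) (sm n z s))"
    by (rule avg_cong) (simp add: sm_sm assms)
  also have "\<dots> = avg (cb n) (\<lambda>u. f (sm n z u) u)"
    by (rule avg_sm[OF assms, of "\<lambda>u. f (sm n z u) u"])
  finally show ?thesis .
qed

section \<open>The entropy function and its binary increments\<close>

definition eta :: "real \<Rightarrow> real" where "eta x = x * ln x"

lemma eta_0 [simp]: "eta 0 = 0" and eta_1 [simp]: "eta 1 = 0"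
  by (simp_all add: eta_def)

lemma eta_mult: "0 < x \<Longrightarrow> 0 \<le> y \<Longrightarrow> eta (x * y) = y * eta x + x * eta y"
  by (cases "y = 0") (auto simp: eta_def ln_mult algebra_simps)

lemma ln_ge_sqrt: assumes "0 < (x::real)" shows "x * ln x \<ge> 2 * x - 2 * sqrt x"
proof -
  have s: "0 < sqrt x" "x = sqrt x * sqrt x" using assms by auto
  have "ln (1 / sqrt x) \<le> 1 / sqrt x - 1" using s by (intro ln_le_minus_one) auto
  then have "ln (sqrt x) \<ge> 1 - 1 / sqrt x" using s by (simp add: ln_div)
  then have "ln x \<ge> 2 - 2 / sqrt x" using assms by (simp add: ln_sqrt)
  then have "x * ln x \<ge> x * (2 - 2 / sqrt x)" using assms by (intro mult_left_mono) auto
  moreover have "x * (2 - 2 / sqrt x) = 2 * x - 2 * sqrt x"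
    using s by (simp add: field_simps)
  ultimately show ?thesis by simp
qed

text \<open>The bound \<open>ln_ge_sqrt\<close> leaves the remainder
  \<open>(sqrt x - 1)\<^sup>2\<close>, which is \<open>(x - 1)\<^sup>2\<close> divided by
  \<open>(sqrt x + 1)\<^sup>2\<close>, and on [0, 2] this divisor is at most 6. The factors 6 in the
  entropy estimates below come from here.\<close>

lemma eta_ge_sq:
  assumes "0 \<le> x" "x \<le> 2"
  shows "eta x \<ge> x - 1 + (x - 1)\<^sup>2 / 6"
proof (cases "x = 0")
  case False
  then have x: "0 < x" using assms by simp
  have "(sqrt x - 1)\<^sup>2 * 6 \<ge> (sqrt x - 1)\<^sup>2 * (sqrt x + 1)\<^sup>2"
  proof (rule mult_left_mono)
    \<comment> \<open>1.42 exceeds the square root of 2, and 2.42 squared is still below 6.\<close>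
    have "sqrt x \<le> 1.42" using assms by (intro real_le_lsqrt) (auto simp: power2_eq_square)
    then have "(sqrt x + 1)\<^sup>2 \<le> (2.42)\<^sup>2" using x by (intro power_mono) auto
    then show "(sqrt x + 1)\<^sup>2 \<le> 6" by (simp add: power2_eq_square)
  qed auto
  moreover have "(sqrt x - 1)\<^sup>2 * (sqrt x + 1)\<^sup>2 = (x - 1)\<^sup>2"
  proof -
    have "(sqrt x - 1) * (sqrt x + 1) = x - 1" using x by (simp add: algebra_simps)
    then show ?thesis by (metis power_mult_distrib)
  qed
  moreover have "(sqrt x - 1)\<^sup>2 = x + 1 - 2 * sqrt x"
    using x by (simp add: power2_eq_square algebra_simps)
  ultimately show ?thesis using ln_ge_sqrt[OF x] by (simp add: eta_def)
qed (simp add: eta_def)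

lemma eta_ge: assumes "0 \<le> x" shows "eta x \<ge> x - 1"
proof (cases "x = 0")
  case False
  have "sqrt x * 2 \<le> x + 1" using assms arith_geo_mean_sqrt[of x 1] by simp
  with False assms show ?thesis using ln_ge_sqrt[of x] by (simp add: eta_def)
qed simp

text \<open>Each logarithm is compared with its tangent at the common ratio \<open>P / R\<close>;
  the linear terms cancel in the sum.\<close>

lemma log_sum:
  fixes w p q :: "'a \<Rightarrow> real"
  assumes "finite A" and w: "\<And>a. a \<in> A \<Longrightarrow> 0 \<le> w a" and p: "\<And>a. a \<in> A \<Longrightarrow> 0 \<le> p a"
    and q: "\<And>a. a \<in> A \<Longrightarrow> 0 \<le> q a" and pq: "\<And>a. a \<in> A \<Longrightarrow> q a = 0 \<Longrightarrow> p a = 0"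
  defines "P \<equiv> \<Sum>a\<in>A. w a * p a" and "R \<equiv> \<Sum>a\<in>A. w a * q a"
  shows "P * ln (P / R) \<le> (\<Sum>a\<in>A. w a * (p a * ln (p a / q a)))"
proof (cases "P = 0")
  case True
  then have "\<And>a. a \<in> A \<Longrightarrow> w a * p a = 0"
    unfolding P_def using assms(1) w p by (subst (asm) sum_nonneg_eq_0_iff) auto
  then have "(\<Sum>a\<in>A. w a * (p a * ln (p a / q a))) = 0"
    by (intro sum.neutral) (auto simp flip: mult.assoc)
  with True show ?thesis by simp
next
  case False
  then have P: "P > 0" unfolding P_def using w p by (simp add: order_less_le sum_nonneg)
  have R: "R > 0"
  proof (rule ccontr)
    assume "\<not> R > 0"
    then have "R = 0" unfolding R_def using w q by (simp add: order_less_le sum_nonneg)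
    then have "\<And>a. a \<in> A \<Longrightarrow> w a * q a = 0"
      unfolding R_def using assms(1) w q by (subst (asm) sum_nonneg_eq_0_iff) auto
    then have "P = 0" unfolding P_def using pq by (intro sum.neutral) force
    with False show False by simp
  qed
  have step: "w a * p a * ln (P / R) + w a * p a - w a * q a * (P / R) \<le> w a * (p a * ln (p a / q a))"
    if a: "a \<in> A" for a
  proof (cases "p a = 0")
    case True
    have "0 \<le> w a * q a * (P / R)" using P R w[OF a] q[OF a] by simp
    with True show ?thesis by simp
  next
    case False
    then have pa: "p a > 0" "q a > 0" using p[OF a] q[OF a] pq[OF a] by force+
    have "ln ((P / R) / (p a / q a)) \<le> (P / R) / (p a / q a) - 1"
      using P R pa by (intro ln_le_minus_one) auto
    then have "ln (P / R) + 1 - (P / R) * q a / p a \<le> ln (p a / q a)"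
      using P R pa by (subst (asm) ln_div) (auto simp: algebra_simps)
    then have "p a * (ln (P / R) + 1 - (P / R) * q a / p a) \<le> p a * ln (p a / q a)"
      using pa by (intro mult_left_mono) auto
    then have "p a * ln (P / R) + p a - q a * (P / R) \<le> p a * ln (p a / q a)"
      using pa by (simp add: algebra_simps)
    then have "w a * (p a * ln (P / R) + p a - q a * (P / R)) \<le> w a * (p a * ln (p a / q a))"
      using w[OF a] by (intro mult_left_mono) auto
    then show ?thesis by (simp add: algebra_simps)
  qed
  have "(\<Sum>a\<in>A. w a * p a * ln (P / R) + w a * p a - w a * q a * (P / R))
      = P * ln (P / R) + P - R * (P / R)"
    unfolding P_def R_def by (simp only: sum.distrib sum_subtractf sum_distrib_right)
  also have "\<dots> = P * ln (P / R)" using R by simp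
  finally have "P * ln (P / R) = (\<Sum>a\<in>A. w a * p a * ln (P / R) + w a * p a - w a * q a * (P / R))"
    by simp
  also have "\<dots> \<le> (\<Sum>a\<in>A. w a * (p a * ln (p a / q a)))"
    by (rule sum_mono) (rule step)
  finally show ?thesis .
qed

text \<open>The term of one bit in the chain rule for entropy: its two values carry the densities
  \<open>x + y\<close> and \<open>x - y\<close>, whose marginal is \<open>x\<close>.\<close>

definition bin_gap :: "real \<Rightarrow> real \<Rightarrow> real" where
  "bin_gap x y = (eta (x + y) + eta (x - y)) / 2 - eta x"

lemma bin_gap_eq:
  assumes "\<bar>y\<bar> \<le> x"
  shows "bin_gap x y = ((x + y) * ln ((x + y) / x) + (x - y) * ln ((x - y) / x)) / 2"
proof -
  have *: "p * ln (p / x) = eta p - p * ln x" if "0 \<le> p" "p \<le> 2 * x" for p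
    using that by (cases "p = 0") (auto simp: eta_def ln_div right_diff_distrib)
  show ?thesis
    unfolding bin_gap_def using assms
    by (subst (1 2) *) (auto simp: eta_def field_simps)
qed

text \<open>In the form \<open>bin_gap_eq\<close> the gap is half a sum of two relative-entropy
  terms against \<open>x\<close>. Such terms are homogeneous and jointly convex, so
  \<open>log_sum\<close> applies to each half.\<close>

lemma bin_gap_Jensen:
  fixes w x y :: "'a \<Rightarrow> real"
  assumes "finite A" and w: "\<And>a. a \<in> A \<Longrightarrow> 0 \<le> w a" and xy: "\<And>a. a \<in> A \<Longrightarrow> \<bar>y a\<bar> \<le> x a"
  shows "bin_gap (\<Sum>a\<in>A. w a * x a) (\<Sum>a\<in>A. w a * y a) \<le> (\<Sum>a\<in>A. w a * bin_gap (x a) (y a))"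
proof -
  let ?X = "\<Sum>a\<in>A. w a * x a" and ?Y = "\<Sum>a\<in>A. w a * y a"
  have XY: "\<bar>?Y\<bar> \<le> ?X"
    by (rule order_trans[OF sum_abs]) (auto intro!: sum_mono mult_left_mono simp: abs_mult w xy)
  have 1: "(\<Sum>a\<in>A. w a * (x a + y a)) = ?X + ?Y" "(\<Sum>a\<in>A. w a * (x a - y a)) = ?X - ?Y"
    by (simp_all add: algebra_simps sum.distrib sum_subtractf)
  have "(?X + ?Y) * ln ((?X + ?Y) / ?X) \<le> (\<Sum>a\<in>A. w a * ((x a + y a) * ln ((x a + y a) / x a)))"
    by (subst (1 2) 1(1)[symmetric], rule log_sum) (use assms(1) w xy in \<open>force+\<close>)
  moreover have "(?X - ?Y) * ln ((?X - ?Y) / ?X) \<le> (\<Sum>a\<in>A. w a * ((x a - y a) * ln ((x a - y a) / x a)))"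
    by (subst (1 2) 1(2)[symmetric], rule log_sum) (use assms(1) w xy in \<open>force+\<close>)
  ultimately have "bin_gap ?X ?Y \<le> ((\<Sum>a\<in>A. w a * ((x a + y a) * ln ((x a + y a) / x a)))
      + (\<Sum>a\<in>A. w a * ((x a - y a) * ln ((x a - y a) / x a)))) / 2"
    unfolding bin_gap_eq[OF XY] by simp
  also have "\<dots> = (\<Sum>a\<in>A. w a * bin_gap (x a) (y a))"
    by (subst sum.distrib[symmetric], subst sum_divide_distrib, rule sum.cong)
      (auto simp: bin_gap_eq xy algebra_simps)
  finally show ?thesis .
qed

text \<open>By homogeneity \<open>x = 1\<close>, where the gap lies between
  \<open>v\<^sup>2 / 6\<close> and \<open>v\<^sup>2\<close>. Shrinking the bias by \<open>t\<close>
  therefore gains \<open>t\<^sup>2\<close>, up to the factor 6.\<close>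

lemma bin_gap_scale:
  assumes "\<bar>y\<bar> \<le> x" "\<bar>t\<bar> \<le> 1"
  shows "bin_gap x (t * y) \<le> 6 * t\<^sup>2 * bin_gap x y"
proof (cases "x = 0")
  case False
  then have x: "x > 0" using assms by linarith
  define v where "v = y / x"
  have v: "\<bar>v\<bar> \<le> 1" and y: "y = x * v" using assms x by (auto simp: v_def)
  have hom: "bin_gap x (x * v) = x * bin_gap 1 v" if "\<bar>v\<bar> \<le> 1" for v
  proof -
    have "eta (x + x * v) = (1 + v) * eta x + x * eta (1 + v)"
      using eta_mult[of x "1 + v"] x that by (simp add: algebra_simps)
    moreover have "eta (x - x * v) = (1 - v) * eta x + x * eta (1 - v)"
      using eta_mult[of x "1 - v"] x that by (simp add: algebra_simps)
    ultimately show ?thesis unfolding bin_gap_def by (simp add: algebra_simps)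
  qed
  have tv: "\<bar>t * v\<bar> \<le> 1" using v assms by (simp add: abs_mult mult_le_one)
  have up: "bin_gap 1 u \<le> u\<^sup>2" if "\<bar>u\<bar> \<le> 1" for u
  proof -
    have "eta (1 + u) \<le> (1 + u) * u"
      using that ln_le_minus_one[of "1 + u"] by (cases "1 + u = 0") (auto simp: eta_def intro!: mult_left_mono)
    moreover have "eta (1 - u) \<le> (1 - u) * (- u)"
      using that ln_le_minus_one[of "1 - u"] unfolding eta_def
      by (cases "1 - u = 0") (simp, intro mult_left_mono, auto)
    ultimately show ?thesis unfolding bin_gap_def by (simp add: power2_eq_square algebra_simps)
  qed
  have lo: "bin_gap 1 v \<ge> v\<^sup>2 / 6"
    using eta_ge_sq[of "1 + v"] eta_ge_sq[of "1 - v"] v unfolding bin_gap_def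
    by (simp add: abs_le_iff)
  have "bin_gap x (t * y) = x * bin_gap 1 (t * v)"
    using hom[OF tv] by (simp add: y mult.left_commute)
  also have "\<dots> \<le> x * (t\<^sup>2 * v\<^sup>2)"
    using up[OF tv] x by (intro mult_left_mono) (auto simp: power_mult_distrib)
  also have "\<dots> \<le> x * (t\<^sup>2 * (6 * bin_gap 1 v))"
    using lo x by (intro mult_left_mono) auto
  also have "\<dots> = 6 * t\<^sup>2 * bin_gap x y" by (simp add: y hom[OF v])
  finally show ?thesis .
qed (use assms in \<open>simp add: bin_gap_def\<close>)

text \<open>The scaling bound at \<open>t = 1\<close> reads \<open>B \<le> 6 * B\<close>, which
  forces \<open>0 \<le> B\<close>.\<close>

lemma bin_gap_nonneg: assumes "\<bar>y\<bar> \<le> x" shows "0 \<le> bin_gap x y"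
  using bin_gap_scale[OF assms, of 0] bin_gap_scale[OF assms, of 1] by simp

text \<open>Entropy decay under independent sign noise: the coordinate weights \<open>I i\<close> are the conditional
  entropy deficits of the chain rule, and they do not depend on the noise parameters \<open>t\<close>.\<close>

lemma noise_entropy:
  assumes "\<And>s. s \<in> cb n \<Longrightarrow> 0 \<le> F s"
  shows "\<exists>I. (\<forall>i<n. 0 \<le> I i) \<and> (\<Sum>i<n. I i) = avg (cb n) (\<lambda>s. eta (F s)) - eta (avg (cb n) F) \<and>
    (\<forall>t. (\<forall>i<n. \<bar>t i\<bar> \<le> 1) \<longrightarrow>
      avg (cb n) (\<lambda>e. eta (avg (cb n) (\<lambda>a. F a * (\<Prod>i<n. 1 + a i * (e i * t i))))) - eta (avg (cb n) F)
        \<le> 6 * (\<Sum>i<n. (t i)\<^sup>2 * I i))"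
  using assms
proof (induction n arbitrary: F)
  case 0
  have "cb 0 = {\<lambda>_. undefined}" by (simp add: cb_def)
  then show ?case by simp
next
  case (Suc n)
  \<comment> \<open>Even and odd part in the last coordinate. \<open>F0\<close> is the marginal on
    the other coordinates, and noise on the last one multiplies \<open>F1\<close> alone.\<close>
  define F0 where "F0 s = (F (s(n := 1)) + F (s(n := -1))) / 2" for s
  define F1 where "F1 s = (F (s(n := 1)) - F (s(n := -1))) / 2" for s
  have mem: "s(n := 1) \<in> cb (Suc n)" "s(n := -1) \<in> cb (Suc n)" if "s \<in> cb n" for s
    using that by (auto simp: cb_def PiE_iff extensional_def less_Suc_eq)
  have F01: "\<bar>F1 s\<bar> \<le> F0 s" "0 \<le> F0 s" if "s \<in> cb n" for s
    using Suc.prems[OF mem(1)[OF that]] Suc.prems[OF mem(2)[OF that]]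
    unfolding F0_def F1_def abs_le_iff by (simp_all del: fun_upd_apply add: field_simps)
  have Fs: "F (s(n := 1)) = F0 s + F1 s" "F (s(n := -1)) = F0 s - F1 s" for s
    by (simp_all add: F0_def F1_def field_simps)
  have avF: "avg (cb (Suc n)) F = avg (cb n) F0"
    unfolding avg_cb_Suc by (rule avg_cong) (simp add: F0_def)
  from Suc.IH[of F0] F01 obtain I where I: "\<forall>i<n. 0 \<le> I i"
    "(\<Sum>i<n. I i) = avg (cb n) (\<lambda>s. eta (F0 s)) - eta (avg (cb n) F0)"
    "\<And>t. (\<forall>i<n. \<bar>t i\<bar> \<le> 1) \<Longrightarrow>
      avg (cb n) (\<lambda>e. eta (avg (cb n) (\<lambda>a. F0 a * (\<Prod>i<n. 1 + a i * (e i * t i))))) - eta (avg (cb n) F0)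
        \<le> 6 * (\<Sum>i<n. (t i)\<^sup>2 * I i)"
    by blast
  \<comment> \<open>The chain-rule term of the last coordinate given the others.\<close>
  define In where "In = avg (cb n) (\<lambda>s. bin_gap (F0 s) (F1 s))"
  have In0: "0 \<le> In" unfolding In_def by (intro avg_nonneg bin_gap_nonneg F01)
  define I' where "I' = I(n := In)"
  show ?case
  proof (intro exI[of _ I'] conjI allI impI)
    show "0 \<le> I' i" if "i < Suc n" for i
      using that I(1) In0 by (auto simp: I'_def less_Suc_eq)
    have "avg (cb (Suc n)) (\<lambda>s. eta (F s)) = avg (cb n) (\<lambda>s. eta (F0 s) + bin_gap (F0 s) (F1 s))"
      by (simp add: avg_cb_Suc Fs bin_gap_def)
    then show "sum I' {..<Suc n} = avg (cb (Suc n)) (\<lambda>s. eta (F s)) - eta (avg (cb (Suc n)) F)"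
      using I(2) by (simp add: I'_def avF avg_add In_def)
  next
    fix t :: "nat \<Rightarrow> real" assume t: "\<forall>i<Suc n. \<bar>t i\<bar> \<le> 1"
    define W where "W e a = (\<Prod>i<n. 1 + a i * (e i * t i))" for e a :: "nat \<Rightarrow> real"
    have W0: "0 \<le> W e a" if "e \<in> cb n" "a \<in> cb n" for e a
      unfolding W_def
    proof (rule prod_nonneg, clarify)
      fix i assume "i < n"
      then have "\<bar>a i * (e i * t i)\<bar> \<le> 1" using t cb_abs[OF that(1)] cb_abs[OF that(2)]
        by (simp add: abs_mult)
      then show "0 \<le> 1 + a i * (e i * t i)" by linarith
    qed
    have W1: "avg (cb n) (\<lambda>e. W e a) = 1" for a
      unfolding W_def by (subst avg_cb_prod) simp
    define D0 where "D0 e = avg (cb n) (\<lambda>a. F0 a * W e a)" for e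
    define D1 where "D1 e = avg (cb n) (\<lambda>a. F1 a * W e a)" for e
    have D: "avg (cb (Suc n)) (\<lambda>a. F a * (\<Prod>i<Suc n. 1 + a i * ((e(n := v)) i * t i))) = D0 e + t n * (v * D1 e)"
      for e v
    proof -
      have "avg (cb (Suc n)) (\<lambda>a. F a * (\<Prod>i<Suc n. 1 + a i * ((e(n := v)) i * t i)))
         = avg (cb n) (\<lambda>a. F0 a * W e a + t n * v * (F1 a * W e a))"
        unfolding avg_cb_Suc W_def by (rule avg_cong) (simp add: F0_def F1_def field_simps)
      then show ?thesis by (simp add: avg_add avg_cmult D0_def D1_def)
    qed
    have D01: "\<bar>D1 e\<bar> \<le> D0 e" if "e \<in> cb n" for e
    proof -
      have "\<bar>D1 e\<bar> \<le> avg (cb n) (\<lambda>a. \<bar>F1 a * W e a\<bar>)"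
        unfolding D1_def avg_def by (auto simp: abs_div intro!: divide_right_mono sum_abs)
      also have "\<dots> \<le> D0 e"
        unfolding D0_def by (rule avg_mono) (auto simp: abs_mult W0 that intro!: mult_right_mono F01)
      finally show ?thesis .
    qed
    have "avg (cb (Suc n)) (\<lambda>e. eta (avg (cb (Suc n)) (\<lambda>a. F a * (\<Prod>i<Suc n. 1 + a i * (e i * t i)))))
        = avg (cb n) (\<lambda>e. eta (D0 e) + bin_gap (D0 e) (t n * D1 e))"
      by (subst avg_cb_Suc, unfold D, rule avg_cong) (simp add: bin_gap_def)
    \<comment> \<open>The noise on the last coordinate is paid for here.\<close>
    also have "\<dots> \<le> avg (cb n) (\<lambda>e. eta (D0 e) + 6 * (t n)\<^sup>2 * bin_gap (D0 e) (D1 e))"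
      using t D01 by (intro avg_mono add_left_mono bin_gap_scale) auto
    \<comment> \<open>Convexity removes the noise on the other coordinates. As \<open>W\<close> has
      mean 1 over \<open>e\<close>, what remains is \<open>In\<close>, whatever the other noise
      parameters are.\<close>
    also have "\<dots> \<le> avg (cb n) (\<lambda>e. eta (D0 e) + 6 * (t n)\<^sup>2 * avg (cb n) (\<lambda>a. W e a * bin_gap (F0 a) (F1 a)))"
    proof (intro avg_mono add_left_mono mult_left_mono)
      fix e assume e: "e \<in> cb n"
      have "bin_gap (\<Sum>a\<in>cb n. W e a / 2 ^ n * F0 a) (\<Sum>a\<in>cb n. W e a / 2 ^ n * F1 a)
          \<le> (\<Sum>a\<in>cb n. W e a / 2 ^ n * bin_gap (F0 a) (F1 a))"
        by (rule bin_gap_Jensen) (auto simp: W0 e F01)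
      then show "bin_gap (D0 e) (D1 e) \<le> avg (cb n) (\<lambda>a. W e a * bin_gap (F0 a) (F1 a))"
        by (simp add: D0_def D1_def avg_def card_cb sum_divide_distrib mult.commute)
    qed auto
    also have "\<dots> = avg (cb n) (\<lambda>e. eta (D0 e)) + 6 * (t n)\<^sup>2 * In"
      by (simp add: avg_add avg_cmult, subst avg_swap) (simp add: avg_multc W1 In_def)
    finally have "avg (cb (Suc n)) (\<lambda>e. eta (avg (cb (Suc n)) (\<lambda>a. F a * (\<Prod>i<Suc n. 1 + a i * (e i * t i)))))
        \<le> avg (cb n) (\<lambda>e. eta (D0 e)) + 6 * (t n)\<^sup>2 * In" .
    moreover have "avg (cb n) (\<lambda>e. eta (D0 e)) - eta (avg (cb n) F0) \<le> 6 * (\<Sum>i<n. (t i)\<^sup>2 * I i)"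
      unfolding D0_def W_def using t by (intro I(3)) auto
    ultimately show "avg (cb (Suc n)) (\<lambda>e. eta (avg (cb (Suc n)) (\<lambda>a. F a * (\<Prod>i<Suc n. 1 + a i * (e i * t i)))))
        - eta (avg (cb (Suc n)) F) \<le> 6 * (\<Sum>i<Suc n. (t i)\<^sup>2 * I' i)"
      by (simp add: avF I'_def algebra_simps)
  qed
qed

lemma avg_Jensen_sq: "(avg A f)\<^sup>2 \<le> avg A (\<lambda>x. (f x)\<^sup>2)"
proof (cases "finite A \<and> A \<noteq> {}")
  case True
  then have "card A > 0" by (simp add: card_gt_0_iff)
  then have c: "real (card A) > 0" by linarith
  have "(\<Sum>x\<in>A. f x)\<^sup>2 \<le> (\<Sum>x\<in>A. (f x)\<^sup>2) * card A"
    using Cauchy_Schwarz_ineq_sum[of f "\<lambda>_. 1" A] by simp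
  then have "(\<Sum>x\<in>A. f x)\<^sup>2 / (real (card A))\<^sup>2 \<le> (\<Sum>x\<in>A. (f x)\<^sup>2) * card A / (real (card A))\<^sup>2"
    by (intro divide_right_mono) auto
  then show ?thesis using c(1) unfolding avg_def
    by (simp add: power_divide power2_eq_square)
qed (auto simp: avg_def)

text \<open>An inequality of Pinsker type. Below 1 the quadratic bound for \<open>eta\<close>
  dominates the squared deficit, above 1 the deficit vanishes, and the linear terms cancel because
  the mean is 1.\<close>

lemma deficit_le_entropy:
  assumes "\<And>s. s \<in> A \<Longrightarrow> 0 \<le> f s" "avg A f = 1"
  shows "avg A (\<lambda>s. max 0 (1 - f s)) \<le> sqrt (6 * avg A (\<lambda>s. eta (f s)))"
proof -
  have fin: "finite A" "A \<noteq> {}" 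
    using assms(2) by (metis avg_def card.infinite div_by_0 of_nat_0 zero_neq_one,
      metis avg_def card.empty div_by_0 of_nat_0 zero_neq_one assms(2))
  have "(avg A (\<lambda>s. max 0 (1 - f s)))\<^sup>2 \<le> avg A (\<lambda>s. (max 0 (1 - f s))\<^sup>2)"
    by (rule avg_Jensen_sq)
  also have "\<dots> \<le> avg A (\<lambda>s. 6 * (eta (f s) - f s + 1))"
  proof (rule avg_mono)
    fix s assume s: "s \<in> A"
    show "(max 0 (1 - f s))\<^sup>2 \<le> 6 * (eta (f s) - f s + 1)"
    proof (cases "f s \<le> 1")
      case True
      then have "(max 0 (1 - f s))\<^sup>2 = (f s - 1)\<^sup>2" by (simp add: power2_commute max_def)
      then show ?thesis using eta_ge_sq[of "f s"] assms(1)[OF s] True by simp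
    next
      case False
      then show ?thesis using eta_ge[OF assms(1)[OF s]] by simp
    qed
  qed
  also have "\<dots> = 6 * avg A (\<lambda>s. eta (f s))"
    by (simp add: avg_cmult avg_add avg_diff assms(2) avg_const[OF fin])
  finally show ?thesis by (rule real_le_rsqrt)
qed

text \<open>Cholesky factorisation by induction: the Schur complement \<open>B\<close> of the last
  diagonal entry is again positive semidefinite.\<close>

lemma psd_gram:
  fixes A :: "nat \<Rightarrow> nat \<Rightarrow> real"
  assumes "\<And>i j. i < n \<Longrightarrow> j < n \<Longrightarrow> A i j = A j i"
    and "\<And>y. 0 \<le> (\<Sum>i<n. \<Sum>j<n. y i * A i j * y j)"
  shows "\<exists>v :: nat \<Rightarrow> nat \<Rightarrow> real. \<forall>i<n. \<forall>j<n. (\<Sum>l<n. v i l * v j l) = A i j"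
  using assms
proof (induction n arbitrary: A)
  case (Suc n)
  have quad: "(\<Sum>i<Suc n. \<Sum>j<Suc n. y i * A i j * y j) =
      (\<Sum>i<n. \<Sum>j<n. y i * A i j * y j) + 2 * y n * (\<Sum>i<n. A i n * y i) + A n n * (y n)\<^sup>2" for y
  proof -
    have "(\<Sum>j<n. y n * A n j * y j) = y n * (\<Sum>i<n. A i n * y i)"
      unfolding sum_distrib_left using Suc.prems(1)[of n] by (intro sum.cong) auto
    moreover have "(\<Sum>i<n. y i * A i n * y n) = y n * (\<Sum>i<n. A i n * y i)"
      unfolding sum_distrib_left by (intro sum.cong) auto
    ultimately show ?thesis by (simp add: sum.distrib power2_eq_square algebra_simps)
  qed
  have Ann: "0 \<le> A n n"
    using Suc.prems(2)[of "\<lambda>i. if i = n then 1 else 0"] unfolding quad by simp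
  define B where "B i j = A i j - A i n * A j n / A n n" for i j
  have "\<exists>v :: nat \<Rightarrow> nat \<Rightarrow> real. \<forall>i<n. \<forall>j<n. (\<Sum>l<n. v i l * v j l) = B i j"
  proof (rule Suc.IH)
    show "B i j = B j i" if "i < n" "j < n" for i j
      using that Suc.prems(1)[of i j] by (simp add: B_def mult.commute)
    fix y :: "nat \<Rightarrow> real"
    define u where "u = (\<Sum>i<n. A i n * y i)"
    have "(\<Sum>i<n. \<Sum>j<n. y i * (A i n * A j n / A n n) * y j) = u * u / A n n"
      unfolding u_def sum_product by (simp add: sum_divide_distrib mult_ac)
    then have eq: "(\<Sum>i<n. \<Sum>j<n. y i * B i j * y j) = (\<Sum>i<n. \<Sum>j<n. y i * A i j * y j) - u * u / A n n"
      by (simp add: B_def algebra_simps sum_subtractf)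
    have q: "0 \<le> (\<Sum>i<n. \<Sum>j<n. y i * A i j * y j) + 2 * t * u + A n n * t\<^sup>2" for t
    proof -
      let ?y = "y(n := t)"
      have "(\<Sum>i<n. \<Sum>j<n. ?y i * A i j * ?y j) = (\<Sum>i<n. \<Sum>j<n. y i * A i j * y j)"
        by (intro sum.cong) auto
      moreover have "(\<Sum>i<n. A i n * ?y i) = u" unfolding u_def by (intro sum.cong) auto
      ultimately show ?thesis using Suc.prems(2)[of ?y] unfolding quad by simp
    qed
    show "0 \<le> (\<Sum>i<n. \<Sum>j<n. y i * B i j * y j)"
    proof (cases "A n n = 0")
      case True
      then show ?thesis using q[of 0] eq by simp
    next
      case False
      \<comment> \<open>The value of the last coordinate that minimises the quadratic form.\<close>
      then show ?thesis using q[of "- u / A n n"] eq Ann by (simp add: power2_eq_square)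
    qed
  qed
  then obtain v where v: "\<And>i j. i < n \<Longrightarrow> j < n \<Longrightarrow> (\<Sum>l<n. v i l * v j l) = B i j" by blast
  \<comment> \<open>Along the i-th unit vector plus \<open>t\<close> times the last one the form is
    affine in \<open>t\<close>, so its slope must vanish. The division by zero in \<open>B\<close>
    is then harmless.\<close>
  have zero: "A i n = 0" if "A n n = 0" "i < n" for i
  proof (rule ccontr)
    assume ne: "A i n \<noteq> 0"
    have "0 \<le> A i i + 2 * t * A i n" for t
    proof -
      let ?y = "(\<lambda>k. if k = i then 1 else if k = n then t else 0)"
      have 1: "(\<Sum>k<n. \<Sum>j<n. ?y k * A k j * ?y j) = (\<Sum>k<n. \<Sum>j<n. if k = i \<and> j = i then A i i else 0)"
        by (intro sum.cong refl) auto
      have 2: "\<dots> = A i i"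
        using that(2) by (subst sum.remove[of _ i]) (auto simp: sum.delta)
      have 3: "(\<Sum>k<n. A k n * ?y k) = (\<Sum>k<n. if k = i then A i n else 0)"
        by (intro sum.cong) auto
      show ?thesis using Suc.prems(2)[of ?y] that unfolding quad 1 2 3 by (simp add: sum.delta)
    qed
    from this[of "- (A i i + 1) / (2 * A i n)"] ne show False by (simp add: field_simps)
  qed
  define w where "w i l = (if l = n then (if i = n then sqrt (A n n) else A i n / sqrt (A n n))
      else if i = n then 0 else v i l)" for i l
  show ?case
  proof (intro exI[of _ w] allI impI)
    fix i j assume ij: "i < Suc n" "j < Suc n"
    have s: "sqrt (A n n) * sqrt (A n n) = A n n" using Ann by simp
    have *: "(\<Sum>l<Suc n. w i l * w j l) = (if i = n \<or> j = n then 0 else B i j) + w i n * w j n"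
    proof -
      have "(\<Sum>l<n. w i l * w j l) = (\<Sum>l<n. (if i = n \<or> j = n then 0 else v i l * v j l))"
        by (intro sum.cong) (auto simp: w_def)
      then show ?thesis using v[of i j] ij by (auto simp: less_Suc_eq)
    qed
    show "(\<Sum>l<Suc n. w i l * w j l) = A i j"
      unfolding * using ij s zero[of i] zero[of j] Suc.prems(1)[of i j]
      by (cases "A n n = 0") (auto simp: w_def B_def less_Suc_eq field_simps)
  qed
qed simp

section \<open>Gaussian signs of a matrix\<close>

abbreviation gauss :: "nat \<Rightarrow> (nat \<Rightarrow> real) measure" where
  "gauss L \<equiv> \<Pi>\<^sub>M l\<in>{..<L}. std_normal_distribution"

lemma prob_space_std_normal: "prob_space std_normal_distribution"
  by (rule prob_space_normal_density) simp

interpretation std_normal: prob_space std_normal_distribution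
  by (rule prob_space_std_normal)

interpretation gauss_product: product_prob_space "\<lambda>_. std_normal_distribution" I for I :: "nat set"
  by unfold_locales

lemma prob_space_gauss: "prob_space (gauss L)"
  by (rule prob_space_PiM) (rule prob_space_std_normal)

lemma integrable_gauss_bounded:
  fixes f :: "_ \<Rightarrow> 'b :: {banach, second_countable_topology}"
  assumes "f \<in> borel_measurable (gauss L)" "\<And>z. norm (f z) \<le> c"
  shows "integrable (gauss L) f"
  by (rule finite_measure.integrable_const_bound[OF prob_space.finite_measure[OF prob_space_gauss]])
    (use assms in auto)

lemma std_normal_cis: "(LINT x|std_normal_distribution. cis (t * x)) = complex_of_real (exp (- (t\<^sup>2) / 2))"
proof -
  have "char std_normal_distribution t = (LINT x|std_normal_distribution. cis (t * x))"
    by (simp add: char_def cis_conv_exp mult.commute)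
  then show ?thesis by (simp add: char_std_normal_distribution)
qed

lemma gauss_cis:
  "(LINT z|gauss L. cis (\<Sum>l<L. v l * z l)) = complex_of_real (exp (- (\<Sum>l<L. (v l)\<^sup>2) / 2))"
proof -
  have cs: "cis (\<Sum>l\<in>A. f l) = (\<Prod>l\<in>A. cis (f l))" if "finite A" for A :: "nat set" and f
    using that by (induction A rule: finite_induct) (auto simp flip: cis_mult)
  have "(LINT z|gauss L. cis (\<Sum>l<L. v l * z l)) = (LINT z|gauss L. (\<Prod>l<L. cis (v l * z l)))"
    by (simp add: cs)
  also have "\<dots> = (\<Prod>l<L. (LINT x|std_normal_distribution. cis (v l * x)))"
  proof (rule gauss_product.product_integral_prod)
    show "integrable std_normal_distribution (\<lambda>x. cis (v i * x))" for i
      by (rule std_normal.integrable_const_bound[of _ 1]) (auto simp: cis_conv_exp)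
  qed simp
  also have "\<dots> = complex_of_real (exp (\<Sum>l<L. - (v l)\<^sup>2 / 2))"
    by (simp add: std_normal_cis exp_sum)
  finally show ?thesis by (simp add: sum_divide_distrib sum_negf)
qed

lemma measurable_lin [measurable]:
  "L' \<le> L \<Longrightarrow> (\<lambda>z. \<Sum>l<L'. v l * z l) \<in> borel_measurable (gauss L)"
  by (intro borel_measurable_sum borel_measurable_times measurable_compose[OF measurable_component_singleton]) auto

text \<open>\<open>trig_coeff a e\<close> is the coefficient of \<open>cis (e x)\<close> in \<open>1 + a sin x\<close>.\<close>

definition trig_coeff :: "real \<Rightarrow> int \<Rightarrow> complex" where
  "trig_coeff a e = (if e = 0 then 1 else complex_of_real (a * of_int e) / (2 * \<i>))"

text \<open>The Fourier expansion of the expected product of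
  \<open>1 + \<alpha> k * sin (X k)\<close> for a centred Gaussian family \<open>X\<close> with
  covariance \<open>G\<close>. It mentions the covariance only, so that one and the same kernel can
  be evaluated in several Gaussian realisations.\<close>

definition gram_form :: "'k set \<Rightarrow> ('k \<Rightarrow> real) \<Rightarrow> ('k \<Rightarrow> 'k \<Rightarrow> real) \<Rightarrow> complex" where
  "gram_form A \<alpha> G = (\<Sum>e\<in>A \<rightarrow>\<^sub>E {-1, 0, 1 :: int}. (\<Prod>k\<in>A. trig_coeff (\<alpha> k) (e k)) *
     complex_of_real (exp (- (\<Sum>k\<in>A. \<Sum>k'\<in>A. of_int (e k) * of_int (e k') * G k k') / 2)))"

lemma trig_coeff_sum:
  "complex_of_real (1 + a * sin x) = (\<Sum>e\<in>{-1, 0, 1}. trig_coeff a e * cis (of_int e * x))"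
  by (simp add: trig_coeff_def complex_eq_iff field_simps)

lemma gauss_gram:
  fixes v :: "'k \<Rightarrow> nat \<Rightarrow> real"
  assumes "finite A"
  shows "complex_of_real (LINT z|gauss L. (\<Prod>k\<in>A. 1 + \<alpha> k * sin (\<Sum>l<L. v k l * z l)))
    = gram_form A \<alpha> (\<lambda>k k'. \<Sum>l<L. v k l * v k' l)"
proof -
  let ?E = "A \<rightarrow>\<^sub>E {-1, 0, 1 :: int}"
  let ?x = "\<lambda>k z. \<Sum>l<L. v k l * z l"
  have fin: "finite ?E" using assms by (intro finite_PiE) auto
  have pt: "complex_of_real (\<Prod>k\<in>A. 1 + \<alpha> k * sin (?x k z)) =
      (\<Sum>e\<in>?E. (\<Prod>k\<in>A. trig_coeff (\<alpha> k) (e k)) * cis (\<Sum>l<L. (\<Sum>k\<in>A. of_int (e k) * v k l) * z l))" for z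
  proof -
    have cs: "(\<Prod>k\<in>A. cis (f k)) = cis (\<Sum>k\<in>A. f k)" for f :: "'k \<Rightarrow> real"
      using assms by (induction A rule: finite_induct) (auto simp flip: cis_mult)
    have "complex_of_real (\<Prod>k\<in>A. 1 + \<alpha> k * sin (?x k z)) =
        (\<Prod>k\<in>A. \<Sum>e\<in>{-1, 0, 1}. trig_coeff (\<alpha> k) e * cis (of_int e * ?x k z))"
      by (simp only: of_real_prod trig_coeff_sum)
    also have "\<dots> = (\<Sum>e\<in>?E. \<Prod>k\<in>A. trig_coeff (\<alpha> k) (e k) * cis (of_int (e k) * ?x k z))"
      using assms by (intro prod_sum_PiE) auto
    also have "\<dots> = (\<Sum>e\<in>?E. (\<Prod>k\<in>A. trig_coeff (\<alpha> k) (e k)) * cis (\<Sum>k\<in>A. of_int (e k) * ?x k z))"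
      by (simp add: prod.distrib cs)
    also have "\<dots> = (\<Sum>e\<in>?E. (\<Prod>k\<in>A. trig_coeff (\<alpha> k) (e k)) * cis (\<Sum>l<L. (\<Sum>k\<in>A. of_int (e k) * v k l) * z l))"
    proof -
      have "(\<Sum>k\<in>A. real_of_int (e k) * ?x k z) = (\<Sum>l<L. (\<Sum>k\<in>A. of_int (e k) * v k l) * z l)" for e :: "'k \<Rightarrow> int"
        unfolding sum_distrib_left sum_distrib_right by (subst sum.swap) (simp add: mult.assoc)
      then show ?thesis by simp
    qed
    finally show ?thesis .
  qed
  have int: "integrable (gauss L) (\<lambda>z. cis (\<Sum>l<L. u l * z l))" for u
    by (rule integrable_gauss_bounded[of _ _ 1]) (auto simp: cis_conv_exp)
  have "complex_of_real (LINT z|gauss L. (\<Prod>k\<in>A. 1 + \<alpha> k * sin (?x k z)))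
      = (LINT z|gauss L. complex_of_real (\<Prod>k\<in>A. 1 + \<alpha> k * sin (?x k z)))"
    by (rule integral_complex_of_real[symmetric])
  also have "\<dots> = (\<Sum>e\<in>?E. (\<Prod>k\<in>A. trig_coeff (\<alpha> k) (e k)) *
      (LINT z|gauss L. cis (\<Sum>l<L. (\<Sum>k\<in>A. of_int (e k) * v k l) * z l)))"
    unfolding pt by (subst Bochner_Integration.integral_sum) (auto intro!: int)
  also have "\<dots> = gram_form A \<alpha> (\<lambda>k k'. \<Sum>l<L. v k l * v k' l)"
    unfolding gram_form_def
  proof (intro sum.cong refl arg_cong2[where f = "(*)"])
    fix e :: "'k \<Rightarrow> int"
    have "(\<Sum>l<L. (\<Sum>k\<in>A. of_int (e k) * v k l)\<^sup>2) =
        (\<Sum>l<L. \<Sum>k\<in>A. \<Sum>k'\<in>A. of_int (e k) * of_int (e k') * (v k l * v k' l))"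
      by (simp add: power2_eq_square sum_product mult_ac)
    also have "\<dots> = (\<Sum>k\<in>A. \<Sum>k'\<in>A. \<Sum>l<L. of_int (e k) * of_int (e k') * (v k l * v k' l))"
      by (subst sum.swap) (intro sum.cong refl, subst sum.swap, simp)
    finally show "(LINT z|gauss L. cis (\<Sum>l<L. (\<Sum>k\<in>A. of_int (e k) * v k l) * z l)) =
        complex_of_real (exp (- (\<Sum>k\<in>A. \<Sum>k'\<in>A. of_int (e k) * of_int (e k') * (\<Sum>l<L. v k l * v k' l)) / 2))"
      by (simp add: gauss_cis sum_distrib_left)
  qed
  finally show ?thesis .
qed

section \<open>Sign kernels of a matrix and their subcube averages\<close>

text \<open>The operator norm of a block, expressed by a bilinear form so that blocks are given by
  index sets alone.\<close>

definition minor_le :: "(nat \<Rightarrow> nat \<Rightarrow> real) \<Rightarrow> nat set \<Rightarrow> nat set \<Rightarrow> real \<Rightarrow> bool" where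
  "minor_le M T T' \<sigma> \<longleftrightarrow> (\<forall>x y. \<bar>\<Sum>i\<in>T. \<Sum>j\<in>T'. x i * M i j * y j\<bar>
     \<le> \<sigma> * sqrt (\<Sum>i\<in>T. (x i)\<^sup>2) * sqrt (\<Sum>j\<in>T'. (y j)\<^sup>2))"

text \<open>The bilinear bound is tested with \<open>x\<close> equal to the image of
  \<open>y\<close>, and one factor \<open>X\<close> is cancelled.\<close>

lemma minor_le_norm:
  assumes "minor_le M T T' \<sigma>" "0 \<le> \<sigma>"
  shows "(\<Sum>i\<in>T. (\<Sum>j\<in>T'. M i j * y j)\<^sup>2) \<le> \<sigma>\<^sup>2 * (\<Sum>j\<in>T'. (y j)\<^sup>2)"
proof -
  define X where "X = sqrt (\<Sum>i\<in>T. (\<Sum>j\<in>T'. M i j * y j)\<^sup>2)"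
  define Y where "Y = sqrt (\<Sum>j\<in>T'. (y j)\<^sup>2)"
  have X: "X\<^sup>2 = (\<Sum>i\<in>T. (\<Sum>j\<in>T'. M i j * y j)\<^sup>2)" "0 \<le> X"
    and Y: "Y\<^sup>2 = (\<Sum>j\<in>T'. (y j)\<^sup>2)" "0 \<le> Y" by (auto simp: X_def Y_def sum_nonneg)
  have "(\<Sum>i\<in>T. \<Sum>j\<in>T'. (\<Sum>j\<in>T'. M i j * y j) * M i j * y j) = X\<^sup>2"
    unfolding X by (simp add: power2_eq_square sum_distrib_left mult_ac)
  then have "X\<^sup>2 \<le> \<sigma> * X * Y"
    using assms(1)[unfolded minor_le_def, rule_format, of "\<lambda>i. \<Sum>j\<in>T'. M i j * y j" y]
    by (simp add: X_def[symmetric] Y_def[symmetric])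
  then have "X \<le> \<sigma> * Y" using X assms(2) Y by (cases "X = 0") (auto simp: power2_eq_square)
  then have "X\<^sup>2 \<le> (\<sigma> * Y)\<^sup>2" using X by (intro power_mono) auto
  then show ?thesis by (simp only: X Y power_mult_distrib)
qed

definition pair_gram :: "(nat \<Rightarrow> nat \<Rightarrow> real) \<Rightarrow> nat + nat \<Rightarrow> nat + nat \<Rightarrow> real" where
  "pair_gram M k k' = (case k of
      Inl i \<Rightarrow> (case k' of Inl i' \<Rightarrow> of_bool (i = i') | Inr j \<Rightarrow> M i j)
    | Inr j \<Rightarrow> (case k' of Inl i \<Rightarrow> M i j | Inr j' \<Rightarrow> of_bool (j = j')))"

text \<open>Twice-normalised joint law of two sign vectors, restricted to the coordinates in \<open>T\<close> and
  \<open>T'\<close>: given standard Gaussian vectors \<open>g\<close>, \<open>h\<close> with cross-covariance \<open>M\<close>, the signs are independent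
  with means \<open>sin (g i)\<close> and \<open>sin (h j)\<close>.\<close>

definition pairQ :: "(nat \<Rightarrow> nat \<Rightarrow> real) \<Rightarrow> nat set \<Rightarrow> nat set \<Rightarrow> (nat \<Rightarrow> real) \<Rightarrow> (nat \<Rightarrow> real) \<Rightarrow> real" where
  "pairQ M T T' a b = Re (gram_form (T <+> T') (case_sum a b) (pair_gram M))"

text \<open>The conditional mean of
  \<open>sin (\<sigma> * y + sqrt (1 - \<sigma>\<^sup>2) * w)\<close> over an independent standard
  Gaussian \<open>w\<close>: of an input only the part of size \<sigma> is visible.\<close>

definition tau :: "real \<Rightarrow> real \<Rightarrow> real" where
  "tau \<sigma> y = exp (- (1 - \<sigma>\<^sup>2) / 2) * sin (\<sigma> * y)"

text \<open>A standard Gaussian output in \<open>n + n\<close> coordinates. The first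
  \<open>n\<close> are the visible input parts, weighted so as to have covariance \<open>M\<close>
  with the inputs; the last \<open>n\<close> supply the missing variance through
  \<open>r\<close>.\<close>

definition out_form :: "nat \<Rightarrow> (nat \<Rightarrow> nat \<Rightarrow> real) \<Rightarrow> nat set \<Rightarrow> real \<Rightarrow> (nat \<Rightarrow> nat \<Rightarrow> real) \<Rightarrow>
    (nat \<Rightarrow> real) \<Rightarrow> nat \<Rightarrow> (nat \<Rightarrow> real) \<Rightarrow> real" where
  "out_form n M T \<sigma> r e j z = (\<Sum>l<n + n. (if l < n then (if l \<in> T then M l j / \<sigma> * e l else 0) else r j (l - n)) * z l)"

lemma Re_eqI: "complex_of_real x = g \<Longrightarrow> Re g = x"
  by auto

lemma sum_shift: "(\<Sum>l<n + m. f l) = (\<Sum>l<n. f l) + (\<Sum>l<m. f (n + l))" for f :: "nat \<Rightarrow> real"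
  by (induction m) (auto simp: add.assoc)

lemma trig_coeff_mult: "trig_coeff (a * c) k = trig_coeff a k * complex_of_real (if k = 0 then 1 else c)"
  by (simp add: trig_coeff_def)

text \<open>An input is written as \<open>\<sigma> * e i * z i\<close> plus hidden independent
  noise, which is integrated out and leaves \<open>tau\<close>. The weights
  \<open>M i j / \<sigma>\<close> reproduce the cross-covariance, and the rest of the output
  covariance is positive semidefinite because the block has norm at most \<sigma>. The symmetry of
  the Gaussian leaves the signs \<open>e\<close> free; averaging over them yields the independent
  sign noise of \<open>noise_entropy\<close>.\<close>

lemma pairQ_gauss:
  assumes T: "T \<subseteq> {..<n}" "T' \<subseteq> {..<n}" and \<sigma>: "0 < \<sigma>" and m: "minor_le M T T' \<sigma>"
  shows "\<exists>r. \<forall>S U a b e. S \<subseteq> T \<longrightarrow> U \<subseteq> T' \<longrightarrow> (\<forall>i\<in>T. e i = 1 \<or> e i = -1) \<longrightarrow>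
    pairQ M S U a b = (LINT z|gauss (n + n). (\<Prod>i\<in>S. 1 + a i * (e i * tau \<sigma> (z i))) *
      (\<Prod>j\<in>U. 1 + b j * sin (out_form n M T \<sigma> r e j z)))"
proof -
  have fin: "finite T" "finite T'" using T finite_subset by blast+
  \<comment> \<open>The covariance left to the hidden coordinates, extended by the identity outside
    \<open>T'\<close>.\<close>
  define A where "A j j' = of_bool (j = j') -
    (if j \<in> T' \<and> j' \<in> T' then (\<Sum>i\<in>T. M i j * M i j') / \<sigma>\<^sup>2 else 0)" for j j'
  have "\<exists>r :: nat \<Rightarrow> nat \<Rightarrow> real. \<forall>i<n. \<forall>j<n. (\<Sum>l<n. r i l * r j l) = A i j"
  proof (rule psd_gram)
    show "A i j = A j i" for i j by (auto simp: A_def mult.commute intro!: sum.cong)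
    fix y :: "nat \<Rightarrow> real"
    have 1: "(\<Sum>j<n. \<Sum>j'<n. y j * of_bool (j = j') * y j') = (\<Sum>j<n. (y j)\<^sup>2)"
      by (intro sum.cong refl) (simp add: power2_eq_square of_bool_def if_distrib if_distribR cong: if_cong)
    have "(\<Sum>j<n. \<Sum>j'<n. y j * (if j \<in> T' \<and> j' \<in> T' then (\<Sum>i\<in>T. M i j * M i j') / \<sigma>\<^sup>2 else 0) * y j')
        = (\<Sum>j<n. if j \<in> T' then (\<Sum>j'<n. if j' \<in> T' then y j * ((\<Sum>i\<in>T. M i j * M i j') / \<sigma>\<^sup>2) * y j' else 0) else 0)"
      by (auto intro!: sum.cong)
    also have "\<dots> = (\<Sum>j\<in>T'. \<Sum>j'\<in>T'. y j * ((\<Sum>i\<in>T. M i j * M i j') / \<sigma>\<^sup>2) * y j')"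
      using T(2) by (simp add: sum.inter_restrict[symmetric] Int_absorb1)
    also have "\<dots> = (\<Sum>j\<in>T'. \<Sum>j'\<in>T'. \<Sum>i\<in>T. (M i j * y j) * (M i j' * y j')) / \<sigma>\<^sup>2"
      by (simp add: sum_distrib_left sum_distrib_right sum_divide_distrib mult_ac)
    also have "\<dots> = (\<Sum>i\<in>T. (\<Sum>j\<in>T'. M i j * y j)\<^sup>2) / \<sigma>\<^sup>2"
    proof -
      have "(\<Sum>j\<in>T'. \<Sum>j'\<in>T'. \<Sum>i\<in>T. (M i j * y j) * (M i j' * y j')) = (\<Sum>i\<in>T. \<Sum>j\<in>T'. \<Sum>j'\<in>T'. (M i j * y j) * (M i j' * y j'))"
        by (subst (2) sum.swap, rule sum.cong[OF refl], rule sum.swap)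
      then show ?thesis by (simp add: power2_eq_square sum_product)
    qed
    also have "\<dots> \<le> (\<Sum>j\<in>T'. (y j)\<^sup>2)"
      using minor_le_norm[OF m, of y] \<sigma> by (simp add: divide_le_eq mult.commute)
    also have "\<dots> \<le> (\<Sum>j<n. (y j)\<^sup>2)" using T by (intro sum_mono2) auto
    finally show "0 \<le> (\<Sum>i<n. \<Sum>j<n. y i * A i j * y j)"
      by (simp add: A_def left_diff_distrib right_diff_distrib sum_subtractf 1)
  qed
  then obtain r where r: "\<And>i j. i < n \<Longrightarrow> j < n \<Longrightarrow> (\<Sum>l<n. r i l * r j l) = A i j" by blast
  show ?thesis
  proof (intro exI[of _ r] allI impI)
    fix S U and a b e :: "nat \<Rightarrow> real"
    assume SU: "S \<subseteq> T" "U \<subseteq> T'" and e: "\<forall>i\<in>T. e i = 1 \<or> e i = -1"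
    have fin: "finite S" "finite U" using SU fin finite_subset by blast+
    define c where "c = exp (- (1 - \<sigma>\<^sup>2) / 2)"
    define v where "v k l = (case k of Inl i \<Rightarrow> of_bool (l = i) * (\<sigma> * e i) | Inr j \<Rightarrow>
      (if l < n then (if l \<in> T then M l j / \<sigma> * e l else 0) else r j (l - n)))" for k l
    define \<alpha> where "\<alpha> = case_sum (\<lambda>i. a i * c) b"
    have ee: "e i * e i = 1" if "i \<in> T" for i using e that by auto
    have lin: "(\<Sum>l<n + n. v (Inl i) l * z l) = \<sigma> * e i * z i" if "i \<in> T" for i z
      using that T(1) unfolding v_def
      by (subst sum.remove[of _ i]) (auto simp: of_bool_def intro!: sum.neutral)
    have "(\<Prod>k\<in>S <+> U. 1 + \<alpha> k * sin (\<Sum>l<n + n. v k l * z l)) =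
        (\<Prod>i\<in>S. 1 + a i * (e i * tau \<sigma> (z i))) * (\<Prod>j\<in>U. 1 + b j * sin (out_form n M T \<sigma> r e j z))" for z
    proof -
      have "(\<Prod>i\<in>S. 1 + \<alpha> (Inl i) * sin (\<Sum>l<n + n. v (Inl i) l * z l)) = (\<Prod>i\<in>S. 1 + a i * (e i * tau \<sigma> (z i)))"
      proof (rule prod.cong[OF refl])
        fix i assume "i \<in> S"
        then have i: "i \<in> T" using SU by blast
        show "1 + \<alpha> (Inl i) * sin (\<Sum>l<n + n. v (Inl i) l * z l) = 1 + a i * (e i * tau \<sigma> (z i))"
          using e[rule_format, OF i] unfolding lin[OF i] by (auto simp: \<alpha>_def tau_def c_def)
      qed
      then show ?thesis
        using fin by (simp add: prod.Plus) (simp add: \<alpha>_def out_form_def v_def)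
    qed
    then have "complex_of_real (LINT z|gauss (n + n). (\<Prod>i\<in>S. 1 + a i * (e i * tau \<sigma> (z i))) *
        (\<Prod>j\<in>U. 1 + b j * sin (out_form n M T \<sigma> r e j z)))
      = gram_form (S <+> U) \<alpha> (\<lambda>k k'. \<Sum>l<n + n. v k l * v k' l)"
      using gauss_gram[of "S <+> U" "n + n" \<alpha> v] fin by simp
    also have "\<dots> = gram_form (S <+> U) (case_sum a b) (pair_gram M)"
      unfolding gram_form_def
    proof (rule sum.cong[OF refl])
      fix E :: "nat + nat \<Rightarrow> int" assume E: "E \<in> S <+> U \<rightarrow>\<^sub>E {-1, 0, 1}"
      define s where "s = (\<Sum>i\<in>S. (real_of_int (E (Inl i)))\<^sup>2)"
      define cross where "cross = (\<Sum>i\<in>S. \<Sum>j\<in>U. of_int (E (Inl i)) * of_int (E (Inr j)) * M i j)"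
      define s' where "s' = (\<Sum>j\<in>U. (real_of_int (E (Inr j)))\<^sup>2)"
      have G1: "(\<Sum>l<n + n. v (Inl i) l * v (Inl i') l) = \<sigma>\<^sup>2 * of_bool (i = i')" if "i \<in> T" "i' \<in> S" for i i'
        using that(1) ee[OF that(1)] unfolding lin[OF that(1)] by (auto simp: v_def power2_eq_square)
      have G2: "(\<Sum>l<n + n. v (Inl i) l * v (Inr j) l) = M i j" if "i \<in> T" for i j
        using that ee[OF that] T(1) \<sigma> unfolding lin[OF that] by (auto simp: v_def)
      have G3: "(\<Sum>l<n + n. v (Inr j) l * v (Inr j') l) = of_bool (j = j')" if "j \<in> U" "j' \<in> U" for j j'
      proof -
        have "(\<Sum>l<n. v (Inr j) l * v (Inr j') l) = (\<Sum>l<n. if l \<in> T then M l j * M l j' / \<sigma>\<^sup>2 else 0)"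
        proof (rule sum.cong[OF refl])
          fix l assume "l \<in> {..<n}"
          then show "v (Inr j) l * v (Inr j') l = (if l \<in> T then M l j * M l j' / \<sigma>\<^sup>2 else 0)"
            using ee[of l] by (auto simp: v_def power2_eq_square)
        qed
        also have "\<dots> = (\<Sum>i\<in>T. M i j * M i j') / \<sigma>\<^sup>2"
          using T(1) by (simp add: sum.inter_restrict[symmetric] Int_absorb1 sum_divide_distrib)
        finally have "(\<Sum>l<n. v (Inr j) l * v (Inr j') l) = (\<Sum>i\<in>T. M i j * M i j') / \<sigma>\<^sup>2" .
        moreover have "(\<Sum>l<n. v (Inr j) (n + l) * v (Inr j') (n + l)) = A j j'"
          using r[of j j'] that T(2) SU(2) by (auto simp: v_def)
        ultimately show ?thesis using that SU(2) by (auto simp: sum_shift A_def)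
      qed
      have Q1: "(\<Sum>k\<in>S <+> U. \<Sum>k'\<in>S <+> U. of_int (E k) * of_int (E k') * pair_gram M k k') = s + 2 * cross + s'"
      proof -
        have "(\<Sum>j\<in>U. \<Sum>i\<in>S. of_int (E (Inr j)) * of_int (E (Inl i)) * M i j) = cross"
          unfolding cross_def by (subst sum.swap) (simp add: mult_ac)
        moreover have "(\<Sum>i\<in>S. \<Sum>i'\<in>S. of_int (E (Inl i)) * of_int (E (Inl i')) * of_bool (i = i')) = s"
          unfolding s_def using fin by (intro sum.cong refl) (simp add: power2_eq_square of_bool_def if_distrib if_distribR cong: if_cong)
        moreover have "(\<Sum>i\<in>U. \<Sum>i'\<in>U. of_int (E (Inr i)) * of_int (E (Inr i')) * of_bool (i = i')) = s'"
          unfolding s'_def using fin by (intro sum.cong refl) (simp add: power2_eq_square of_bool_def if_distrib if_distribR cong: if_cong)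
        ultimately show ?thesis
          using fin by (simp add: sum.Plus sum.distrib pair_gram_def cross_def)
      qed
      \<comment> \<open>Compared with \<open>Q1\<close>, only the variance of the inputs has
        changed, from 1 to \<open>\<sigma>\<^sup>2\<close>.\<close>
      have Q2: "(\<Sum>k\<in>S <+> U. \<Sum>k'\<in>S <+> U. of_int (E k) * of_int (E k') * (\<Sum>l<n + n. v k l * v k' l)) = \<sigma>\<^sup>2 * s + 2 * cross + s'"
      proof -
        have G2': "(\<Sum>l<n + n. v (Inr j) l * v (Inl i) l) = M i j" if "i \<in> T" for i j
          using G2[OF that, of j] by (simp add: mult.commute)
        have "(\<Sum>i\<in>S. \<Sum>i'\<in>S. of_int (E (Inl i)) * of_int (E (Inl i')) * (\<Sum>l<n + n. v (Inl i) l * v (Inl i') l)) = \<sigma>\<^sup>2 * s"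
        proof -
          have "(\<Sum>i\<in>S. \<Sum>i'\<in>S. of_int (E (Inl i)) * of_int (E (Inl i')) * (\<Sum>l<n + n. v (Inl i) l * v (Inl i') l)) =
            (\<Sum>i\<in>S. \<Sum>i'\<in>S. of_int (E (Inl i)) * of_int (E (Inl i')) * (\<sigma>\<^sup>2 * of_bool (i = i')))"
            using SU by (intro sum.cong refl) (auto simp only: G1 subset_iff)
          then show ?thesis
            unfolding s_def sum_distrib_left using fin
            by (simp add: power2_eq_square of_bool_def if_distrib if_distribR mult_ac cong: if_cong)
        qed
        moreover have "(\<Sum>i\<in>S. \<Sum>j\<in>U. of_int (E (Inl i)) * of_int (E (Inr j)) * (\<Sum>l<n + n. v (Inl i) l * v (Inr j) l)) = cross"
          unfolding cross_def using SU by (intro sum.cong refl) (auto simp only: G2 subset_iff)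
        moreover have "(\<Sum>j\<in>U. \<Sum>i\<in>S. of_int (E (Inr j)) * of_int (E (Inl i)) * (\<Sum>l<n + n. v (Inr j) l * v (Inl i) l)) = cross"
          unfolding cross_def using SU by (subst sum.swap, intro sum.cong refl) (auto simp only: subset_iff G2' mult.commute[of "of_int (E (Inr _))"])
        moreover have "(\<Sum>j\<in>U. \<Sum>j'\<in>U. of_int (E (Inr j)) * of_int (E (Inr j')) * (\<Sum>l<n + n. v (Inr j) l * v (Inr j') l)) = s'"
        proof -
          have "(\<Sum>j\<in>U. \<Sum>j'\<in>U. of_int (E (Inr j)) * of_int (E (Inr j')) * (\<Sum>l<n + n. v (Inr j) l * v (Inr j') l)) =
            (\<Sum>i\<in>U. \<Sum>i'\<in>U. of_int (E (Inr i)) * of_int (E (Inr i')) * of_bool (i = i'))"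
            by (intro sum.cong refl) (simp only: G3)
          then show ?thesis
            unfolding s'_def using fin
            by (simp add: power2_eq_square of_bool_def if_distrib if_distribR cong: if_cong)
        qed
        ultimately show ?thesis
          using fin by (simp only: sum.Plus sum.distrib comp_def finite_Plus_iff)
      qed
      \<comment> \<open>The frequencies are -1, 0 or 1, so damping every nonzero one by
        \<open>c\<close> is the Gaussian factor of the missing variance
        \<open>1 - \<sigma>\<^sup>2\<close>.\<close>
      have cE: "complex_of_real (\<Prod>i\<in>S. if E (Inl i) = 0 then 1 else c) = exp (- (1 - \<sigma>\<^sup>2) / 2 * s)"
      proof -
        have "(\<Prod>i\<in>S. if E (Inl i) = 0 then 1 else c) = (\<Prod>i\<in>S. exp (- (1 - \<sigma>\<^sup>2) / 2 * (real_of_int (E (Inl i)))\<^sup>2))"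
        proof (rule prod.cong[OF refl])
          fix i assume "i \<in> S"
          then have "E (Inl i) \<in> {-1, 0, 1}" using E by (auto simp: PiE_iff)
          then show "(if E (Inl i) = 0 then 1 else c) = exp (- (1 - \<sigma>\<^sup>2) / 2 * (real_of_int (E (Inl i)))\<^sup>2)"
            by (auto simp: c_def)
        qed
        then show ?thesis using fin by (simp add: s_def sum_distrib_left exp_sum)
      qed
      define P where "P = (\<Prod>i\<in>S. trig_coeff (a i) (E (Inl i)))"
      define P' where "P' = (\<Prod>j\<in>U. trig_coeff (b j) (E (Inr j)))"
      have pI: "(\<Prod>i\<in>S. trig_coeff (\<alpha> (Inl i)) (E (Inl i))) =
          P * complex_of_real (\<Prod>i\<in>S. if E (Inl i) = 0 then 1 else c)"
        unfolding P_def of_real_prod prod.distrib[symmetric]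
        by (rule prod.cong[OF refl]) (simp only: \<alpha>_def sum.case trig_coeff_mult)
      have p1: "(\<Prod>k\<in>S <+> U. trig_coeff (\<alpha> k) (E k)) = (\<Prod>i\<in>S. trig_coeff (\<alpha> (Inl i)) (E (Inl i))) * P'"
        using fin by (simp add: prod.Plus P'_def) (simp add: \<alpha>_def)
      have p2: "(\<Prod>k\<in>S <+> U. trig_coeff (case_sum a b k) (E k)) = P * P'"
        using fin by (simp add: prod.Plus P_def P'_def)
      have ex: "exp (- (1 - \<sigma>\<^sup>2) / 2 * s) * exp (- (\<sigma>\<^sup>2 * s + 2 * cross + s') / 2) = exp (- (s + 2 * cross + s') / 2)"
        unfolding exp_add[symmetric] by (rule arg_cong[where f = exp]) (simp add: field_simps)
      show "(\<Prod>k\<in>S <+> U. trig_coeff (\<alpha> k) (E k)) * complex_of_real (exp (- (\<Sum>k\<in>S <+> U. \<Sum>k'\<in>S <+> U. of_int (E k) * of_int (E k') * (\<Sum>l<n + n. v k l * v k' l)) / 2))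
        = (\<Prod>k\<in>S <+> U. trig_coeff (case_sum a b k) (E k)) * complex_of_real (exp (- (\<Sum>k\<in>S <+> U. \<Sum>k'\<in>S <+> U. of_int (E k) * of_int (E k') * pair_gram M k k') / 2))"
      proof -
        have "P * complex_of_real (exp (- (1 - \<sigma>\<^sup>2) / 2 * s)) * P' * complex_of_real (exp (- (\<sigma>\<^sup>2 * s + 2 * cross + s') / 2)) =
            P * P' * complex_of_real (exp (- (s + 2 * cross + s') / 2))"
          by (subst ex[symmetric]) (simp only: of_real_mult mult_ac)
        then show ?thesis by (simp only: Q1 Q2 p1 p2 pI cE)
      qed
    qed
    finally show "pairQ M S U a b = (LINT z|gauss (n + n). (\<Prod>i\<in>S. 1 + a i * (e i * tau \<sigma> (z i))) *
      (\<Prod>j\<in>U. 1 + b j * sin (out_form n M T \<sigma> r e j z)))"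
      unfolding pairQ_def by (rule Re_eqI)
  qed
qed

lemma tau_abs: assumes "0 < \<sigma>" "\<sigma> \<le> 1" shows "\<bar>tau \<sigma> y\<bar> \<le> 1"
proof -
  have "\<sigma>\<^sup>2 \<le> 1" using assms by (simp add: power_le_one)
  then have "exp (- (1 - \<sigma>\<^sup>2) / 2) \<le> 1" by simp
  then show ?thesis unfolding tau_def abs_mult by (intro mult_le_one) auto
qed

lemma measurable_comp_gauss [measurable]: "i < L \<Longrightarrow> (\<lambda>z. z i) \<in> borel_measurable (gauss L)"
  using measurable_component_singleton[of i "{..<L}" "\<lambda>_. std_normal_distribution"] by simp

lemma measurable_tau [measurable]: "tau \<sigma> \<in> borel_measurable borel"
  unfolding tau_def by measurable

lemma measurable_out_form [measurable]: "out_form n M T \<sigma> r e j \<in> borel_measurable (gauss (n + n))"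
  unfolding out_form_def by measurable

text \<open>After dropping the damping, the mean of the squared sine is
  \<open>(1 - exp (- 2 * \<sigma>\<^sup>2)) / 2\<close>, read off from the characteristic
  function.\<close>

lemma integral_tau_sq:
  assumes "0 < \<sigma>" "\<sigma> \<le> 1" "i < L"
  shows "(LINT z|gauss L. (tau \<sigma> (z i))\<^sup>2) \<le> \<sigma>\<^sup>2"
proof -
  have m: "(\<lambda>z. cos (2 * \<sigma> * z i)) \<in> borel_measurable (gauss L)" using assms(3) by measurable
  have ic: "integrable (gauss L) (\<lambda>z. cos (2 * \<sigma> * z i))"
    by (rule integrable_gauss_bounded[of _ _ 1]) (use m in auto)
  have mc: "(\<lambda>z. cis (2 * \<sigma> * z i)) \<in> borel_measurable (gauss L)" 
    unfolding cis_conv_exp using assms(3) by measurable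
  have "(LINT z|gauss L. cos (2 * \<sigma> * z i)) = (LINT z|gauss L. Re (cis (2 * \<sigma> * z i)))"
    by simp
  also have "\<dots> = Re (LINT z|gauss L. cis (2 * \<sigma> * z i))"
    by (rule integral_Re, rule integrable_gauss_bounded[of _ _ 1]) (use mc in auto)
  also have "(LINT z|gauss L. cis (2 * \<sigma> * z i)) = (LINT z|gauss L. cis (\<Sum>l<L. (of_bool (l = i) * (2 * \<sigma>)) * z l))"
    using assms(3) by (intro arg_cong[where f = "integral\<^sup>L _"] ext) (simp add: of_bool_def if_distrib if_distribR cong: if_cong)
  also have "\<dots> = complex_of_real (exp (- (2 * \<sigma>)\<^sup>2 / 2))"
    unfolding gauss_cis using assms(3) by (simp add: of_bool_def if_distrib if_distribR power_mult_distrib cong: if_cong)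
  finally have c: "(LINT z|gauss L. cos (2 * \<sigma> * z i)) = exp (- 2 * \<sigma>\<^sup>2)" by (simp add: power2_eq_square)
  have "\<sigma>\<^sup>2 \<le> 1" using assms by (simp add: power_le_one)
  then have e1: "(exp (- (1 - \<sigma>\<^sup>2) / 2))\<^sup>2 \<le> 1" by (simp add: power_le_one)
  have "(LINT z|gauss L. (tau \<sigma> (z i))\<^sup>2) \<le> (LINT z|gauss L. (1 - cos (2 * \<sigma> * z i)) / 2)"
  proof (rule integral_mono)
    have "\<bar>(tau \<sigma> y)\<^sup>2\<bar> \<le> 1" for y using tau_abs[OF assms(1,2), of y] by (simp add: abs_square_le_1)
    then show "integrable (gauss L) (\<lambda>z. (tau \<sigma> (z i))\<^sup>2)"
      by (intro integrable_gauss_bounded[of _ _ 1]) (use assms(3) in \<open>auto intro!: borel_measurable_power measurable_compose[OF measurable_comp_gauss measurable_tau]\<close>)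
    show "integrable (gauss L) (\<lambda>z. (1 - cos (2 * \<sigma> * z i)) / 2)"
      using ic prob_space_gauss[of L] by (auto intro!: Bochner_Integration.integrable_diff finite_measure.integrable_const prob_space.finite_measure)
    fix z :: "nat \<Rightarrow> real"
    have "(tau \<sigma> (z i))\<^sup>2 = (exp (- (1 - \<sigma>\<^sup>2) / 2))\<^sup>2 * (sin (\<sigma> * z i))\<^sup>2"
      unfolding tau_def power_mult_distrib by simp
    also have "\<dots> \<le> 1 * (sin (\<sigma> * z i))\<^sup>2" using e1 by (intro mult_right_mono) auto
    also have "\<dots> = (1 - cos (2 * \<sigma> * z i)) / 2"
      using cos_double_sin[of "\<sigma> * z i"] by (simp add: mult_ac)
    finally show "(tau \<sigma> (z i))\<^sup>2 \<le> (1 - cos (2 * \<sigma> * z i)) / 2" .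
  qed
  also have "\<dots> = (1 - exp (- 2 * \<sigma>\<^sup>2)) / 2"
    using ic prob_space_gauss[of L] c by (subst integral_divide_zero, subst Bochner_Integration.integral_diff)
      (auto intro!: finite_measure.integrable_const prob_space.finite_measure simp: prob_space.prob_space)
  also have "\<dots> \<le> \<sigma>\<^sup>2" using exp_ge_add_one_self[of "- 2 * \<sigma>\<^sup>2"] by simp
  finally show ?thesis .
qed

text \<open>The outputs alone are independent standard Gaussians, here realised by the coordinates
  themselves, and the sine has mean 0.\<close>

lemma pairQ_empty: assumes "T' \<subseteq> {..<n}" shows "pairQ M {} T' a b = 1"
proof -
  have fin: "finite T'" using assms finite_subset by blast
  define v :: "nat + nat \<Rightarrow> nat \<Rightarrow> real" where "v k l = of_bool (k = Inr l)" for k l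
  have lin: "(\<Sum>l<n. v (Inr j) l * z l) = z j" if "j \<in> T'" for j z
    using that assms by (simp add: v_def of_bool_def if_distrib if_distribR subset_iff cong: if_cong)
  have isin: "integrable std_normal_distribution (\<lambda>x. c * sin x)" for c
    by (rule std_normal.integrable_const_bound[of _ "\<bar>c\<bar>"]) (auto simp: abs_mult intro!: mult_left_le)
  have icis: "integrable std_normal_distribution (\<lambda>x. cis x)"
    by (rule std_normal.integrable_const_bound[of _ 1]) (auto simp: cis_conv_exp)
  have "(LINT x|std_normal_distribution. sin x) = Im (LINT x|std_normal_distribution. cis x)"
    using integral_Im[OF icis] by simp
  also have "\<dots> = 0" using std_normal_cis[of 1] by simp
  finally have s0: "(LINT x|std_normal_distribution. sin x) = 0" .
  have "(LINT z|gauss n. (\<Prod>k\<in>{} <+> T'. 1 + case_sum a b k * sin (\<Sum>l<n. v k l * z l))) =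
      (LINT z|gauss n. (\<Prod>l<n. 1 + (if l \<in> T' then b l else 0) * sin (z l)))"
  proof (intro arg_cong[where f = "integral\<^sup>L _"] ext)
    fix z :: "nat \<Rightarrow> real"
    have "(\<Prod>l<n. 1 + (if l \<in> T' then b l else 0) * sin (z l)) = (\<Prod>l<n. if l \<in> T' then 1 + b l * sin (z l) else 1)"
      by (intro prod.cong) auto
    also have "\<dots> = (\<Prod>l\<in>T'. 1 + b l * sin (z l))"
      using assms by (simp add: prod.inter_restrict[symmetric] Int_absorb1)
    finally show "(\<Prod>k\<in>{} <+> T'. 1 + case_sum a b k * sin (\<Sum>l<n. v k l * z l)) = (\<Prod>l<n. 1 + (if l \<in> T' then b l else 0) * sin (z l))"
      using fin by (simp add: prod.Plus lin)
  qed
  also have "\<dots> = (\<Prod>l<n. (LINT x|std_normal_distribution. 1 + (if l \<in> T' then b l else 0) * sin x))"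
    by (rule gauss_product.product_integral_prod) (auto intro!: Bochner_Integration.integrable_add isin)
  also have "\<dots> = 1"
  proof (rule prod.neutral, clarify)
    fix l
    have "(LINT x|std_normal_distribution. 1 + c * sin x) = 1" for c
      using isin[of c] std_normal.prob_space
      by (subst Bochner_Integration.integral_add) (auto simp: s0)
    then show "(LINT x|std_normal_distribution. 1 + (if l \<in> T' then b l else 0) * sin x) = 1" .
  qed
  finally have "complex_of_real 1 = gram_form ({} <+> T') (case_sum a b) (\<lambda>k k'. \<Sum>l<n. v k l * v k' l)"
    using gauss_gram[of "{} <+> T'" n "case_sum a b" v] fin by simp
  also have "\<dots> = gram_form ({} <+> T') (case_sum a b) (pair_gram M)"
    unfolding gram_form_def
  proof (intro sum.cong refl arg_cong2[where f = "(*)"] arg_cong[where f = "\<lambda>x. complex_of_real (exp (- x / 2))"])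
    fix k k' :: "nat + nat" assume k: "k \<in> {} <+> T'" "k' \<in> {} <+> T'"
    then obtain j j' where j: "k = Inr j" "k' = Inr j'" "j \<in> T'" "j' \<in> T'" by auto
    show "(\<Sum>l<n. v k l * v k' l) = pair_gram M k k'"
      using lin[of j "v (Inr j')"] j by (auto simp: v_def pair_gram_def)
  qed
  finally show ?thesis unfolding pairQ_def by (rule Re_eqI)
qed

section \<open>Subcubes, marginals and the entropy contraction of a kernel\<close>

definition cyl :: "nat \<Rightarrow> nat set \<Rightarrow> (nat \<Rightarrow> real) \<Rightarrow> (nat \<Rightarrow> real) set" where
  "cyl n T \<rho> = (\<Pi>\<^sub>E i\<in>{..<n}. if i \<in> T then {\<rho> i} else {-1, 1})"

lemma finite_cyl [simp]: "finite (cyl n T \<rho>)"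
  unfolding cyl_def by (intro finite_PiE) auto

lemma cyl_nonempty [simp]: "cyl n T \<rho> \<noteq> {}"
  by (simp add: cyl_def PiE_eq_empty_iff)

lemma cyl_eq:
  assumes "\<rho> \<in> cb n"
  shows "cyl n T \<rho> = {s \<in> cb n. \<forall>i<n. i \<in> T \<longrightarrow> s i = \<rho> i}"
proof -
  have *: "\<rho> i \<in> {-1, 1}" if "i < n" for i using cb_values[OF assms that] by auto
  show ?thesis
  proof (intro equalityI subsetI)
    fix s assume s: "s \<in> cyl n T \<rho>"
    have m: "s i \<in> (if i \<in> T then {\<rho> i} else {-1, 1})" if "i < n" for i
      using PiE_mem[OF s[unfolded cyl_def], of i] that by simp
    have 1: "s i = \<rho> i" if "i < n" "i \<in> T" for i using m[OF that(1)] that(2) by simp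
    have 2: "s i \<in> {-1, 1}" if "i < n" for i
      using m[OF that] 1[OF that] *[OF that] by (cases "i \<in> T") (simp_all only: if_True if_False)
    have "s \<in> extensional {..<n}" using s unfolding cyl_def PiE_iff by blast
    then show "s \<in> {s \<in> cb n. \<forall>i<n. i \<in> T \<longrightarrow> s i = \<rho> i}"
      using 1 2 unfolding cb_def PiE_iff by blast
  next
    fix s assume s: "s \<in> {s \<in> cb n. \<forall>i<n. i \<in> T \<longrightarrow> s i = \<rho> i}"
    then have "s \<in> extensional {..<n}" "\<And>i. i < n \<Longrightarrow> s i \<in> {-1, 1}" "\<And>i. i < n \<Longrightarrow> i \<in> T \<Longrightarrow> s i = \<rho> i"
      unfolding cb_def PiE_iff by blast+
    then show "s \<in> cyl n T \<rho>" unfolding cyl_def PiE_iff by simp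
  qed
qed

lemma cyl_subset: "\<rho> \<in> cb n \<Longrightarrow> cyl n T \<rho> \<subseteq> cb n"
  by (auto simp: cyl_eq)

lemma card_cyl: "card (cyl n T \<rho>) = (\<Prod>i<n. if i \<in> T then 1 else 2)"
  unfolding cyl_def by (subst card_PiE) (auto intro!: prod.cong)

text \<open>Lying in the same subcube is a symmetric relation and all these subcubes have equal
  size, so a double count gives the law of total expectation.\<close>

lemma avg_cyl: "avg (cb n) G = avg (cb n) (\<lambda>b. avg (cyl n T b) G)"
proof -
  let ?C = "real (\<Prod>i<n. if i \<in> T then 1 else 2)"
  have C: "?C > 0" by (simp add: prod_pos)
  have "(\<Sum>b\<in>cb n. \<Sum>c\<in>cyl n T b. G c) = (\<Sum>b\<in>cb n. \<Sum>c\<in>cb n. if c \<in> cyl n T b then G c else 0)"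
  proof (rule sum.cong[OF refl])
    fix b assume "b \<in> cb n"
    then show "(\<Sum>c\<in>cyl n T b. G c) = (\<Sum>c\<in>cb n. if c \<in> cyl n T b then G c else 0)"
      using cyl_subset[of b n T] by (simp add: sum.inter_restrict[symmetric] Int_absorb1)
  qed
  also have "\<dots> = (\<Sum>c\<in>cb n. \<Sum>b\<in>cb n. if c \<in> cyl n T b then G c else 0)" by (rule sum.swap)
  also have "\<dots> = (\<Sum>c\<in>cb n. ?C * G c)"
  proof (rule sum.cong[OF refl])
    fix c assume c: "c \<in> cb n"
    have "(\<Sum>b\<in>cb n. if c \<in> cyl n T b then G c else 0) = (\<Sum>b\<in>cb n. if b \<in> cyl n T c then G c else 0)"
      using c by (intro sum.cong refl) (auto simp: cyl_eq)
    also have "\<dots> = (\<Sum>b\<in>cyl n T c. G c)"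
      using cyl_subset[OF c, of T] by (simp add: sum.inter_restrict[symmetric] Int_absorb1)
    finally show "(\<Sum>b\<in>cb n. if c \<in> cyl n T b then G c else 0) = ?C * G c" by (simp add: card_cyl)
  qed
  finally have "(\<Sum>b\<in>cb n. \<Sum>c\<in>cyl n T b. G c) = ?C * (\<Sum>c\<in>cb n. G c)" by (simp add: sum_distrib_left)
  then show ?thesis using C
    by (simp add: avg_def card_cyl sum_divide_distrib[symmetric])
qed

lemma avg_cyl_prod:
  assumes "T \<subseteq> {..<n}"
  shows "avg (cyl n T \<rho>) (\<lambda>s. \<Prod>i<n. 1 + s i * x i) = (\<Prod>i\<in>T. 1 + \<rho> i * x i)"
proof -
  have "(\<Sum>s\<in>cyl n T \<rho>. \<Prod>i<n. 1 + s i * x i) = (\<Prod>i<n. \<Sum>y\<in>(if i \<in> T then {\<rho> i} else {-1, 1}). 1 + y * x i)"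
    unfolding cyl_def by (subst prod_sum_PiE) auto
  also have "\<dots> = (\<Prod>i<n. (if i \<in> T then 1 + \<rho> i * x i else 1) * (if i \<in> T then 1 else 2))"
    by (intro prod.cong) auto
  also have "\<dots> = (\<Prod>i<n. if i \<in> T then 1 + \<rho> i * x i else 1) * (\<Prod>i<n. if i \<in> T then 1 else 2)"
    by (simp add: prod.distrib)
  also have "(\<Prod>i<n. if i \<in> T then 1 + \<rho> i * x i else 1) = (\<Prod>i\<in>T. 1 + \<rho> i * x i)"
    using assms by (simp add: prod.inter_restrict[symmetric] Int_absorb1)
  finally have eq: "(\<Sum>s\<in>cyl n T \<rho>. \<Prod>i<n. 1 + s i * x i) = (\<Prod>i\<in>T. 1 + \<rho> i * x i) * (\<Prod>i<n. if i \<in> T then 1 else 2)" .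
  have "real (card (cyl n T \<rho>)) = (\<Prod>i<n. if i \<in> T then 1 else 2)"
    unfolding card_cyl of_nat_prod by (intro prod.cong) auto
  moreover have "(\<Prod>i<n. if i \<in> T then 1 else 2) > (0 :: real)" by (simp add: prod_pos)
  ultimately show ?thesis unfolding avg_def eq by simp
qed

lemma integral_avg:
  assumes "\<And>a. a \<in> A \<Longrightarrow> integrable N (f a)"
  shows "avg A (\<lambda>a. LINT z|N. f a z) = (LINT z|N. avg A (\<lambda>a. f a z))"
  unfolding avg_def using assms by (subst integral_divide_zero) (simp add: Bochner_Integration.integral_sum)

lemma minor_le_subset:
  assumes "minor_le M T T' \<sigma>" "S \<subseteq> T" "U \<subseteq> T'" "finite T" "finite T'"
  shows "minor_le M S U \<sigma>"
  unfolding minor_le_def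
proof (intro allI)
  fix x y :: "nat \<Rightarrow> real"
  define x' where "x' i = (if i \<in> S then x i else 0)" for i
  define y' where "y' j = (if j \<in> U then y j else 0)" for j
  have 1: "(\<Sum>i\<in>T. g (x' i) i) = (\<Sum>i\<in>S. g (x i) i)" if "\<And>i. g 0 i = 0" for g :: "real \<Rightarrow> nat \<Rightarrow> real"
    using assms that by (intro sum.mono_neutral_cong_right) (auto simp: x'_def)
  have 2: "(\<Sum>j\<in>T'. g (y' j) j) = (\<Sum>j\<in>U. g (y j) j)" if "\<And>j. g 0 j = 0" for g :: "real \<Rightarrow> nat \<Rightarrow> real"
    using assms that by (intro sum.mono_neutral_cong_right) (auto simp: y'_def)
  have "(\<Sum>i\<in>T. \<Sum>j\<in>T'. x' i * M i j * y' j) = (\<Sum>i\<in>S. \<Sum>j\<in>U. x i * M i j * y j)"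
    using 1[of "\<lambda>t i. \<Sum>j\<in>T'. t * M i j * y' j"] 2[of "\<lambda>t j. x i * M i j * t" for i] by simp
  moreover have "(\<Sum>i\<in>T. (x' i)\<^sup>2) = (\<Sum>i\<in>S. (x i)\<^sup>2)" using 1[of "\<lambda>t i. t\<^sup>2"] by simp
  moreover have "(\<Sum>j\<in>T'. (y' j)\<^sup>2) = (\<Sum>j\<in>U. (y j)\<^sup>2)" using 2[of "\<lambda>t i. t\<^sup>2"] by simp
  ultimately show "\<bar>\<Sum>i\<in>S. \<Sum>j\<in>U. x i * M i j * y j\<bar> \<le> \<sigma> * sqrt (\<Sum>i\<in>S. (x i)\<^sup>2) * sqrt (\<Sum>j\<in>U. (y j)\<^sup>2)"
    using assms(1)[unfolded minor_le_def, rule_format, of x' y'] by simp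
qed

text \<open>The input factor of \<open>pairQ_gauss\<close>, kept apart from the output factor
  \<open>outF\<close>: in the entropy estimate it forms a density, while the other one acts as a
  likelihood.\<close>

definition inF :: "nat set \<Rightarrow> real \<Rightarrow> (nat \<Rightarrow> real) \<Rightarrow> (nat \<Rightarrow> real) \<Rightarrow> (nat \<Rightarrow> real) \<Rightarrow> real" where
  "inF S \<sigma> a e z = (\<Prod>i\<in>S. 1 + a i * (e i * tau \<sigma> (z i)))"

definition outF :: "nat \<Rightarrow> (nat \<Rightarrow> nat \<Rightarrow> real) \<Rightarrow> nat set \<Rightarrow> real \<Rightarrow> (nat \<Rightarrow> nat \<Rightarrow> real) \<Rightarrow> nat set \<Rightarrow>
    (nat \<Rightarrow> real) \<Rightarrow> (nat \<Rightarrow> real) \<Rightarrow> (nat \<Rightarrow> real) \<Rightarrow> real" where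
  "outF n M T \<sigma> r U b e z = (\<Prod>j\<in>U. 1 + b j * sin (out_form n M T \<sigma> r e j z))"

lemma prod_bounds:
  fixes f :: "nat \<Rightarrow> real"
  assumes "finite S" "\<And>i. i \<in> S \<Longrightarrow> \<bar>f i\<bar> \<le> 1"
  shows "0 \<le> (\<Prod>i\<in>S. 1 + f i)" "(\<Prod>i\<in>S. 1 + f i) \<le> 2 ^ card S"
proof -
  have b: "0 \<le> 1 + f i \<and> 1 + f i \<le> 2" if "i \<in> S" for i using assms(2)[OF that] by (simp add: abs_le_iff)
  show "0 \<le> (\<Prod>i\<in>S. 1 + f i)" using b by (intro prod_nonneg) auto
  show "(\<Prod>i\<in>S. 1 + f i) \<le> 2 ^ card S"
    using prod_mono[of S "\<lambda>i. 1 + f i" "\<lambda>_. 2"] b by simp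
qed

lemma inF_bounds:
  assumes "finite S" "0 < \<sigma>" "\<sigma> \<le> 1" "\<And>i. i \<in> S \<Longrightarrow> \<bar>a i\<bar> \<le> 1" "\<And>i. i \<in> S \<Longrightarrow> \<bar>e i\<bar> \<le> 1"
  shows "0 \<le> inF S \<sigma> a e z" "inF S \<sigma> a e z \<le> 2 ^ card S"
  unfolding inF_def using assms tau_abs[OF assms(2,3)]
  by (auto intro!: prod_bounds mult_le_one simp: abs_mult)

lemma outF_bounds:
  assumes "finite U" "\<And>i. i \<in> U \<Longrightarrow> \<bar>b i\<bar> \<le> 1"
  shows "0 \<le> outF n M T \<sigma> r U b e z" "outF n M T \<sigma> r U b e z \<le> 2 ^ card U"
  unfolding outF_def using assms
  by (auto intro!: prod_bounds mult_le_one simp: abs_mult)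

lemma measurable_inF [measurable]:
  "S \<subseteq> {..<n} \<Longrightarrow> inF S \<sigma> a e \<in> borel_measurable (gauss (n + n))"
  unfolding inF_def
  by (intro borel_measurable_prod borel_measurable_add borel_measurable_const borel_measurable_times
      measurable_compose[OF measurable_comp_gauss measurable_tau]) auto

lemma measurable_outF [measurable]: "outF n M T \<sigma> r U b e \<in> borel_measurable (gauss (n + n))"
  unfolding outF_def
  by (intro borel_measurable_prod borel_measurable_add borel_measurable_const borel_measurable_times
      measurable_compose[OF measurable_out_form borel_measurable_sin])

lemma cb_le1: "s \<in> cb n \<Longrightarrow> i < n \<Longrightarrow> \<bar>s i\<bar> \<le> 1"
  using cb_abs[of s n i] by simp

lemma integrable_in_out:
  assumes "S \<subseteq> {..<n}" "U \<subseteq> {..<n}" "0 < \<sigma>" "\<sigma> \<le> 1" "\<And>i. i < n \<Longrightarrow> \<bar>a i\<bar> \<le> 1" "\<And>i. i < n \<Longrightarrow> \<bar>b i\<bar> \<le> 1"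
    "\<And>i. i < n \<Longrightarrow> \<bar>e i\<bar> \<le> 1"
  shows "integrable (gauss (n + n)) (\<lambda>z. inF S \<sigma> a e z * outF n M T \<sigma> r U b e z)"
proof (rule integrable_gauss_bounded)
  show "(\<lambda>z. inF S \<sigma> a e z * outF n M T \<sigma> r U b e z) \<in> borel_measurable (gauss (n + n))"
    by (intro borel_measurable_times measurable_inF measurable_outF assms(1))
  have fin: "finite S" "finite U" using assms(1,2) finite_subset by blast+
  have ae: "\<bar>a i\<bar> \<le> 1" "\<bar>e i\<bar> \<le> 1" if "i \<in> S" for i using assms(1,5,7) that by auto
  have bU: "\<bar>b i\<bar> \<le> 1" if "i \<in> U" for i using assms(2,6) that by auto
  fix z
  have i: "0 \<le> inF S \<sigma> a e z" "inF S \<sigma> a e z \<le> 2 ^ card S"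
    by (rule inF_bounds[OF fin(1) assms(3,4) ae]; assumption)+
  have out: "0 \<le> outF n M T \<sigma> r U b e z" "outF n M T \<sigma> r U b e z \<le> 2 ^ card U"
    by (rule outF_bounds[OF fin(2) bU]; assumption)+
  show "norm (inF S \<sigma> a e z * outF n M T \<sigma> r U b e z) \<le> 2 ^ card S * 2 ^ card U"
    using i out unfolding real_norm_def abs_mult by (intro mult_mono) auto
qed

lemma pairQ_gauss':
  assumes "T \<subseteq> {..<n}" "T' \<subseteq> {..<n}" "0 < \<sigma>" "minor_le M T T' \<sigma>"
  shows "\<exists>r. \<forall>S U a b e. S \<subseteq> T \<longrightarrow> U \<subseteq> T' \<longrightarrow> e \<in> cb n \<longrightarrow>
    pairQ M S U a b = (LINT z|gauss (n + n). inF S \<sigma> a e z * outF n M T \<sigma> r U b e z)"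
proof -
  obtain r where r: "\<forall>S U a b e. S \<subseteq> T \<longrightarrow> U \<subseteq> T' \<longrightarrow> (\<forall>i\<in>T. e i = 1 \<or> e i = -1) \<longrightarrow>
      pairQ M S U a b = (LINT z|gauss (n + n). inF S \<sigma> a e z * outF n M T \<sigma> r U b e z)"
    using pairQ_gauss[OF assms] unfolding inF_def outF_def ..
  show ?thesis
  proof (intro exI[of _ r] allI impI)
    fix S U a b e assume SU: "S \<subseteq> T" "U \<subseteq> T'" and "e \<in> cb n"
    then have "\<forall>i\<in>T. e i = 1 \<or> e i = -1" using cb_values[of e n] assms(1) by auto
    then show "pairQ M S U a b = (LINT z|gauss (n + n). inF S \<sigma> a e z * outF n M T \<sigma> r U b e z)"
      by (intro r[rule_format, OF SU]) auto
  qed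
qed

text \<open>Norm at most 1 makes \<open>pair_gram M\<close> a covariance matrix, so that the kernel
  is the law of genuine signs.\<close>

locale contraction =
  fixes n :: nat and M :: "nat \<Rightarrow> nat \<Rightarrow> real"
  assumes contr: "minor_le M {..<n} {..<n} 1"
begin

lemma full_gauss:
  "\<exists>r. \<forall>S U a b e. S \<subseteq> {..<n} \<longrightarrow> U \<subseteq> {..<n} \<longrightarrow> e \<in> cb n \<longrightarrow>
    pairQ M S U a b = (LINT z|gauss (n + n). inF S 1 a e z * outF n M {..<n} 1 r U b e z)"
  by (rule pairQ_gauss') (use contr in auto)

lemma one_cb: "(\<lambda>i\<in>{..<n}. 1) \<in> cb n"
  by (simp add: cb_def)

lemma pairQ_nonneg:
  assumes "T \<subseteq> {..<n}" "T' \<subseteq> {..<n}" "a \<in> cb n" "b \<in> cb n"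
  shows "0 \<le> pairQ M T T' a b"
proof -
  obtain r where r: "\<And>S U a b e. S \<subseteq> {..<n} \<Longrightarrow> U \<subseteq> {..<n} \<Longrightarrow> e \<in> cb n \<Longrightarrow>
    pairQ M S U a b = (LINT z|gauss (n + n). inF S 1 a e z * outF n M {..<n} 1 r U b e z)"
    using full_gauss by blast
  have fin: "finite T" "finite T'" using assms(1,2) finite_subset by blast+
  show ?thesis
    unfolding r[OF assms(1,2) one_cb]
    using assms fin cb_le1[OF assms(3)] cb_le1[OF assms(4)]
    by (intro Bochner_Integration.integral_nonneg mult_nonneg_nonneg inF_bounds outF_bounds) auto
qed

text \<open>Over a free sign \<open>b j\<close> the factor \<open>1 + b j * t\<close> averages to 1,
  so averaging over a subcube passes to the marginal on its fixed coordinates.\<close>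

lemma avg_pairQ_right:
  assumes "T \<subseteq> {..<n}" "U \<subseteq> {..<n}" "a \<in> cb n" "\<beta> \<in> cb n"
  shows "avg (cyl n U \<beta>) (\<lambda>b. pairQ M T {..<n} a b) = pairQ M T U a \<beta>"
proof -
  obtain r where r: "\<And>S U a b e. S \<subseteq> {..<n} \<Longrightarrow> U \<subseteq> {..<n} \<Longrightarrow> e \<in> cb n \<Longrightarrow>
    pairQ M S U a b = (LINT z|gauss (n + n). inF S 1 a e z * outF n M {..<n} 1 r U b e z)"
    using full_gauss by blast
  let ?e = "\<lambda>i\<in>{..<n}. 1"
  have "avg (cyl n U \<beta>) (\<lambda>b. pairQ M T {..<n} a b)
      = (LINT z|gauss (n + n). avg (cyl n U \<beta>) (\<lambda>b. inF T 1 a ?e z * outF n M {..<n} 1 r {..<n} b ?e z))"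
    unfolding r[OF assms(1) order_refl one_cb]
    using assms cb_le1[OF assms(3)]
    by (intro integral_avg integrable_in_out) (auto intro: cb_le1 cb_le1[OF subsetD[OF cyl_subset[OF assms(4)]]])
  also have "\<dots> = pairQ M T U a \<beta>"
    unfolding r[OF assms(1,2) one_cb] avg_cmult
    by (simp add: outF_def avg_cyl_prod[OF assms(2)])
  finally show ?thesis .
qed

lemma avg_pairQ_left:
  assumes "T \<subseteq> {..<n}" "U \<subseteq> {..<n}" "\<alpha> \<in> cb n" "b \<in> cb n"
  shows "avg (cyl n T \<alpha>) (\<lambda>a. pairQ M {..<n} U a b) = pairQ M T U \<alpha> b"
proof -
  obtain r where r: "\<And>S U a b e. S \<subseteq> {..<n} \<Longrightarrow> U \<subseteq> {..<n} \<Longrightarrow> e \<in> cb n \<Longrightarrow>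
    pairQ M S U a b = (LINT z|gauss (n + n). inF S 1 a e z * outF n M {..<n} 1 r U b e z)"
    using full_gauss by blast
  let ?e = "\<lambda>i\<in>{..<n}. 1"
  have "avg (cyl n T \<alpha>) (\<lambda>a. pairQ M {..<n} U a b)
      = (LINT z|gauss (n + n). avg (cyl n T \<alpha>) (\<lambda>a. inF {..<n} 1 a ?e z * outF n M {..<n} 1 r U b ?e z))"
    unfolding r[OF order_refl assms(2) one_cb]
    using assms cb_le1[OF assms(4)]
    by (intro integral_avg integrable_in_out) (auto intro: cb_le1 cb_le1[OF subsetD[OF cyl_subset[OF assms(3)]]])
  also have "\<dots> = pairQ M T U \<alpha> b"
    unfolding r[OF assms(1,2) one_cb] avg_multc
    by (simp only: inF_def avg_cyl_prod[OF assms(1)])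
  finally show ?thesis .
qed

lemma cyl_empty: "cyl n {} \<alpha> = cb n"
  by (simp add: cyl_def cb_def)

text \<open>The representation holds for every sign vector \<open>e\<close>, so it may be averaged
  over \<open>e\<close>. With no outputs present, that average turns every input factor into
  1.\<close>

lemma pairQ_empty_right:
  assumes "T \<subseteq> {..<n}" "a \<in> cb n" "b \<in> cb n"
  shows "pairQ M T {} a b = 1"
proof -
  obtain r where r: "\<And>S U a b e. S \<subseteq> {..<n} \<Longrightarrow> U \<subseteq> {..<n} \<Longrightarrow> e \<in> cb n \<Longrightarrow>
    pairQ M S U a b = (LINT z|gauss (n + n). inF S 1 a e z * outF n M {..<n} 1 r U b e z)"
    using full_gauss by blast
  have "pairQ M T {} a b = avg (cb n) (\<lambda>e. pairQ M T {} a b)" by (simp add: avg_const)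
  also have "\<dots> = avg (cb n) (\<lambda>e. LINT z|gauss (n + n). inF T 1 a e z * outF n M {..<n} 1 r {} b e z)"
    by (rule avg_cong) (use r[OF assms(1), of "{}"] in simp)
  also have "\<dots> = (LINT z|gauss (n + n). avg (cb n) (\<lambda>e. inF T 1 a e z * outF n M {..<n} 1 r {} b e z))"
    using assms by (intro integral_avg integrable_in_out) (auto intro: cb_le1)
  also have "\<dots> = (LINT z|gauss (n + n). 1)"
  proof (intro arg_cong[where f = "integral\<^sup>L _"] ext)
    fix z
    have "avg (cb n) (\<lambda>e. inF T 1 a e z) = avg (cb n) (\<lambda>e. \<Prod>i<n. 1 + e i * (if i \<in> T then a i * tau 1 (z i) else 0))"
    proof (rule avg_cong)
      fix e
      have "(\<Prod>i<n. 1 + e i * (if i \<in> T then a i * tau 1 (z i) else 0)) = (\<Prod>i<n. if i \<in> T then 1 + a i * (e i * tau 1 (z i)) else 1)"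
        by (intro prod.cong) auto
      then show "inF T 1 a e z = (\<Prod>i<n. 1 + e i * (if i \<in> T then a i * tau 1 (z i) else 0))"
        using assms(1) by (simp add: inF_def prod.inter_restrict[symmetric] Int_absorb1)
    qed
    also have "\<dots> = 1" by (subst avg_cb_prod) simp
    finally show "avg (cb n) (\<lambda>e. inF T 1 a e z * outF n M {..<n} 1 r {} b e z) = 1" by (simp add: outF_def)
  qed
  also have "\<dots> = 1" using prob_space.prob_space[OF prob_space_gauss[of "n + n"]] by simp
  finally show ?thesis .
qed

text \<open>The one-step entropy contraction. All randomness other than the sign noise on the input is
  handed to Jensen's inequality.\<close>

lemma pairQ_entropy:
  assumes T: "T \<subseteq> {..<n}" "T' \<subseteq> {..<n}" and \<sigma>: "0 < \<sigma>" "\<sigma> \<le> 1" and m: "minor_le M T T' \<sigma>"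
    and p: "\<And>a. a \<in> cb n \<Longrightarrow> 0 \<le> p a" "avg (cb n) p = 1"
  shows "avg (cb n) (\<lambda>b. eta (avg (cb n) (\<lambda>a. p a * pairQ M T T' a b))) \<le> 6 * \<sigma>\<^sup>2 * avg (cb n) (\<lambda>a. eta (p a))"
proof -
  let ?G = "gauss (n + n)"
  obtain r where r: "\<And>S U a b e. S \<subseteq> T \<Longrightarrow> U \<subseteq> T' \<Longrightarrow> e \<in> cb n \<Longrightarrow>
    pairQ M S U a b = (LINT z|?G. inF S \<sigma> a e z * outF n M T \<sigma> r U b e z)"
    using pairQ_gauss'[OF T \<sigma>(1) m] by blast
  have fin: "finite T" "finite T'" using T finite_subset by blast+
  define L where "L b e z = outF n M T \<sigma> r T' b e z" for b e z
  \<comment> \<open>For fixed \<open>z\<close>, \<open>D\<close> is the density of the signs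
    \<open>e\<close> obtained from \<open>p\<close> by sign noise of strength
    \<open>tau \<sigma> (z i)\<close>, and \<open>L\<close> is the density of the outputs
    \<open>b\<close> given \<open>e\<close> and \<open>z\<close>.\<close>
  define D where "D e z = avg (cb n) (\<lambda>a. p a * inF T \<sigma> a e z)" for e z
  define q where "q b = avg (cb n) (\<lambda>a. p a * pairQ M T T' a b)" for b
  have in_b: "0 \<le> inF T \<sigma> a e z" "inF T \<sigma> a e z \<le> 2 ^ card T" if "a \<in> cb n" "e \<in> cb n" for a e z
    using that T fin \<sigma> by (auto intro!: inF_bounds intro: cb_le1)
  have L_b: "0 \<le> L b e z" "L b e z \<le> 2 ^ card T'" if "b \<in> cb n" for b e z
    using that T fin unfolding L_def by (auto intro!: outF_bounds intro: cb_le1)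
  have L_meas: "L b e \<in> borel_measurable ?G" for b e
    unfolding L_def by measurable
  have D_meas: "D e \<in> borel_measurable ?G" for e
    unfolding D_def avg_def using T by measurable
  have D_b: "0 \<le> D e z" "D e z \<le> 2 ^ card T" if "e \<in> cb n" for e z
  proof -
    show "0 \<le> D e z" unfolding D_def using p in_b that by (intro avg_nonneg) auto
    have "D e z \<le> avg (cb n) (\<lambda>a. p a * 2 ^ card T)"
      unfolding D_def using p in_b that by (intro avg_mono mult_left_mono) auto
    then show "D e z \<le> 2 ^ card T" by (simp add: avg_multc p)
  qed
  define K where "K = (2 :: real) ^ card T * 2 ^ card T + 1"
  have eta_b: "\<bar>eta (D e z)\<bar> \<le> K" if "e \<in> cb n" for e z
  proof -
    have "eta (D e z) \<le> D e z * D e z"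
    proof (cases "D e z = 0")
      case False
      then show ?thesis unfolding eta_def using D_b[OF that, of z] ln_le_minus_one[of "D e z"]
        by (intro mult_left_mono) auto
    qed simp
    also have "\<dots> \<le> 2 ^ card T * 2 ^ card T" using D_b[OF that, of z] by (intro mult_mono) auto
    finally have "eta (D e z) \<le> K" by (simp add: K_def)
    moreover have "eta (D e z) \<ge> -1" using eta_ge[of "D e z"] D_b[OF that, of z] by simp
    moreover have "K \<ge> 1" by (simp add: K_def)
    ultimately show ?thesis by simp
  qed
  have etaD_meas: "(\<lambda>z. eta (D e z)) \<in> borel_measurable ?G" for e
    unfolding eta_def using D_meas[of e] by measurable
  have intL: "integrable ?G (L b e)" if "b \<in> cb n" for b e
    by (rule integrable_gauss_bounded[of _ _ "2 ^ card T'"]) (use L_meas L_b[OF that] in auto)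
  have L1: "(LINT z|?G. L b e z) = 1" if "b \<in> cb n" "e \<in> cb n" for b e
    using r[of "{}" T' e b b] that T pairQ_empty[of T' n M b b] by (simp add: L_def inF_def)
  have qe: "q b = (LINT z|?G. D e z * L b e z)" if "b \<in> cb n" "e \<in> cb n" for b e
  proof -
    have "q b = avg (cb n) (\<lambda>a. LINT z|?G. p a * (inF T \<sigma> a e z * L b e z))"
      unfolding q_def by (rule avg_cong) (simp add: r[OF order_refl order_refl that(2)] L_def)
    also have "\<dots> = (LINT z|?G. avg (cb n) (\<lambda>a. p a * (inF T \<sigma> a e z * L b e z)))"
      unfolding L_def using T \<sigma> that
      by (intro integral_avg integrable_mult_right integrable_in_out) (auto intro: cb_le1)
    also have "\<dots> = (LINT z|?G. D e z * L b e z)"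
      unfolding D_def avg_multc[symmetric] by (simp add: mult.assoc)
    finally show ?thesis .
  qed
  have q0: "0 \<le> q b" if "b \<in> cb n" for b
    unfolding q_def using p T that by (intro avg_nonneg mult_nonneg_nonneg pairQ_nonneg) auto
  have intDL: "integrable ?G (\<lambda>z. D e z * L b e z)" if "b \<in> cb n" "e \<in> cb n" for b e
    by (rule integrable_gauss_bounded[of _ _ "2 ^ card T * 2 ^ card T'"])
      (use L_meas D_meas L_b[OF that(1)] D_b[OF that(2)] in \<open>auto simp: abs_mult intro!: mult_mono borel_measurable_times\<close>)
  have intEL: "integrable ?G (\<lambda>z. eta (D e z) * L b e z)" if "b \<in> cb n" "e \<in> cb n" for b e
    by (rule integrable_gauss_bounded[of _ _ "K * 2 ^ card T'"])
      (use L_meas etaD_meas L_b[OF that(1)] eta_b[OF that(2)] in \<open>auto simp: abs_mult K_def intro!: mult_mono borel_measurable_times\<close>)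
  have intE: "integrable ?G (\<lambda>z. eta (D e z))" if "e \<in> cb n" for e
    by (rule integrable_gauss_bounded[of _ _ K]) (use etaD_meas eta_b[OF that] in auto)
  \<comment> \<open>The tangent of \<open>eta\<close> at \<open>s\<close>. Integrated against the
    probability density \<open>L b e\<close>, it yields Jensen's inequality at
    \<open>s = q b\<close>.\<close>
  have tangent: "x * ln s + x - s \<le> eta x" if "0 < s" "0 \<le> x" for x s :: real
  proof (cases "x = 0")
    case False
    then have "ln (s / x) \<le> s / x - 1" using that by (intro ln_le_minus_one) auto
    then have "x * (ln s - ln x) \<le> x * (s / x - 1)" using that False by (intro mult_left_mono) (auto simp: ln_div)
    then show ?thesis using False by (simp add: eta_def algebra_simps)
  qed (use that in simp)
  have jensen_s: "q b * ln s + q b - s \<le> (LINT z|?G. eta (D e z) * L b e z)"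
    if be: "b \<in> cb n" "e \<in> cb n" and s: "0 < s" for b e s
  proof -
    have "q b * ln s + q b - s = (LINT z|?G. D e z * L b e z) * (ln s + 1) - s * (LINT z|?G. L b e z)"
      using L1[OF be] qe[OF be] by (simp add: algebra_simps)
    also have "\<dots> = (LINT z|?G. D e z * L b e z * (ln s + 1) - s * L b e z)"
      using intDL[OF be] intL[OF be(1), of e] by simp
    also have "\<dots> \<le> (LINT z|?G. eta (D e z) * L b e z)"
    proof (rule integral_mono)
      show "integrable ?G (\<lambda>z. D e z * L b e z * (ln s + 1) - s * L b e z)"
        using intDL[OF be] intL[OF be(1), of e] by simp
      show "integrable ?G (\<lambda>z. eta (D e z) * L b e z)" by (rule intEL[OF be])
      fix z
      have "D e z * L b e z * (ln s + 1) - s * L b e z = (D e z * ln s + D e z - s) * L b e z"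
        by (simp add: algebra_simps)
      also have "\<dots> \<le> eta (D e z) * L b e z"
        by (intro mult_right_mono tangent s D_b[OF be(2)] L_b[OF be(1)])
      finally show "D e z * L b e z * (ln s + 1) - s * L b e z \<le> eta (D e z) * L b e z" .
    qed
    finally show ?thesis .
  qed
  have jensen: "eta (q b) \<le> (LINT z|?G. eta (D e z) * L b e z)" if be: "b \<in> cb n" "e \<in> cb n" for b e
  proof (cases "q b = 0")
    \<comment> \<open>At 0 there is no tangent, but a small positive \<open>s\<close> contradicts a
      negative integral.\<close>
    case True
    show ?thesis
    proof (rule ccontr)
      assume "\<not> ?thesis"
      then have neg: "(LINT z|?G. eta (D e z) * L b e z) < 0" using True by simp
      from jensen_s[OF be, of "- (LINT z|?G. eta (D e z) * L b e z) / 2"] True neg show False by simp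
    qed
  next
    case False
    then show ?thesis using jensen_s[OF be, of "q b"] q0[OF be(1)] by (simp add: eta_def)
  qed
  have avgL: "avg (cb n) (\<lambda>b. L b e z) = 1" for e z
  proof -
    have "avg (cb n) (\<lambda>b. L b e z) = avg (cb n) (\<lambda>b. \<Prod>j<n. 1 + b j * (if j \<in> T' then sin (out_form n M T \<sigma> r e j z) else 0))"
    proof (rule avg_cong)
      fix b
      have "(\<Prod>j<n. 1 + b j * (if j \<in> T' then sin (out_form n M T \<sigma> r e j z) else 0)) =
          (\<Prod>j<n. if j \<in> T' then 1 + b j * sin (out_form n M T \<sigma> r e j z) else 1)"
        by (intro prod.cong) auto
      then show "L b e z = (\<Prod>j<n. 1 + b j * (if j \<in> T' then sin (out_form n M T \<sigma> r e j z) else 0))"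
        using T by (simp add: L_def outF_def prod.inter_restrict[symmetric] Int_absorb1)
    qed
    also have "\<dots> = 1" by (subst avg_cb_prod) simp
    finally show ?thesis .
  qed
  \<comment> \<open>Averaging over the outputs removes the likelihood, whose mean over
    \<open>b\<close> is 1.\<close>
  have e_step: "avg (cb n) (\<lambda>b. eta (q b)) \<le> (LINT z|?G. eta (D e z))" if e: "e \<in> cb n" for e
  proof -
    have "avg (cb n) (\<lambda>b. eta (q b)) \<le> avg (cb n) (\<lambda>b. LINT z|?G. eta (D e z) * L b e z)"
      by (rule avg_mono) (rule jensen[OF _ e])
    also have "\<dots> = (LINT z|?G. avg (cb n) (\<lambda>b. eta (D e z) * L b e z))"
      by (rule integral_avg) (rule intEL[OF _ e])
    also have "\<dots> = (LINT z|?G. eta (D e z))" by (simp add: avg_cmult avgL)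
    finally show ?thesis .
  qed
  obtain I where I: "\<forall>i<n. 0 \<le> I i" "(\<Sum>i<n. I i) = avg (cb n) (\<lambda>s. eta (p s)) - eta (avg (cb n) p)"
    "\<And>t. (\<forall>i<n. \<bar>t i\<bar> \<le> 1) \<Longrightarrow>
      avg (cb n) (\<lambda>e. eta (avg (cb n) (\<lambda>a. p a * (\<Prod>i<n. 1 + a i * (e i * t i))))) - eta (avg (cb n) p)
        \<le> 6 * (\<Sum>i<n. (t i)\<^sup>2 * I i)"
    using noise_entropy[of n p] p(1) by blast
  define t where "t z i = (if i \<in> T then tau \<sigma> (z i) else 0)" for z i
  have t1: "\<bar>t z i\<bar> \<le> 1" for z i using tau_abs[OF \<sigma>] by (simp add: t_def)
  have inFt: "inF T \<sigma> a e z = (\<Prod>i<n. 1 + a i * (e i * t z i))" for a e z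
  proof -
    have "(\<Prod>i<n. 1 + a i * (e i * t z i)) = (\<Prod>i<n. if i \<in> T then 1 + a i * (e i * tau \<sigma> (z i)) else 1)"
      by (intro prod.cong) (auto simp: t_def)
    then show ?thesis using T by (simp add: inF_def prod.inter_restrict[symmetric] Int_absorb1)
  qed
  have t_meas: "(\<lambda>z. (t z i)\<^sup>2) \<in> borel_measurable ?G" for i
    using T unfolding t_def
    by (cases "i \<in> T") (auto intro!: borel_measurable_power measurable_compose[OF measurable_comp_gauss measurable_tau])
  have int_t: "integrable ?G (\<lambda>z. (t z i)\<^sup>2)" for i
    by (rule integrable_gauss_bounded[of _ _ 1]) (use t_meas t1 in \<open>auto simp: abs_square_le_1\<close>)
  have t_sq: "(LINT z|?G. (t z i)\<^sup>2) \<le> \<sigma>\<^sup>2" for i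
    using integral_tau_sq[OF \<sigma>, of i "n + n"] T by (cases "i \<in> T") (auto simp: t_def)
  \<comment> \<open>The bound holds for each \<open>e\<close>, so its right side may be averaged
    over \<open>e\<close>, which brings in \<open>noise_entropy\<close>.\<close>
  have "avg (cb n) (\<lambda>b. eta (q b)) = avg (cb n) (\<lambda>e. avg (cb n) (\<lambda>b. eta (q b)))"
    by (simp add: avg_const)
  also have "\<dots> \<le> avg (cb n) (\<lambda>e. LINT z|?G. eta (D e z))"
    by (rule avg_mono) (rule e_step)
  also have "\<dots> = (LINT z|?G. avg (cb n) (\<lambda>e. eta (D e z)))"
    by (rule integral_avg) (rule intE)
  also have "\<dots> \<le> (LINT z|?G. 6 * (\<Sum>i<n. (t z i)\<^sup>2 * I i))"
  proof (rule integral_mono)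
    show "integrable ?G (\<lambda>z. avg (cb n) (\<lambda>e. eta (D e z)))"
      unfolding avg_def using intE by (intro integrable_divide_zero Bochner_Integration.integrable_sum) auto
    show "integrable ?G (\<lambda>z. 6 * (\<Sum>i<n. (t z i)\<^sup>2 * I i))"
      using int_t by (intro integrable_mult_right Bochner_Integration.integrable_sum integrable_mult_left) auto
    fix z
    show "avg (cb n) (\<lambda>e. eta (D e z)) \<le> 6 * (\<Sum>i<n. (t z i)\<^sup>2 * I i)"
      using I(3)[of "t z"] t1 p(2) by (simp add: D_def inFt)
  qed
  also have "\<dots> = 6 * (\<Sum>i<n. (LINT z|?G. (t z i)\<^sup>2) * I i)"
    using int_t by (simp add: Bochner_Integration.integral_sum)
  also have "\<dots> \<le> 6 * (\<Sum>i<n. \<sigma>\<^sup>2 * I i)"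
    using I(1) t_sq by (intro mult_left_mono sum_mono mult_right_mono) auto
  also have "\<dots> = 6 * \<sigma>\<^sup>2 * avg (cb n) (\<lambda>a. eta (p a))"
    using I(2) p(2) by (simp flip: sum_distrib_left)
  finally show ?thesis unfolding q_def .
qed

end

section \<open>Iterated averages and the chains of kernels along the layers\<close>

primrec avl :: "'a set list \<Rightarrow> ('a list \<Rightarrow> real) \<Rightarrow> real" where
  "avl [] f = f []"
| "avl (A # As) f = avl As (\<lambda>zs. avg A (\<lambda>z. f (z # zs)))"

lemma avl_append: "avl (As @ Bs) f = avl Bs (\<lambda>ys. avl As (\<lambda>xs. f (xs @ ys)))"
  by (induction As arbitrary: f) auto

lemma avl_avg: "avl As (\<lambda>xs. avg B (f xs)) = avg B (\<lambda>b. avl As (\<lambda>xs. f xs b))"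
proof (induction As arbitrary: f)
  case (Cons A As)
  show ?case using Cons.IH[of "\<lambda>zs b. avg A (\<lambda>z. f (z # zs) b)"] by (simp add: avg_swap[of A B])
qed simp

lemma avl_cmult: "avl As (\<lambda>xs. c * f xs) = c * avl As f"
  by (induction As arbitrary: f) (simp_all add: avg_cmult)

lemma avl_add: "avl As (\<lambda>xs. f xs + g xs) = avl As f + avl As g"
  by (induction As arbitrary: f g) (simp_all add: avg_add)

lemma avl_const: "(\<And>A. A \<in> set As \<Longrightarrow> finite A \<and> A \<noteq> {}) \<Longrightarrow> avl As (\<lambda>_. c) = c"
  by (induction As) (simp_all add: avg_const)

lemma avl_mono:
  assumes "\<And>zs. list_all2 (\<in>) zs As \<Longrightarrow> f zs \<le> g zs"
  shows "avl As f \<le> avl As g"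
  using assms
proof (induction As arbitrary: f g)
  case (Cons A As)
  show ?case
    unfolding avl.simps
  proof (intro Cons.IH avg_mono)
    fix zs z assume "list_all2 (\<in>) zs As" "z \<in> A"
    then show "f (z # zs) \<le> g (z # zs)" by (intro Cons.prems) simp
  qed
qed simp

lemma avl_cong:
  assumes "\<And>zs. list_all2 (\<in>) zs As \<Longrightarrow> f zs = g zs"
  shows "avl As f = avl As g"
  by (intro antisym avl_mono) (simp_all add: assms)

lemma pairQ_cong:
  assumes "\<And>i. i \<in> T \<Longrightarrow> a i = a' i" "\<And>j. j \<in> U \<Longrightarrow> b j = b' j"
  shows "pairQ M T U a b = pairQ M T U a' b'"
  unfolding pairQ_def gram_form_def
  by (intro arg_cong[where f = Re] sum.cong refl arg_cong2[where f = "(*)"] prod.cong)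
    (use assms in \<open>auto simp: Plus_def\<close>)

lemma cyl_cong: "(\<And>i. i \<in> T \<Longrightarrow> \<rho> i = \<rho>' i) \<Longrightarrow> cyl n T \<rho> = cyl n T \<rho>'"
  unfolding cyl_def by (intro PiE_cong) auto

lemma avg_cyl_sm:
  assumes "s \<in> cb n" "\<rho> \<in> cb n"
  shows "avg (cyl n T \<rho>) (\<lambda>z. f (sm n z s)) = avg (cyl n T (sm n \<rho> s)) f"
proof (rule avg_bij)
  show "bij_betw (\<lambda>z. sm n z s) (cyl n T \<rho>) (cyl n T (sm n \<rho> s))"
  proof (rule bij_betw_byWitness[of _ "\<lambda>z. sm n z s"])
    have m: "z \<in> cb n" if "z \<in> cyl n T \<rho>" for z using that cyl_subset[OF assms(2)] by auto
    have m': "z \<in> cb n" if "z \<in> cyl n T (sm n \<rho> s)" for z using that cyl_subset[OF sm_cb[OF assms(2,1)]] by auto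
    show "\<forall>a\<in>cyl n T \<rho>. sm n (sm n a s) s = a"
      using sm_sm[OF assms(1)] m by (simp add: sm_commute[of n _ s])
    show "\<forall>a\<in>cyl n T (sm n \<rho> s). sm n (sm n a s) s = a"
      using sm_sm[OF assms(1)] m' by (simp add: sm_commute[of n _ s])
    show "(\<lambda>z. sm n z s) ` cyl n T \<rho> \<subseteq> cyl n T (sm n \<rho> s)"
      using m sm_cb[OF _ assms(1)] by (auto simp: cyl_eq[OF sm_cb[OF assms(2,1)]] cyl_eq[OF assms(2)])
    show "(\<lambda>z. sm n z s) ` cyl n T (sm n \<rho> s) \<subseteq> cyl n T \<rho>"
    proof clarify
      fix z assume z: "z \<in> cyl n T (sm n \<rho> s)"
      have "z i * s i = \<rho> i" if "i < n" "i \<in> T" for i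
        using z that cb_sq[OF assms(1), of i] by (auto simp: cyl_eq[OF sm_cb[OF assms(2,1)]])
      then show "sm n z s \<in> cyl n T \<rho>"
        using sm_cb[OF m'[OF z] assms(1)] by (auto simp: cyl_eq[OF assms(2)])
    qed
  qed
qed

text \<open>Density of the signs that leave a path of layers. The path starts at the all-ones
  vector; at each step the current signs are multiplied by a layer and sent through the kernel. The
  head of the list is the layer passed last.\<close>

primrec chain :: "nat \<Rightarrow> (nat \<Rightarrow> nat \<Rightarrow> real) \<Rightarrow> (nat \<Rightarrow> real) list \<Rightarrow> (nat \<Rightarrow> real) \<Rightarrow> real" where
  "chain n M [] s = (if s = (\<lambda>i\<in>{..<n}. 1) then 2 ^ n else 0)"
| "chain n M (z # zs) s = avg (cb n) (\<lambda>s'. chain n M zs s' * pairQ M {..<n} {..<n} (sm n z s') s)"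

text \<open>The chain after averaging out the free coordinates: \<open>fst x\<close> are the fixed
  coordinates of a layer, \<open>snd x\<close> its values there, and \<open>U\<close> the outputs
  still observed.\<close>

primrec red_chain :: "nat \<Rightarrow> (nat \<Rightarrow> nat \<Rightarrow> real) \<Rightarrow> (nat set \<times> (nat \<Rightarrow> real)) list \<Rightarrow> nat set \<Rightarrow> (nat \<Rightarrow> real) \<Rightarrow> real" where
  "red_chain n M [] U s = (if s = (\<lambda>i\<in>{..<n}. 1) then 2 ^ n else 0)"
| "red_chain n M (x # L) U s = avg (cb n) (\<lambda>s'. red_chain n M L (fst x) s' * pairQ M (fst x) U (sm n (snd x) s') s)"

text \<open>Two chains run inwards from both ends, and the middle layer \<open>hd zs\<close> is the
  product of their outputs: a convolution on the sign group.\<close>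

definition dens :: "nat \<Rightarrow> (nat \<Rightarrow> nat \<Rightarrow> real) \<Rightarrow> nat \<Rightarrow> (nat \<Rightarrow> real) list \<Rightarrow> real" where
  "dens n M k zs = avg (cb n) (\<lambda>s. chain n M (take k (tl zs)) s * chain n M (drop k (tl zs)) (sm n (hd zs) s))"

context contraction
begin

text \<open>A test function that sees only \<open>U\<close> is constant on the subcubes fixing
  \<open>U\<close>, over which the kernel averages to its marginal.\<close>

lemma avg_pairQ_left_cyl:
  assumes "T \<subseteq> {..<n}" "U \<subseteq> {..<n}" "a \<in> cb n" "\<And>s s'. s \<in> cb n \<Longrightarrow> s' \<in> cb n \<Longrightarrow> (\<And>i. i \<in> U \<Longrightarrow> s i = s' i) \<Longrightarrow> \<psi> s = \<psi> s'"
  shows "avg (cb n) (\<lambda>s. pairQ M T {..<n} a s * \<psi> s) = avg (cb n) (\<lambda>s. pairQ M T U a s * \<psi> s)"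
proof -
  have "avg (cb n) (\<lambda>s. pairQ M T {..<n} a s * \<psi> s) = avg (cb n) (\<lambda>s. avg (cyl n U s) (\<lambda>c. pairQ M T {..<n} a c * \<psi> c))"
    by (rule avg_cyl)
  also have "\<dots> = avg (cb n) (\<lambda>s. avg (cyl n U s) (\<lambda>c. pairQ M T {..<n} a c * \<psi> s))"
    using assms(2) by (intro avg_cong arg_cong2[where f = "(*)"] refl assms(4)) (auto simp: cyl_eq)
  also have "\<dots> = avg (cb n) (\<lambda>s. pairQ M T U a s * \<psi> s)"
    by (rule avg_cong) (simp add: avg_multc avg_pairQ_right assms(1-3))
  finally show ?thesis .
qed

lemma avg_pairQ_1:
  assumes "T \<subseteq> {..<n}" "U \<subseteq> {..<n}" "a \<in> cb n"
  shows "avg (cb n) (pairQ M T U a) = 1"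
proof -
  have "avg (cb n) (pairQ M T U a) = avg (cb n) (\<lambda>s. pairQ M T {..<n} a s)"
    using avg_pairQ_left_cyl[OF assms, of "\<lambda>_. 1"] by simp
  also have "\<dots> = pairQ M T {} a (\<lambda>i\<in>{..<n}. 1)"
    using avg_pairQ_right[OF assms(1), of "{}" a "\<lambda>i\<in>{..<n}. 1"] assms(3) one_cb by (simp add: cyl_empty)
  also have "\<dots> = 1" by (rule pairQ_empty_right[OF assms(1,3) one_cb])
  finally show ?thesis .
qed

text \<open>Averaging the free coordinates of the layer passed last removes the corresponding inputs
  of its kernel. The remaining test function sees the earlier signs only through \<open>T\<close>,
  so the induction continues with \<open>T\<close> in place of \<open>U\<close>.\<close>

lemma avl_chain:
  assumes "\<And>x. x \<in> set L \<Longrightarrow> fst x \<subseteq> {..<n} \<and> snd x \<in> cb n" "U \<subseteq> {..<n}"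
    "\<And>s s'. s \<in> cb n \<Longrightarrow> s' \<in> cb n \<Longrightarrow> (\<And>i. i \<in> U \<Longrightarrow> s i = s' i) \<Longrightarrow> \<psi> s = \<psi> s'"
  shows "avl (map (\<lambda>x. cyl n (fst x) (snd x)) L) (\<lambda>zs. avg (cb n) (\<lambda>s. chain n M zs s * \<psi> s))
    = avg (cb n) (\<lambda>s. red_chain n M L U s * \<psi> s)"
  using assms
proof (induction L arbitrary: U \<psi>)
  case (Cons x L)
  obtain T \<rho> where x: "x = (T, \<rho>)" by (cases x)
  have T: "T \<subseteq> {..<n}" and \<rho>: "\<rho> \<in> cb n" using Cons.prems(1)[of x] by (auto simp: x)
  define \<psi>' where "\<psi>' s' = avg (cb n) (\<lambda>s. pairQ M T U (sm n \<rho> s') s * \<psi> s)" for s'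
  have inner: "avg (cyl n T \<rho>) (\<lambda>z. avg (cb n) (\<lambda>s. chain n M (z # zs) s * \<psi> s)) = avg (cb n) (\<lambda>s'. chain n M zs s' * \<psi>' s')" for zs
  proof -
    have "avg (cyl n T \<rho>) (\<lambda>z. avg (cb n) (\<lambda>s. chain n M (z # zs) s * \<psi> s))
       = avg (cyl n T \<rho>) (\<lambda>z. avg (cb n) (\<lambda>s. avg (cb n) (\<lambda>s'. chain n M zs s' * (pairQ M {..<n} {..<n} (sm n z s') s * \<psi> s))))"
      by (simp add: avg_multc[symmetric] mult.assoc)
    also have "\<dots> = avg (cb n) (\<lambda>s'. avg (cb n) (\<lambda>s. avg (cyl n T \<rho>) (\<lambda>z. chain n M zs s' * (pairQ M {..<n} {..<n} (sm n z s') s * \<psi> s))))"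
      by (subst avg_swap[of "cb n" "cb n"], subst avg_swap[of "cyl n T \<rho>"], rule avg_cong, subst avg_swap, rule refl)
    also have "\<dots> = avg (cb n) (\<lambda>s'. chain n M zs s' * avg (cb n) (\<lambda>s. avg (cyl n T \<rho>) (\<lambda>z. pairQ M {..<n} {..<n} (sm n z s') s) * \<psi> s))"
      by (simp add: avg_cmult avg_multc)
    also have "\<dots> = avg (cb n) (\<lambda>s'. chain n M zs s' * \<psi>' s')"
    proof (intro avg_cong arg_cong2[where f = "(*)"] refl)
      fix s' assume s': "s' \<in> cb n"
      have "avg (cb n) (\<lambda>s. avg (cyl n T \<rho>) (\<lambda>z. pairQ M {..<n} {..<n} (sm n z s') s) * \<psi> s)
         = avg (cb n) (\<lambda>s. pairQ M T {..<n} (sm n \<rho> s') s * \<psi> s)"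
        by (rule avg_cong) (simp add: avg_cyl_sm[OF s' \<rho>, where f = "\<lambda>a. pairQ M _ _ a _"] avg_pairQ_left T sm_cb \<rho> s')
      also have "\<dots> = \<psi>' s'"
        unfolding \<psi>'_def by (rule avg_pairQ_left_cyl[OF T Cons.prems(2) sm_cb[OF \<rho> s'] Cons.prems(3)])
      finally show "avg (cb n) (\<lambda>s. avg (cyl n T \<rho>) (\<lambda>z. pairQ M {..<n} {..<n} (sm n z s') s) * \<psi> s) = \<psi>' s'" .
    qed
    finally show ?thesis .
  qed
  have "avl (map (\<lambda>x. cyl n (fst x) (snd x)) (x # L)) (\<lambda>zs. avg (cb n) (\<lambda>s. chain n M zs s * \<psi> s))
      = avl (map (\<lambda>x. cyl n (fst x) (snd x)) L) (\<lambda>zs. avg (cb n) (\<lambda>s. chain n M zs s * \<psi>' s))"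
    by (simp add: x inner del: chain.simps)
  also have "\<dots> = avg (cb n) (\<lambda>s. red_chain n M L T s * \<psi>' s)"
  proof (rule Cons.IH)
    show "fst x \<subseteq> {..<n} \<and> snd x \<in> cb n" if "x \<in> set L" for x using Cons.prems(1) that by simp
    show "T \<subseteq> {..<n}" by fact
    fix s s' assume "s \<in> cb n" "s' \<in> cb n" and e: "\<And>i. i \<in> T \<Longrightarrow> s i = s' i"
    show "\<psi>' s = \<psi>' s'" unfolding \<psi>'_def using T e
      by (intro avg_cong arg_cong2[where f = "(*)"] refl pairQ_cong) (auto simp: sm_def)
  qed
  also have "\<dots> = avg (cb n) (\<lambda>s. red_chain n M (x # L) U s * \<psi> s)"
    unfolding \<psi>'_def by (simp add: x avg_multc[symmetric] avg_cmult[symmetric] mult.assoc)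
      (rule avg_swap)
  finally show ?case .
qed simp

lemma red_chain_nonneg:
  assumes "\<And>x. x \<in> set L \<Longrightarrow> fst x \<subseteq> {..<n} \<and> snd x \<in> cb n" "U \<subseteq> {..<n}" "s \<in> cb n"
  shows "0 \<le> red_chain n M L U s"
  using assms
proof (induction L arbitrary: U s)
  case (Cons x L)
  have "0 \<le> red_chain n M L (fst x) s' * pairQ M (fst x) U (sm n (snd x) s') s" if "s' \<in> cb n" for s'
    using Cons.prems that by (intro mult_nonneg_nonneg Cons.IH pairQ_nonneg sm_cb) auto
  then show ?case by (simp add: avg_nonneg)
qed simp

lemma avg_red_chain:
  assumes "\<And>x. x \<in> set L \<Longrightarrow> fst x \<subseteq> {..<n} \<and> snd x \<in> cb n" "U \<subseteq> {..<n}"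
  shows "avg (cb n) (red_chain n M L U) = 1"
  using assms
proof (induction L arbitrary: U)
  case Nil
  have "(\<Sum>s\<in>cb n. if s = (\<lambda>i\<in>{..<n}. 1) then 2 ^ n else 0) = (2 :: real) ^ n"
    using one_cb by (simp add: sum.delta)
  then show ?case by (simp add: avg_def card_cb)
next
  case (Cons x L)
  have "avg (cb n) (red_chain n M (x # L) U) =
      avg (cb n) (\<lambda>s'. red_chain n M L (fst x) s' * avg (cb n) (pairQ M (fst x) U (sm n (snd x) s')))"
  proof -
    have "avg (cb n) (red_chain n M (x # L) U) =
        avg (cb n) (\<lambda>s. avg (cb n) (\<lambda>s'. red_chain n M L (fst x) s' * pairQ M (fst x) U (sm n (snd x) s') s))"
      by (rule avg_cong) simp
    then show ?thesis by (subst (asm) avg_swap) (simp add: avg_cmult)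
  qed
  also have "\<dots> = avg (cb n) (red_chain n M L (fst x))"
    using Cons.prems by (intro avg_cong) (simp add: avg_pairQ_1 sm_cb)
  also have "\<dots> = 1" using Cons by simp
  finally show ?case .
qed

text \<open>The initial point mass has entropy \<open>n * ln 2\<close>. A fixed layer is a
  translation and preserves entropy, and each kernel contracts it by
  \<open>pairQ_entropy\<close>.\<close>

lemma red_chain_entropy:
  assumes "\<And>x. x \<in> set L \<Longrightarrow> fst x \<subseteq> {..<n} \<and> snd x \<in> cb n \<and> card (fst x) \<le> d" "U \<subseteq> {..<n}" "card U \<le> d"
    and \<sigma>: "0 < \<sigma>" "\<sigma> \<le> 1"
    and minors: "\<And>T T'. T \<subseteq> {..<n} \<Longrightarrow> T' \<subseteq> {..<n} \<Longrightarrow> card T \<le> d \<Longrightarrow> card T' \<le> d \<Longrightarrow> minor_le M T T' \<sigma>"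
  shows "avg (cb n) (\<lambda>s. eta (red_chain n M L U s)) \<le> (6 * \<sigma>\<^sup>2) ^ length L * n"
  using assms(1-3)
proof (induction L arbitrary: U)
  case Nil
  have "(\<Sum>s\<in>cb n. eta (if s = (\<lambda>i\<in>{..<n}. 1) then 2 ^ n else 0)) = (\<Sum>s\<in>cb n. if s = (\<lambda>i\<in>{..<n}. 1) then eta (2 ^ n) else 0)"
    by (intro sum.cong) auto
  also have "\<dots> = 2 ^ n * (n * ln 2)"
    using one_cb by (simp add: sum.delta eta_def ln_realpow)
  finally have "avg (cb n) (\<lambda>s. eta (red_chain n M [] U s)) = n * ln 2" by (simp add: avg_def card_cb)
  also have "\<dots> \<le> n" using ln_2_less_1 by (simp add: mult_left_le)
  finally show ?case by simp
next
  case (Cons x L)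
  let ?p = "\<lambda>a. red_chain n M L (fst x) (sm n (snd x) a)"
  have x: "fst x \<subseteq> {..<n}" "snd x \<in> cb n" "card (fst x) \<le> d" using Cons.prems by auto
  have L: "\<And>x. x \<in> set L \<Longrightarrow> fst x \<subseteq> {..<n} \<and> snd x \<in> cb n" using Cons.prems by auto
  have "avg (cb n) (\<lambda>b. eta (red_chain n M (x # L) U b)) = avg (cb n) (\<lambda>b. eta (avg (cb n) (\<lambda>a. ?p a * pairQ M (fst x) U a b)))"
    by (simp add: avg_sm2[OF x(2), of "\<lambda>s' a. red_chain n M L (fst x) s' * pairQ M (fst x) U a _"])
  also have "\<dots> \<le> 6 * \<sigma>\<^sup>2 * avg (cb n) (\<lambda>a. eta (?p a))"
  proof (rule pairQ_entropy[OF x(1) Cons.prems(2) \<sigma>])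
    show "minor_le M (fst x) U \<sigma>" using x Cons.prems by (intro minors) auto
    show "0 \<le> ?p a" if "a \<in> cb n" for a
      using L x that by (intro red_chain_nonneg sm_cb) auto
    show "avg (cb n) ?p = 1"
      using avg_sm[OF x(2), of "red_chain n M L (fst x)"] avg_red_chain[OF L x(1)] by simp
  qed
  also have "avg (cb n) (\<lambda>a. eta (?p a)) = avg (cb n) (\<lambda>a. eta (red_chain n M L (fst x) a))"
    using avg_sm[OF x(2), of "\<lambda>s. eta (red_chain n M L (fst x) s)"] by simp
  also have "6 * \<sigma>\<^sup>2 * \<dots> \<le> 6 * \<sigma>\<^sup>2 * ((6 * \<sigma>\<^sup>2) ^ length L * n)"
    using Cons.prems x by (intro mult_left_mono Cons.IH) auto
  finally show ?case by (simp add: mult_ac)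
qed

lemma red_chain_cong:
  assumes "L \<noteq> []" "\<And>i. i \<in> U \<Longrightarrow> s i = s' i"
  shows "red_chain n M L U s = red_chain n M L U s'"
  using assms by (cases L) (auto intro!: avg_cong arg_cong2[where f = "(*)"] pairQ_cong)

text \<open>The halves are reduced one after the other by \<open>avl_chain\<close>. The second
  reduction requires that the first reduced half sees only \<open>T\<close>; this is where
  \<open>k > 0\<close> enters, as a chain without kernels sees all coordinates.\<close>

lemma avl_dens_eq:
  assumes LR: "\<And>x. x \<in> set L \<union> set R \<Longrightarrow> fst x \<subseteq> {..<n} \<and> snd x \<in> cb n"
    and len: "length L = k" "k > 0" and T: "T \<subseteq> {..<n}" and \<rho>: "\<rho> \<in> cb n"
  shows "avl (cyl n T \<rho> # map (\<lambda>x. cyl n (fst x) (snd x)) (L @ R)) (dens n M k)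
    = avg (cb n) (\<lambda>v. red_chain n M R T v * red_chain n M L T (sm n \<rho> v))"
proof -
  let ?A = "map (\<lambda>x. cyl n (fst x) (snd x)) L" and ?B = "map (\<lambda>x. cyl n (fst x) (snd x)) R"
  define \<psi> where "\<psi> ys s = avg (cyl n T \<rho>) (\<lambda>z. chain n M ys (sm n z s))" for ys s
  have "avl (cyl n T \<rho> # map (\<lambda>x. cyl n (fst x) (snd x)) (L @ R)) (dens n M k) =
      avl ?B (\<lambda>ys. avl ?A (\<lambda>xs. avg (cyl n T \<rho>) (\<lambda>z. dens n M k (z # xs @ ys))))"
    by (simp add: avl_append)
  also have "\<dots> = avl ?B (\<lambda>ys. avl ?A (\<lambda>xs. avg (cb n) (\<lambda>s. chain n M xs s * \<psi> ys s)))"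
  proof (intro avl_cong)
    fix ys xs assume "list_all2 (\<in>) xs ?A"
    then have "length xs = k" using len by (auto dest: list_all2_lengthD)
    then have "avg (cyl n T \<rho>) (\<lambda>z. dens n M k (z # xs @ ys)) =
        avg (cyl n T \<rho>) (\<lambda>z. avg (cb n) (\<lambda>s. chain n M xs s * chain n M ys (sm n z s)))"
      by (simp add: dens_def)
    also have "\<dots> = avg (cb n) (\<lambda>s. chain n M xs s * \<psi> ys s)"
      by (subst avg_swap) (simp add: avg_cmult \<psi>_def)
    finally show "avg (cyl n T \<rho>) (\<lambda>z. dens n M k (z # xs @ ys)) = avg (cb n) (\<lambda>s. chain n M xs s * \<psi> ys s)" .
  qed
  also have "\<dots> = avl ?B (\<lambda>ys. avg (cb n) (\<lambda>s. red_chain n M L T s * \<psi> ys s))"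
  proof (intro avl_cong avl_chain)
    fix ys s s' assume s: "s \<in> cb n" "s' \<in> cb n" "\<And>i. i \<in> T \<Longrightarrow> s i = s' i"
    have "cyl n T (sm n \<rho> s) = cyl n T (sm n \<rho> s')" using s(3) by (intro cyl_cong) (simp add: sm_def)
    then show "\<psi> ys s = \<psi> ys s'"
      unfolding \<psi>_def using avg_cyl_sm[OF s(1) \<rho>, of T "chain n M ys"] avg_cyl_sm[OF s(2) \<rho>, of T "chain n M ys"] by simp
  qed (use LR T in auto)
  also have "\<dots> = avl ?B (\<lambda>ys. avg (cb n) (\<lambda>v. chain n M ys v * red_chain n M L T (sm n \<rho> v)))"
  proof (intro avl_cong)
    fix ys
    have "avg (cb n) (\<lambda>s. red_chain n M L T s * \<psi> ys s) = avg (cyl n T \<rho>) (\<lambda>z. avg (cb n) (\<lambda>s. red_chain n M L T s * chain n M ys (sm n z s)))"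
      unfolding \<psi>_def by (subst avg_swap) (simp add: avg_cmult)
    also have "\<dots> = avg (cyl n T \<rho>) (\<lambda>z. avg (cb n) (\<lambda>v. chain n M ys v * red_chain n M L T (sm n \<rho> v)))"
    proof (rule avg_cong)
      fix z assume z: "z \<in> cyl n T \<rho>"
      then have zc: "z \<in> cb n" using cyl_subset[OF \<rho>] by auto
      have "red_chain n M L T (sm n z v) = red_chain n M L T (sm n \<rho> v)" for v
        using len z T by (intro red_chain_cong) (auto simp: sm_def cyl_eq[OF \<rho>])
      then show "avg (cb n) (\<lambda>s. red_chain n M L T s * chain n M ys (sm n z s)) = avg (cb n) (\<lambda>v. chain n M ys v * red_chain n M L T (sm n \<rho> v))"
        using avg_sm2[OF zc, of "\<lambda>s u. red_chain n M L T s * chain n M ys u"] by (simp add: mult.commute)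
    qed
    finally show "avg (cb n) (\<lambda>s. red_chain n M L T s * \<psi> ys s) = avg (cb n) (\<lambda>v. chain n M ys v * red_chain n M L T (sm n \<rho> v))"
      by (simp add: avg_const)
  qed
  also have "\<dots> = avg (cb n) (\<lambda>v. red_chain n M R T v * red_chain n M L T (sm n \<rho> v))"
  proof (rule avl_chain)
    fix s s' assume s: "s \<in> cb n" "s' \<in> cb n" "\<And>i. i \<in> T \<Longrightarrow> s i = s' i"
    then show "red_chain n M L T (sm n \<rho> s) = red_chain n M L T (sm n \<rho> s')"
      using len by (intro red_chain_cong) (auto simp: sm_def)
  qed (use LR T in auto)
  finally show ?thesis .
qed

text \<open>Translating one factor by \<rho> does not change its mean deficit, so the pointwise
  product bound \<open>pt\<close> is averaged with the same error for every fixing of the middle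
  layer.\<close>

theorem dens_subcube:
  assumes LR: "\<And>x. x \<in> set L \<union> set R \<Longrightarrow> fst x \<subseteq> {..<n} \<and> snd x \<in> cb n \<and> card (fst x) \<le> d"
    and len: "length L = k" "length R = k" "k > 0" and T: "T \<subseteq> {..<n}" "card T \<le> d" and \<rho>: "\<rho> \<in> cb n"
    and \<sigma>: "0 < \<sigma>" "\<sigma> \<le> 1"
    and minors: "\<And>T T'. T \<subseteq> {..<n} \<Longrightarrow> T' \<subseteq> {..<n} \<Longrightarrow> card T \<le> d \<Longrightarrow> card T' \<le> d \<Longrightarrow> minor_le M T T' \<sigma>"
  shows "avl (cyl n T \<rho> # map (\<lambda>x. cyl n (fst x) (snd x)) (L @ R)) (dens n M k)
    \<ge> 1 - 2 * sqrt (6 * ((6 * \<sigma>\<^sup>2) ^ k * n))"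
proof -
  let ?f = "red_chain n M R T" and ?g = "red_chain n M L T"
  have LR': "\<And>x. x \<in> set L \<union> set R \<Longrightarrow> fst x \<subseteq> {..<n} \<and> snd x \<in> cb n" using LR by blast
  have f: "0 \<le> ?f s" "0 \<le> ?g s" if "s \<in> cb n" for s
    using LR' T that by (auto intro!: red_chain_nonneg)
  have av: "avg (cb n) ?f = 1" "avg (cb n) ?g = 1"
    using LR' T by (auto intro!: avg_red_chain)
  have e: "avg (cb n) (\<lambda>s. eta (?f s)) \<le> (6 * \<sigma>\<^sup>2) ^ k * n" "avg (cb n) (\<lambda>s. eta (?g s)) \<le> (6 * \<sigma>\<^sup>2) ^ k * n"
    using red_chain_entropy[of R d T \<sigma>] red_chain_entropy[of L d T \<sigma>] LR T \<sigma> minors len by auto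
  have def_le: "avg (cb n) (\<lambda>s. max 0 (1 - ?f s)) \<le> sqrt (6 * ((6 * \<sigma>\<^sup>2) ^ k * n))"
      "avg (cb n) (\<lambda>s. max 0 (1 - ?g s)) \<le> sqrt (6 * ((6 * \<sigma>\<^sup>2) ^ k * n))"
    using e by (auto intro!: order_trans[OF deficit_le_entropy[OF f(1) av(1)]] order_trans[OF deficit_le_entropy[OF f(2) av(2)]])
  have pt: "1 - max 0 (1 - x) - max 0 (1 - y) \<le> x * y" if "0 \<le> x" "0 \<le> y" for x y :: real
  proof -
    consider "x \<ge> 1" | "x < 1" "y \<ge> 1" | "x < 1" "y < 1" by linarith
    then show ?thesis
    proof cases
      case 1
      have "1 * y \<le> x * y" using 1 that by (intro mult_right_mono) auto
      then show ?thesis using 1 by (simp add: max_def)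
    next
      case 2
      have "x * 1 \<le> x * y" using 2 that by (intro mult_left_mono) auto
      then show ?thesis using 2 by (simp add: max_def)
    next
      case 3
      have "0 \<le> (1 - x) * (1 - y)" using 3 by simp
      then show ?thesis using 3 by (simp add: max_def algebra_simps)
    qed
  qed
  have "1 - 2 * sqrt (6 * ((6 * \<sigma>\<^sup>2) ^ k * n)) \<le> 1 - avg (cb n) (\<lambda>s. max 0 (1 - ?f s)) - avg (cb n) (\<lambda>s. max 0 (1 - ?g s))"
    using def_le by simp
  also have "\<dots> = avg (cb n) (\<lambda>v. 1 - max 0 (1 - ?f v) - max 0 (1 - ?g (sm n \<rho> v)))"
    using avg_sm[OF \<rho>, of "\<lambda>s. max 0 (1 - ?g s)"] by (simp add: avg_diff avg_const)
  also have "\<dots> \<le> avg (cb n) (\<lambda>v. ?f v * ?g (sm n \<rho> v))"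
    by (intro avg_mono pt f sm_cb \<rho>)
  also have "\<dots> = avl (cyl n T \<rho> # map (\<lambda>x. cyl n (fst x) (snd x)) (L @ R)) (dens n M k)"
    using avl_dens_eq[OF LR' len(1,3) T(1) \<rho>] by simp
  finally show ?thesis .
qed

lemma chain_nonneg:
  assumes "set zs \<subseteq> cb n" "s \<in> cb n"
  shows "0 \<le> chain n M zs s"
  using assms
  by (induction zs arbitrary: s) (auto intro!: avg_nonneg mult_nonneg_nonneg pairQ_nonneg sm_cb)

lemma dens_nonneg:
  assumes "set zs \<subseteq> cb n" "zs \<noteq> []"
  shows "0 \<le> dens n M k zs"
proof -
  have "set (take k (tl zs)) \<subseteq> cb n" "set (drop k (tl zs)) \<subseteq> cb n" "hd zs \<in> cb n"
    using assms set_take_subset[of k "tl zs"] set_drop_subset[of k "tl zs"] by (cases zs; auto)+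
  then show ?thesis unfolding dens_def
    by (intro avg_nonneg mult_nonneg_nonneg chain_nonneg sm_cb)
qed

end

section \<open>Moments of the forrelation form\<close>

text \<open>The product is the density of independent signs with means \<open>x l\<close>.\<close>

lemma avg_cb_two:
  assumes "i < n" "i' < n"
  shows "avg (cb n) (\<lambda>u. (\<Prod>l<n. 1 + u l * x l) * (u i * u i')) = (if i = i' then 1 else x i * x i')"
proof -
  define w where "w l y = (if l = i then y else 1) * (if l = i' then y else (1 :: real))" for l y
  have "u i * u i' = (\<Prod>l<n. w l (u l))" for u :: "nat \<Rightarrow> real"
    using assms by (simp add: w_def prod.distrib prod.delta)
  then have "avg (cb n) (\<lambda>u. (\<Prod>l<n. 1 + u l * x l) * (u i * u i')) = avg (cb n) (\<lambda>u. \<Prod>l<n. (1 + u l * x l) * w l (u l))"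
    by (simp add: prod.distrib)
  also have "\<dots> = (\<Prod>l<n. ((1 + 1 * x l) * w l 1 + (1 + (-1) * x l) * w l (-1)) / 2)"
    by (rule avg_cb_prod)
  also have "\<dots> = (\<Prod>l<n. (if l = i then (if i = i' then 1 else x i) else 1) * (if l = i' then (if i = i' then 1 else x i') else 1))"
    by (rule prod.cong) (auto simp: w_def)
  also have "\<dots> = (if i = i' then 1 else x i * x i')"
    using assms by (simp add: prod.distrib prod.delta)
  finally show ?thesis .
qed

lemma avg_cb_one:
  assumes "i < n"
  shows "avg (cb n) (\<lambda>u. (\<Prod>l<n. 1 + u l * x l) * u i) = x i"
proof -
  have "u i = (\<Prod>l<n. if l = i then u l else 1)" for u :: "nat \<Rightarrow> real"
    using assms by (simp add: prod.delta)
  then have "avg (cb n) (\<lambda>u. (\<Prod>l<n. 1 + u l * x l) * u i) = avg (cb n) (\<lambda>u. \<Prod>l<n. (1 + u l * x l) * (if l = i then u l else 1))"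
    by (simp add: prod.distrib)
  also have "\<dots> = (\<Prod>l<n. ((1 + 1 * x l) * (if l = i then 1 else 1) + (1 + (-1) * x l) * (if l = i then -1 else 1)) / 2)"
    by (rule avg_cb_prod[of n "\<lambda>l y. (1 + y * x l) * (if l = i then y else 1)"])
  also have "\<dots> = (\<Prod>l<n. if l = i then x l else 1)"
    by (rule prod.cong) auto
  also have "\<dots> = x i" using assms by (simp add: prod.delta)
  finally show ?thesis .
qed

lemma avg_cb_square: "avg (cb n) (\<lambda>u. (\<Sum>i<n. u i * a i)\<^sup>2) = (\<Sum>i<n. (a i)\<^sup>2)"
proof -
  have "avg (cb n) (\<lambda>u. (\<Sum>i<n. u i * a i)\<^sup>2) = avg (cb n) (\<lambda>u. \<Sum>i<n. \<Sum>i'<n. (a i * a i') * ((\<Prod>l<n. 1 + u l * 0) * (u i * u i')))"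
    by (simp add: power2_eq_square sum_product mult_ac)
  also have "\<dots> = (\<Sum>i<n. \<Sum>i'<n. (a i * a i') * (if i = i' then 1 else 0))"
    unfolding avg_sum avg_cmult by (intro sum.cong refl) (subst avg_cb_two, auto)
  also have "\<dots> = (\<Sum>i<n. (a i)\<^sup>2)"
    by (simp add: power2_eq_square if_distrib cong: if_cong)
  finally show ?thesis .
qed

lemma gauss_cos:
  assumes "\<And>k k'. k \<in> K \<Longrightarrow> k' \<in> K \<Longrightarrow> (\<Sum>l<L. v k l * v k' l) = G k k'" "finite K"
  shows "(LINT z|gauss L. cos (\<Sum>k\<in>K. c k * (\<Sum>l<L. v k l * z l))) = exp (- (\<Sum>k\<in>K. \<Sum>k'\<in>K. c k * c k' * G k k') / 2)"
proof -
  let ?w = "\<lambda>l. \<Sum>k\<in>K. c k * v k l"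
  have 1: "(\<Sum>k\<in>K. c k * (\<Sum>l<L. v k l * z l)) = (\<Sum>l<L. ?w l * z l)" for z
    unfolding sum_distrib_left sum_distrib_right by (subst sum.swap) (simp add: mult.assoc)
  have "(\<Sum>l<L. (?w l)\<^sup>2) = (\<Sum>l<L. \<Sum>k\<in>K. \<Sum>k'\<in>K. c k * c k' * (v k l * v k' l))"
    by (simp add: power2_eq_square sum_product mult_ac)
  also have "\<dots> = (\<Sum>k\<in>K. \<Sum>k'\<in>K. \<Sum>l<L. c k * c k' * (v k l * v k' l))"
    by (subst sum.swap) (intro sum.cong refl, subst sum.swap, simp)
  also have "\<dots> = (\<Sum>k\<in>K. \<Sum>k'\<in>K. c k * c k' * G k k')"
    by (intro sum.cong refl) (simp only: sum_distrib_left[symmetric] assms(1))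
  finally have 2: "(\<Sum>l<L. (?w l)\<^sup>2) = (\<Sum>k\<in>K. \<Sum>k'\<in>K. c k * c k' * G k k')" .
  have int: "integrable (gauss L) (\<lambda>z. cis (\<Sum>l<L. ?w l * z l))"
    by (rule integrable_gauss_bounded[of _ _ 1]) (auto simp: cis_conv_exp)
  have "(LINT z|gauss L. cos (\<Sum>l<L. ?w l * z l)) = Re (LINT z|gauss L. cis (\<Sum>l<L. ?w l * z l))"
    using integral_Re[OF int] by simp
  then show ?thesis unfolding 1 gauss_cis 2 by simp
qed

lemma sin_sin: "sin a * sin b = (cos (a - b) - cos (a + b)) / (2 :: real)"
  by (simp add: cos_diff cos_add)

lemma sin_four: "sin a * sin b * (sin c * sin d) = (cos (a - b + c - d) + cos (a - b - c + d) - cos (a - b + c + d) - cos (a - b - c - d)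
    - cos (a + b + c - d) - cos (a + b - c + d) + cos (a + b + c + d) + cos (a + b - c - d)) / (8 :: real)"
  by (simp add: cos_add cos_diff sin_add sin_diff field_simps)

text \<open>The inputs are the first \<open>n\<close> coordinates, the outputs are columns of
  \<open>M\<close> completed by residual coordinates. Moments can then be computed in one fixed
  realisation.\<close>

lemma (in contraction) full_gram:
  "\<exists>v. (\<forall>k\<in>{..<n} <+> {..<n}. \<forall>k'\<in>{..<n} <+> {..<n}. (\<Sum>l<n + n. v k l * v k' l) = pair_gram M k k')"
proof -
  define A where "A j j' = of_bool (j = j') - (\<Sum>i<n. M i j * M i j')" for j j'
  have "\<exists>r :: nat \<Rightarrow> nat \<Rightarrow> real. \<forall>i<n. \<forall>j<n. (\<Sum>l<n. r i l * r j l) = A i j"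
  proof (rule psd_gram)
    show "A i j = A j i" for i j by (auto simp: A_def mult.commute)
    fix y :: "nat \<Rightarrow> real"
    have 1: "(\<Sum>j<n. \<Sum>j'<n. y j * of_bool (j = j') * y j') = (\<Sum>j<n. (y j)\<^sup>2)"
      by (intro sum.cong refl) (simp add: power2_eq_square of_bool_def if_distrib if_distribR cong: if_cong)
    have "(\<Sum>j<n. \<Sum>j'<n. y j * (\<Sum>i<n. M i j * M i j') * y j') = (\<Sum>j<n. \<Sum>j'<n. \<Sum>i<n. (M i j * y j) * (M i j' * y j'))"
      by (simp add: sum_distrib_left sum_distrib_right mult_ac)
    also have "\<dots> = (\<Sum>i<n. \<Sum>j<n. \<Sum>j'<n. (M i j * y j) * (M i j' * y j'))"
    proof -
      have "(\<Sum>j<n. \<Sum>j'<n. \<Sum>i<n. (M i j * y j) * (M i j' * y j')) = (\<Sum>j<n. \<Sum>i<n. \<Sum>j'<n. (M i j * y j) * (M i j' * y j'))"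
        by (rule sum.cong[OF refl]) (rule sum.swap)
      then show ?thesis using sum.swap[of "\<lambda>j i. \<Sum>j'<n. (M i j * y j) * (M i j' * y j')" "{..<n}" "{..<n}"] by simp
    qed
    also have "\<dots> = (\<Sum>i<n. (\<Sum>j<n. M i j * y j)\<^sup>2)"
      by (simp add: power2_eq_square sum_product)
    also have "\<dots> \<le> (\<Sum>j<n. (y j)\<^sup>2)" using minor_le_norm[OF contr, of y] by simp
    finally show "0 \<le> (\<Sum>i<n. \<Sum>j<n. y i * A i j * y j)"
      by (simp add: A_def left_diff_distrib right_diff_distrib sum_subtractf 1)
  qed
  then obtain r where r: "\<And>i j. i < n \<Longrightarrow> j < n \<Longrightarrow> (\<Sum>l<n. r i l * r j l) = A i j" by blast
  define v where "v k l = (case k of Inl i \<Rightarrow> of_bool (l = i) | Inr j \<Rightarrow> if l < n then M l j else r j (l - n))" for k l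
  have lin: "(\<Sum>l<n + n. v (Inl i) l * z l) = z i" if "i < n" for i z
    using that by (subst sum.remove[of _ i]) (auto simp: v_def of_bool_def intro!: sum.neutral)
  have lin': "(\<Sum>l<n + n. z l * v (Inl i) l) = z i" if "i < n" for i z
    using lin[OF that, of z] by (simp add: mult.commute)
  have rr: "(\<Sum>l<n + n. v (Inr j) l * v (Inr j') l) = of_bool (j = j')" if "j < n" "j' < n" for j j'
  proof -
    have "(\<Sum>l<n. v (Inr j) l * v (Inr j') l) = (\<Sum>i<n. M i j * M i j')" by (simp add: v_def)
    moreover have "(\<Sum>l<n. v (Inr j) (n + l) * v (Inr j') (n + l)) = A j j'" using r[OF that] by (simp add: v_def)
    ultimately show ?thesis by (simp add: sum_shift A_def)
  qed
  show ?thesis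
    by (intro exI[of _ v] ballI) (auto simp: pair_gram_def lin lin' rr, auto simp: v_def)
qed

text \<open>All entries have the same modulus \<open>x\<close>, which makes fourth moments explicit;
  the numerical bound on \<open>x\<close> leaves room for the variance estimate
  \<open>pair_var\<close>.\<close>

locale forr = contraction +
  fixes S :: "nat \<Rightarrow> nat \<Rightarrow> real" and x :: real
  assumes M: "M i j = x * S i j"
    and S: "i < n \<Longrightarrow> j < n \<Longrightarrow> S i j = 1 \<or> S i j = -1"
    and sym: "S i j = S j i"
    and x: "0 < x" "17 * x\<^sup>2 * n \<le> 1" and n: "0 < n"
begin

abbreviation Q where "Q \<equiv> pairQ M {..<n} {..<n}"

definition gv where "gv = (SOME v. \<forall>k\<in>{..<n} <+> {..<n}. \<forall>k'\<in>{..<n} <+> {..<n}. (\<Sum>l<n + n. v k l * v k' l) = pair_gram M k k')"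

lemma gv: "k \<in> {..<n} <+> {..<n} \<Longrightarrow> k' \<in> {..<n} <+> {..<n} \<Longrightarrow> (\<Sum>l<n + n. gv k l * gv k' l) = pair_gram M k k'"
  using someI_ex[OF full_gram] unfolding gv_def[symmetric] by blast

abbreviation gX where "gX k z \<equiv> \<Sum>l<n + n. gv k l * z l"

lemma Q_gv: "Q a b = (LINT z|gauss (n + n). (\<Prod>i<n. 1 + a i * sin (gX (Inl i) z)) * (\<Prod>j<n. 1 + b j * sin (gX (Inr j) z)))"
proof -
  have "complex_of_real (LINT z|gauss (n + n). (\<Prod>k\<in>{..<n} <+> {..<n}. 1 + case_sum a b k * sin (gX k z)))
      = gram_form ({..<n} <+> {..<n}) (case_sum a b) (\<lambda>k k'. \<Sum>l<n + n. gv k l * gv k' l)"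
    by (rule gauss_gram) simp
  also have "\<dots> = gram_form ({..<n} <+> {..<n}) (case_sum a b) (pair_gram M)"
    unfolding gram_form_def
    by (intro sum.cong refl arg_cong2[where f = "(*)"] arg_cong[where f = "\<lambda>x. complex_of_real (exp (- x / 2))"] gv)
  finally show ?thesis unfolding pairQ_def by (subst Re_eqI) (simp_all add: prod.Plus)
qed

lemma gX_meas [measurable]: "gX k \<in> borel_measurable (gauss (n + n))"
  by measurable

lemma pair_integrable:
  assumes "\<And>i. i < n \<Longrightarrow> \<bar>a i\<bar> \<le> 1" "\<And>i. i < n \<Longrightarrow> \<bar>b i\<bar> \<le> 1"
  shows "integrable (gauss (n + n)) (\<lambda>z. (\<Prod>i<n. 1 + a i * sin (gX (Inl i) z)) * (\<Prod>j<n. 1 + b j * sin (gX (Inr j) z)))"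
proof (rule integrable_gauss_bounded)
  fix z
  have 1: "0 \<le> (\<Prod>i<n. 1 + a i * sin (gX (Inl i) z))" "(\<Prod>i<n. 1 + a i * sin (gX (Inl i) z)) \<le> 2 ^ card {..<n}"
    using assms(1) by (intro prod_bounds; simp add: abs_mult mult_le_one)+
  have 2: "0 \<le> (\<Prod>i<n. 1 + b i * sin (gX (Inr i) z))" "(\<Prod>i<n. 1 + b i * sin (gX (Inr i) z)) \<le> 2 ^ card {..<n}"
    using assms(2) by (intro prod_bounds; simp add: abs_mult mult_le_one)+
  show "norm ((\<Prod>i<n. 1 + a i * sin (gX (Inl i) z)) * (\<Prod>j<n. 1 + b j * sin (gX (Inr j) z))) \<le> 2 ^ card {..<n} * 2 ^ card {..<n}"
    using 1 2 unfolding real_norm_def abs_mult by (intro mult_mono) auto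
qed measurable

text \<open>Given the Gaussian vector the two sign vectors are independent, so for a product test
  function the conditional means multiply.\<close>

lemma pair_moment:
  "avg (cb n) (\<lambda>u. avg (cb n) (\<lambda>w. Q u w * (f u * g w)))
    = (LINT z|gauss (n + n). avg (cb n) (\<lambda>u. (\<Prod>i<n. 1 + u i * sin (gX (Inl i) z)) * f u) * avg (cb n) (\<lambda>w. (\<Prod>j<n. 1 + w j * sin (gX (Inr j) z)) * g w))"
proof -
  let ?I = "\<lambda>u w z. (\<Prod>i<n. 1 + u i * sin (gX (Inl i) z)) * (\<Prod>j<n. 1 + w j * sin (gX (Inr j) z))"
  have int: "integrable (gauss (n + n)) (?I u w)" if "u \<in> cb n" "w \<in> cb n" for u w
    using that by (intro pair_integrable) (auto intro: cb_le1)
  have "avg (cb n) (\<lambda>u. avg (cb n) (\<lambda>w. Q u w * (f u * g w))) = avg (cb n) (\<lambda>u. avg (cb n) (\<lambda>w. LINT z|gauss (n + n). ?I u w z * (f u * g w)))"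
    by (intro avg_cong) (simp add: Q_gv int)
  also have "\<dots> = avg (cb n) (\<lambda>u. LINT z|gauss (n + n). avg (cb n) (\<lambda>w. ?I u w z * (f u * g w)))"
    by (intro avg_cong integral_avg integrable_mult_left int)
  also have "\<dots> = (LINT z|gauss (n + n). avg (cb n) (\<lambda>u. avg (cb n) (\<lambda>w. ?I u w z * (f u * g w))))"
    by (rule integral_avg) (auto simp: avg_def intro!: integrable_divide_zero Bochner_Integration.integrable_sum integrable_mult_left int)
  also have "(\<lambda>z. avg (cb n) (\<lambda>u. avg (cb n) (\<lambda>w. ?I u w z * (f u * g w)))) = (\<lambda>z. avg (cb n) (\<lambda>u. (\<Prod>i<n. 1 + u i * sin (gX (Inl i) z)) * f u) * avg (cb n) (\<lambda>w. (\<Prod>j<n. 1 + w j * sin (gX (Inr j) z)) * g w))"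
  proof
    fix z
    let ?P = "\<lambda>u. \<Prod>i<n. 1 + u i * sin (gX (Inl i) z)" and ?R = "\<lambda>w. \<Prod>j<n. 1 + w j * sin (gX (Inr j) z)"
    have "?P u * ?R w * (f u * g w) = (?P u * f u) * (?R w * g w)" for u w by (simp only: mult.assoc mult.left_commute)
    then show "avg (cb n) (\<lambda>u. avg (cb n) (\<lambda>w. ?I u w z * (f u * g w))) = avg (cb n) (\<lambda>u. ?P u * f u) * avg (cb n) (\<lambda>w. ?R w * g w)"
      by (simp only: avg_cmult avg_multc)
  qed
  finally show ?thesis .
qed

lemma int_cos: "integrable (gauss (n + n)) (\<lambda>z. cos (\<Sum>k\<in>K. c k * gX k z))"
proof (rule integrable_gauss_bounded[of _ _ 1])
  show "(\<lambda>z. cos (\<Sum>k\<in>K. c k * gX k z)) \<in> borel_measurable (gauss (n + n))"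
    by (intro measurable_compose[OF _ borel_measurable_cos] borel_measurable_sum borel_measurable_times borel_measurable_const gX_meas)
qed simp

lemma cos_two:
  assumes "k \<in> {..<n} <+> {..<n}" "k' \<in> {..<n} <+> {..<n}" "k \<noteq> k'"
  shows "integrable (gauss (n + n)) (\<lambda>z. cos (p * gX k z + q * gX k' z))"
    "(LINT z|gauss (n + n). cos (p * gX k z + q * gX k' z)) = exp (- (p\<^sup>2 + q\<^sup>2 + 2 * (p * q * pair_gram M k k')) / 2)"
proof -
  define c where "c j = (if j = k then p else q)" for j
  have e: "(\<Sum>j\<in>{k, k'}. c j * gX j z) = p * gX k z + q * gX k' z" for z
    using assms(3) by (simp add: c_def)
  show "integrable (gauss (n + n)) (\<lambda>z. cos (p * gX k z + q * gX k' z))"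
    using int_cos[of c "{k, k'}"] unfolding e .
  have d: "pair_gram M k k = 1" "pair_gram M k' k' = 1" "pair_gram M k' k = pair_gram M k k'"
    by (auto simp: pair_gram_def split: sum.splits)
  show "(LINT z|gauss (n + n). cos (p * gX k z + q * gX k' z)) = exp (- (p\<^sup>2 + q\<^sup>2 + 2 * (p * q * pair_gram M k k')) / 2)"
  proof -
    have "(LINT z|gauss (n + n). cos (\<Sum>j\<in>{k, k'}. c j * gX j z)) = exp (- (\<Sum>j\<in>{k, k'}. \<Sum>j'\<in>{k, k'}. c j * c j' * pair_gram M j j') / 2)"
      by (rule gauss_cos) (use gv assms(1,2) in auto)
    moreover have "(\<Sum>j\<in>{k, k'}. \<Sum>j'\<in>{k, k'}. c j * c j' * pair_gram M j j') = p\<^sup>2 + q\<^sup>2 + 2 * (p * q * pair_gram M k k')"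
      using assms(3) d by (simp add: c_def power2_eq_square)
    ultimately show ?thesis unfolding e by simp
  qed
qed

text \<open>The product of sines is half a difference of cosines of Gaussians, whose variances are
  \<open>2 - 2 * c\<close> and \<open>2 + 2 * c\<close> for covariance \<open>c\<close>.\<close>

lemma sin_two:
  assumes "k \<in> {..<n} <+> {..<n}" "k' \<in> {..<n} <+> {..<n}" "k \<noteq> k'"
  shows "(LINT z|gauss (n + n). sin (gX k z) * sin (gX k' z)) = exp (-1) * sinh (pair_gram M k k')"
proof -
  note c1 = cos_two[OF assms, of 1 "-1"] and c2 = cos_two[OF assms, of 1 1]
  have "(LINT z|gauss (n + n). sin (gX k z) * sin (gX k' z)) = (LINT z|gauss (n + n). (cos (1 * gX k z + (-1) * gX k' z) - cos (1 * gX k z + 1 * gX k' z)) / 2)"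
    by (simp add: sin_sin)
  also have "\<dots> = (exp (- (2 + 2 * (- pair_gram M k k')) / 2) - exp (- (2 + 2 * pair_gram M k k') / 2)) / 2"
    by (subst integral_divide_zero, subst Bochner_Integration.integral_diff[OF c1(1) c2(1)], subst c1(2), subst c2(2)) simp
  also have "\<dots> = exp (-1) * sinh (pair_gram M k k')"
  proof -
    have "exp (- (2 + 2 * (- t)) / 2) = exp (-1) * exp t" "exp (- (2 + 2 * t) / 2) = exp (-1) * exp (- t)" for t :: real
      by (auto simp flip: exp_add)
    then show ?thesis by (simp only:) (simp add: sinh_def field_simps)
  qed
  finally show ?thesis .
qed

lemma cos_four:
  assumes "i < n" "i' < n" "j < n" "j' < n" "i \<noteq> i'" "j \<noteq> j'" and sg: "p\<^sup>2 = 1" "q\<^sup>2 = 1" "r\<^sup>2 = 1" "t\<^sup>2 = 1"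
  shows "integrable (gauss (n + n)) (\<lambda>z. cos (p * gX (Inl i) z + q * gX (Inl i') z + r * gX (Inr j) z + t * gX (Inr j') z))"
    "(LINT z|gauss (n + n). cos (p * gX (Inl i) z + q * gX (Inl i') z + r * gX (Inr j) z + t * gX (Inr j') z))
      = exp (-2) * exp (- (p * r * M i j + p * t * M i j' + q * r * M i' j + q * t * M i' j'))"
proof -
  define c where "c k = (if k = Inl i then p else if k = Inl i' then q else if k = Inr j then r else t)" for k
  let ?K = "{Inl i, Inl i', Inr j, Inr j'} :: (nat + nat) set"
  have e: "(\<Sum>k\<in>?K. c k * gX k z) = p * gX (Inl i) z + q * gX (Inl i') z + r * gX (Inr j) z + t * gX (Inr j') z" for z
    using assms(5,6) by (simp add: c_def)
  show "integrable (gauss (n + n)) (\<lambda>z. cos (p * gX (Inl i) z + q * gX (Inl i') z + r * gX (Inr j) z + t * gX (Inr j') z))"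
    using int_cos[of c ?K] unfolding e .
  have "(\<Sum>k\<in>?K. \<Sum>k'\<in>?K. c k * c k' * pair_gram M k k') = p * p + q * q + r * r + t * t + 2 * (p * r * M i j + p * t * M i j' + q * r * M i' j + q * t * M i' j')"
    using assms(5,6) by (simp add: c_def pair_gram_def algebra_simps)
  also have "\<dots> = 4 + 2 * (p * r * M i j + p * t * M i j' + q * r * M i' j + q * t * M i' j')"
    using sg by (simp add: power2_eq_square)
  finally have "(\<Sum>k\<in>?K. \<Sum>k'\<in>?K. c k * c k' * pair_gram M k k') = 4 + 2 * (p * r * M i j + p * t * M i j' + q * r * M i' j + q * t * M i' j')" .
  moreover have "(LINT z|gauss (n + n). cos (\<Sum>k\<in>?K. c k * gX k z)) = exp (- (\<Sum>k\<in>?K. \<Sum>k'\<in>?K. c k * c k' * pair_gram M k k') / 2)"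
    by (rule gauss_cos) (use gv assms(1-4) in auto)
  ultimately have "(LINT z|gauss (n + n). cos (p * gX (Inl i) z + q * gX (Inl i') z + r * gX (Inr j) z + t * gX (Inr j') z))
     = exp (- (4 + 2 * (p * r * M i j + p * t * M i j' + q * r * M i' j + q * t * M i' j')) / 2)"
    unfolding e by simp
  also have "\<dots> = exp (-2 + - (p * r * M i j + p * t * M i j' + q * r * M i' j + q * t * M i' j'))"
    by (rule arg_cong[where f = exp]) (simp add: field_simps)
  finally show "(LINT z|gauss (n + n). cos (p * gX (Inl i) z + q * gX (Inl i') z + r * gX (Inr j) z + t * gX (Inr j') z))
      = exp (-2) * exp (- (p * r * M i j + p * t * M i j' + q * r * M i' j + q * t * M i' j'))"
    by (simp only: exp_add)
qed

text \<open>The product becomes eight cosines with known means. As all entries are \<open>x\<close>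
  or \<open>-x\<close>, the arguments left over are 0 or, up to sign, \<open>2 * x\<close> or
  \<open>4 * x\<close>, and a case distinction on four signs finishes.\<close>

lemma sin_four_moment:
  assumes "i < n" "i' < n" "j < n" "j' < n" "i \<noteq> i'" "j \<noteq> j'"
  shows "(LINT z|gauss (n + n). sin (gX (Inl i) z) * sin (gX (Inl i') z) * (sin (gX (Inr j) z) * sin (gX (Inr j') z)))
    = exp (-2) * (cosh x)\<^sup>2 * (sinh x)\<^sup>2 * (S i j * S i' j' + S i j' * S i' j)"
proof -
  let ?C = "\<lambda>p q r t z. cos (p * gX (Inl i) z + q * gX (Inl i') z + r * gX (Inr j) z + t * gX (Inr j') z)"
  let ?E = "\<lambda>p q r t. exp (-2) * exp (- (p * r * M i j + p * t * M i j' + q * r * M i' j + q * t * M i' j'))"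
  note c = cos_four[OF assms]
  have "(LINT z|gauss (n + n). sin (gX (Inl i) z) * sin (gX (Inl i') z) * (sin (gX (Inr j) z) * sin (gX (Inr j') z)))
     = (LINT z|gauss (n + n). (?C 1 (-1) 1 (-1) z + ?C 1 (-1) (-1) 1 z - ?C 1 (-1) 1 1 z - ?C 1 (-1) (-1) (-1) z
       - ?C 1 1 1 (-1) z - ?C 1 1 (-1) 1 z + ?C 1 1 1 1 z + ?C 1 1 (-1) (-1) z) / 8)"
    by (simp add: sin_four)
  also have "\<dots> = (?E 1 (-1) 1 (-1) + ?E 1 (-1) (-1) 1 - ?E 1 (-1) 1 1 - ?E 1 (-1) (-1) (-1)
       - ?E 1 1 1 (-1) - ?E 1 1 (-1) 1 + ?E 1 1 1 1 + ?E 1 1 (-1) (-1)) / 8"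
    by (subst integral_divide_zero) (simp only: Bochner_Integration.integral_add Bochner_Integration.integral_diff
        Bochner_Integration.integrable_add Bochner_Integration.integrable_diff c power_one power2_minus)
  also have "\<dots> = exp (-2) / 4 * (cosh (M i j - M i j' - M i' j + M i' j') - cosh (M i j + M i j' - M i' j - M i' j')
      - cosh (M i j - M i j' + M i' j - M i' j') + cosh (M i j + M i j' + M i' j + M i' j'))"
    by (simp add: cosh_def algebra_simps add_divide_distrib diff_divide_distrib)
  also have "\<dots> = exp (-2) * (cosh x)\<^sup>2 * (sinh x)\<^sup>2 * (S i j * S i' j' + S i j' * S i' j)"
  proof -
    have c4: "cosh (4 * x) = 1 + 8 * ((cosh x)\<^sup>2 * (sinh x)\<^sup>2)"
    proof -
      have "cosh (4 * x) = cosh (2 * (2 * x))" by simp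
      also have "\<dots> = (cosh (2 * x))\<^sup>2 + (sinh (2 * x))\<^sup>2" by (rule cosh_double)
      also have "\<dots> = 1 + 2 * (sinh (2 * x))\<^sup>2" by (simp add: cosh_square_eq)
      also have "sinh (2 * x) = 2 * sinh x * cosh x" by (rule sinh_double)
      finally show ?thesis by (simp add: power_mult_distrib)
    qed
    have c4': "cosh (x * 4) = 1 + 8 * ((cosh x)\<^sup>2 * (sinh x)\<^sup>2)" using c4 by (simp add: mult.commute)
    have cm: "cosh (- t) = cosh t" for t :: real by simp
    show ?thesis
      using S[OF assms(1,3)] S[OF assms(1,4)] S[OF assms(2,3)] S[OF assms(2,4)] cm[of "4 * x"] cm[of "2 * x"]
      unfolding M by (elim disjE) (simp_all add: c4 c4' algebra_simps)
  qed
  finally show ?thesis .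
qed

lemma pair_mean: "i < n \<Longrightarrow> j < n \<Longrightarrow> avg (cb n) (\<lambda>u. avg (cb n) (\<lambda>w. Q u w * (u i * w j))) = exp (-1) * sinh (M i j)"
  using sin_two[of "Inl i" "Inr j"]
  unfolding pair_moment[of "\<lambda>u. u i" "\<lambda>w. w j"] by (simp add: avg_cb_one) (simp add: InlI InrI pair_gram_def)

lemma pair_four:
  assumes "i < n" "i' < n" "j < n" "j' < n"
  shows "avg (cb n) (\<lambda>u. avg (cb n) (\<lambda>w. Q u w * (u i * u i' * (w j * w j')))) =
    (if i = i' then of_bool (j = j') else if j = j' then 0
     else exp (-2) * (cosh x)\<^sup>2 * (sinh x)\<^sup>2 * (S i j * S i' j' + S i j' * S i' j))"
proof -
  have p1: "(LINT z|gauss (n + n). (1 :: real)) = 1"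
    using prob_space.prob_space[OF prob_space_gauss[of "n + n"]] by simp
  have g0: "pair_gram M (Inl i) (Inl i') = 0" if "i \<noteq> i'" using that by (simp add: pair_gram_def)
  have g1: "pair_gram M (Inr j) (Inr j') = 0" if "j \<noteq> j'" using that by (simp add: pair_gram_def)
  show ?thesis
    unfolding pair_moment[of "\<lambda>u. u i * u i'" "\<lambda>w. w j * w j'"] avg_cb_two[OF assms(1,2)] avg_cb_two[OF assms(3,4)]
    using sin_four_moment[OF assms] sin_two[of "Inl i" "Inl i'"] sin_two[of "Inr j" "Inr j'"] assms p1 g0 g1
    by (cases "i = i'"; cases "j = j'") auto
qed

end

section \<open>Concentration of the form under the planted and the uniform law\<close>

lemma norm1_le: "(\<Sum>i<n. a i)\<^sup>2 \<le> real n * (\<Sum>i<n. (a i)\<^sup>2)" for a :: "nat \<Rightarrow> real"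
  using Cauchy_Schwarz_ineq_sum[of a "\<lambda>_. 1" "{..<n}"] by (simp add: mult.commute)

text \<open>The path vector: layers, as diagonal matrices, and copies of \<open>M\<close> are
  applied alternately to the all-ones vector, ending with \<open>M\<close>.\<close>

primrec lvec :: "nat \<Rightarrow> (nat \<Rightarrow> nat \<Rightarrow> real) \<Rightarrow> (nat \<Rightarrow> real) list \<Rightarrow> nat \<Rightarrow> real" where
  "lvec n M [] j = 1"
| "lvec n M (z # zs) j = (\<Sum>i<n. M j i * (z i * lvec n M zs i))"

text \<open>The form cut at the middle layer; division by \<open>n\<close> normalises the two
  all-ones end vectors.\<close>

definition phi :: "nat \<Rightarrow> (nat \<Rightarrow> nat \<Rightarrow> real) \<Rightarrow> nat \<Rightarrow> (nat \<Rightarrow> real) list \<Rightarrow> real" where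
  "phi n M k zs = (\<Sum>i<n. hd zs i * lvec n M (take k (tl zs)) i * lvec n M (drop k (tl zs)) i) / n"

text \<open>On either diagonal the sign product is 1 and the bracket is 2. The off-diagonal sum is
  thus the full sum, minus twice each diagonal, plus twice their intersection.\<close>

lemma sum_off_diag:
  fixes X y :: "nat \<Rightarrow> real" and S :: "nat \<Rightarrow> nat \<Rightarrow> real"
  assumes S: "\<And>i j. i < n \<Longrightarrow> j < n \<Longrightarrow> S i j = 1 \<or> S i j = -1"
  shows "(\<Sum>i<n. \<Sum>i'<n. \<Sum>j<n. \<Sum>j'<n. X i * X i' * (y j * y j') * (if i = i' then (if j = j' then A else 0) else if j = j' then 0 else K * (1 + S i j * S i' j * (S i j' * S i' j'))))
   = A * (\<Sum>i<n. (X i)\<^sup>2) * (\<Sum>j<n. (y j)\<^sup>2) + K * ((\<Sum>i<n. X i)\<^sup>2 * (\<Sum>j<n. y j)\<^sup>2 + (\<Sum>i<n. \<Sum>i'<n. X i * X i' * (\<Sum>j<n. y j * (S i j * S i' j))\<^sup>2)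
      - 2 * (\<Sum>i<n. (X i)\<^sup>2) * (\<Sum>j<n. y j)\<^sup>2 - 2 * (\<Sum>i<n. X i)\<^sup>2 * (\<Sum>j<n. (y j)\<^sup>2) + 2 * (\<Sum>i<n. (X i)\<^sup>2) * (\<Sum>j<n. (y j)\<^sup>2))"
proof -
  have pt: "X i * X i' * (y j * y j') * (if i = i' then (if j = j' then A else 0) else if j = j' then 0 else K * (1 + S i j * S i' j * (S i j' * S i' j')))
    = A * ((of_bool (i = i') * (X i * X i')) * (of_bool (j = j') * (y j * y j')))
      + K * ((X i * X i') * (y j * y j')) + K * (X i * X i' * ((y j * (S i j * S i' j)) * (y j' * (S i j' * S i' j'))))
      - 2 * K * ((of_bool (i = i') * (X i * X i')) * (y j * y j')) - 2 * K * ((X i * X i') * (of_bool (j = j') * (y j * y j')))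
      + 2 * K * ((of_bool (i = i') * (X i * X i')) * (of_bool (j = j') * (y j * y j')))"
    if "i < n" "i' < n" "j < n" "j' < n" for i i' j j'
  proof -
    have "S i j * S i j = 1" "S i j' * S i j' = 1" "S i' j * S i' j = 1" "S i' j' * S i' j' = 1"
      using S that by (metis mult_1 mult_minus1 minus_minus)+
    then have "i = i' \<or> j = j' \<Longrightarrow> S i j * S i' j * (S i j' * S i' j') = 1"
      by (auto simp: mult_ac)
    then show ?thesis by (cases "i = i'"; cases "j = j'") (simp_all add: algebra_simps)
  qed
  have f: "(\<Sum>i<n. \<Sum>i'<n. \<Sum>j<n. \<Sum>j'<n. f i i' * g j j') = (\<Sum>i<n. \<Sum>i'<n. f i i') * (\<Sum>j<n. \<Sum>j'<n. g j j')" for f g :: "nat \<Rightarrow> nat \<Rightarrow> real"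
    by (simp only: sum_distrib_left[symmetric] sum_distrib_right[symmetric])
  have c: "(\<Sum>i<n. \<Sum>i'<n. \<Sum>j<n. \<Sum>j'<n. c * t i i' j j') = c * (\<Sum>i<n. \<Sum>i'<n. \<Sum>j<n. \<Sum>j'<n. t i i' j j')" for c and t :: "nat \<Rightarrow> nat \<Rightarrow> nat \<Rightarrow> nat \<Rightarrow> real"
    by (simp only: sum_distrib_left[symmetric])
  have d: "(\<Sum>i<n. \<Sum>i'<n. of_bool (i = i') * (X i * X i')) = (\<Sum>i<n. (X i)\<^sup>2)" for X :: "nat \<Rightarrow> real"
    by (intro sum.cong refl) (simp add: power2_eq_square of_bool_def if_distrib if_distribR cong: if_cong)
  have p: "(\<Sum>i<n. \<Sum>i'<n. X i * X i') = (\<Sum>i<n. X i)\<^sup>2" for X :: "nat \<Rightarrow> real"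
    by (simp add: power2_eq_square sum_product)
  have w: "(\<Sum>i<n. \<Sum>i'<n. \<Sum>j<n. \<Sum>j'<n. X i * X i' * ((y j * (S i j * S i' j)) * (y j' * (S i j' * S i' j')))) = (\<Sum>i<n. \<Sum>i'<n. X i * X i' * (\<Sum>j<n. y j * (S i j * S i' j))\<^sup>2)"
    by (simp only: power2_eq_square sum_product) (simp only: sum_distrib_left)
  have "(\<Sum>i<n. \<Sum>i'<n. \<Sum>j<n. \<Sum>j'<n. X i * X i' * (y j * y j') * (if i = i' then (if j = j' then A else 0) else if j = j' then 0 else K * (1 + S i j * S i' j * (S i j' * S i' j'))))
    = (\<Sum>i<n. \<Sum>i'<n. \<Sum>j<n. \<Sum>j'<n. A * ((of_bool (i = i') * (X i * X i')) * (of_bool (j = j') * (y j * y j')))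
      + K * ((X i * X i') * (y j * y j')) + K * (X i * X i' * ((y j * (S i j * S i' j)) * (y j' * (S i j' * S i' j'))))
      - 2 * K * ((of_bool (i = i') * (X i * X i')) * (y j * y j')) - 2 * K * ((X i * X i') * (of_bool (j = j') * (y j * y j')))
      + 2 * K * ((of_bool (i = i') * (X i * X i')) * (of_bool (j = j') * (y j * y j'))))"
    by (intro sum.cong refl pt) auto
  also have "\<dots> = A * ((\<Sum>i<n. (X i)\<^sup>2) * (\<Sum>j<n. (y j)\<^sup>2)) + K * ((\<Sum>i<n. X i)\<^sup>2 * (\<Sum>j<n. y j)\<^sup>2) + K * (\<Sum>i<n. \<Sum>i'<n. X i * X i' * (\<Sum>j<n. y j * (S i j * S i' j))\<^sup>2)
      - 2 * K * ((\<Sum>i<n. (X i)\<^sup>2) * (\<Sum>j<n. y j)\<^sup>2) - 2 * K * ((\<Sum>i<n. X i)\<^sup>2 * (\<Sum>j<n. (y j)\<^sup>2)) + 2 * K * ((\<Sum>i<n. (X i)\<^sup>2) * (\<Sum>j<n. (y j)\<^sup>2))"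
    by (simp only: sum.distrib sum_subtractf c f d p w)
  finally show ?thesis by (simp add: algebra_simps)
qed

context forr
begin

text \<open>The mean of \<open>M i j * u i * w j\<close> under the kernel; the sign of the entry
  cancels because \<open>sinh\<close> is odd.\<close>

definition mu where "mu = x * exp (-1) * sinh x"

lemma x_small: "x\<^sup>2 * n \<le> 1 / 17" "x \<le> 1 / 4" "x\<^sup>2 \<le> 1 / 16"
proof -
  show 1: "x\<^sup>2 * n \<le> 1 / 17" using x by simp
  have "x\<^sup>2 * 1 \<le> x\<^sup>2 * n" using n by (intro mult_left_mono) auto
  then show "x\<^sup>2 \<le> 1 / 16" using 1 by simp
  then have "x\<^sup>2 \<le> (1 / 4)\<^sup>2" by (simp add: power2_eq_square)
  then show "x \<le> 1 / 4" by (rule power2_le_imp_le) simp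
qed

lemma sinh_bounds: "x \<le> sinh x" "sinh x \<le> 3 / 2 * x"
proof -
  have "exp x \<le> 1 + x + x\<^sup>2" using x_small x by (intro exp_bound) auto
  moreover have "1 - x \<le> exp (- x)" using exp_ge_add_one_self[of "- x"] by simp
  moreover have "x\<^sup>2 \<le> x" using x_small x by (simp add: power2_eq_square mult_left_le)
  ultimately show "sinh x \<le> 3 / 2 * x" by (simp add: sinh_def)
  show "x \<le> sinh x"
  proof -
    have "(\<lambda>t. sinh t - t) 0 \<le> (\<lambda>t. sinh t - t) x"
      by (rule DERIV_nonneg_imp_nondecreasing[of 0 x]) (use x cosh_real_ge_1 in \<open>auto intro!: exI derivative_eq_intros\<close>)
    then show ?thesis by simp
  qed
qed

lemma mu_bounds: "0 < mu" "mu \<le> x\<^sup>2" "exp (-1) * x\<^sup>2 \<le> mu"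
proof -
  show "0 < mu" unfolding mu_def using x sinh_bounds by (intro mult_pos_pos) auto
  have e: "exp (-1 :: real) \<le> 1 / 2" using exp_ge_add_one_self[of 1] by (simp add: exp_minus field_simps)
  have "mu \<le> x * (1 / 2) * (3 / 2 * x)" unfolding mu_def
    using x sinh_bounds e by (intro mult_mono) auto
  also have "\<dots> \<le> x\<^sup>2" by (simp add: power2_eq_square)
  finally show "mu \<le> x\<^sup>2" .
  have "x * exp (-1) * x \<le> mu" unfolding mu_def using x sinh_bounds by (intro mult_left_mono) auto
  then show "exp (-1) * x\<^sup>2 \<le> mu" by (simp add: power2_eq_square mult_ac)
qed

lemma pair_mean_form:
  "avg (cb n) (\<lambda>u. avg (cb n) (\<lambda>w. Q u w * (\<Sum>i<n. \<Sum>j<n. X i * u i * M i j * (w j * y j)))) = mu * (\<Sum>i<n. X i) * (\<Sum>j<n. y j)"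
proof -
  have "avg (cb n) (\<lambda>u. avg (cb n) (\<lambda>w. Q u w * (\<Sum>i<n. \<Sum>j<n. X i * u i * M i j * (w j * y j))))
    = (\<Sum>i<n. \<Sum>j<n. (X i * M i j * y j) * avg (cb n) (\<lambda>u. avg (cb n) (\<lambda>w. Q u w * (u i * w j))))"
    by (simp add: sum_distrib_left avg_sum avg_cmult[symmetric] mult_ac)
  also have "\<dots> = (\<Sum>i<n. \<Sum>j<n. X i * y j * mu)"
  proof (intro sum.cong refl)
    fix i j assume "i \<in> {..<n}" "j \<in> {..<n}"
    then have ij: "i < n" "j < n" by auto
    show "(X i * M i j * y j) * avg (cb n) (\<lambda>u. avg (cb n) (\<lambda>w. Q u w * (u i * w j))) = X i * y j * mu"
      using S[OF ij] unfolding pair_mean[OF ij] mu_def M by (elim disjE) simp_all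
  qed
  also have "\<dots> = mu * (\<Sum>i<n. X i) * (\<Sum>j<n. y j)"
    by (simp add: sum_product sum_distrib_left sum_distrib_right mult_ac)
  finally show ?thesis .
qed

lemma avg_Q_right: "u \<in> cb n \<Longrightarrow> avg (cb n) (Q u) = 1"
  by (rule avg_pairQ_1) auto

text \<open>The rank-one part of the second moment is the squared mean times
  \<open>(cosh x)\<^sup>2\<close>, so after subtraction only \<open>(sinh x)\<^sup>2\<close>, of
  order \<open>x\<^sup>2\<close>, survives. The other off-diagonal part \<open>W\<close> is
  controlled by the norm of \<open>M\<close>.\<close>

lemma pair_var:
  "avg (cb n) (\<lambda>u. avg (cb n) (\<lambda>w. Q u w * ((\<Sum>i<n. \<Sum>j<n. X i * u i * M i j * (w j * y j)) - mu * (\<Sum>i<n. X i) * (\<Sum>j<n. y j))\<^sup>2))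
    \<le> (\<Sum>i<n. (X i)\<^sup>2) * (\<Sum>j<n. (y j)\<^sup>2) / n"
proof -
  define P where "P = (\<Sum>i<n. (X i)\<^sup>2) * (\<Sum>j<n. (y j)\<^sup>2)"
  define E where "E = mu * (\<Sum>i<n. X i) * (\<Sum>j<n. y j)"
  define K where "K = exp (-2) * (cosh x)\<^sup>2 * (sinh x)\<^sup>2"
  define W where "W = (\<Sum>i<n. \<Sum>i'<n. X i * X i' * (\<Sum>j<n. y j * (S i j * S i' j))\<^sup>2)"
  have P0: "0 \<le> P" by (simp add: P_def sum_nonneg)
  let ?Z = "\<lambda>u w. \<Sum>i<n. \<Sum>j<n. X i * u i * M i j * (w j * y j)"
  have Z: "avg (cb n) (\<lambda>u. avg (cb n) (\<lambda>w. Q u w * ?Z u w)) = E" unfolding E_def by (rule pair_mean_form)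
  have one: "avg (cb n) (\<lambda>u. avg (cb n) (Q u)) = 1"
    using avg_cong[of "cb n" "\<lambda>u. avg (cb n) (Q u)" "\<lambda>_. 1"] avg_Q_right by (simp add: avg_const)
  have sq: "(?Z u w)\<^sup>2 = (\<Sum>i<n. \<Sum>i'<n. \<Sum>j<n. \<Sum>j'<n. (X i * X i' * (y j * y j') * (M i j * M i' j')) * (u i * u i' * (w j * w j')))" for u w
  proof -
    have "(?Z u w)\<^sup>2 = (\<Sum>i<n. \<Sum>i'<n. (\<Sum>j<n. X i * u i * M i j * (w j * y j)) * (\<Sum>j<n. X i' * u i' * M i' j * (w j * y j)))"
      by (simp add: power2_eq_square sum_product)
    also have "\<dots> = (\<Sum>i<n. \<Sum>i'<n. \<Sum>j<n. \<Sum>j'<n. (X i * X i' * (y j * y j') * (M i j * M i' j')) * (u i * u i' * (w j * w j')))"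
      by (simp add: sum_product mult_ac)
    finally show ?thesis .
  qed
  have "avg (cb n) (\<lambda>u. avg (cb n) (\<lambda>w. Q u w * (?Z u w)\<^sup>2)) =
    (\<Sum>i<n. \<Sum>i'<n. \<Sum>j<n. \<Sum>j'<n. (X i * X i' * (y j * y j') * (M i j * M i' j')) * avg (cb n) (\<lambda>u. avg (cb n) (\<lambda>w. Q u w * (u i * u i' * (w j * w j')))))"
  proof -
    have "Q u w * (?Z u w)\<^sup>2 = (\<Sum>i<n. \<Sum>i'<n. \<Sum>j<n. \<Sum>j'<n. (X i * X i' * (y j * y j') * (M i j * M i' j')) * (Q u w * (u i * u i' * (w j * w j'))))" for u w
      unfolding sq by (simp add: sum_distrib_left mult_ac)
    then show ?thesis by (simp only: avg_sum avg_cmult)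
  qed
  also have "\<dots> = (\<Sum>i<n. \<Sum>i'<n. \<Sum>j<n. \<Sum>j'<n. X i * X i' * (y j * y j') * (if i = i' then (if j = j' then x\<^sup>2 else 0) else if j = j' then 0 else (x\<^sup>2 * K) * (1 + S i j * S i' j * (S i j' * S i' j'))))"
  proof (intro sum.cong refl)
    fix i i' j j' assume "i \<in> {..<n}" "i' \<in> {..<n}" "j \<in> {..<n}" "j' \<in> {..<n}"
    then have lt: "i < n" "i' < n" "j < n" "j' < n" by auto
    have s: "S i j * S i j = 1" "S i j' * S i j' = 1" "S i' j * S i' j = 1" "S i' j' * S i' j' = 1"
      using S lt by (metis mult_1 mult_minus1 minus_minus)+
    have t: "S i j * S i' j' * (S i j * S i' j' + S i j' * S i' j) = 1 + S i j * S i' j * (S i j' * S i' j')"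
    proof -
      have "S i j * S i' j' * (S i j * S i' j' + S i j' * S i' j) = (S i j * S i j) * (S i' j' * S i' j') + S i j * S i' j * (S i j' * S i' j')"
        by (simp add: algebra_simps)
      then show ?thesis by (simp add: s)
    qed
    show "(X i * X i' * (y j * y j') * (M i j * M i' j')) * avg (cb n) (\<lambda>u. avg (cb n) (\<lambda>w. Q u w * (u i * u i' * (w j * w j'))))
       = X i * X i' * (y j * y j') * (if i = i' then (if j = j' then x\<^sup>2 else 0) else if j = j' then 0 else (x\<^sup>2 * K) * (1 + S i j * S i' j * (S i j' * S i' j')))"
    proof (cases "i = i' \<or> j = j'")
      case True
      then show ?thesis using s unfolding pair_four[OF lt] M by (auto simp: power2_eq_square)
    next
      case False
      then show ?thesis unfolding pair_four[OF lt] M t[symmetric] by (simp add: K_def power2_eq_square mult_ac)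
    qed
  qed
  also have "\<dots> = x\<^sup>2 * (\<Sum>i<n. (X i)\<^sup>2) * (\<Sum>j<n. (y j)\<^sup>2) + x\<^sup>2 * K * ((\<Sum>i<n. X i)\<^sup>2 * (\<Sum>j<n. y j)\<^sup>2 + W
      - 2 * (\<Sum>i<n. (X i)\<^sup>2) * (\<Sum>j<n. y j)\<^sup>2 - 2 * (\<Sum>i<n. X i)\<^sup>2 * (\<Sum>j<n. (y j)\<^sup>2) + 2 * (\<Sum>i<n. (X i)\<^sup>2) * (\<Sum>j<n. (y j)\<^sup>2))"
    unfolding W_def by (rule sum_off_diag) (rule S)
  also have "\<dots> \<le> x\<^sup>2 * P + x\<^sup>2 * K * ((\<Sum>i<n. X i)\<^sup>2 * (\<Sum>j<n. y j)\<^sup>2 + W + 2 * P)"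
  proof -
    have "0 \<le> (\<Sum>i<n. (X i)\<^sup>2) * (\<Sum>j<n. y j)\<^sup>2" "0 \<le> (\<Sum>i<n. X i)\<^sup>2 * (\<Sum>j<n. (y j)\<^sup>2)" "0 \<le> x\<^sup>2 * K"
      by (auto intro!: mult_nonneg_nonneg sum_nonneg simp: K_def)
    moreover from this have "(\<Sum>i<n. X i)\<^sup>2 * (\<Sum>j<n. y j)\<^sup>2 + W
      - 2 * (\<Sum>i<n. (X i)\<^sup>2) * (\<Sum>j<n. y j)\<^sup>2 - 2 * (\<Sum>i<n. X i)\<^sup>2 * (\<Sum>j<n. (y j)\<^sup>2) + 2 * (\<Sum>i<n. (X i)\<^sup>2) * (\<Sum>j<n. (y j)\<^sup>2)
      \<le> (\<Sum>i<n. X i)\<^sup>2 * (\<Sum>j<n. y j)\<^sup>2 + W + 2 * P"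
      unfolding P_def mult.assoc by linarith
    ultimately show ?thesis unfolding P_def by (intro add_mono mult_left_mono) (auto simp: mult.assoc)
  qed
  finally have Z2: "avg (cb n) (\<lambda>u. avg (cb n) (\<lambda>w. Q u w * (?Z u w)\<^sup>2)) \<le> x\<^sup>2 * P + x\<^sup>2 * K * ((\<Sum>i<n. X i)\<^sup>2 * (\<Sum>j<n. y j)\<^sup>2 + W + 2 * P)" .
  \<comment> \<open>Bounding \<open>X i * X i'\<close> by half the sum of squares leaves row sums of
    \<open>G\<close>. A row sum is the squared norm of the image of \<open>y j * S i j\<close> under
    \<open>M\<close>, divided by \<open>x\<^sup>2\<close>.\<close>
  have W_le: "W \<le> P / x\<^sup>2"
  proof -
    define G where "G i i' = (\<Sum>j<n. y j * (S i j * S i' j))\<^sup>2" for i i'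
    have Gs: "G i i' = G i' i" for i i' by (simp add: G_def mult_ac)
    have G0: "0 \<le> G i i'" for i i' by (simp add: G_def)
    have "W \<le> (\<Sum>i<n. \<Sum>i'<n. ((X i)\<^sup>2 + (X i')\<^sup>2) / 2 * G i i')"
      unfolding W_def G_def[symmetric]
    proof (intro sum_mono mult_right_mono G0)
      fix i i' show "X i * X i' \<le> ((X i)\<^sup>2 + (X i')\<^sup>2) / 2"
        using sum_squares_bound[of "X i" "X i'"] by simp
    qed
    also have "\<dots> = (\<Sum>i<n. \<Sum>i'<n. (X i)\<^sup>2 * G i i') / 2 + (\<Sum>i<n. \<Sum>i'<n. (X i')\<^sup>2 * G i i') / 2"
      by (simp add: sum.distrib sum_divide_distrib add_divide_distrib distrib_right)
    also have "(\<Sum>i<n. \<Sum>i'<n. (X i')\<^sup>2 * G i i') = (\<Sum>i<n. \<Sum>i'<n. (X i)\<^sup>2 * G i i')"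
      by (subst sum.swap) (simp add: Gs)
    also have "(\<Sum>i<n. \<Sum>i'<n. (X i)\<^sup>2 * G i i') / 2 + (\<Sum>i<n. \<Sum>i'<n. (X i)\<^sup>2 * G i i') / 2 = (\<Sum>i<n. (X i)\<^sup>2 * (\<Sum>i'<n. G i i'))"
      by (simp add: sum_distrib_left)
    also have "\<dots> \<le> (\<Sum>i<n. (X i)\<^sup>2 * ((\<Sum>j<n. (y j)\<^sup>2) / x\<^sup>2))"
    proof (intro sum_mono mult_left_mono)
      fix i assume "i \<in> {..<n}"
      then have i: "i < n" by simp
      have "(\<Sum>i'<n. (\<Sum>j<n. M i' j * (y j * S i j))\<^sup>2) \<le> 1\<^sup>2 * (\<Sum>j<n. (y j * S i j)\<^sup>2)"
        by (rule minor_le_norm[OF contr]) simp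
      moreover have "(\<Sum>j<n. (y j * S i j)\<^sup>2) = (\<Sum>j<n. (y j)\<^sup>2)"
        using S[OF i] by (intro sum.cong refl) (force simp: power_mult_distrib)
      moreover have "(\<Sum>j<n. M i' j * (y j * S i j))\<^sup>2 = x\<^sup>2 * G i i'" for i'
        unfolding G_def M power_mult_distrib[symmetric] sum_distrib_left by (simp add: mult_ac)
      ultimately have "x\<^sup>2 * (\<Sum>i'<n. G i i') \<le> (\<Sum>j<n. (y j)\<^sup>2)" by (simp add: sum_distrib_left)
      then show "(\<Sum>i'<n. G i i') \<le> (\<Sum>j<n. (y j)\<^sup>2) / x\<^sup>2" using x by (simp add: field_simps)
    qed auto
    also have "\<dots> = P / x\<^sup>2" 
      unfolding P_def times_divide_eq_right[symmetric] by (rule sum_distrib_right[symmetric])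
    finally show ?thesis .
  qed
  have e2: "exp (-2 :: real) = exp (-1) * exp (-1)" by (simp flip: exp_add)
  have xK: "x\<^sup>2 * K = mu\<^sup>2 * (cosh x)\<^sup>2"
    unfolding K_def mu_def e2 by (simp add: power2_eq_square mult_ac)
  have ch: "(cosh x)\<^sup>2 = 1 + (sinh x)\<^sup>2" by (simp add: cosh_square_eq)
  have sh: "(sinh x)\<^sup>2 \<le> 9 / 4 * x\<^sup>2"
  proof -
    have "(sinh x)\<^sup>2 \<le> (3 / 2 * x)\<^sup>2" using sinh_bounds x by (intro power_mono) auto
    then show ?thesis by (simp add: power_mult_distrib power2_eq_square)
  qed
  have ch2: "(cosh x)\<^sup>2 \<le> 2" using ch sh x_small by simp
  have Ple: "(\<Sum>i<n. X i)\<^sup>2 * (\<Sum>j<n. y j)\<^sup>2 \<le> (real n)\<^sup>2 * P"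
  proof -
    have "(\<Sum>i<n. X i)\<^sup>2 * (\<Sum>j<n. y j)\<^sup>2 \<le> (real n * (\<Sum>i<n. (X i)\<^sup>2)) * (real n * (\<Sum>i<n. (y i)\<^sup>2))"
      by (intro mult_mono norm1_le) (auto intro!: mult_nonneg_nonneg sum_nonneg)
    then show ?thesis by (simp add: P_def power2_eq_square mult_ac)
  qed
  have "avg (cb n) (\<lambda>u. avg (cb n) (\<lambda>w. Q u w * (?Z u w - E)\<^sup>2)) =
     avg (cb n) (\<lambda>u. avg (cb n) (\<lambda>w. Q u w * (?Z u w)\<^sup>2)) - 2 * E * avg (cb n) (\<lambda>u. avg (cb n) (\<lambda>w. Q u w * ?Z u w)) + E\<^sup>2 * avg (cb n) (\<lambda>u. avg (cb n) (Q u))"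
    by (simp add: power2_diff avg_add[symmetric] avg_diff[symmetric] avg_cmult[symmetric] algebra_simps)
  also have "\<dots> = avg (cb n) (\<lambda>u. avg (cb n) (\<lambda>w. Q u w * (?Z u w)\<^sup>2)) - E\<^sup>2"
    unfolding Z one by (simp add: power2_eq_square)
  also have "\<dots> \<le> x\<^sup>2 * P + mu\<^sup>2 * (cosh x)\<^sup>2 * ((\<Sum>i<n. X i)\<^sup>2 * (\<Sum>j<n. y j)\<^sup>2 + W + 2 * P) - E\<^sup>2"
    using Z2 xK by simp
  also have "\<dots> = x\<^sup>2 * P + mu\<^sup>2 * (sinh x)\<^sup>2 * ((\<Sum>i<n. X i)\<^sup>2 * (\<Sum>j<n. y j)\<^sup>2) + mu\<^sup>2 * (cosh x)\<^sup>2 * (W + 2 * P)"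
    unfolding ch E_def by (simp add: algebra_simps power_mult_distrib)
  also have "\<dots> \<le> x\<^sup>2 * P + x ^ 4 * (9 / 4 * x\<^sup>2) * ((real n)\<^sup>2 * P) + x ^ 4 * 2 * (P / x\<^sup>2 + 2 * P)"
  proof -
    have m2: "mu\<^sup>2 \<le> x ^ 4" using power_mono[OF mu_bounds(2), of 2] mu_bounds(1) by simp
    have "mu\<^sup>2 * (sinh x)\<^sup>2 * ((\<Sum>i<n. X i)\<^sup>2 * (\<Sum>j<n. y j)\<^sup>2) \<le> x ^ 4 * (9 / 4 * x\<^sup>2) * ((real n)\<^sup>2 * P)"
      by (rule mult_mono[OF mult_mono[OF m2 sh] Ple]) auto
    moreover have "mu\<^sup>2 * (cosh x)\<^sup>2 * (W + 2 * P) \<le> mu\<^sup>2 * (cosh x)\<^sup>2 * (P / x\<^sup>2 + 2 * P)"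
      using W_le by (intro mult_left_mono) auto
    moreover have "mu\<^sup>2 * (cosh x)\<^sup>2 * (P / x\<^sup>2 + 2 * P) \<le> x ^ 4 * 2 * (P / x\<^sup>2 + 2 * P)"
      by (rule mult_right_mono[OF mult_mono[OF m2 ch2]]) (use P0 in auto)
    ultimately show ?thesis by linarith
  qed
  also have "\<dots> = P * x\<^sup>2 * (1 + 9 / 4 * (x\<^sup>2 * n)\<^sup>2 + 2 + 4 * x\<^sup>2)"
    using x by (simp add: field_simps power2_eq_square power4_eq_xxxx)
  also have "\<dots> \<le> P * x\<^sup>2 * 5"
  proof -
    have "(x\<^sup>2 * n)\<^sup>2 \<le> (1 / 17)\<^sup>2" using x_small by (intro power_mono) auto
    then show ?thesis using P0 x_small by (intro mult_left_mono) (auto simp: power2_eq_square)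
  qed
  also have "\<dots> \<le> P / n"
  proof -
    have "x\<^sup>2 * 5 \<le> 1 / n" using x n by (simp add: field_simps)
    then have "P * (x\<^sup>2 * 5) \<le> P * (1 / n)" using P0 by (intro mult_left_mono) auto
    then show ?thesis by (simp add: mult.assoc)
  qed
  finally show ?thesis unfolding E_def P_def .
qed

end

context forr
begin

text \<open>The signal kept by one kernel: it multiplies the normalised coordinate sum by this
  factor.\<close>

definition cc where "cc = real n * mu"

lemma cc_bounds: "0 < cc" "cc \<le> 1" "exp (-1) * (x\<^sup>2 * n) \<le> cc"
proof -
  show "0 < cc" using mu_bounds n by (simp add: cc_def)
  have "cc \<le> n * x\<^sup>2" unfolding cc_def using mu_bounds by (intro mult_left_mono) auto
  then show "cc \<le> 1" using x_small by (simp add: mult.commute)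
  have "n * (exp (-1) * x\<^sup>2) \<le> cc" unfolding cc_def using mu_bounds by (intro mult_left_mono) auto
  then show "exp (-1) * (x\<^sup>2 * n) \<le> cc" by (simp add: mult_ac)
qed

lemma lvec_norm:
  assumes "set zs \<subseteq> cb n"
  shows "(\<Sum>j<n. (lvec n M zs j)\<^sup>2) \<le> n"
  using assms
proof (induction zs)
  case (Cons z zs)
  have "(\<Sum>j<n. (lvec n M (z # zs) j)\<^sup>2) \<le> 1\<^sup>2 * (\<Sum>i<n. (z i * lvec n M zs i)\<^sup>2)"
    unfolding lvec.simps by (rule minor_le_norm[OF contr]) simp
  also have "(\<Sum>i<n. (z i * lvec n M zs i)\<^sup>2) = (\<Sum>i<n. (lvec n M zs i)\<^sup>2)"
    using Cons.prems cb_sq[of z n] by (intro sum.cong refl) (simp add: power_mult_distrib power2_eq_square)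
  finally show ?case using Cons by simp
qed simp

lemma M_sym: "M i j = M j i"
  by (simp add: M sym)

text \<open>For fixed earlier signs \<open>s'\<close> the input \<open>u\<close> of the kernel is
  the layer times \<open>s'\<close>; it ranges uniformly, and the layer is recovered as the product
  of \<open>u\<close> and \<open>s'\<close>.\<close>

lemma avg_chain_step:
  "avg (cb n) (\<lambda>z. avg (cb n) (\<lambda>s. chain n M (z # zs) s * f s z))
    = avg (cb n) (\<lambda>s'. chain n M zs s' * avg (cb n) (\<lambda>u. avg (cb n) (\<lambda>s. Q u s * f s (sm n u s'))))"
proof -
  have "avg (cb n) (\<lambda>z. avg (cb n) (\<lambda>s. chain n M (z # zs) s * f s z))
     = avg (cb n) (\<lambda>z. avg (cb n) (\<lambda>s. avg (cb n) (\<lambda>s'. chain n M zs s' * (Q (sm n z s') s * f s z))))"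
    by (simp add: avg_multc[symmetric] mult.assoc)
  also have "\<dots> = avg (cb n) (\<lambda>z. avg (cb n) (\<lambda>s'. chain n M zs s' * avg (cb n) (\<lambda>s. Q (sm n z s') s * f s z)))"
    by (rule avg_cong, subst avg_swap) (simp add: avg_cmult)
  also have "\<dots> = avg (cb n) (\<lambda>s'. chain n M zs s' * avg (cb n) (\<lambda>z. avg (cb n) (\<lambda>s. Q (sm n z s') s * f s z)))"
    by (subst avg_swap) (simp add: avg_cmult)
  also have "\<dots> = avg (cb n) (\<lambda>s'. chain n M zs s' * avg (cb n) (\<lambda>u. avg (cb n) (\<lambda>s. Q u s * f s (sm n u s'))))"
  proof (rule avg_cong, rule arg_cong2[where f = "(*)", OF refl])
    fix s' assume s': "s' \<in> cb n"
    show "avg (cb n) (\<lambda>z. avg (cb n) (\<lambda>s. Q (sm n z s') s * f s z)) = avg (cb n) (\<lambda>u. avg (cb n) (\<lambda>s. Q u s * f s (sm n u s')))"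
      using avg_sm2[OF s', of "\<lambda>z u. avg (cb n) (\<lambda>s. Q u s * f s z)"] by (simp add: sm_commute[of n _ s'])
  qed
  finally show ?thesis .
qed

lemma avg_chain: "set zs \<subseteq> cb n \<Longrightarrow> avg (cb n) (chain n M zs) = 1"
proof (induction zs)
  case Nil
  have "(\<Sum>s\<in>cb n. if s = (\<lambda>i\<in>{..<n}. 1) then 2 ^ n else 0) = (2 :: real) ^ n"
    using one_cb by (simp add: sum.delta)
  then show ?case by (simp add: avg_def card_cb)
next
  case (Cons z zs)
  have "avg (cb n) (chain n M (z # zs)) = avg (cb n) (\<lambda>s. avg (cb n) (\<lambda>s'. chain n M zs s' * Q (sm n z s') s))"
    by (rule avg_cong) simp
  also have "\<dots> = avg (cb n) (\<lambda>s'. chain n M zs s' * avg (cb n) (Q (sm n z s')))"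
    by (subst avg_swap) (simp add: avg_cmult)
  also have "\<dots> = avg (cb n) (chain n M zs)"
    using Cons.prems by (intro avg_cong) (simp add: avg_Q_right sm_cb)
  finally show ?case using Cons by (simp del: chain.simps)
qed

abbreviation cubes where "cubes k \<equiv> replicate k (cb n)"

lemma avl_cubes_const: "avl (cubes k) (\<lambda>_. c) = c"
  by (rule avl_const) auto

lemma list_all2_cubes: "list_all2 (\<in>) zs (cubes k) \<Longrightarrow> set zs \<subseteq> cb n \<and> length zs = k"
  by (auto simp: list_all2_conv_all_nth in_set_conv_nth)

text \<open>One more kernel adds its own variance from \<open>pair_var\<close> and transports the
  previous error of the coordinate sum with a factor \<open>mu\<close>. Splitting the square into
  these two parts costs a factor 2 each, so the constants obey \<open>C' = 2 + 2 * C\<close> with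
  \<open>C = 0\<close> at the start.\<close>

lemma chain_concentration:
  "avl (cubes t) (\<lambda>zs. avg (cb n) (\<lambda>s. chain n M zs s * ((\<Sum>j<n. s j * lvec n M zs j * y j) - cc ^ t * (\<Sum>j<n. y j))\<^sup>2))
    \<le> (2 ^ (t + 1) - 2) * (\<Sum>j<n. (y j)\<^sup>2)"
proof (induction t arbitrary: y)
  case 0
  have "avg (cb n) (\<lambda>s. chain n M [] s * ((\<Sum>j<n. s j * lvec n M [] j * y j) - cc ^ 0 * (\<Sum>j<n. y j))\<^sup>2) = avg (cb n) (\<lambda>s. 0)"
    by (intro avg_cong) auto
  then show ?case by (simp add: avg_const)
next
  case (Suc t)
  let ?Y = "\<Sum>j<n. (y j)\<^sup>2"
  have step: "avg (cb n) (\<lambda>z. avg (cb n) (\<lambda>s. chain n M (z # zs) s * ((\<Sum>j<n. s j * lvec n M (z # zs) j * y j) - cc ^ Suc t * (\<Sum>j<n. y j))\<^sup>2))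
      \<le> 2 * ?Y + (2 * mu\<^sup>2 * (\<Sum>j<n. y j)\<^sup>2) * avg (cb n) (\<lambda>s. chain n M zs s * ((\<Sum>j<n. s j * lvec n M zs j * 1) - cc ^ t * (\<Sum>j<n. 1))\<^sup>2)"
    if zs: "set zs \<subseteq> cb n" for zs
  proof -
    define X where "X s' i = s' i * lvec n M zs i" for s' i
    have "avg (cb n) (\<lambda>z. avg (cb n) (\<lambda>s. chain n M (z # zs) s * ((\<Sum>j<n. s j * lvec n M (z # zs) j * y j) - cc ^ Suc t * (\<Sum>j<n. y j))\<^sup>2))
      = avg (cb n) (\<lambda>s'. chain n M zs s' * avg (cb n) (\<lambda>u. avg (cb n) (\<lambda>s. Q u s * ((\<Sum>j<n. s j * (\<Sum>i<n. M j i * (sm n u s' i * lvec n M zs i)) * y j) - cc ^ Suc t * (\<Sum>j<n. y j))\<^sup>2)))"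
      unfolding lvec.simps
      by (rule avg_chain_step[of _ "\<lambda>s z. ((\<Sum>j<n. s j * (\<Sum>i<n. M j i * (z i * lvec n M zs i)) * y j) - cc ^ Suc t * (\<Sum>j<n. y j))\<^sup>2"])
    also have "\<dots> \<le> avg (cb n) (\<lambda>s'. chain n M zs s' * (2 * ?Y + 2 * mu\<^sup>2 * (\<Sum>j<n. y j)\<^sup>2 * ((\<Sum>j<n. X s' j) - cc ^ t * n)\<^sup>2))"
    proof (intro avg_mono mult_left_mono)
      fix s' assume s': "s' \<in> cb n"
      let ?Z = "\<lambda>u s. \<Sum>i<n. \<Sum>j<n. X s' i * u i * M i j * (s j * y j)"
      let ?E = "mu * (\<Sum>i<n. X s' i) * (\<Sum>j<n. y j)"
      have Zeq: "(\<Sum>j<n. s j * (\<Sum>i<n. M j i * (sm n u s' i * lvec n M zs i)) * y j) = ?Z u s" for u s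
      proof -
        have "(\<Sum>j<n. s j * (\<Sum>i<n. M j i * (sm n u s' i * lvec n M zs i)) * y j) = (\<Sum>j<n. \<Sum>i<n. X s' i * u i * M i j * (s j * y j))"
          unfolding sum_distrib_left sum_distrib_right
        proof (intro sum.cong refl)
          fix j i assume "i \<in> {..<n}"
          then show "s j * (M j i * (sm n u s' i * lvec n M zs i)) * y j = X s' i * u i * M i j * (s j * y j)"
            unfolding M_sym[of j i] by (simp add: X_def mult_ac)
        qed
        then show ?thesis by (subst sum.swap) simp
      qed
      have X2: "(\<Sum>i<n. (X s' i)\<^sup>2) \<le> n"
      proof -
        have "(\<Sum>i<n. (X s' i)\<^sup>2) = (\<Sum>i<n. (lvec n M zs i)\<^sup>2)"
          using cb_sq[OF s'] by (intro sum.cong refl) (simp add: X_def power_mult_distrib power2_eq_square)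
        then show ?thesis using lvec_norm[OF zs] by simp
      qed
      have E: "?E - cc ^ Suc t * (\<Sum>j<n. y j) = mu * (\<Sum>j<n. y j) * ((\<Sum>j<n. X s' j) - cc ^ t * n)"
        by (simp add: cc_def algebra_simps)
      have "avg (cb n) (\<lambda>u. avg (cb n) (\<lambda>s. Q u s * (?Z u s - cc ^ Suc t * (\<Sum>j<n. y j))\<^sup>2))
         \<le> avg (cb n) (\<lambda>u. avg (cb n) (\<lambda>s. 2 * (Q u s * (?Z u s - ?E)\<^sup>2) + 2 * (?E - cc ^ Suc t * (\<Sum>j<n. y j))\<^sup>2 * Q u s))"
      proof (intro avg_mono)
        fix u s assume us: "u \<in> cb n" "s \<in> cb n"
        have sq2: "(a - c)\<^sup>2 \<le> 2 * (a - b)\<^sup>2 + 2 * (b - c)\<^sup>2" for a b c :: real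
        proof -
          have "0 \<le> ((a - b) - (b - c))\<^sup>2" by simp
          then show ?thesis by (simp add: power2_eq_square algebra_simps)
        qed
        have "Q u s * (?Z u s - cc ^ Suc t * (\<Sum>j<n. y j))\<^sup>2 \<le> Q u s * (2 * (?Z u s - ?E)\<^sup>2 + 2 * (?E - cc ^ Suc t * (\<Sum>j<n. y j))\<^sup>2)"
          by (intro mult_left_mono sq2 pairQ_nonneg us) auto
        then show "Q u s * (?Z u s - cc ^ Suc t * (\<Sum>j<n. y j))\<^sup>2 \<le> 2 * (Q u s * (?Z u s - ?E)\<^sup>2) + 2 * (?E - cc ^ Suc t * (\<Sum>j<n. y j))\<^sup>2 * Q u s"
          by (simp add: algebra_simps)
      qed
      also have "\<dots> = 2 * avg (cb n) (\<lambda>u. avg (cb n) (\<lambda>s. Q u s * (?Z u s - ?E)\<^sup>2)) + 2 * (?E - cc ^ Suc t * (\<Sum>j<n. y j))\<^sup>2"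
      proof -
        have "avg (cb n) (\<lambda>u. avg (cb n) (Q u)) = 1"
          using avg_cong[of "cb n" "\<lambda>u. avg (cb n) (Q u)" "\<lambda>_. 1"] avg_Q_right by (simp add: avg_const)
        then show ?thesis by (simp add: avg_add avg_cmult)
      qed
      also have "\<dots> \<le> 2 * ((\<Sum>i<n. (X s' i)\<^sup>2) * ?Y / n) + 2 * (?E - cc ^ Suc t * (\<Sum>j<n. y j))\<^sup>2"
        by (intro add_mono mult_left_mono pair_var order_refl) auto
      also have "\<dots> \<le> 2 * ?Y + 2 * mu\<^sup>2 * (\<Sum>j<n. y j)\<^sup>2 * ((\<Sum>j<n. X s' j) - cc ^ t * n)\<^sup>2"
      proof -
        have "(\<Sum>i<n. (X s' i)\<^sup>2) * ?Y \<le> n * ?Y" using X2 by (intro mult_right_mono) (auto simp: sum_nonneg)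
        then have "(\<Sum>i<n. (X s' i)\<^sup>2) * ?Y / n \<le> ?Y" using n by (simp add: field_simps)
        then show ?thesis unfolding E by (simp add: power_mult_distrib)
      qed
      finally show "avg (cb n) (\<lambda>u. avg (cb n) (\<lambda>s. Q u s * ((\<Sum>j<n. s j * (\<Sum>i<n. M j i * (sm n u s' i * lvec n M zs i)) * y j) - cc ^ Suc t * (\<Sum>j<n. y j))\<^sup>2))
         \<le> 2 * ?Y + 2 * mu\<^sup>2 * (\<Sum>j<n. y j)\<^sup>2 * ((\<Sum>j<n. X s' j) - cc ^ t * n)\<^sup>2"
        unfolding Zeq .
    qed (use zs in \<open>simp add: chain_nonneg\<close>)
    also have "\<dots> = 2 * ?Y * avg (cb n) (chain n M zs) + (2 * mu\<^sup>2 * (\<Sum>j<n. y j)\<^sup>2) * avg (cb n) (\<lambda>s. chain n M zs s * ((\<Sum>j<n. X s j) - cc ^ t * n)\<^sup>2)"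
    proof -
      have "chain n M zs s' * (2 * ?Y + 2 * mu\<^sup>2 * (\<Sum>j<n. y j)\<^sup>2 * ((\<Sum>j<n. X s' j) - cc ^ t * n)\<^sup>2)
        = 2 * ?Y * chain n M zs s' + (2 * mu\<^sup>2 * (\<Sum>j<n. y j)\<^sup>2) * (chain n M zs s' * ((\<Sum>j<n. X s' j) - cc ^ t * n)\<^sup>2)" for s'
        by (simp add: algebra_simps)
      then show ?thesis by (simp only: avg_add avg_cmult)
    qed
    also have "\<dots> = 2 * ?Y + (2 * mu\<^sup>2 * (\<Sum>j<n. y j)\<^sup>2) * avg (cb n) (\<lambda>s. chain n M zs s * ((\<Sum>j<n. s j * lvec n M zs j * 1) - cc ^ t * (\<Sum>j<n. 1))\<^sup>2)"
      by (simp add: avg_chain[OF zs] X_def)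
    finally show ?thesis .
  qed
  have "avl (cubes (Suc t)) (\<lambda>zs. avg (cb n) (\<lambda>s. chain n M zs s * ((\<Sum>j<n. s j * lvec n M zs j * y j) - cc ^ Suc t * (\<Sum>j<n. y j))\<^sup>2))
     \<le> avl (cubes t) (\<lambda>zs. 2 * ?Y + (2 * mu\<^sup>2 * (\<Sum>j<n. y j)\<^sup>2) * avg (cb n) (\<lambda>s. chain n M zs s * ((\<Sum>j<n. s j * lvec n M zs j * 1) - cc ^ t * (\<Sum>j<n. 1))\<^sup>2))"
    unfolding replicate_Suc avl.simps by (intro avl_mono step) (auto dest: list_all2_cubes)
  also have "\<dots> = 2 * ?Y + (2 * mu\<^sup>2 * (\<Sum>j<n. y j)\<^sup>2) * avl (cubes t) (\<lambda>zs. avg (cb n) (\<lambda>s. chain n M zs s * ((\<Sum>j<n. s j * lvec n M zs j * 1) - cc ^ t * (\<Sum>j<n. 1))\<^sup>2))"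
    by (simp only: avl_add avl_cmult avl_cubes_const)
  also have "\<dots> \<le> 2 * ?Y + (2 * mu\<^sup>2 * (\<Sum>j<n. y j)\<^sup>2) * ((2 ^ (t + 1) - 2) * (\<Sum>j<n. (1 :: real)\<^sup>2))"
    by (intro add_left_mono mult_left_mono Suc.IH) auto
  also have "\<dots> \<le> 2 * ?Y + 2 * (2 ^ (t + 1) - 2) * ?Y"
  proof -
    have "mu\<^sup>2 * n * (\<Sum>j<n. y j)\<^sup>2 \<le> mu\<^sup>2 * n * (n * ?Y)" by (intro mult_left_mono norm1_le) auto
    also have "\<dots> = cc\<^sup>2 * ?Y" by (simp add: cc_def power2_eq_square mult_ac)
    also have "\<dots> \<le> 1 * ?Y" using cc_bounds by (intro mult_right_mono) (auto simp: power_le_one sum_nonneg)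
    finally have "mu\<^sup>2 * n * (\<Sum>j<n. y j)\<^sup>2 \<le> ?Y" by simp
    moreover have "(0 :: real) \<le> 2 * (2 ^ (t + 1) - 2)" using one_le_power[of "2 :: real" t] by simp
    ultimately have "2 * (2 ^ (t + 1) - 2) * (mu\<^sup>2 * n * (\<Sum>j<n. y j)\<^sup>2) \<le> 2 * (2 ^ (t + 1) - 2) * ?Y"
      by (intro mult_left_mono) auto
    moreover have "(2 * mu\<^sup>2 * (\<Sum>j<n. y j)\<^sup>2) * (K * (\<Sum>j<n. (1 :: real)\<^sup>2)) = 2 * K * (mu\<^sup>2 * n * (\<Sum>j<n. y j)\<^sup>2)" for K :: real
      by simp
    ultimately show ?thesis by (simp only: add_le_cancel_left)
  qed
  also have "\<dots> = (2 ^ (Suc t + 1) - 2) * ?Y" by (simp add: algebra_simps)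
  finally show ?case .
qed

lemma avl_cubes_split: "avl (cubes (2 * k + 1)) f = avl (cubes k) (\<lambda>ys. avl (cubes k) (\<lambda>xs. avg (cb n) (\<lambda>z. f (z # xs @ ys))))"
proof -
  have "cubes (2 * k + 1) = cb n # (cubes k @ cubes k)" by (simp add: replicate_add[symmetric] mult_2)
  then show ?thesis by (simp add: avl_append)
qed

text \<open>Writing the middle layer as the product of \<open>s\<close> and \<open>v\<close>
  decouples the two chains.\<close>

lemma avg_dens:
  assumes "length xs = k"
  shows "avg (cb n) (\<lambda>z. dens n M k (z # xs @ ys) * f z) =
    avg (cb n) (\<lambda>v. chain n M ys v * avg (cb n) (\<lambda>s. chain n M xs s * f (sm n s v)))"
proof -
  have "avg (cb n) (\<lambda>z. dens n M k (z # xs @ ys) * f z) = avg (cb n) (\<lambda>z. avg (cb n) (\<lambda>s. chain n M xs s * chain n M ys (sm n z s) * f z))"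
    using assms by (simp add: dens_def avg_multc[symmetric])
  also have "\<dots> = avg (cb n) (\<lambda>s. avg (cb n) (\<lambda>z. chain n M xs s * chain n M ys (sm n s z) * f z))"
    by (subst avg_swap) (simp add: sm_commute)
  also have "\<dots> = avg (cb n) (\<lambda>s. avg (cb n) (\<lambda>v. chain n M xs s * chain n M ys v * f (sm n s v)))"
  proof (rule avg_cong)
    fix s assume "s \<in> cb n"
    then show "avg (cb n) (\<lambda>z. chain n M xs s * chain n M ys (sm n s z) * f z) = avg (cb n) (\<lambda>v. chain n M xs s * chain n M ys v * f (sm n s v))"
      by (rule avg_sm2[of s n "\<lambda>z v. chain n M xs s * chain n M ys v * f z"])
  qed
  also have "\<dots> = avg (cb n) (\<lambda>v. chain n M ys v * avg (cb n) (\<lambda>s. chain n M xs s * f (sm n s v)))"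
    by (subst avg_swap) (simp add: avg_cmult[symmetric] mult_ac)
  finally show ?thesis .
qed

lemma avl_dens_1: "avl (cubes (2 * k + 1)) (dens n M k) = 1"
proof -
  have "avl (cubes (2 * k + 1)) (dens n M k) = avl (cubes k) (\<lambda>ys. avl (cubes k) (\<lambda>xs. 1))"
    unfolding avl_cubes_split
  proof (intro avl_cong)
    fix ys xs assume "list_all2 (\<in>) ys (cubes k)" "list_all2 (\<in>) xs (cubes k)"
    then have "set ys \<subseteq> cb n" "set xs \<subseteq> cb n" "length xs = k" using list_all2_cubes by blast+
    then show "avg (cb n) (\<lambda>z. dens n M k (z # xs @ ys)) = 1"
      using avg_dens[of xs k ys "\<lambda>_. 1"] by (simp add: avg_chain)
  qed
  then show ?thesis by (simp add: avl_cubes_const)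
qed

text \<open>Concentration is used twice: over one half, with weights \<open>Y\<close> made from the
  other half, which leaves \<open>cc ^ k\<close> times the coordinate sum of those weights; then
  over the other half, where that sum concentrates at \<open>cc ^ k * n\<close>.\<close>

theorem phi_dens:
  "avl (cubes (2 * k + 1)) (\<lambda>zs. dens n M k zs * (phi n M k zs - cc ^ (2 * k))\<^sup>2) \<le> 2 ^ (k + 3) / n"
proof -
  let ?C = "(2 :: real) ^ (k + 1) - 2"
  have C0: "0 \<le> ?C" using one_le_power[of "2 :: real" k] by simp
  let ?g = "\<lambda>ys v. ((\<Sum>j<n. v j * lvec n M ys j * 1) - cc ^ k * (\<Sum>j<n. 1))\<^sup>2"
  have main: "avl (cubes k) (\<lambda>xs. avg (cb n) (\<lambda>z. dens n M k (z # xs @ ys) * (phi n M k (z # xs @ ys) - cc ^ (2 * k))\<^sup>2))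
      \<le> (2 * ?C * n + 2 * avg (cb n) (\<lambda>v. chain n M ys v * ?g ys v)) / n\<^sup>2" if ys: "set ys \<subseteq> cb n" for ys
  proof -
    define Y where "Y v j = v j * lvec n M ys j" for v j
    have "avl (cubes k) (\<lambda>xs. avg (cb n) (\<lambda>z. dens n M k (z # xs @ ys) * (phi n M k (z # xs @ ys) - cc ^ (2 * k))\<^sup>2))
      = avl (cubes k) (\<lambda>xs. avg (cb n) (\<lambda>v. chain n M ys v * avg (cb n) (\<lambda>s. chain n M xs s * (((\<Sum>j<n. s j * lvec n M xs j * Y v j) / n - cc ^ (2 * k))\<^sup>2))))"
    proof (rule avl_cong)
      fix xs assume "list_all2 (\<in>) xs (cubes k)"
      then have len: "length xs = k" using list_all2_cubes by blast
      have "phi n M k (z # xs @ ys) = (\<Sum>i<n. z i * lvec n M xs i * lvec n M ys i) / n" for z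
        using len by (simp add: phi_def)
      moreover have "(\<Sum>i<n. sm n s v i * lvec n M xs i * lvec n M ys i) = (\<Sum>j<n. s j * lvec n M xs j * Y v j)" for s v
        by (intro sum.cong) (auto simp: Y_def)
      ultimately show "avg (cb n) (\<lambda>z. dens n M k (z # xs @ ys) * (phi n M k (z # xs @ ys) - cc ^ (2 * k))\<^sup>2) =
        avg (cb n) (\<lambda>v. chain n M ys v * avg (cb n) (\<lambda>s. chain n M xs s * (((\<Sum>j<n. s j * lvec n M xs j * Y v j) / n - cc ^ (2 * k))\<^sup>2)))"
        using avg_dens[OF len, of ys "\<lambda>z. ((\<Sum>i<n. z i * lvec n M xs i * lvec n M ys i) / n - cc ^ (2 * k))\<^sup>2"] by simp
    qed
    also have "\<dots> = avg (cb n) (\<lambda>v. chain n M ys v * avl (cubes k) (\<lambda>xs. avg (cb n) (\<lambda>s. chain n M xs s * (((\<Sum>j<n. s j * lvec n M xs j * Y v j) / n - cc ^ (2 * k))\<^sup>2))))"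
      by (simp add: avl_avg avl_cmult)
    also have "\<dots> \<le> avg (cb n) (\<lambda>v. chain n M ys v * ((2 * ?C * n + 2 * ?g ys v) / n\<^sup>2))"
    proof (intro avg_mono mult_left_mono)
      fix v assume v: "v \<in> cb n"
      let ?G = "cc ^ k * (\<Sum>j<n. Y v j)"
      have pt: "((\<Sum>j<n. s j * lvec n M xs j * Y v j) / n - cc ^ (2 * k))\<^sup>2
          \<le> (2 * ((\<Sum>j<n. s j * lvec n M xs j * Y v j) - ?G)\<^sup>2 + 2 * ?g ys v) / n\<^sup>2" for s xs
      proof -
        have gen: "(A / N - e)\<^sup>2 \<le> (2 * (A - G)\<^sup>2 + 2 * B) / N\<^sup>2" if "(G - e * N)\<^sup>2 \<le> B" "0 < N" for A N e G B :: real
        proof -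
          have "0 \<le> ((A - G) - (G - e * N))\<^sup>2" by simp
          then have "(A - e * N)\<^sup>2 \<le> 2 * (A - G)\<^sup>2 + 2 * (G - e * N)\<^sup>2" by (simp add: power2_eq_square algebra_simps)
          then have "(A - e * N)\<^sup>2 / N\<^sup>2 \<le> (2 * (A - G)\<^sup>2 + 2 * B) / N\<^sup>2" using that by (intro divide_right_mono) auto
          moreover have "(A - e * N) / N = A / N - e" using that by (simp add: diff_divide_distrib)
          ultimately show ?thesis by (metis power_divide)
        qed
        have "?G - cc ^ (2 * k) * n = cc ^ k * ((\<Sum>j<n. Y v j) - cc ^ k * n)"
          unfolding mult_2 power_add by (simp add: right_diff_distrib mult.assoc)
        then have "(?G - cc ^ (2 * k) * n)\<^sup>2 = (cc ^ k)\<^sup>2 * ?g ys v"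
          by (simp add: Y_def power_mult_distrib)
        also have "(cc ^ k)\<^sup>2 * ?g ys v \<le> 1 * ?g ys v"
          by (rule mult_right_mono) (use cc_bounds in \<open>auto simp: power_le_one\<close>)
        finally have "(?G - cc ^ (2 * k) * n)\<^sup>2 \<le> ?g ys v" by simp
        then show ?thesis unfolding of_nat_power by (rule gen) (use n in simp)
      qed
      have "avl (cubes k) (\<lambda>xs. avg (cb n) (\<lambda>s. chain n M xs s * (((\<Sum>j<n. s j * lvec n M xs j * Y v j) / n - cc ^ (2 * k))\<^sup>2)))
         \<le> avl (cubes k) (\<lambda>xs. avg (cb n) (\<lambda>s. chain n M xs s * ((2 * ((\<Sum>j<n. s j * lvec n M xs j * Y v j) - ?G)\<^sup>2 + 2 * ?g ys v) / n\<^sup>2)))"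
        by (intro avl_mono avg_mono mult_left_mono pt chain_nonneg) (auto dest: list_all2_cubes)
      also have "\<dots> = avl (cubes k) (\<lambda>xs. 2 / n\<^sup>2 * avg (cb n) (\<lambda>s. chain n M xs s * ((\<Sum>j<n. s j * lvec n M xs j * Y v j) - ?G)\<^sup>2) + 2 * ?g ys v / n\<^sup>2)"
      proof (rule avl_cong)
        fix xs assume "list_all2 (\<in>) xs (cubes k)"
        then have "avg (cb n) (chain n M xs) = 1" by (intro avg_chain) (auto dest: list_all2_cubes)
        moreover have "chain n M xs s * ((2 * ((\<Sum>j<n. s j * lvec n M xs j * Y v j) - ?G)\<^sup>2 + 2 * ?g ys v) / n\<^sup>2) =
          2 / n\<^sup>2 * (chain n M xs s * ((\<Sum>j<n. s j * lvec n M xs j * Y v j) - ?G)\<^sup>2) + 2 * ?g ys v / n\<^sup>2 * chain n M xs s" for s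
          by (simp add: add_divide_distrib algebra_simps)
        ultimately show "avg (cb n) (\<lambda>s. chain n M xs s * ((2 * ((\<Sum>j<n. s j * lvec n M xs j * Y v j) - ?G)\<^sup>2 + 2 * ?g ys v) / n\<^sup>2))
          = 2 / n\<^sup>2 * avg (cb n) (\<lambda>s. chain n M xs s * ((\<Sum>j<n. s j * lvec n M xs j * Y v j) - ?G)\<^sup>2) + 2 * ?g ys v / n\<^sup>2"
          by (simp only: avg_add avg_cmult mult_1_right)
      qed
      also have "\<dots> = 2 / n\<^sup>2 * avl (cubes k) (\<lambda>xs. avg (cb n) (\<lambda>s. chain n M xs s * ((\<Sum>j<n. s j * lvec n M xs j * Y v j) - ?G)\<^sup>2)) + 2 * ?g ys v / n\<^sup>2"
        by (simp only: avl_add avl_cmult avl_cubes_const)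
      also have "\<dots> \<le> 2 / n\<^sup>2 * (?C * (\<Sum>j<n. (Y v j)\<^sup>2)) + 2 * ?g ys v / n\<^sup>2"
        by (intro add_right_mono mult_left_mono chain_concentration) auto
      also have "\<dots> \<le> 2 / n\<^sup>2 * (?C * n) + 2 * ?g ys v / n\<^sup>2"
      proof -
        have "(\<Sum>j<n. (Y v j)\<^sup>2) = (\<Sum>j<n. (lvec n M ys j)\<^sup>2)"
          using cb_sq[OF v] by (intro sum.cong refl) (simp add: Y_def power_mult_distrib power2_eq_square)
        then show ?thesis using lvec_norm[OF ys] C0 by (intro add_right_mono mult_left_mono) auto
      qed
      also have "\<dots> = (2 * ?C * n + 2 * ?g ys v) / n\<^sup>2" by (simp add: add_divide_distrib)
      finally show "avl (cubes k) (\<lambda>xs. avg (cb n) (\<lambda>s. chain n M xs s * (((\<Sum>j<n. s j * lvec n M xs j * Y v j) / n - cc ^ (2 * k))\<^sup>2))) \<le> (2 * ?C * n + 2 * ?g ys v) / n\<^sup>2" .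
    qed (use ys in \<open>simp add: chain_nonneg\<close>)
    also have "\<dots> = (2 * ?C * n * avg (cb n) (chain n M ys) + 2 * avg (cb n) (\<lambda>v. chain n M ys v * ?g ys v)) / n\<^sup>2"
    proof -
      have "chain n M ys v * ((2 * ?C * n + 2 * ?g ys v) / n\<^sup>2) = (2 * ?C * n * chain n M ys v + 2 * (chain n M ys v * ?g ys v)) / n\<^sup>2" for v
        by (simp add: algebra_simps)
      then show ?thesis by (simp only: avg_divide avg_add avg_cmult)
    qed
    finally show ?thesis by (simp add: avg_chain[OF ys])
  qed
  have "avl (cubes (2 * k + 1)) (\<lambda>zs. dens n M k zs * (phi n M k zs - cc ^ (2 * k))\<^sup>2)
     \<le> avl (cubes k) (\<lambda>ys. (2 * ?C * n + 2 * avg (cb n) (\<lambda>v. chain n M ys v * ?g ys v)) / n\<^sup>2)"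
    unfolding avl_cubes_split by (intro avl_mono main) (auto dest: list_all2_cubes)
  also have "\<dots> = avl (cubes k) (\<lambda>ys. 2 * ?C * n / n\<^sup>2 + 2 / n\<^sup>2 * avg (cb n) (\<lambda>v. chain n M ys v * ?g ys v))"
    by (intro avl_cong) (simp add: add_divide_distrib)
  also have "\<dots> = 2 * ?C * n / n\<^sup>2 + 2 / n\<^sup>2 * avl (cubes k) (\<lambda>ys. avg (cb n) (\<lambda>v. chain n M ys v * ?g ys v))"
    by (simp only: avl_add avl_cmult avl_cubes_const)
  also have "\<dots> \<le> 2 * ?C * n / n\<^sup>2 + 2 / n\<^sup>2 * (?C * (\<Sum>j<n. (1 :: real)\<^sup>2))"
    by (intro add_left_mono mult_left_mono chain_concentration) auto
  also have "\<dots> = 4 * ?C / n" using n by (simp add: power2_eq_square field_simps)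
  also have "\<dots> \<le> 2 ^ (k + 3) / n" by (intro divide_right_mono) (auto simp: power_add)
  finally show ?thesis .
qed

lemma lvec_sq_avg:
  assumes "0 < k" "j < n"
  shows "avl (cubes k) (\<lambda>zs. (lvec n M zs j)\<^sup>2) \<le> 1"
proof -
  obtain k' where k: "k = Suc k'" using assms(1) by (cases k) auto
  have "avl (cubes k) (\<lambda>zs. (lvec n M zs j)\<^sup>2) = avl (cubes k') (\<lambda>zs. avg (cb n) (\<lambda>z. (\<Sum>i<n. z i * (M j i * lvec n M zs i))\<^sup>2))"
    by (simp add: k mult_ac)
  also have "\<dots> \<le> avl (cubes k') (\<lambda>_. 1)"
  proof (rule avl_mono)
    fix zs assume "list_all2 (\<in>) zs (cubes k')"
    then have zs: "set zs \<subseteq> cb n" by (auto dest: list_all2_cubes)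
    have "avg (cb n) (\<lambda>z. (\<Sum>i<n. z i * (M j i * lvec n M zs i))\<^sup>2) = (\<Sum>i<n. (M j i * lvec n M zs i)\<^sup>2)"
      by (rule avg_cb_square)
    also have "\<dots> = x\<^sup>2 * (\<Sum>i<n. (lvec n M zs i)\<^sup>2)"
      unfolding sum_distrib_left using S[OF assms(2)] by (intro sum.cong refl) (force simp: M power_mult_distrib)
    also have "\<dots> \<le> x\<^sup>2 * n" using lvec_norm[OF zs] by (intro mult_left_mono) auto
    also have "\<dots> \<le> 1" using x_small by simp
    finally show "avg (cb n) (\<lambda>z. (\<Sum>i<n. z i * (M j i * lvec n M zs i))\<^sup>2) \<le> 1" .
  qed
  finally show ?thesis by (simp add: avl_cubes_const)
qed

text \<open>The signs of the middle layer are orthogonal, so only squares remain. The two halves are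
  independent, and each coordinate of a nonempty half has second moment at most 1.\<close>

theorem phi_uniform:
  assumes "0 < k"
  shows "avl (cubes (2 * k + 1)) (\<lambda>zs. (phi n M k zs)\<^sup>2) \<le> 1 / n"
proof -
  have "avl (cubes (2 * k + 1)) (\<lambda>zs. (phi n M k zs)\<^sup>2) = avl (cubes k) (\<lambda>ys. avl (cubes k) (\<lambda>xs. (\<Sum>i<n. 1 / n\<^sup>2 * ((lvec n M ys i)\<^sup>2 * (lvec n M xs i)\<^sup>2))))"
    unfolding avl_cubes_split
  proof (intro avl_cong)
    fix ys xs assume "list_all2 (\<in>) xs (cubes k)"
    then have len: "length xs = k" by (auto dest: list_all2_cubes)
    have "avg (cb n) (\<lambda>z. (phi n M k (z # xs @ ys))\<^sup>2) = avg (cb n) (\<lambda>z. (\<Sum>i<n. z i * (lvec n M xs i * lvec n M ys i))\<^sup>2 / n\<^sup>2)"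
      using len by (simp add: phi_def power_divide mult.assoc)
    also have "\<dots> = (\<Sum>i<n. (lvec n M xs i * lvec n M ys i)\<^sup>2) / n\<^sup>2"
      by (simp only: avg_divide avg_cb_square)
    finally show "avg (cb n) (\<lambda>z. (phi n M k (z # xs @ ys))\<^sup>2) = (\<Sum>i<n. 1 / n\<^sup>2 * ((lvec n M ys i)\<^sup>2 * (lvec n M xs i)\<^sup>2))"
      by (simp add: power_mult_distrib sum_divide_distrib mult_ac)
  qed
  also have "\<dots> = (\<Sum>i<n. 1 / n\<^sup>2 * (avl (cubes k) (\<lambda>ys. (lvec n M ys i)\<^sup>2) * avl (cubes k) (\<lambda>xs. (lvec n M xs i)\<^sup>2)))"
  proof -
    have sm: "avl As (\<lambda>xs. \<Sum>i<n. f i xs) = (\<Sum>i<n. avl As (f i))" for As :: "(nat \<Rightarrow> real) set list" and f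
      by (induction As arbitrary: f) (simp_all add: avg_sum)
    have mc: "avl As (\<lambda>xs. f xs * c) = avl As f * c" for As :: "(nat \<Rightarrow> real) set list" and f c
      using avl_cmult[of As c f] by (simp add: mult.commute)
    show ?thesis by (simp only: sm avl_cmult mc)
  qed
  also have "\<dots> \<le> (\<Sum>i<n. 1 / n\<^sup>2 * (1 * 1))"
  proof (intro sum_mono mult_left_mono mult_mono lvec_sq_avg assms)
    fix i show "0 \<le> avl (cubes k) (\<lambda>xs. (lvec n M xs i)\<^sup>2)"
      using avl_mono[of "cubes k" "\<lambda>_. 0" "\<lambda>xs. (lvec n M xs i)\<^sup>2"] by (simp add: avl_cubes_const)
  qed auto
  also have "\<dots> = 1 / n" using n by (simp add: power2_eq_square)
  finally show ?thesis .
qed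

end

section \<open>A random sign matrix\<close>

text \<open>The logarithm of \<open>cosh\<close> has derivative \<open>sinh t / cosh t\<close>, at
  most \<open>t\<close> for \<open>0 \<le> t\<close>.\<close>

lemma cosh_le_exp: "cosh x \<le> exp (x\<^sup>2 / 2)" for x :: real
proof -
  have pos: "cosh x \<le> exp (x\<^sup>2 / 2)" if "0 \<le> x" for x :: real
  proof -
    have sc: "sinh t \<le> t * cosh t" if "0 \<le> t" for t :: real
    proof -
      have "(\<lambda>t. t * cosh t - sinh t) 0 \<le> (\<lambda>t. t * cosh t - sinh t) t"
        by (rule DERIV_nonneg_imp_nondecreasing[of 0 t]) (use that in \<open>auto intro!: exI derivative_eq_intros simp: sinh_real_nonneg_iff\<close>)
      then show ?thesis by simp
    qed
    have "(\<lambda>t. t\<^sup>2 / 2 - ln (cosh t)) 0 \<le> (\<lambda>t. t\<^sup>2 / 2 - ln (cosh t)) x"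
    proof (rule DERIV_nonneg_imp_nondecreasing[of 0 x])
      fix t assume t: "0 \<le> t" "t \<le> x"
      have "((\<lambda>t. t\<^sup>2 / 2 - ln (cosh t)) has_real_derivative (t - sinh t / cosh t)) (at t)"
        by (auto intro!: derivative_eq_intros simp: cosh_real_pos field_simps)
      moreover have "0 \<le> t - sinh t / cosh t" using sc[OF t(1)] cosh_real_pos[of t] by (simp add: field_simps)
      ultimately show "\<exists>y. ((\<lambda>t. t\<^sup>2 / 2 - ln (cosh t)) has_real_derivative y) (at t) \<and> 0 \<le> y" by blast
    qed (use that in simp)
    then have "ln (cosh x) \<le> x\<^sup>2 / 2" by simp
    then show ?thesis using cosh_real_pos[of x] by (metis exp_le_cancel_iff exp_ln)
  qed
  show ?thesis using pos[of x] pos[of "- x"] by (cases "0 \<le> x") auto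
qed

text \<open>Exponential moments at parameter \<open>t / 2\<close>, which minimises the exponent for
  squared coefficients summing to 2.\<close>

lemma sign_tail:
  fixes c :: "'a \<Rightarrow> real"
  assumes D: "finite D" and c: "(\<Sum>e\<in>D. (c e)\<^sup>2) \<le> 2" and t: "0 < t"
  shows "real (card {w \<in> D \<rightarrow>\<^sub>E {-1, 1 :: real}. t < (\<Sum>e\<in>D. w e * c e)}) \<le> card (D \<rightarrow>\<^sub>E {-1, 1 :: real}) * exp (- t\<^sup>2 / 4)"
proof -
  let ?W = "D \<rightarrow>\<^sub>E {-1, 1 :: real}" and ?l = "t / 2"
  have fin: "finite ?W" using D by (intro finite_PiE) auto
  have "real (card {w \<in> ?W. t < (\<Sum>e\<in>D. w e * c e)}) * exp (?l * t) = (\<Sum>w\<in>{w \<in> ?W. t < (\<Sum>e\<in>D. w e * c e)}. exp (?l * t))"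
    by simp
  also have "\<dots> \<le> (\<Sum>w\<in>{w \<in> ?W. t < (\<Sum>e\<in>D. w e * c e)}. exp (?l * (\<Sum>e\<in>D. w e * c e)))"
    using t by (intro sum_mono) auto
  also have "\<dots> \<le> (\<Sum>w\<in>?W. exp (?l * (\<Sum>e\<in>D. w e * c e)))"
    using fin by (intro sum_mono2) auto
  also have "\<dots> = (\<Sum>w\<in>?W. \<Prod>e\<in>D. exp (?l * (w e * c e)))"
    using D by (simp only: sum_distrib_left exp_sum)
  also have "\<dots> = (\<Prod>e\<in>D. \<Sum>y\<in>{-1, 1}. exp (?l * (y * c e)))"
    using D by (intro prod_sum_PiE[symmetric]) auto
  also have "\<dots> = (\<Prod>e\<in>D. 2 * cosh (?l * c e))"
    by (intro prod.cong) (auto simp: cosh_def)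
  also have "\<dots> \<le> (\<Prod>e\<in>D. 2 * exp ((?l * c e)\<^sup>2 / 2))"
    using cosh_real_nonneg by (intro prod_mono conjI mult_nonneg_nonneg mult_left_mono cosh_le_exp) auto
  also have "\<dots> = card ?W * exp (?l\<^sup>2 / 2 * (\<Sum>e\<in>D. (c e)\<^sup>2))"
  proof -
    have "(\<Prod>e\<in>D. exp ((?l * c e)\<^sup>2 / 2)) = exp (?l\<^sup>2 / 2 * (\<Sum>e\<in>D. (c e)\<^sup>2))"
      using D by (simp add: exp_sum sum_distrib_left sum_divide_distrib power_mult_distrib power_divide mult_ac)
    moreover have "real (card ?W) = 2 ^ card D" using D by (simp add: card_PiE numeral_2_eq_2)
    ultimately show ?thesis using D by (simp only: prod.distrib prod_constant)
  qed
  also have "\<dots> \<le> card ?W * exp (?l\<^sup>2 / 2 * 2)"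
    using c by (intro mult_left_mono) (auto intro!: mult_left_mono)
  finally have "real (card {w \<in> ?W. t < (\<Sum>e\<in>D. w e * c e)}) * exp (?l * t) \<le> card ?W * exp (?l\<^sup>2)" by simp
  then have "real (card {w \<in> ?W. t < (\<Sum>e\<in>D. w e * c e)}) \<le> card ?W * exp (?l\<^sup>2) / exp (?l * t)"
    by (simp add: pos_le_divide_eq)
  also have "\<dots> = card ?W * exp (?l\<^sup>2 - ?l * t)" by (simp add: exp_diff)
  also have "?l\<^sup>2 - ?l * t = - t\<^sup>2 / 4" by (simp add: power2_eq_square field_simps)
  finally show ?thesis .
qed

text \<open>An integer point \<open>k\<close> stands for the vector
  \<open>k i / (4 * sqrt s)\<close> of the unit ball.\<close>

definition net :: "nat set \<Rightarrow> nat \<Rightarrow> (nat \<Rightarrow> int) set" where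
  "net T s = {k \<in> T \<rightarrow>\<^sub>E {- int (16 * s)..int (16 * s)}. (\<Sum>i\<in>T. (k i)\<^sup>2) \<le> int (16 * s)}"

lemma geometric_int: "(\<Sum>v\<in>{- int N..int N}. (1 / 2) ^ nat \<bar>v\<bar>) \<le> (3 :: real)"
proof -
  have "(\<Sum>v\<in>{- int N..int N}. (1 / 2) ^ nat \<bar>v\<bar>) = (3 :: real) - 2 * (1 / 2) ^ N"
  proof (induction N)
    case (Suc N)
    have "{- int (Suc N)..int (Suc N)} = insert (- int (Suc N)) (insert (int (Suc N)) {- int N..int N})" by auto
    then show ?case using Suc by (simp del: of_nat_Suc)
  qed simp
  then show ?thesis by simp
qed

lemma finite_net [simp]: "finite T \<Longrightarrow> finite (net T s)"
  unfolding net_def by (rule finite_subset[of _ "T \<rightarrow>\<^sub>E {- int (16 * s)..int (16 * s)}"]) (auto intro!: finite_PiE)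

text \<open>The weight \<open>exp (16 * s)\<close> times the product of
  \<open>exp (- k\<^sup>2)\<close> over the coordinates dominates the indicator of the net. Each
  coordinate sum is at most 3, by comparison with a geometric series, and 3 is at most
  \<open>exp 2\<close>.\<close>

lemma card_net:
  assumes "finite T" "card T \<le> s"
  shows "real (card (net T s)) \<le> exp (18 * s)"
proof -
  let ?P = "T \<rightarrow>\<^sub>E {- int (16 * s)..int (16 * s)}"
  have fin: "finite ?P" using assms by (intro finite_PiE) auto
  have pt: "exp (- ((real_of_int v)\<^sup>2)) \<le> (1 / 2) ^ nat \<bar>v\<bar>" for v :: int
  proof -
    have "(real (nat \<bar>v\<bar>)) \<le> (real_of_int v)\<^sup>2"
    proof (cases "v = 0")
      case False
      then have "\<bar>v\<bar> * 1 \<le> \<bar>v\<bar> * \<bar>v\<bar>" by (intro mult_left_mono) auto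
      then have "real_of_int \<bar>v\<bar> \<le> real_of_int (v\<^sup>2)" by (simp only: of_int_le_iff) (simp add: power2_eq_square)
      then show ?thesis by simp
    qed simp
    then have "exp (- ((real_of_int v)\<^sup>2)) \<le> exp (- real (nat \<bar>v\<bar>))" by simp
    also have "\<dots> = exp (-1) ^ nat \<bar>v\<bar>" by (simp flip: exp_of_nat_mult)
    also have "\<dots> \<le> (1 / 2) ^ nat \<bar>v\<bar>"
      using exp_ge_add_one_self[of 1] by (intro power_mono) (auto simp: exp_minus field_simps)
    finally show ?thesis .
  qed
  have "real (card (net T s)) = (\<Sum>k\<in>net T s. 1)" by simp
  also have "\<dots> \<le> (\<Sum>k\<in>net T s. exp (16 * s - (\<Sum>i\<in>T. (real_of_int (k i))\<^sup>2)))"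
  proof (rule sum_mono)
    fix k assume "k \<in> net T s"
    then have "real_of_int (\<Sum>i\<in>T. (k i)\<^sup>2) \<le> real_of_int (int (16 * s))" unfolding net_def by (simp only: of_int_le_iff) simp
    then show "(1 :: real) \<le> exp (16 * s - (\<Sum>i\<in>T. (real_of_int (k i))\<^sup>2))" by simp
  qed
  also have "\<dots> \<le> (\<Sum>k\<in>?P. exp (16 * s - (\<Sum>i\<in>T. (real_of_int (k i))\<^sup>2)))"
    using fin by (intro sum_mono2) (auto simp: net_def)
  also have "\<dots> = exp (16 * s) * (\<Sum>k\<in>?P. \<Prod>i\<in>T. exp (- ((real_of_int (k i))\<^sup>2)))"
    unfolding sum_distrib_left
  proof (rule sum.cong[OF refl])
    fix k :: "nat \<Rightarrow> int"
    have "(\<Prod>i\<in>T. exp (- ((real_of_int (k i))\<^sup>2))) = exp (- (\<Sum>i\<in>T. (real_of_int (k i))\<^sup>2))"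
      using assms(1) by (simp only: exp_sum sum_negf[symmetric])
    then show "exp (real (16 * s) - (\<Sum>i\<in>T. (real_of_int (k i))\<^sup>2)) = exp (real (16 * s)) * (\<Prod>i\<in>T. exp (- ((real_of_int (k i))\<^sup>2)))"
      by (simp only: mult_exp_exp) simp
  qed
  also have "(\<Sum>k\<in>?P. \<Prod>i\<in>T. exp (- ((real_of_int (k i))\<^sup>2))) = (\<Prod>i\<in>T. \<Sum>v\<in>{- int (16 * s)..int (16 * s)}. exp (- ((real_of_int v)\<^sup>2)))"
    using assms(1) by (intro prod_sum_PiE[symmetric]) auto
  also have "\<dots> \<le> (\<Prod>i\<in>T. 3)"
    by (intro prod_mono conjI sum_nonneg order_trans[OF sum_mono[OF pt] geometric_int]) auto
  also have "\<dots> = 3 ^ card T" by simp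
  also have "\<dots> \<le> 3 ^ s" using assms by (intro power_increasing) auto
  also have "\<dots> \<le> exp 2 ^ s" using exp_ge_add_one_self[of 2] by (intro power_mono) auto
  also have "\<dots> = exp (2 * s)" by (simp flip: exp_of_nat_mult add: mult.commute)
  finally have "real (card (net T s)) \<le> exp (16 * s) * exp (2 * s)" by simp
  then show ?thesis by (simp flip: exp_add)
qed

text \<open>Rounding is towards 0, so that the rounded vector does not leave the unit ball.\<close>

definition rnd :: "nat \<Rightarrow> real \<Rightarrow> int" where
  "rnd s y = (if 0 \<le> y then \<lfloor>4 * sqrt s * y\<rfloor> else - \<lfloor>4 * sqrt s * (- y)\<rfloor>)"

lemma rnd:
  assumes "0 < s"
  shows "\<bar>real_of_int (rnd s y)\<bar> \<le> 4 * sqrt s * \<bar>y\<bar>" "\<bar>y - real_of_int (rnd s y) / (4 * sqrt s)\<bar> \<le> 1 / (4 * sqrt s)"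
proof -
  let ?q = "4 * sqrt s"
  have q: "0 < ?q" using assms by simp
  have pos: "0 \<le> real_of_int \<lfloor>?q * y\<rfloor> \<and> real_of_int \<lfloor>?q * y\<rfloor> \<le> ?q * y \<and> ?q * y - real_of_int \<lfloor>?q * y\<rfloor> \<le> 1" if "0 \<le> y" for y
  proof -
    have "0 \<le> ?q * y" using that q by simp
    then have "0 \<le> \<lfloor>?q * y\<rfloor>" by (simp only: zero_le_floor)
    then show ?thesis using floor_correct[of "?q * y"] by linarith
  qed
  have "\<bar>real_of_int (rnd s y)\<bar> \<le> ?q * \<bar>y\<bar> \<and> \<bar>?q * y - real_of_int (rnd s y)\<bar> \<le> 1"
  proof (cases "0 \<le> y")
    case True
    then show ?thesis proof -
      have r: "rnd s y = \<lfloor>?q * y\<rfloor>" "\<bar>y\<bar> = y" using True by (auto simp: rnd_def)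
      show ?thesis unfolding r using pos[OF True] by (intro conjI; linarith)
    qed
  next
    case False
    then show ?thesis proof -
      have r: "rnd s y = - \<lfloor>?q * - y\<rfloor>" "\<bar>y\<bar> = - y" using False by (auto simp: rnd_def)
      show ?thesis unfolding r using pos[of "- y"] False by (intro conjI; (simp only: of_int_minus; linarith))
    qed
  qed
  then show "\<bar>real_of_int (rnd s y)\<bar> \<le> ?q * \<bar>y\<bar>" and "\<bar>y - real_of_int (rnd s y) / ?q\<bar> \<le> 1 / ?q"
  proof -
    assume a: "\<bar>real_of_int (rnd s y)\<bar> \<le> ?q * \<bar>y\<bar> \<and> \<bar>?q * y - real_of_int (rnd s y)\<bar> \<le> 1"
    then show "\<bar>real_of_int (rnd s y)\<bar> \<le> ?q * \<bar>y\<bar>" by simp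
    have "y - real_of_int (rnd s y) / ?q = (?q * y - real_of_int (rnd s y)) / ?q" using q by (simp add: diff_divide_distrib)
    then have "\<bar>y - real_of_int (rnd s y) / ?q\<bar> = \<bar>?q * y - real_of_int (rnd s y)\<bar> / ?q" using q by (simp add: abs_divide)
    also have "\<dots> \<le> 1 / ?q" using a q by (intro divide_right_mono) auto
    finally show "\<bar>y - real_of_int (rnd s y) / ?q\<bar> \<le> 1 / ?q" .
  qed
qed

text \<open>Each of at most \<open>s\<close> coordinates is off by at most
  \<open>1 / (4 * sqrt s)\<close>; hence four times the error is again a vector of the unit
  ball.\<close>

lemma net_approx:
  assumes "finite T" "card T \<le> s" "0 < s" "(\<Sum>i\<in>T. (y i)\<^sup>2) \<le> 1"
  shows "\<exists>k\<in>net T s. (\<Sum>i\<in>T. (4 * (y i - k i / (4 * sqrt s)))\<^sup>2) \<le> 1 \<and> (\<Sum>i\<in>T. (k i / (4 * sqrt s))\<^sup>2) \<le> 1"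
proof -
  define k where "k = (\<lambda>i\<in>T. rnd s (y i))"
  let ?q = "4 * sqrt s"
  have q: "0 < ?q" "?q\<^sup>2 = 16 * s" using assms(3) by (auto simp: power_mult_distrib)
  have sq: "(real_of_int (k i))\<^sup>2 \<le> 16 * s * (y i)\<^sup>2" if "i \<in> T" for i
  proof -
    have "\<bar>real_of_int (k i)\<bar>\<^sup>2 \<le> (?q * \<bar>y i\<bar>)\<^sup>2" using rnd(1)[OF assms(3), of "y i"] that by (intro power_mono) (auto simp: k_def)
    then show ?thesis using q(2) by (simp add: power_mult_distrib)
  qed
  have "(\<Sum>i\<in>T. (real_of_int (k i))\<^sup>2) \<le> (\<Sum>i\<in>T. real (16 * s) * (y i)\<^sup>2)" by (rule sum_mono) (use sq in simp)
  also have "\<dots> \<le> real (16 * s) * 1" unfolding sum_distrib_left[symmetric] using assms(4) by (intro mult_left_mono) auto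
  finally have tot: "(\<Sum>i\<in>T. (real_of_int (k i))\<^sup>2) \<le> 16 * s" by simp
  then have "real_of_int (\<Sum>i\<in>T. (k i)\<^sup>2) \<le> real_of_int (int (16 * s))" by simp
  then have toti: "(\<Sum>i\<in>T. (k i)\<^sup>2) \<le> int (16 * s)" by (simp only: of_int_le_iff)
  have "\<bar>k i\<bar> \<le> int (16 * s)" if "i \<in> T" for i
  proof -
    have "\<bar>k i\<bar> \<le> (k i)\<^sup>2"
    proof (cases "k i = 0")
      case False
      then have "\<bar>k i\<bar> * 1 \<le> \<bar>k i\<bar> * \<bar>k i\<bar>" by (intro mult_left_mono) auto
      then show ?thesis by (simp add: power2_eq_square)
    qed simp
    also have "\<dots> \<le> (\<Sum>i\<in>T. (k i)\<^sup>2)" using assms(1) that by (intro member_le_sum) auto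
    finally show ?thesis using toti by simp
  qed
  then have "k \<in> T \<rightarrow>\<^sub>E {- int (16 * s)..int (16 * s)}" by (auto simp: k_def abs_le_iff PiE_iff minus_le_iff)
  then have net: "k \<in> net T s" using toti by (simp add: net_def)
  have "(\<Sum>i\<in>T. (4 * (y i - k i / ?q))\<^sup>2) \<le> (\<Sum>i\<in>T. 1 / s)"
  proof (rule sum_mono)
    fix i assume "i \<in> T"
    then have "\<bar>y i - k i / ?q\<bar> \<le> 1 / ?q" using rnd(2)[OF assms(3), of "y i"] by (simp add: k_def)
    then have "\<bar>y i - k i / ?q\<bar>\<^sup>2 \<le> (1 / ?q)\<^sup>2" by (intro power_mono) auto
    then have "16 * (y i - k i / ?q)\<^sup>2 \<le> 16 * (1 / (16 * s))" by (simp only: power2_abs power_divide q(2)) simp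
    then show "(4 * (y i - k i / ?q))\<^sup>2 \<le> 1 / s" by (simp only: power_mult_distrib) simp
  qed
  also have "\<dots> \<le> 1" using assms by simp
  finally have 1: "(\<Sum>i\<in>T. (4 * (y i - k i / ?q))\<^sup>2) \<le> 1" .
  have "(\<Sum>i\<in>T. (k i / ?q)\<^sup>2) = (\<Sum>i\<in>T. (real_of_int (k i))\<^sup>2) / (16 * s)"
    by (simp add: power_divide q(2) sum_divide_distrib)
  then have 2: "(\<Sum>i\<in>T. (k i / ?q)\<^sup>2) \<le> 1" using tot assms(3) by (simp add: divide_le_eq)
  show ?thesis using net 1 2 by blast
qed

abbreviation bil :: "nat set \<Rightarrow> nat set \<Rightarrow> (nat \<Rightarrow> nat \<Rightarrow> real) \<Rightarrow> (nat \<Rightarrow> real) \<Rightarrow> (nat \<Rightarrow> real) \<Rightarrow> real" where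
  "bil T T' S x y \<equiv> \<Sum>i\<in>T. \<Sum>j\<in>T'. x i * S i j * y j"

text \<open>Moving both vectors to the net costs two errors of a quarter of the supremum, so a bound
  \<beta> improves to \<open>v + \<beta> / 2\<close>. Iteration from the trivial bound converges to
  \<open>2 * v\<close>.\<close>

lemma net_bound:
  assumes fin: "finite T" "card T \<le> s" "finite T'" "card T' \<le> s" and s: "0 < s"
    and S1: "\<And>i j. \<bar>S i j\<bar> \<le> 1"
    and v: "\<And>k k'. k \<in> net T s \<Longrightarrow> k' \<in> net T' s \<Longrightarrow> bil T T' S (\<lambda>i. k i / (4 * sqrt s)) (\<lambda>j. k' j / (4 * sqrt s)) \<le> v"
  shows "minor_le S T T' (2 * v)"
proof -
  define B where "B = bil T T' S"
  have Badd: "B (\<lambda>i. x i + x' i) y = B x y + B x' y" "B x (\<lambda>i. y i + y' i) = B x y + B x y'" for x x' y y'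
    by (simp_all add: B_def sum.distrib algebra_simps)
  have Bmul: "B (\<lambda>i. c * x i) y = c * B x y" "B x (\<lambda>i. c * y i) = c * B x y" for c x y
    by (simp_all add: B_def sum_distrib_left mult_ac)
  define ok where "ok T x \<longleftrightarrow> (\<Sum>i\<in>T. (x i)\<^sup>2) \<le> 1" for T and x :: "nat \<Rightarrow> real"
  have start: "B x y \<le> real (card T) * real (card T')" if "ok T x" "ok T' y" for x y
  proof -
    have le1: "\<bar>x i\<bar> \<le> 1" if "finite T" "ok T x" "i \<in> T" for T i and x :: "nat \<Rightarrow> real"
    proof -
      have "(x i)\<^sup>2 \<le> (\<Sum>i\<in>T. (x i)\<^sup>2)" using that by (intro member_le_sum) auto
      then have "(x i)\<^sup>2 \<le> 1" using that(2) by (simp add: ok_def)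
      then show ?thesis by (simp add: abs_square_le_1)
    qed
    have "B x y \<le> (\<Sum>i\<in>T. \<Sum>j\<in>T'. 1)" unfolding B_def
    proof (intro sum_mono)
      fix i j assume "i \<in> T" "j \<in> T'"
      then have "\<bar>x i * S i j * y j\<bar> \<le> 1" unfolding abs_mult
        using le1[OF fin(1) that(1)] le1[OF fin(3) that(2)] S1 by (intro mult_le_one mult_nonneg_nonneg) auto
      then show "x i * S i j * y j \<le> 1" by linarith
    qed
    then show ?thesis by simp
  qed
  have improve: "B x y \<le> v + \<beta> / 2" if \<beta>: "\<And>x y. ok T x \<Longrightarrow> ok T' y \<Longrightarrow> B x y \<le> \<beta>" and xy: "ok T x" "ok T' y" for \<beta> x y
  proof -
    let ?q = "4 * sqrt s"
    obtain k where k: "k \<in> net T s" "ok T (\<lambda>i. 4 * (x i - k i / ?q))" "ok T (\<lambda>i. k i / ?q)"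
      using net_approx[OF fin(1,2) s, of x] xy(1) unfolding ok_def by blast
    obtain k' where k': "k' \<in> net T' s" "ok T' (\<lambda>i. 4 * (y i - k' i / ?q))" "ok T' (\<lambda>i. k' i / ?q)"
      using net_approx[OF fin(3,4) s, of y] xy(2) unfolding ok_def by blast
    have "B x y = B (\<lambda>i. k i / ?q) (\<lambda>i. k' i / ?q) + 1 / 4 * B (\<lambda>i. 4 * (x i - k i / ?q)) y + 1 / 4 * B (\<lambda>i. k i / ?q) (\<lambda>i. 4 * (y i - k' i / ?q))"
    proof -
      have "B x y = B (\<lambda>i. k i / ?q + (x i - k i / ?q)) y" by simp
      also have "\<dots> = B (\<lambda>i. k i / ?q) y + B (\<lambda>i. x i - k i / ?q) y" by (rule Badd(1))
      also have "B (\<lambda>i. k i / ?q) y = B (\<lambda>i. k i / ?q) (\<lambda>i. k' i / ?q + (y i - k' i / ?q))" by simp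
      also have "\<dots> = B (\<lambda>i. k i / ?q) (\<lambda>i. k' i / ?q) + B (\<lambda>i. k i / ?q) (\<lambda>i. y i - k' i / ?q)" by (rule Badd(2))
      finally show ?thesis by (simp only: Bmul)
    qed
    also have "\<dots> \<le> v + 1 / 4 * \<beta> + 1 / 4 * \<beta>"
      using v[OF k(1) k'(1)] \<beta>[OF k(2) xy(2)] \<beta>[OF k(3) k'(2)] unfolding B_def by simp
    finally show ?thesis by simp
  qed
  define c where "c = real (card T) * real (card T')"
  have iter: "\<forall>x y. ok T x \<longrightarrow> ok T' y \<longrightarrow> B x y \<le> 2 * v + (1 / 2) ^ m * (c - 2 * v)" for m
  proof (induction m)
    case 0 then show ?case using start by (simp add: c_def)
  next
    case (Suc m)
    have "B x y \<le> v + (2 * v + (1 / 2) ^ m * (c - 2 * v)) / 2" if "ok T x" "ok T' y" for x y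
      using Suc that by (intro improve) auto
    then show ?case by (simp add: field_simps)
  qed
  have unit: "B x y \<le> 2 * v" if "ok T x" "ok T' y" for x y
  proof (rule LIMSEQ_le_const)
    have "(\<lambda>m. (1 / 2 :: real) ^ m) \<longlonglongrightarrow> 0" by (simp add: LIMSEQ_realpow_zero)
    then have "(\<lambda>m. 2 * v + (1 / 2) ^ m * (c - 2 * v)) \<longlonglongrightarrow> 2 * v + 0 * (c - 2 * v)" by (intro tendsto_add tendsto_mult tendsto_const)
    then show "(\<lambda>m. 2 * v + (1 / 2) ^ m * (c - 2 * v)) \<longlonglongrightarrow> 2 * v" by simp
    show "\<exists>N. \<forall>m\<ge>N. B x y \<le> 2 * v + (1 / 2) ^ m * (c - 2 * v)" using iter that by blast
  qed
  have hom: "B x y \<le> 2 * v * sqrt (\<Sum>i\<in>T. (x i)\<^sup>2) * sqrt (\<Sum>j\<in>T'. (y j)\<^sup>2)" for x y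
  proof -
    define a where "a = sqrt (\<Sum>i\<in>T. (x i)\<^sup>2)"
    define b where "b = sqrt (\<Sum>j\<in>T'. (y j)\<^sup>2)"
    have sq: "a\<^sup>2 = (\<Sum>i\<in>T. (x i)\<^sup>2)" "b\<^sup>2 = (\<Sum>j\<in>T'. (y j)\<^sup>2)" and ab: "0 \<le> a" "0 \<le> b"
      by (auto simp: a_def b_def sum_nonneg)
    show ?thesis
    proof (cases "a = 0 \<or> b = 0")
      case True
      then have "(\<forall>i\<in>T. x i = 0) \<or> (\<forall>j\<in>T'. y j = 0)"
        using sq fin by (auto simp: sum_nonneg_eq_0_iff)
      then have "B x y = 0" unfolding B_def by (auto intro!: sum.neutral)
      then show ?thesis using True by (auto simp: a_def[symmetric] b_def[symmetric])
    next
      case False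
      have "ok T (\<lambda>i. 1 / a * x i)" "ok T' (\<lambda>i. 1 / b * y i)"
        using False sq by (auto simp: ok_def power_mult_distrib power_divide sum_divide_distrib[symmetric])
      then have "1 / a * (1 / b * B x y) \<le> 2 * v" using unit Bmul by metis
      then show ?thesis using False ab unfolding a_def[symmetric] b_def[symmetric] by (simp add: field_simps)
    qed
  qed
  show ?thesis unfolding minor_le_def
  proof (intro allI)
    fix x y :: "nat \<Rightarrow> real"
    have "B (\<lambda>i. - 1 * x i) y = - B x y" unfolding Bmul by simp
    then show "\<bar>bil T T' S x y\<bar> \<le> 2 * v * sqrt (\<Sum>i\<in>T. (x i)\<^sup>2) * sqrt (\<Sum>j\<in>T'. (y j)\<^sup>2)"
      using hom[of x y] hom[of "\<lambda>i. - 1 * x i" y] by (simp add: B_def abs_le_iff)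
  qed
qed

lemma sum_symmetric_pairs:
  fixes f :: "nat \<Rightarrow> nat \<Rightarrow> real"
  shows "(\<Sum>i<n. \<Sum>j<n. f i j) = (\<Sum>(i, j)\<in>{(i, j). i \<le> j \<and> j < n}. if i = j then f i j else f i j + f j i)"
proof -
  let ?D = "{(i, j). i \<le> j \<and> j < n}" and ?L = "{(i, j). i < j \<and> j < n}" and ?G = "{(i, j). j < i \<and> i < n}"
  have fin: "finite ?D" "finite ?L" "finite ?G"
    by (rule finite_subset[of _ "{..<n} \<times> {..<n}"], auto)+
  have "(\<Sum>i<n. \<Sum>j<n. f i j) = (\<Sum>(i, j)\<in>{..<n} \<times> {..<n}. f i j)" by (rule sum.cartesian_product)
  also have "{..<n} \<times> {..<n} = ?D \<union> ?G" by auto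
  also have "(\<Sum>(i, j)\<in>?D \<union> ?G. f i j) = (\<Sum>(i, j)\<in>?D. f i j) + (\<Sum>(i, j)\<in>?G. f i j)"
    using fin by (intro sum.union_disjoint) auto
  also have "(\<Sum>(i, j)\<in>?G. f i j) = (\<Sum>(i, j)\<in>?L. f j i)"
    by (rule sum.reindex_bij_witness[of _ prod.swap prod.swap]) auto
  also have "\<dots> = (\<Sum>(i, j)\<in>?D. if i = j then 0 else f j i)"
    using fin by (intro sum.mono_neutral_cong_left) (auto split: if_splits)
  also have "(\<Sum>(i, j)\<in>?D. f i j) + (\<Sum>(i, j)\<in>?D. if i = j then 0 else f j i) = (\<Sum>(i, j)\<in>?D. if i = j then f i j else f i j + f j i)"
    by (subst sum.distrib[symmetric], rule sum.cong) auto
  finally show ?thesis .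
qed

text \<open>Only the upper triangle is random. Entries out of range are 1, so that every entry is a
  sign.\<close>

definition sym_of :: "nat \<Rightarrow> (nat \<times> nat \<Rightarrow> real) \<Rightarrow> nat \<Rightarrow> nat \<Rightarrow> real" where
  "sym_of n w i j = (if i < n \<and> j < n then w (min i j, max i j) else 1)"

text \<open>A union bound over two nets of at most \<open>exp (18 * s)\<close> points. Mirror
  entries share one random sign with coefficient \<open>a i * b j + a j * b i\<close>; the squares
  of the coefficients sum to at most 2, as \<open>sign_tail\<close> requires.\<close>

lemma bad_count:
  assumes T: "T \<subseteq> {..<n}" "card T \<le> s" "T' \<subseteq> {..<n}" "card T' \<le> s" and s: "0 < s" and t: "0 < t"
  defines "W \<equiv> {(i, j). i \<le> j \<and> j < n} \<rightarrow>\<^sub>E {-1, 1 :: real}"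
  shows "real (card {w \<in> W. \<not> minor_le (sym_of n w) T T' (2 * t)}) \<le> card W * exp (36 * s - t\<^sup>2 / 4)"
proof -
  let ?D = "{(i, j). i \<le> j \<and> j < n}"
  have finD: "finite ?D" by (rule finite_subset[of _ "{..<n} \<times> {..<n}"]) auto
  have finW: "finite W" unfolding W_def using finD by (intro finite_PiE) auto
  have fin: "finite T" "finite T'" using T finite_subset by blast+
  let ?q = "4 * sqrt s"
  define bad where "bad k k' = {w \<in> W. t < bil T T' (sym_of n w) (\<lambda>i. k i / ?q) (\<lambda>j. k' j / ?q)}" for k k' :: "nat \<Rightarrow> int"
  have sub: "{w \<in> W. \<not> minor_le (sym_of n w) T T' (2 * t)} \<subseteq> (\<Union>(k, k')\<in>net T s \<times> net T' s. bad k k')"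
  proof clarify
    fix w assume w: "w \<in> W" "\<not> minor_le (sym_of n w) T T' (2 * t)"
    have "\<forall>e. e \<in> ?D \<longrightarrow> w e = -1 \<or> w e = 1" using PiE_mem[OF w(1)[unfolded W_def]] by auto
    have "\<bar>sym_of n w i j\<bar> \<le> 1" for i j
    proof (cases "i < n \<and> j < n")
      case True
      then have "(min i j, max i j) \<in> ?D" by auto
      then have "w (min i j, max i j) = -1 \<or> w (min i j, max i j) = 1" using \<open>\<forall>e. e \<in> ?D \<longrightarrow> w e = -1 \<or> w e = 1\<close> by blast
      then show ?thesis using True by (auto simp only: sym_of_def) simp_all
    qed (auto simp: sym_of_def)
    then show "w \<in> (\<Union>(k, k')\<in>net T s \<times> net T' s. bad k k')"
      using net_bound[OF fin(1) T(2) fin(2) T(4) s, of "sym_of n w" t] w unfolding bad_def by (auto simp: not_less) (meson not_less)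
  qed
  have each: "real (card (bad k k')) \<le> card W * exp (- t\<^sup>2 / 4)" if k: "k \<in> net T s" "k' \<in> net T' s" for k k'
  proof -
    define a where "a i = (if i \<in> T then k i / ?q else 0)" for i
    define b where "b i = (if i \<in> T' then k' i / ?q else 0)" for i
    have nrm: "(\<Sum>i<n. (if i \<in> T then k i / ?q else 0)\<^sup>2) \<le> 1" if "k \<in> net T s" "T \<subseteq> {..<n}" for k :: "nat \<Rightarrow> int" and T
    proof -
      have "(\<Sum>i<n. (if i \<in> T then k i / ?q else 0)\<^sup>2) = (\<Sum>i<n. if i \<in> T then (k i / ?q)\<^sup>2 else 0)" by (intro sum.cong) auto
      also have "\<dots> = (\<Sum>i\<in>T. (k i / ?q)\<^sup>2)" using that(2) by (simp add: sum.inter_restrict[symmetric] Int_absorb1)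
      also have "\<dots> = real_of_int (\<Sum>i\<in>T. (k i)\<^sup>2) / (16 * s)" by (simp add: power_divide power_mult_distrib sum_divide_distrib)
      also have "\<dots> \<le> real_of_int (int (16 * s)) / (16 * s)"
        using that(1) by (intro divide_right_mono) (auto simp: net_def simp del: of_int_sum of_int_of_nat_eq)
      finally show ?thesis using s by simp
    qed
    define c where "c e = (case e of (i, j) \<Rightarrow> if i = j then a i * b j else a i * b j + a j * b i)" for e
    have "(\<Sum>e\<in>?D. (c e)\<^sup>2) \<le> (\<Sum>(i, j)\<in>?D. if i = j then 2 * ((a i)\<^sup>2 * (b j)\<^sup>2) else 2 * ((a i)\<^sup>2 * (b j)\<^sup>2) + 2 * ((a j)\<^sup>2 * (b i)\<^sup>2))"
    proof (rule sum_mono, clarify)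
      fix i j
      have "2 * ((a i * b j) * (a j * b i)) \<le> (a i * b j)\<^sup>2 + (a j * b i)\<^sup>2" using sum_squares_bound[of "a i * b j" "a j * b i"] by simp
      then show "(c (i, j))\<^sup>2 \<le> (if i = j then 2 * ((a i)\<^sup>2 * (b j)\<^sup>2) else 2 * ((a i)\<^sup>2 * (b j)\<^sup>2) + 2 * ((a j)\<^sup>2 * (b i)\<^sup>2))"
        by (auto simp: c_def power2_sum power_mult_distrib)
    qed
    also have "\<dots> = (\<Sum>i<n. \<Sum>j<n. 2 * ((a i)\<^sup>2 * (b j)\<^sup>2))" by (rule sum_symmetric_pairs[symmetric])
    also have "\<dots> = 2 * ((\<Sum>i<n. (a i)\<^sup>2) * (\<Sum>j<n. (b j)\<^sup>2))" unfolding sum_product by (simp only: sum_distrib_left)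
    also have "\<dots> \<le> 2 * (1 * 1)"
      using nrm[OF k(1) T(1)] nrm[OF k(2) T(3)] unfolding a_def[symmetric] b_def[symmetric]
      by (intro mult_left_mono mult_mono) (auto simp: sum_nonneg)
    finally have c2: "(\<Sum>e\<in>?D. (c e)\<^sup>2) \<le> 2" by simp
    have eq: "bil T T' (sym_of n w) (\<lambda>i. k i / ?q) (\<lambda>j. k' j / ?q) = (\<Sum>e\<in>?D. w e * c e)" for w
    proof -
      have "bil T T' (sym_of n w) (\<lambda>i. k i / ?q) (\<lambda>j. k' j / ?q) = (\<Sum>i\<in>T. \<Sum>j<n. a i * sym_of n w i j * b j)"
        using T(3) by (intro sum.cong refl sum.mono_neutral_cong_left) (auto simp: a_def b_def)
      also have "\<dots> = (\<Sum>i<n. \<Sum>j<n. a i * sym_of n w i j * b j)"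
        using T(1) by (intro sum.mono_neutral_left) (auto simp: a_def)
      also have "\<dots> = (\<Sum>e\<in>?D. w e * c e)"
        unfolding sum_symmetric_pairs by (intro sum.cong refl) (auto simp: c_def sym_of_def min_def max_def algebra_simps)
      finally show ?thesis .
    qed
    show ?thesis unfolding bad_def eq W_def by (rule sign_tail[OF finD c2 t])
  qed
  have "real (card {w \<in> W. \<not> minor_le (sym_of n w) T T' (2 * t)}) \<le> real (card (\<Union>(k, k')\<in>net T s \<times> net T' s. bad k k'))"
    using sub finW by (intro of_nat_mono card_mono) (auto simp: bad_def intro!: finite_subset[OF _ finW])
  also have "\<dots> \<le> real (\<Sum>(k, k')\<in>net T s \<times> net T' s. card (bad k k'))"
    using card_UN_le[of "net T s \<times> net T' s" "\<lambda>(k, k'). bad k k'"] fin by (intro of_nat_mono) (auto simp: case_prod_unfold)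
  also have "\<dots> = (\<Sum>(k, k')\<in>net T s \<times> net T' s. real (card (bad k k')))"
    by (simp add: case_prod_unfold)
  also have "\<dots> \<le> (\<Sum>(k, k')\<in>net T s \<times> net T' s. card W * exp (- t\<^sup>2 / 4))"
    by (rule sum_mono) (use each in \<open>simp only: split_paired_all mem_Times_iff fst_conv snd_conv case_prod_conv\<close>)
  also have "\<dots> = real (card (net T s)) * real (card (net T' s)) * (card W * exp (- t\<^sup>2 / 4))"
    by (simp add: card_cartesian_product)
  also have "\<dots> \<le> exp (18 * s) * exp (18 * s) * (card W * exp (- t\<^sup>2 / 4))"
    using card_net[OF fin(1) T(2)] card_net[OF fin(2) T(4)] by (intro mult_right_mono mult_mono) auto
  also have "\<dots> = card W * exp (36 * s - t\<^sup>2 / 4)"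
  proof -
    have "exp (18 * s) * exp (18 * s) * exp (- t\<^sup>2 / 4) = exp (36 * s - t\<^sup>2 / 4)" for s by (simp flip: exp_add)
    then show ?thesis by (simp add: mult_ac)
  qed
  finally show ?thesis by simp
qed

text \<open>Thresholds of 13 times a square root give the tail exponent -169/4, which beats the 36
  of the nets. For small minors the additional \<open>ln n\<close> pays for the
  \<open>n ^ (2 * d)\<close> choices of index maps. Each of the two failures has probability at most
  \<open>exp (-2)\<close>, below 1/3.\<close>

theorem sign_matrix_exists:
  assumes n: "0 < n" and d: "0 < d"
  shows "\<exists>S. (\<forall>i j. S i j = S j i) \<and> (\<forall>i j. S i j = 1 \<or> S i j = (-1 :: real)) \<and>
    minor_le S {..<n} {..<n} (26 * sqrt n) \<and>
    (\<forall>T T'. T \<subseteq> {..<n} \<longrightarrow> T' \<subseteq> {..<n} \<longrightarrow> card T \<le> d \<longrightarrow> card T' \<le> d \<longrightarrow> minor_le S T T' (26 * sqrt (d * (1 + ln n))))"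
proof -
  let ?D = "{(i, j). i \<le> j \<and> j < n}"
  define W where "W = ?D \<rightarrow>\<^sub>E {-1, 1 :: real}"
  have finD: "finite ?D" by (rule finite_subset[of _ "{..<n} \<times> {..<n}"]) auto
  have finW: "finite W" unfolding W_def using finD by (intro finite_PiE) auto
  have cW: "card W > 0" using finD by (simp add: W_def card_PiE)
  \<comment> \<open>Every index set of size at most \<open>d\<close> lies in the image of such a
    map, and norm bounds pass to smaller blocks. Counting maps is easier than counting sets.\<close>
  define F where "F = {..<d} \<rightarrow>\<^sub>E {..<n}"
  have finF: "finite F" unfolding F_def by (intro finite_PiE) auto
  let ?u = "13 * sqrt (d * (1 + ln n))"
  have ln0: "0 \<le> ln (real n)" using n by simp
  define B0 where "B0 = {w \<in> W. \<not> minor_le (sym_of n w) {..<n} {..<n} (2 * (13 * sqrt n))}"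
  define B1 where "B1 f g = {w \<in> W. \<not> minor_le (sym_of n w) (f ` {..<d}) (g ` {..<d}) (2 * ?u)}" for f g :: "nat \<Rightarrow> nat"
  have "real (card B0) \<le> card W * exp (real (36 * n) - (13 * sqrt n)\<^sup>2 / 4)"
    using bad_count[of "{..<n}" n n "{..<n}" "13 * sqrt n"] n by (simp add: B0_def W_def)
  also have "\<dots> \<le> card W * exp (-2)"
    using n by (intro mult_left_mono) (auto simp: power_mult_distrib)
  finally have b0: "real (card B0) \<le> card W * exp (-2)" by simp
  have img: "f ` {..<d} \<subseteq> {..<n}" "card (f ` {..<d}) \<le> d" if "f \<in> F" for f
    using that card_image_le[of "{..<d}" f] by (auto simp: F_def)
  have b1: "real (card (B1 f g)) \<le> card W * exp (real (36 * d) - ?u\<^sup>2 / 4)" if "f \<in> F" "g \<in> F" for f g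
    using bad_count[OF img[OF that(1)] img[OF that(2)] d, of ?u] d ln0 by (simp add: B1_def W_def)
  have u2: "?u\<^sup>2 = 169 * (d * (1 + ln n))" using ln0 by (simp add: power_mult_distrib)
  have "real (card (\<Union>(f, g)\<in>F \<times> F. B1 f g)) \<le> real (\<Sum>(f, g)\<in>F \<times> F. card (B1 f g))"
    using card_UN_le[of "F \<times> F" "\<lambda>(f, g). B1 f g"] finF by (intro of_nat_mono) (auto simp: case_prod_unfold)
  also have "\<dots> = (\<Sum>(f, g)\<in>F \<times> F. real (card (B1 f g)))" by (simp add: case_prod_unfold)
  also have "\<dots> \<le> (\<Sum>(f, g)\<in>F \<times> F. card W * exp (real (36 * d) - ?u\<^sup>2 / 4))"
    by (rule sum_mono) (use b1 in \<open>simp only: split_paired_all mem_Times_iff fst_conv snd_conv case_prod_conv\<close>)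
  also have "\<dots> = real n ^ d * real n ^ d * (card W * exp (real (36 * d) - ?u\<^sup>2 / 4))"
    by (simp add: F_def card_cartesian_product card_PiE)
  also have "real n ^ d = exp (d * ln n)" using n by (simp add: exp_of_nat_mult)
  also have "exp (d * ln n) * exp (d * ln n) * (card W * exp (real (36 * d) - ?u\<^sup>2 / 4)) = card W * exp (2 * (d * ln n) + (real (36 * d) - ?u\<^sup>2 / 4))"
  proof -
    have "exp a * exp a * exp b = exp (2 * a + b)" for a b :: real by (simp flip: exp_add)
    then show ?thesis by (simp add: mult_ac)
  qed
  also have "\<dots> \<le> card W * exp (-2)"
  proof -
    have "2 * (d * ln n) + (real (36 * d) - ?u\<^sup>2 / 4) = - (25 / 4 * d) - 161 / 4 * (d * ln n)"
      unfolding u2 by (simp add: algebra_simps)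
    also have "\<dots> \<le> -2" using d ln0 mult_nonneg_nonneg[of "real d" "ln n"] by linarith
    finally show ?thesis by (intro mult_left_mono) auto
  qed
  finally have b2: "real (card (\<Union>(f, g)\<in>F \<times> F. B1 f g)) \<le> card W * exp (-2)" .
  have "real (card (B0 \<union> (\<Union>(f, g)\<in>F \<times> F. B1 f g))) \<le> card W * exp (-2) + card W * exp (-2)"
    using b0 b2 card_Un_le[of B0 "\<Union>(f, g)\<in>F \<times> F. B1 f g"] by linarith
  also have "\<dots> < card W"
  proof -
    have "exp (-2 :: real) \<le> 1 / 3" using exp_ge_add_one_self[of 2] by (simp add: exp_minus field_simps)
    then have "card W * exp (-2 :: real) \<le> card W * (1 / 3)" by (intro mult_left_mono) auto
    then show ?thesis using cW by linarith
  qed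
  finally have "card (B0 \<union> (\<Union>(f, g)\<in>F \<times> F. B1 f g)) < card W" by simp
  then have "\<not> W \<subseteq> B0 \<union> (\<Union>(f, g)\<in>F \<times> F. B1 f g)"
    using card_mono[of "B0 \<union> (\<Union>(f, g)\<in>F \<times> F. B1 f g)" W] finW finF
    by (auto simp: B0_def B1_def intro!: finite_subset[OF _ finW])
  then obtain w where w: "w \<in> W" "w \<notin> B0" "\<And>f g. f \<in> F \<Longrightarrow> g \<in> F \<Longrightarrow> w \<notin> B1 f g" by auto
  show ?thesis
  proof (intro exI[of _ "sym_of n w"] conjI allI impI)
    show "sym_of n w i j = sym_of n w j i" for i j by (auto simp: sym_of_def min.commute max.commute)
    have we: "w e = -1 \<or> w e = 1" if "e \<in> ?D" for e using PiE_mem[OF w(1)[unfolded W_def] that] by auto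
    show "sym_of n w i j = 1 \<or> sym_of n w i j = -1" for i j
      using we[of "(min i j, max i j)"] by (auto simp: sym_of_def)
    show "minor_le (sym_of n w) {..<n} {..<n} (26 * sqrt n)" using w by (simp add: B0_def)
    fix T T' assume T: "T \<subseteq> {..<n}" "T' \<subseteq> {..<n}" "card T \<le> d" "card T' \<le> d"
    have ex: "\<exists>f\<in>F. T \<subseteq> f ` {..<d}" if "T \<subseteq> {..<n}" "card T \<le> d" for T
    proof -
      have finT: "finite T" using that finite_subset by blast
      obtain g where g: "bij_betw g {0..<card T} T" using ex_bij_betw_nat_finite[OF finT] by blast
      define f where "f = (\<lambda>i\<in>{..<d}. if i < card T then g i else 0)"
      have "g i < n" if "i < card T" for i using g that \<open>T \<subseteq> {..<n}\<close> by (auto simp: bij_betw_def)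
      then have "f \<in> F" using n by (auto simp: F_def f_def)
      moreover have "T \<subseteq> f ` {..<d}"
      proof
        fix x assume "x \<in> T"
        then obtain i where "i < card T" "x = g i" using g unfolding bij_betw_def by (metis imageE atLeastLessThan_iff)
        then show "x \<in> f ` {..<d}" using that by (intro image_eqI[of _ _ i]) (auto simp: f_def)
      qed
      ultimately show ?thesis by blast
    qed
    obtain f where f: "f \<in> F" "T \<subseteq> f ` {..<d}" using ex[OF T(1,3)] by blast
    obtain g where g: "g \<in> F" "T' \<subseteq> g ` {..<d}" using ex[OF T(2,4)] by blast
    have "minor_le (sym_of n w) (f ` {..<d}) (g ` {..<d}) (26 * sqrt (d * (1 + ln n)))"
      using w(1) w(3)[OF f(1) g(1)] by (simp add: B1_def)
    then show "minor_le (sym_of n w) T T' (26 * sqrt (d * (1 + ln n)))"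
      by (rule minor_le_subset) (use f g in auto)
  qed
qed

section \<open>Lifting to rectangles\<close>

text \<open>Serves both for slices of a side of a rectangle and for subcubes of sign
  strings.\<close>

definition ag :: "'v set \<Rightarrow> ('v \<Rightarrow> 'q) \<Rightarrow> ('v \<Rightarrow> 'q) set \<Rightarrow> ('v \<Rightarrow> 'q) set" where
  "ag S x A = {x' \<in> A. \<forall>v\<in>S. x' v = x v}"

lemma sum_Pow_power:
  fixes c :: real
  assumes "finite U"
  shows "(\<Sum>S\<in>Pow U. c ^ card S) = (1 + c) ^ card U"
  using prod_add[OF assms, of "\<lambda>_. c" "\<lambda>_. 1"] by (simp add: add.commute)

text \<open>The gadget is a Hadamard matrix. Its order is written as a 16th power so that the
  fractional powers of the density argument become powers of \<open>r\<close>.\<close>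

locale lifting =
  fixes V :: "'v set" and Q :: "'q set" and g :: "'q \<Rightarrow> 'q \<Rightarrow> real" and r :: real
  assumes finV: "finite V" and finQ: "finite Q"
    and g1: "a \<in> Q \<Longrightarrow> b \<in> Q \<Longrightarrow> g a b = 1 \<or> g a b = -1"
    and orth: "a \<in> Q \<Longrightarrow> a' \<in> Q \<Longrightarrow> a \<noteq> a' \<Longrightarrow> (\<Sum>b\<in>Q. g a b * g a' b) = 0"
    and r: "2 \<le> r" and q: "real (card Q) = r ^ 16"
begin

definition G :: "('v \<Rightarrow> 'q) \<Rightarrow> ('v \<Rightarrow> 'q) \<Rightarrow> 'v \<Rightarrow> real" where
  "G x y = (\<lambda>v\<in>V. g (x v) (y v))"

abbreviation "X \<equiv> V \<rightarrow>\<^sub>E Q"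
abbreviation "Z \<equiv> V \<rightarrow>\<^sub>E {-1, 1 :: real}"

lemma finX [simp]: "finite X" using finV finQ by (intro finite_PiE) auto
lemma finZ [simp]: "finite Z" using finV by (intro finite_PiE) auto

lemma X_val: "x \<in> A \<Longrightarrow> A \<subseteq> X \<Longrightarrow> v \<in> V \<Longrightarrow> x v \<in> Q"
  by (blast dest: PiE_mem)

lemma G_Z: "x \<in> X \<Longrightarrow> y \<in> X \<Longrightarrow> G x y \<in> Z"
  unfolding G_def using g1 by (intro PiE_I) (fastforce simp: PiE_iff)+

text \<open>Lindsey's lemma for a tensor power: apply Cauchy-Schwarz over the contents of
  \<open>y\<close> on \<open>S\<close>. Orthogonality removes all pairs of rows that differ on
  \<open>S\<close>, so that collisions are left to count on either side.\<close>

lemma Lindsey: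
  assumes A: "A \<subseteq> X" and B: "B \<subseteq> X" and S: "S \<subseteq> V"
  shows "(\<Sum>x\<in>A. \<Sum>y\<in>B. \<Prod>v\<in>S. g (x v) (y v))\<^sup>2
    \<le> r ^ (16 * card S) * (\<Sum>x\<in>A. real (card (ag S x A))) * (\<Sum>y\<in>B. real (card (ag S y B)))"
proof -
  have fin: "finite A" "finite B" "finite S" using A B S finV finX finite_subset by blast+
  let ?P = "S \<rightarrow>\<^sub>E Q"
  have finP: "finite ?P" using fin finQ by (intro finite_PiE) auto
  define F where "F y = (\<Sum>x\<in>A. \<Prod>v\<in>S. g (x v) (y v))" for y
  define b where "b \<beta> = real (card {y \<in> B. restrict y S = \<beta>})" for \<beta>
  have im: "(\<lambda>y. restrict y S) ` B \<subseteq> ?P" using X_val[OF _ B] S by auto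
  have F_res: "F (restrict y S) = F y" for y unfolding F_def by (intro sum.cong prod.cong) auto
  have "(\<Sum>x\<in>A. \<Sum>y\<in>B. \<Prod>v\<in>S. g (x v) (y v)) = (\<Sum>y\<in>B. F y)" unfolding F_def by (rule sum.swap)
  also have "\<dots> = (\<Sum>\<beta>\<in>?P. \<Sum>y\<in>{y \<in> B. restrict y S = \<beta>}. F y)"
    by (rule sum.group[symmetric, OF fin(2) finP im])
  also have "\<dots> = (\<Sum>\<beta>\<in>?P. b \<beta> * F \<beta>)"
  proof (rule sum.cong[OF refl])
    fix \<beta>
    have "(\<Sum>y\<in>{y \<in> B. restrict y S = \<beta>}. F y) = (\<Sum>y\<in>{y \<in> B. restrict y S = \<beta>}. F \<beta>)"
      using F_res by (intro sum.cong) auto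
    then show "(\<Sum>y\<in>{y \<in> B. restrict y S = \<beta>}. F y) = b \<beta> * F \<beta>" by (simp add: b_def)
  qed
  finally have eq: "(\<Sum>x\<in>A. \<Sum>y\<in>B. \<Prod>v\<in>S. g (x v) (y v)) = (\<Sum>\<beta>\<in>?P. b \<beta> * F \<beta>)" .
  have ag_res: "{y' \<in> B. restrict y' S = restrict y S} = ag S y B" for y
    unfolding ag_def by (auto simp: fun_eq_iff restrict_def)
  have "(\<Sum>\<beta>\<in>?P. (b \<beta>)\<^sup>2) = (\<Sum>\<beta>\<in>?P. \<Sum>y\<in>{y \<in> B. restrict y S = \<beta>}. b (restrict y S))"
  proof (rule sum.cong[OF refl])
    fix \<beta>
    have "(\<Sum>y\<in>{y \<in> B. restrict y S = \<beta>}. b (restrict y S)) = (\<Sum>y\<in>{y \<in> B. restrict y S = \<beta>}. b \<beta>)"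
      by (intro sum.cong) auto
    also have "\<dots> = (b \<beta>)\<^sup>2" by (simp add: b_def power2_eq_square)
    finally show "(b \<beta>)\<^sup>2 = (\<Sum>y\<in>{y \<in> B. restrict y S = \<beta>}. b (restrict y S))" by simp
  qed
  also have "\<dots> = (\<Sum>y\<in>B. b (restrict y S))" by (rule sum.group[OF fin(2) finP im])
  finally have b2: "(\<Sum>\<beta>\<in>?P. (b \<beta>)\<^sup>2) = (\<Sum>y\<in>B. real (card (ag S y B)))" unfolding b_def ag_res .
  have pair: "(\<Sum>\<beta>\<in>?P. (\<Prod>v\<in>S. g (x v) (\<beta> v)) * (\<Prod>v\<in>S. g (x' v) (\<beta> v))) = (if \<forall>v\<in>S. x' v = x v then r ^ (16 * card S) else 0)"
    if "x \<in> A" "x' \<in> A" for x x'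
  proof -
    have xQ: "x v \<in> Q" "x' v \<in> Q" if "v \<in> S" for v using X_val[OF \<open>x \<in> A\<close> A] X_val[OF \<open>x' \<in> A\<close> A] that S by auto
    have "(\<Sum>\<beta>\<in>?P. (\<Prod>v\<in>S. g (x v) (\<beta> v)) * (\<Prod>v\<in>S. g (x' v) (\<beta> v))) = (\<Sum>\<beta>\<in>?P. \<Prod>v\<in>S. g (x v) (\<beta> v) * g (x' v) (\<beta> v))"
      by (simp add: prod.distrib)
    also have "\<dots> = (\<Prod>v\<in>S. \<Sum>w\<in>Q. g (x v) w * g (x' v) w)"
      using fin finQ by (intro prod_sum_PiE[symmetric]) auto
    also have "\<dots> = (\<Prod>v\<in>S. if x' v = x v then r ^ 16 else 0)"
    proof (rule prod.cong[OF refl])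
      fix v assume v: "v \<in> S"
      have "g (x v) w * g (x v) w = 1" if "w \<in> Q" for w using g1[OF xQ(1)[OF v] that] by auto
      then have "(\<Sum>w\<in>Q. g (x v) w * g (x v) w) = r ^ 16" by (simp add: q)
      then show "(\<Sum>w\<in>Q. g (x v) w * g (x' v) w) = (if x' v = x v then r ^ 16 else 0)"
        using orth[OF xQ[OF v]] by auto
    qed
    also have "\<dots> = (if \<forall>v\<in>S. x' v = x v then r ^ (16 * card S) else 0)"
      using fin(3) by (auto simp: power_mult intro!: prod_zero)
    finally show ?thesis .
  qed
  have "(\<Sum>\<beta>\<in>?P. (F \<beta>)\<^sup>2) = (\<Sum>\<beta>\<in>?P. \<Sum>x\<in>A. \<Sum>x'\<in>A. (\<Prod>v\<in>S. g (x v) (\<beta> v)) * (\<Prod>v\<in>S. g (x' v) (\<beta> v)))"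
    by (simp add: F_def power2_eq_square sum_product)
  also have "\<dots> = (\<Sum>x\<in>A. \<Sum>x'\<in>A. \<Sum>\<beta>\<in>?P. (\<Prod>v\<in>S. g (x v) (\<beta> v)) * (\<Prod>v\<in>S. g (x' v) (\<beta> v)))"
    by (subst sum.swap, rule sum.cong[OF refl], rule sum.swap)
  also have "\<dots> = (\<Sum>x\<in>A. \<Sum>x'\<in>A. if \<forall>v\<in>S. x' v = x v then r ^ (16 * card S) else 0)"
    by (intro sum.cong refl pair)
  also have "\<dots> = (\<Sum>x\<in>A. r ^ (16 * card S) * real (card (ag S x A)))"
    using fin(1) by (intro sum.cong refl) (simp add: ag_def sum.inter_filter[symmetric])
  finally have F2: "(\<Sum>\<beta>\<in>?P. (F \<beta>)\<^sup>2) = r ^ (16 * card S) * (\<Sum>x\<in>A. real (card (ag S x A)))" by (simp add: sum_distrib_left)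
  show ?thesis unfolding eq using Cauchy_Schwarz_ineq_sum[of b F ?P] unfolding b2 F2 by (simp add: mult_ac)
qed

text \<open>Min-entropy at rate 12/16 on every set of free blocks. The rates of the two sides exceed
  1 in total, which makes all characters small.\<close>

definition dense :: "'v set \<Rightarrow> ('v \<Rightarrow> 'q) set \<Rightarrow> bool" where
  "dense U A \<longleftrightarrow> (\<forall>I\<subseteq>U. \<forall>x\<in>A. real (card (ag I x A)) * r ^ (12 * card I) \<le> card A)"

text \<open>The character bounds \<open>(1 / r ^ 4) ^ card S\<close> summed over the nonempty
  subsets of \<open>V\<close>.\<close>

definition "\<eta> = (1 + 1 / r ^ 4) ^ card V - 1"

lemma \<eta>_nonneg: "0 \<le> \<eta>"
  using r by (simp add: \<eta>_def one_le_power)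

text \<open>Per block the exponents in \<open>Lindsey\<close> add up to 16 - 12 - 12 = -8, and the
  square root leaves \<open>1 / r ^ 4\<close>.\<close>

lemma character_sum:
  assumes A: "A \<subseteq> X" and B: "B \<subseteq> X" and S: "S \<subseteq> U" "U \<subseteq> V" and d: "dense U A" "dense U B"
  shows "\<bar>\<Sum>x\<in>A. \<Sum>y\<in>B. \<Prod>v\<in>S. g (x v) (y v)\<bar> \<le> real (card A) * card B * (1 / r ^ 4) ^ card S"
proof -
  let ?s = "card S"
  have r0: "0 < r ^ m" for m using r by simp
  have one: "(\<Sum>x\<in>A. real (card (ag S x A))) \<le> card A * card A / r ^ (12 * ?s)" if "dense U A" for A
  proof -
    have "(\<Sum>x\<in>A. real (card (ag S x A))) \<le> (\<Sum>x\<in>A. card A / r ^ (12 * ?s))"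
      using that S r0 by (intro sum_mono) (auto simp: dense_def pos_le_divide_eq)
    then show ?thesis by simp
  qed
  have "(\<Sum>x\<in>A. \<Sum>y\<in>B. \<Prod>v\<in>S. g (x v) (y v))\<^sup>2
      \<le> r ^ (16 * ?s) * (\<Sum>x\<in>A. real (card (ag S x A))) * (\<Sum>y\<in>B. real (card (ag S y B)))"
    by (rule Lindsey) (use A B S in auto)
  also have "\<dots> \<le> r ^ (16 * ?s) * (card A * card A / r ^ (12 * ?s)) * (card B * card B / r ^ (12 * ?s))"
    using one[OF d(1)] one[OF d(2)] r by (intro mult_mono) (auto simp: sum_nonneg)
  also have "\<dots> = (real (card A) * card B * (1 / r ^ 4) ^ ?s)\<^sup>2"
  proof -
    have "r ^ (12 * ?s) * r ^ (12 * ?s) = r ^ (16 * ?s) * (r ^ (4 * ?s) * r ^ (4 * ?s))" by (simp flip: power_add)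
    moreover have "(1 / r ^ 4) ^ ?s = 1 / r ^ (4 * ?s)" by (simp add: power_divide power_mult)
    moreover have "w * (a * a / p) * (b * b / p) = (a * b * (1 / u))\<^sup>2" if "p * p = w * (u * u)" "0 < p" "0 < u" "0 < w" for a b p u w :: real
    proof -
      have "w * (a * a / p) * (b * b / p) = w * (a * b)\<^sup>2 / (p * p)" by (simp add: power2_eq_square)
      also have "\<dots> = (a * b * (1 / u))\<^sup>2" unfolding that(1) using that by (simp add: power2_eq_square)
      finally show ?thesis .
    qed
    ultimately show ?thesis using r0 by simp
  qed
  finally have "\<bar>\<Sum>x\<in>A. \<Sum>y\<in>B. \<Prod>v\<in>S. g (x v) (y v)\<bar> \<le> \<bar>real (card A) * card B * (1 / r ^ 4) ^ ?s\<bar>"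
    by (simp only: abs_le_square_iff)
  then show ?thesis using r by simp
qed

definition cnt :: "'v set \<Rightarrow> ('v \<Rightarrow> real) \<Rightarrow> ('v \<Rightarrow> 'q) set \<Rightarrow> ('v \<Rightarrow> 'q) set \<Rightarrow> real" where
  "cnt U z A B = (\<Sum>x\<in>A. \<Sum>y\<in>B. if \<forall>v\<in>U. g (x v) (y v) = z v then 1 else 0)"

text \<open>The indicator of an output pattern is expanded into characters; the empty one gives the
  main term and the others the error \<eta>.\<close>

lemma cnt_approx:
  assumes A: "A \<subseteq> X" and B: "B \<subseteq> X" and U: "U \<subseteq> V" and d: "dense U A" "dense U B" and z: "\<And>v. v \<in> U \<Longrightarrow> z v = -1 \<or> z v = 1"
  shows "\<bar>cnt U z A B * 2 ^ card U - real (card A) * card B\<bar> \<le> real (card A) * card B * \<eta>"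
proof -
  have finU: "finite U" using U finV finite_subset by blast
  define f where "f S = (\<Sum>x\<in>A. \<Sum>y\<in>B. \<Prod>v\<in>S. g (x v) (y v))" for S
  have "(if \<forall>v\<in>U. g (x v) (y v) = z v then 1 else 0) * 2 ^ card U = (\<Sum>S\<in>Pow U. (\<Prod>v\<in>S. z v) * (\<Prod>v\<in>S. g (x v) (y v)))"
    if xy: "x \<in> A" "y \<in> B" for x y
  proof -
    have "(\<Sum>S\<in>Pow U. (\<Prod>v\<in>S. z v) * (\<Prod>v\<in>S. g (x v) (y v))) = (\<Prod>v\<in>U. z v * g (x v) (y v) + 1)"
      unfolding prod_add[OF finU] by (simp add: prod.distrib)
    also have "\<dots> = (\<Prod>v\<in>U. if g (x v) (y v) = z v then 2 else 0)"
    proof (rule prod.cong[OF refl])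
      fix v assume v: "v \<in> U"
      then have "g (x v) (y v) = 1 \<or> g (x v) (y v) = -1" using X_val[OF xy(1) A] X_val[OF xy(2) B] U by (intro g1) auto
      then show "z v * g (x v) (y v) + 1 = (if g (x v) (y v) = z v then 2 else 0)" using z[OF v] by auto
    qed
    also have "\<dots> = (if \<forall>v\<in>U. g (x v) (y v) = z v then 1 else 0) * 2 ^ card U"
      using finU by (auto intro!: prod_zero)
    finally show ?thesis by simp
  qed
  then have "cnt U z A B * 2 ^ card U = (\<Sum>x\<in>A. \<Sum>y\<in>B. \<Sum>S\<in>Pow U. (\<Prod>v\<in>S. z v) * (\<Prod>v\<in>S. g (x v) (y v)))"
    unfolding cnt_def sum_distrib_right by (intro sum.cong) auto
  also have "\<dots> = (\<Sum>x\<in>A. \<Sum>S\<in>Pow U. \<Sum>y\<in>B. (\<Prod>v\<in>S. z v) * (\<Prod>v\<in>S. g (x v) (y v)))"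
    by (intro sum.cong refl sum.swap)
  also have "\<dots> = (\<Sum>S\<in>Pow U. \<Sum>x\<in>A. \<Sum>y\<in>B. (\<Prod>v\<in>S. z v) * (\<Prod>v\<in>S. g (x v) (y v)))"
    by (rule sum.swap)
  also have "\<dots> = (\<Sum>S\<in>Pow U. (\<Prod>v\<in>S. z v) * f S)" by (simp add: f_def sum_distrib_left)
  also have "\<dots> = (\<Prod>v\<in>{}. z v) * f {} + (\<Sum>S\<in>Pow U - {{}}. (\<Prod>v\<in>S. z v) * f S)"
    using finU by (intro sum.remove) auto
  also have "(\<Prod>v\<in>{}. z v) * f {} = real (card A) * card B" by (simp add: f_def)
  finally have eq: "cnt U z A B * 2 ^ card U - real (card A) * card B = (\<Sum>S\<in>Pow U - {{}}. (\<Prod>v\<in>S. z v) * f S)" by simp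
  have "\<bar>\<Sum>S\<in>Pow U - {{}}. (\<Prod>v\<in>S. z v) * f S\<bar> \<le> (\<Sum>S\<in>Pow U - {{}}. \<bar>(\<Prod>v\<in>S. z v) * f S\<bar>)" by (rule sum_abs)
  also have "\<dots> \<le> (\<Sum>S\<in>Pow U - {{}}. real (card A) * card B * (1 / r ^ 4) ^ card S)"
  proof (rule sum_mono)
    fix S assume "S \<in> Pow U - {{}}"
    then have S: "S \<subseteq> U" by auto
    have "\<bar>\<Prod>v\<in>S. z v\<bar> = (\<Prod>v\<in>S. 1)" unfolding abs_prod using S z by (intro prod.cong) force+
    then have "\<bar>(\<Prod>v\<in>S. z v) * f S\<bar> = \<bar>f S\<bar>" by (simp add: abs_mult)
    then show "\<bar>(\<Prod>v\<in>S. z v) * f S\<bar> \<le> real (card A) * card B * (1 / r ^ 4) ^ card S"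
      using character_sum[OF A B S U d] by (simp add: f_def)
  qed
  also have "\<dots> = real (card A) * card B * (\<Sum>S\<in>Pow U - {{}}. (1 / r ^ 4) ^ card S)" by (simp add: sum_distrib_left)
  also have "(\<Sum>S\<in>Pow U - {{}}. (1 / r ^ 4) ^ card S) = (1 + 1 / r ^ 4) ^ card U - 1"
    using finU sum_Pow_power[OF finU, of "1 / r ^ 4"] sum.remove[of "Pow U" "{}" "\<lambda>S. (1 / r ^ 4) ^ card S"] by simp
  also have "\<dots> \<le> \<eta>"
    unfolding \<eta>_def using r U finV by (intro diff_right_mono power_increasing card_mono) auto
  finally show ?thesis unfolding eq by (simp add: mult_left_mono)
qed

lemma sum_G:
  fixes \<Psi> :: "('v \<Rightarrow> real) \<Rightarrow> real"
  assumes A: "A \<subseteq> X" and B: "B \<subseteq> X" and T: "T \<subseteq> V" and agT: "\<And>x y v. x \<in> A \<Longrightarrow> y \<in> B \<Longrightarrow> v \<in> T \<Longrightarrow> g (x v) (y v) = \<rho> v"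
  shows "(\<Sum>x\<in>A. \<Sum>y\<in>B. \<Psi> (G x y)) = (\<Sum>z\<in>ag T \<rho> Z. cnt (V - T) z A B * \<Psi> z)"
proof -
  have fin: "finite (ag T \<rho> Z)" by (simp add: ag_def)
  have "\<Psi> (G x y) = (\<Sum>z\<in>ag T \<rho> Z. (if \<forall>v\<in>V - T. g (x v) (y v) = z v then 1 else 0) * \<Psi> z)" if xy: "x \<in> A" "y \<in> B" for x y
  proof -
    have mem: "G x y \<in> ag T \<rho> Z" using xy A B T agT[OF xy] G_Z[of x y] by (auto simp: ag_def G_def)
    have iff: "(\<forall>v\<in>V - T. g (x v) (y v) = z v) \<longleftrightarrow> z = G x y" if "z \<in> ag T \<rho> Z" for z
    proof
      assume l: "\<forall>v\<in>V - T. g (x v) (y v) = z v"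
      show "z = G x y"
      proof
        fix v
        show "z v = G x y v"
        proof (cases "v \<in> V")
          case True
          then show ?thesis using l that agT[OF xy, of v] by (cases "v \<in> T") (auto simp: ag_def G_def)
        next
          case False
          then show ?thesis using that PiE_arb[of z V "\<lambda>_. {-1, 1}" v] by (simp add: ag_def G_def)
        qed
      qed
    next
      assume "z = G x y"
      then show "\<forall>v\<in>V - T. g (x v) (y v) = z v" by (simp add: G_def)
    qed
    have "(\<Sum>z\<in>ag T \<rho> Z. (if \<forall>v\<in>V - T. g (x v) (y v) = z v then 1 else 0) * \<Psi> z) = (\<Sum>z\<in>ag T \<rho> Z. if z = G x y then \<Psi> z else 0)"
      using iff by (intro sum.cong) auto
    also have "\<dots> = \<Psi> (G x y)" using fin mem by (simp add: sum.delta)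
    finally show ?thesis by simp
  qed
  then have "(\<Sum>x\<in>A. \<Sum>y\<in>B. \<Psi> (G x y)) = (\<Sum>x\<in>A. \<Sum>y\<in>B. \<Sum>z\<in>ag T \<rho> Z. (if \<forall>v\<in>V - T. g (x v) (y v) = z v then 1 else 0) * \<Psi> z)"
    by (intro sum.cong) auto
  also have "\<dots> = (\<Sum>x\<in>A. \<Sum>z\<in>ag T \<rho> Z. \<Sum>y\<in>B. (if \<forall>v\<in>V - T. g (x v) (y v) = z v then 1 else 0) * \<Psi> z)"
    by (intro sum.cong refl sum.swap)
  also have "\<dots> = (\<Sum>z\<in>ag T \<rho> Z. \<Sum>x\<in>A. \<Sum>y\<in>B. (if \<forall>v\<in>V - T. g (x v) (y v) = z v then 1 else 0) * \<Psi> z)"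
    by (rule sum.swap)
  also have "\<dots> = (\<Sum>z\<in>ag T \<rho> Z. cnt (V - T) z A B * \<Psi> z)"
    by (simp only: cnt_def sum_distrib_right)
  finally show ?thesis .
qed

lemma card_ag:
  assumes "T \<subseteq> V" "\<And>v. v \<in> V \<Longrightarrow> finite (R v)" "\<And>v. v \<in> T \<Longrightarrow> \<rho> v \<in> R v"
  shows "card (ag T \<rho> (Pi\<^sub>E V R)) = (\<Prod>v\<in>V - T. card (R v))"
proof -
  have "ag T \<rho> (Pi\<^sub>E V R) = Pi\<^sub>E V (\<lambda>v. if v \<in> T then {\<rho> v} else R v)"
  proof (intro equalityI subsetI)
    fix x assume "x \<in> ag T \<rho> (Pi\<^sub>E V R)"
    then show "x \<in> Pi\<^sub>E V (\<lambda>v. if v \<in> T then {\<rho> v} else R v)" by (auto simp: ag_def PiE_iff)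
  next
    fix x assume x: "x \<in> Pi\<^sub>E V (\<lambda>v. if v \<in> T then {\<rho> v} else R v)"
    have "x v = \<rho> v" if "v \<in> T" for v using PiE_mem[OF x, of v] that assms(1) by auto
    moreover have "x v \<in> R v" if "v \<in> V" for v using PiE_mem[OF x that] assms(3) by (auto split: if_splits)
    ultimately show "x \<in> ag T \<rho> (Pi\<^sub>E V R)" using x by (auto simp: ag_def PiE_iff)
  qed
  then have "card (ag T \<rho> (Pi\<^sub>E V R)) = (\<Prod>v\<in>V. card (if v \<in> T then {\<rho> v} else R v))" by (simp add: card_PiE finV)
  also have "\<dots> = (\<Prod>v\<in>V - T. card (R v))"
    using finV by (intro prod.mono_neutral_cong_right) auto
  finally show ?thesis .
qed

lemma card_ag_Z: "T \<subseteq> V \<Longrightarrow> \<rho> \<in> Z \<Longrightarrow> card (ag T \<rho> Z) = 2 ^ card (V - T)"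
  by (subst card_ag) (auto simp: numeral_2_eq_2 PiE_iff)

lemma card_ag_X: "T \<subseteq> V \<Longrightarrow> x \<in> X \<Longrightarrow> real (card (ag T x X)) = r ^ (16 * card (V - T))"
  by (subst card_ag) (auto simp: finQ PiE_iff q power_mult)

lemma card_X: "real (card X) = r ^ (16 * card V)"
  using finV by (simp add: card_PiE q power_mult)

text \<open>The relative error of the counts is the same for all patterns on the free blocks, so it
  carries over to every nonnegative \<Psi>.\<close>

lemma dense_sum:
  fixes \<Psi> :: "('v \<Rightarrow> real) \<Rightarrow> real"
  assumes A: "A \<subseteq> X" and B: "B \<subseteq> X" and T: "T \<subseteq> V" and d: "dense (V - T) A" "dense (V - T) B"
    and agT: "\<And>x y v. x \<in> A \<Longrightarrow> y \<in> B \<Longrightarrow> v \<in> T \<Longrightarrow> g (x v) (y v) = \<rho> v"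
    and \<rho>: "\<rho> \<in> Z" and \<Psi>: "\<And>z. z \<in> Z \<Longrightarrow> 0 \<le> \<Psi> z"
  shows "\<bar>(\<Sum>x\<in>A. \<Sum>y\<in>B. \<Psi> (G x y)) - real (card A) * card B * avg (ag T \<rho> Z) \<Psi>\<bar> \<le> real (card A) * card B * \<eta> * avg (ag T \<rho> Z) \<Psi>"
proof -
  let ?C = "ag T \<rho> Z" and ?M = "2 ^ card (V - T) :: real" and ?AB = "real (card A) * card B"
  have cC: "real (card ?C) = ?M" by (simp add: card_ag_Z[OF T \<rho>])
  have sg: "(\<Sum>x\<in>A. \<Sum>y\<in>B. \<Psi> (G x y)) = (\<Sum>z\<in>?C. cnt (V - T) z A B * \<Psi> z)"
    by (rule sum_G[OF A B T]) (rule agT)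
  have "\<bar>(\<Sum>x\<in>A. \<Sum>y\<in>B. \<Psi> (G x y)) - ?AB * avg ?C \<Psi>\<bar> = \<bar>\<Sum>z\<in>?C. (cnt (V - T) z A B * ?M - ?AB) * \<Psi> z\<bar> / ?M"
  proof -
    have "(\<Sum>x\<in>A. \<Sum>y\<in>B. \<Psi> (G x y)) - ?AB * avg ?C \<Psi> = (\<Sum>z\<in>?C. (cnt (V - T) z A B * ?M - ?AB) * \<Psi> z) / ?M"
      unfolding sg avg_def cC
      by (simp add: left_diff_distrib sum_subtractf diff_divide_distrib sum_divide_distrib sum_distrib_left)
    then show ?thesis by (simp add: abs_divide)
  qed
  also have "\<dots> \<le> (\<Sum>z\<in>?C. ?AB * \<eta> * \<Psi> z) / ?M"
  proof (rule divide_right_mono)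
    have "\<bar>\<Sum>z\<in>?C. (cnt (V - T) z A B * ?M - ?AB) * \<Psi> z\<bar> \<le> (\<Sum>z\<in>?C. \<bar>(cnt (V - T) z A B * ?M - ?AB) * \<Psi> z\<bar>)" by (rule sum_abs)
    also have "\<dots> \<le> (\<Sum>z\<in>?C. ?AB * \<eta> * \<Psi> z)"
    proof (rule sum_mono)
      fix z assume z: "z \<in> ?C"
      then have zZ: "z \<in> Z" by (simp add: ag_def)
      have "\<bar>cnt (V - T) z A B * ?M - ?AB\<bar> \<le> ?AB * \<eta>"
        using zZ by (intro cnt_approx A B d) (auto simp: PiE_iff)
      then show "\<bar>(cnt (V - T) z A B * ?M - ?AB) * \<Psi> z\<bar> \<le> ?AB * \<eta> * \<Psi> z"
        using \<Psi>[OF zZ] by (simp add: abs_mult mult_right_mono)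
    qed
    finally show "\<bar>\<Sum>z\<in>?C. (cnt (V - T) z A B * ?M - ?AB) * \<Psi> z\<bar> \<le> (\<Sum>z\<in>?C. ?AB * \<eta> * \<Psi> z)" .
  qed simp
  also have "\<dots> = ?AB * \<eta> * avg ?C \<Psi>" by (simp add: avg_def cC sum_distrib_left)
  finally show ?thesis .
qed

lemma dense_X: "dense V X"
  unfolding dense_def
proof (intro allI impI ballI)
  fix I x assume I: "I \<subseteq> V" "x \<in> X"
  have "card V = card (V - I) + card I" using I(1) finV by (simp add: card_Diff_subset finite_subset card_mono)
  then have "r ^ (16 * card (V - I)) * r ^ (12 * card I) \<le> r ^ (16 * card V)"
    using r by (simp flip: power_add)
  then show "real (card (ag I x X)) * r ^ (12 * card I) \<le> card X" by (simp add: card_ag_X[OF I] card_X)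
qed

lemma sum_X:
  fixes \<Psi> :: "('v \<Rightarrow> real) \<Rightarrow> real"
  assumes "\<And>z. z \<in> Z \<Longrightarrow> 0 \<le> \<Psi> z"
  shows "\<bar>(\<Sum>x\<in>X. \<Sum>y\<in>X. \<Psi> (G x y)) - (real (card X))\<^sup>2 * avg Z \<Psi>\<bar> \<le> (real (card X))\<^sup>2 * \<eta> * avg Z \<Psi>"
proof -
  have "(\<lambda>v\<in>V. 1) \<in> Z" by auto
  from dense_sum[of X X "{}" "\<lambda>v\<in>V. 1" \<Psi>] this show ?thesis
    using dense_X assms by (simp add: ag_def power2_eq_square)
qed

end

text \<open>The budget of one split: a slice \<open>a'\<close> leaves a side of size
  \<open>a\<close>, and the other side \<open>b\<close> falls into at most
  \<open>r ^ (16 * i)\<close> fibres. Cauchy-Schwarz bounds the fibre terms by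
  \<open>sqrt (a' * b) * r ^ (8 * i)\<close>. Passing from \<open>a\<close> to \<open>a - a'\<close>
  frees \<open>a' / (2 * sqrt a)\<close> in the square root, and as the slice is over-represented
  and \<open>2 \<le> r ^ i\<close>, the factor \<open>r ^ (15 * i)\<close> makes this
  enough.\<close>

lemma split_real:
  fixes a a' b r \<Phi> :: real and bb :: "'b \<Rightarrow> real"
  assumes r: "2 \<le> r" and a: "0 < a'" "a' \<le> a" "a \<le> a' * r ^ (12 * i)" and i: "1 \<le> i"
    and P: "finite P" "real (card P) \<le> r ^ (16 * i)" and bb: "\<And>\<beta>. 0 \<le> bb \<beta>" "(\<Sum>\<beta>\<in>P. bb \<beta>) = b" and \<Phi>: "0 \<le> \<Phi>"
  shows "sqrt ((a - a') * b) * (\<Phi> * r ^ (15 * i)) + (\<Sum>\<beta>\<in>P. sqrt (a' * bb \<beta>) * \<Phi>) \<le> sqrt (a * b) * (\<Phi> * r ^ (15 * i))"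
proof -
  have b0: "0 \<le> b" unfolding bb(2)[symmetric] by (intro sum_nonneg bb)
  have rp: "0 < r ^ m" for m using r by simp
  have "(\<Sum>\<beta>\<in>P. sqrt (bb \<beta>) * 1)\<^sup>2 \<le> (\<Sum>\<beta>\<in>P. (sqrt (bb \<beta>))\<^sup>2) * (\<Sum>\<beta>\<in>P. 1\<^sup>2)" by (rule Cauchy_Schwarz_ineq_sum)
  also have "\<dots> = b * card P" using bb by simp
  also have "\<dots> \<le> b * r ^ (16 * i)" by (intro mult_left_mono P b0)
  also have "\<dots> = (sqrt b * r ^ (8 * i))\<^sup>2"
  proof -
    have "r ^ (16 * i) = (r ^ (8 * i))\<^sup>2" by (simp flip: power_mult)
    then show ?thesis using b0 by (simp add: power_mult_distrib)
  qed
  finally have "(\<Sum>\<beta>\<in>P. sqrt (bb \<beta>))\<^sup>2 \<le> (sqrt b * r ^ (8 * i))\<^sup>2" by simp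
  then have s: "(\<Sum>\<beta>\<in>P. sqrt (bb \<beta>)) \<le> sqrt b * r ^ (8 * i)"
    by (rule power2_le_imp_le) (use r b0 in simp)
  have "2 \<le> r ^ i" using r i power_increasing[of 1 i r] by simp
  have "sqrt a \<le> sqrt (a' * r ^ (12 * i))" using a(3) by simp
  also have "r ^ (12 * i) = (r ^ (6 * i))\<^sup>2" by (simp flip: power_mult)
  also have "sqrt (a' * (r ^ (6 * i))\<^sup>2) = sqrt a' * r ^ (6 * i)" using rp[of "6 * i"] by (simp add: real_sqrt_mult)
  finally have a6: "sqrt a \<le> sqrt a' * r ^ (6 * i)" .
  have r7: "r ^ (7 * i) = r ^ i * r ^ (6 * i)" by (simp flip: power_add)
  have "2 * sqrt a \<le> r ^ i * (sqrt a' * r ^ (6 * i))"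
    by (rule mult_mono[OF \<open>2 \<le> r ^ i\<close> a6]) (use r a in auto)
  then have a7: "2 * sqrt a \<le> sqrt a' * r ^ (7 * i)" unfolding r7 by (simp only: mult_ac)
  have sa: "sqrt a \<noteq> 0" "0 < sqrt a" "0 < sqrt a'" using a by auto
  have "(sqrt (a - a'))\<^sup>2 \<le> (sqrt a - a' / (2 * sqrt a))\<^sup>2"
  proof -
    have "(sqrt a - a' / (2 * sqrt a))\<^sup>2 = (sqrt a)\<^sup>2 - 2 * sqrt a * (a' / (2 * sqrt a)) + (a' / (2 * sqrt a))\<^sup>2"
      by (simp add: power2_diff)
    also have "\<dots> = a - a' + (a' / (2 * sqrt a))\<^sup>2" using a sa by simp
    finally show ?thesis using a by simp
  qed
  moreover have "0 \<le> sqrt a - a' / (2 * sqrt a)"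
  proof -
    have "a' / (2 * sqrt a) \<le> a / sqrt a" using a sa by (intro frac_le) auto
    then show ?thesis using a by (simp add: real_div_sqrt)
  qed
  ultimately have s1: "sqrt (a - a') \<le> sqrt a - a' / (2 * sqrt a)" by (rule power2_le_imp_le)
  have "sqrt a' * (2 * sqrt a) \<le> sqrt a' * (sqrt a' * r ^ (7 * i))" using a7 sa by (intro mult_left_mono) auto
  then have "sqrt a' * (2 * sqrt a) \<le> a' * r ^ (7 * i)" using a by (simp add: mult.assoc[symmetric])
  then have "sqrt a' \<le> a' / (2 * sqrt a) * r ^ (7 * i)" using sa by (simp add: pos_le_divide_eq)
  then have "sqrt a' * r ^ (8 * i) \<le> a' / (2 * sqrt a) * r ^ (7 * i) * r ^ (8 * i)" using rp[of "8 * i"] by (intro mult_right_mono) auto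
  also have "\<dots> = a' / (2 * sqrt a) * r ^ (15 * i)" by (simp flip: power_add)
  finally have s2: "sqrt a' * r ^ (8 * i) \<le> a' / (2 * sqrt a) * r ^ (15 * i)" .
  have "sqrt (a - a') * r ^ (15 * i) + sqrt a' * r ^ (8 * i) \<le> (sqrt a - a' / (2 * sqrt a)) * r ^ (15 * i) + a' / (2 * sqrt a) * r ^ (15 * i)"
    using s1 s2 rp[of "15 * i"] by (intro add_mono mult_right_mono) auto
  also have "\<dots> = sqrt a * r ^ (15 * i)" by (simp add: left_diff_distrib)
  finally have key: "sqrt (a - a') * r ^ (15 * i) + sqrt a' * r ^ (8 * i) \<le> sqrt a * r ^ (15 * i)" .
  have "(\<Sum>\<beta>\<in>P. sqrt (a' * bb \<beta>) * \<Phi>) = sqrt a' * (\<Sum>\<beta>\<in>P. sqrt (bb \<beta>)) * \<Phi>"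
    by (simp add: real_sqrt_mult sum_distrib_left sum_distrib_right)
  also have "\<dots> \<le> sqrt a' * (sqrt b * r ^ (8 * i)) * \<Phi>" using s \<Phi> a by (intro mult_right_mono mult_left_mono) auto
  finally have "sqrt ((a - a') * b) * (\<Phi> * r ^ (15 * i)) + (\<Sum>\<beta>\<in>P. sqrt (a' * bb \<beta>) * \<Phi>)
      \<le> (sqrt (a - a') * r ^ (15 * i) + sqrt a' * r ^ (8 * i)) * (sqrt b * \<Phi>)"
    unfolding real_sqrt_mult[of "a - a'"] distrib_right by (simp only: mult_ac add_left_mono)
  also have "\<dots> \<le> sqrt a * r ^ (15 * i) * (sqrt b * \<Phi>)" using key b0 \<Phi> by (intro mult_right_mono) auto
  finally show ?thesis by (simp add: real_sqrt_mult mult_ac)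
qed

definition cst :: "'v set \<Rightarrow> ('v \<Rightarrow> 'q) set \<Rightarrow> bool" where
  "cst T C \<longleftrightarrow> (\<forall>x\<in>C. \<forall>x'\<in>C. \<forall>v\<in>T. x v = x' v)"

lemma cst_ag: "cst T C \<Longrightarrow> cst (T \<union> I) (ag I x C)"
  unfolding cst_def ag_def by auto

lemma cst_fibre: "cst T C \<Longrightarrow> cst (T \<union> I) {x \<in> C. restrict x I = \<beta>}"
  unfolding cst_def by (auto simp: restrict_def fun_eq_iff)

lemma cst_subset: "cst T C \<Longrightarrow> C' \<subseteq> C \<Longrightarrow> cst T C'"
  unfolding cst_def by auto

context lifting begin

text \<open>The right side is a potential: fixing a block changes the exponent from 16 to 1, and the
  15 gained are what \<open>split_real\<close> consumes. The induction removes points from a side or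
  free blocks, until either both sides are dense or many blocks are fixed.\<close>

lemma rectangle:
  fixes h :: "('v \<Rightarrow> real) \<Rightarrow> real"
  assumes h0: "\<And>z. z \<in> Z \<Longrightarrow> 0 \<le> h z" and c: "0 \<le> c" "c \<le> 1" and \<eta>: "\<eta> \<le> 1"
    and H: "\<And>T \<rho>. T \<subseteq> V \<Longrightarrow> card T < d \<Longrightarrow> \<rho> \<in> Z \<Longrightarrow> c \<le> avg (ag T \<rho> Z) h"
    and "A \<subseteq> X" "B \<subseteq> X" "T \<subseteq> V"
    and "cst T A" and "cst T B"
  shows "(\<Sum>x\<in>A. \<Sum>y\<in>B. (1 - \<eta>) * c - h (G x y)) * r ^ d
    \<le> sqrt (real (card A) * card B) * r ^ (16 * card (V - T) + card T)"
  using assms(6-)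
proof (induction "card A + card B + card (V - T)" arbitrary: A B T rule: less_induct)
  case less
  note A = less.prems(1) and B = less.prems(2) and T = less.prems(3) and cA = less.prems(4) and cB = less.prems(5)
  have fin: "finite A" "finite B" "finite T" using A B T finV finX finite_subset by blast+
  have r0: "0 < r ^ m" for m using r by simp
  define D where "D A B = (\<Sum>x\<in>A. \<Sum>y\<in>B. (1 - \<eta>) * c - h (G x y))" for A B
  have hG: "0 \<le> h (G x y)" if "x \<in> A" "y \<in> B" for x y using that A B by (intro h0 G_Z) auto
  have c'1: "(1 - \<eta>) * c \<le> 1" using c \<eta> \<eta>_nonneg by (intro mult_le_one) auto
  show ?case
  proof (cases "A = {} \<or> B = {}")
    case True
    then show ?thesis by (elim disjE) simp_all
  next
    case False
    then obtain x0 y0 where x0: "x0 \<in> A" and y0: "y0 \<in> B" by auto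
    have agI: "\<exists>I x. I \<subseteq> V - T \<and> I \<noteq> {} \<and> x \<in> C \<and> real (card C) < real (card (ag I x C)) * r ^ (12 * card I)"
      if "\<not> dense (V - T) C" for C
    proof -
      have "\<exists>I. I \<subseteq> V - T \<and> (\<exists>x. x \<in> C \<and> \<not> real (card (ag I x C)) * r ^ (12 * card I) \<le> real (card C))"
        using that by (simp only: dense_def Ball_def not_all not_imp simp_thms)
      then obtain I x where I: "I \<subseteq> V - T" "x \<in> C" "\<not> real (card (ag I x C)) * r ^ (12 * card I) \<le> real (card C)"
        by (elim exE conjE)
      have "I \<noteq> {}"
      proof
        assume e: "I = {}"
        have "ag I x C = C" unfolding e by (simp add: ag_def)
        then show False using I(3) by (simp add: e)
      qed
      then show ?thesis using I(1,2) I(3)[unfolded not_le] by (intro exI[of _ I] exI[of _ x] conjI)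
    qed
    have extend: "finite I" "1 \<le> card I" "card (V - (T \<union> I)) < card (V - T)"
        "r ^ (16 * card (V - (T \<union> I)) + card (T \<union> I)) * r ^ (15 * card I) = r ^ (16 * card (V - T) + card T)"
        "finite (I \<rightarrow>\<^sub>E Q)" "real (card (I \<rightarrow>\<^sub>E Q)) \<le> r ^ (16 * card I)" "T \<union> I \<subseteq> V"
      if I: "I \<subseteq> V - T" "I \<noteq> {}" for I
    proof -
      show fI: "finite I" using I finV finite_subset by blast
      then show "1 \<le> card I" using I by (simp add: Suc_leI card_gt_0_iff)
      have e: "V - (T \<union> I) = (V - T) - I" by auto
      have c1: "card (V - T) = card (V - (T \<union> I)) + card I"
        unfolding e using I fI finV by (simp add: card_Diff_subset card_mono)
      have c2: "card (T \<union> I) = card T + card I" using I fI fin by (intro card_Un_disjoint) auto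
      show "card (V - (T \<union> I)) < card (V - T)" using c1 \<open>1 \<le> card I\<close> by simp
      show "r ^ (16 * card (V - (T \<union> I)) + card (T \<union> I)) * r ^ (15 * card I) = r ^ (16 * card (V - T) + card T)"
        unfolding c1 c2 power_add[symmetric] by (rule arg_cong[where f = "power r"]) simp
      show "finite (I \<rightarrow>\<^sub>E Q)" using fI finQ by (intro finite_PiE) auto
      show "real (card (I \<rightarrow>\<^sub>E Q)) \<le> r ^ (16 * card I)" using fI by (simp add: card_PiE q power_mult)
      show "T \<union> I \<subseteq> V" using I T by auto
    qed
    have part: "(\<Sum>y\<in>C. f y) = (\<Sum>\<beta>\<in>I \<rightarrow>\<^sub>E Q. \<Sum>y\<in>{y \<in> C. restrict y I = \<beta>}. f y)"
      if "C \<subseteq> X" "I \<subseteq> V - T" "finite C" "finite (I \<rightarrow>\<^sub>E Q)" for C I and f :: "('v \<Rightarrow> 'q) \<Rightarrow> real"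
      using that X_val[OF _ that(1)] by (intro sum.group[symmetric]) auto
    consider "d \<le> card T" | "card T < d" "dense (V - T) A" "dense (V - T) B"
      | "\<not> dense (V - T) A" | "\<not> dense (V - T) B" by linarith
    then show ?thesis
    proof cases
      \<comment> \<open>The sides lie in subcubes with only the blocks of \<open>V - T\<close> free,
        and \<open>r ^ card T\<close> absorbs \<open>r ^ d\<close>.\<close>
      case 1
      have small: "real (card C) \<le> r ^ (16 * card (V - T))" if C: "C \<subseteq> X" "x \<in> C" and cC: "cst T C" for C x
      proof -
        have "C \<subseteq> ag T x X" using C cC unfolding ag_def cst_def by blast
        then have "card C \<le> card (ag T x X)" by (intro card_mono) (auto simp: ag_def)
        then show ?thesis using card_ag_X[OF T, of x] C by (metis of_nat_mono subsetD)
      qed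
      have small2: "real (card A) \<le> r ^ (16 * card (V - T))" "real (card B) \<le> r ^ (16 * card (V - T))"
        using small[OF A x0 cA] small[OF B y0 cB] by blast+
      let ?a = "real (card A)" and ?b = "real (card B)"
      have "D A B \<le> (\<Sum>x\<in>A. \<Sum>y\<in>B. 1)" unfolding D_def
      proof (intro sum_mono)
        fix x y assume "x \<in> A" "y \<in> B"
        then show "(1 - \<eta>) * c - h (G x y) \<le> 1" using hG[of x y] c'1 by linarith
      qed
      then have "D A B \<le> ?a * ?b" by simp
      also have "\<dots> = sqrt (?a * ?b) * sqrt (?a * ?b)" by simp
      also have "\<dots> \<le> sqrt (?a * ?b) * r ^ (16 * card (V - T))"
      proof (rule mult_left_mono)
        have "?a * ?b \<le> r ^ (16 * card (V - T)) * r ^ (16 * card (V - T))"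
          using small2 r0[of "16 * card (V - T)"] by (intro mult_mono) auto
        then show "sqrt (?a * ?b) \<le> r ^ (16 * card (V - T))"
          using r0[of "16 * card (V - T)"] by (intro real_le_lsqrt) (auto simp: power2_eq_square)
      qed simp
      finally have "D A B * r ^ d \<le> sqrt (?a * ?b) * r ^ (16 * card (V - T)) * r ^ d"
        using r0[of d] by (intro mult_right_mono) auto
      also have "\<dots> \<le> sqrt (?a * ?b) * r ^ (16 * card (V - T)) * r ^ card T"
        using 1 r by (intro mult_left_mono power_increasing) auto
      finally show ?thesis by (simp add: D_def power_add mult_ac)
    next
      \<comment> \<open>The gadget outputs are nearly uniform on a subcube of codimension below
        \<open>d\<close>, where \<open>h\<close> has average at least \<open>c\<close>. The left
        side is then not positive.\<close>
      case 2
      define \<rho> where "\<rho> = G x0 y0"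
      have \<rho>: "\<rho> \<in> Z" unfolding \<rho>_def using x0 y0 A B by (intro G_Z) auto
      have agT: "g (x v) (y v) = \<rho> v" if "x \<in> A" "y \<in> B" "v \<in> T" for x y v
      proof -
        have "x v = x0 v" "y v = y0 v" using cA x0 cB y0 that unfolding cst_def by blast+
        moreover have "v \<in> V" using that T by auto
        ultimately show ?thesis by (simp add: \<rho>_def G_def)
      qed
      let ?ab = "real (card A) * card B"
      have "(1 - \<eta>) * c \<le> (1 - \<eta>) * avg (ag T \<rho> Z) h" using H[OF T 2(1) \<rho>] by (rule mult_left_mono) (use \<eta> in simp)
      then have "?ab * ((1 - \<eta>) * c) \<le> ?ab * ((1 - \<eta>) * avg (ag T \<rho> Z) h)" by (rule mult_left_mono) simp
      moreover have "\<bar>(\<Sum>x\<in>A. \<Sum>y\<in>B. h (G x y)) - ?ab * avg (ag T \<rho> Z) h\<bar> \<le> ?ab * \<eta> * avg (ag T \<rho> Z) h"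
        by (rule dense_sum[OF A B T 2(2,3) _ \<rho> h0]) (rule agT)
      ultimately have "D A B \<le> 0" unfolding D_def sum_subtractf by (simp add: algebra_simps abs_le_iff)
      then have "D A B * r ^ d \<le> 0" using r0[of d] by (simp add: mult_le_0_iff)
      moreover have "0 \<le> sqrt ?ab * r ^ (16 * card (V - T) + card T)"
        using r by (intro mult_nonneg_nonneg) auto
      ultimately show ?thesis unfolding D_def by linarith
    next
      \<comment> \<open>Some pattern on \<open>I\<close> is over-represented in \<open>A\<close>.
        Its slice is split off and paired with the fibres of \<open>B\<close> over all patterns on
        \<open>I\<close>, so that these blocks become constant on both sides. The rest of
        \<open>A\<close> keeps \<open>T\<close>.\<close>
      case 3
      then obtain I x where I: "I \<subseteq> V - T" "I \<noteq> {}" "x \<in> A" "real (card A) < real (card (ag I x A)) * r ^ (12 * card I)" using agI by blast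
      note su = extend[OF I(1,2)]
      let ?A = "ag I x A" and ?B = "\<lambda>\<beta>. {y \<in> B. restrict y I = \<beta>}" and ?P = "I \<rightarrow>\<^sub>E Q"
      let ?\<Phi> = "r ^ (16 * card (V - (T \<union> I)) + card (T \<union> I))"
      have sub: "?A \<subseteq> A" "x \<in> ?A" using I by (auto simp: ag_def)
      have cards: "card ?A \<le> card A" "0 < card ?A" "card (A - ?A) = card A - card ?A"
        using sub fin finite_subset[OF sub(1)] by (auto simp: card_mono card_gt_0_iff card_Diff_subset)
      have "D A B = D (A - ?A) B + D ?A B"
        unfolding D_def by (rule sum.subset_diff[OF sub(1) fin(1)])
      also have "D ?A B = (\<Sum>\<beta>\<in>?P. D ?A (?B \<beta>))"
        unfolding D_def part[OF B I(1) fin(2) su(5)] by (rule sum.swap)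
      finally have "D A B * r ^ d = D (A - ?A) B * r ^ d + (\<Sum>\<beta>\<in>?P. D ?A (?B \<beta>) * r ^ d)"
        by (simp add: distrib_right sum_distrib_right)
      also have "\<dots> \<le> sqrt ((real (card A) - card ?A) * card B) * (?\<Phi> * r ^ (15 * card I)) + (\<Sum>\<beta>\<in>?P. sqrt (real (card ?A) * card (?B \<beta>)) * ?\<Phi>)"
      proof (intro add_mono sum_mono)
        have "D (A - ?A) B * r ^ d \<le> sqrt (real (card (A - ?A)) * card B) * r ^ (16 * card (V - T) + card T)"
          unfolding D_def using cards A B T cst_subset[OF cA] cB by (intro less.hyps) auto
        then show "D (A - ?A) B * r ^ d \<le> sqrt ((real (card A) - card ?A) * card B) * (?\<Phi> * r ^ (15 * card I))"
          unfolding su(4) using cards by (simp add: of_nat_diff)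
        fix \<beta>
        have "card (?B \<beta>) \<le> card B" using fin by (intro card_mono) auto
        then show "D ?A (?B \<beta>) * r ^ d \<le> sqrt (real (card ?A) * card (?B \<beta>)) * ?\<Phi>"
          unfolding D_def using cards sub A B su(3,7) cst_ag[OF cA] cst_fibre[OF cB]
          by (intro less.hyps) auto
      qed
      also have "\<dots> \<le> sqrt (real (card A) * card B) * (?\<Phi> * r ^ (15 * card I))"
      proof (rule split_real[OF r])
        show "(\<Sum>\<beta>\<in>?P. real (card (?B \<beta>))) = card B" using part[OF B I(1) fin(2) su(5), of "\<lambda>_. 1"] by simp
      qed (use cards I su r0 in \<open>auto simp: less_imp_le\<close>)
      finally show ?thesis unfolding su(4) D_def .
    next
      case 4
      then obtain I x where I: "I \<subseteq> V - T" "I \<noteq> {}" "x \<in> B" "real (card B) < real (card (ag I x B)) * r ^ (12 * card I)" using agI by blast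
      note su = extend[OF I(1,2)]
      let ?B = "ag I x B" and ?A = "\<lambda>\<beta>. {y \<in> A. restrict y I = \<beta>}" and ?P = "I \<rightarrow>\<^sub>E Q"
      let ?\<Phi> = "r ^ (16 * card (V - (T \<union> I)) + card (T \<union> I))"
      have sub: "?B \<subseteq> B" "x \<in> ?B" using I by (auto simp: ag_def)
      have cards: "card ?B \<le> card B" "0 < card ?B" "card (B - ?B) = card B - card ?B"
        using sub fin finite_subset[OF sub(1)] by (auto simp: card_mono card_gt_0_iff card_Diff_subset)
      have "D A B = D A (B - ?B) + D A ?B"
        unfolding D_def sum.distrib[symmetric] by (rule sum.cong[OF refl], rule sum.subset_diff[OF sub(1) fin(2)])
      also have "D A ?B = (\<Sum>\<beta>\<in>?P. D (?A \<beta>) ?B)"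
        unfolding D_def by (rule part[OF A I(1) fin(1) su(5)])
      finally have "D A B * r ^ d = D A (B - ?B) * r ^ d + (\<Sum>\<beta>\<in>?P. D (?A \<beta>) ?B * r ^ d)"
        by (simp add: distrib_right sum_distrib_right)
      also have "\<dots> \<le> sqrt ((real (card B) - card ?B) * card A) * (?\<Phi> * r ^ (15 * card I)) + (\<Sum>\<beta>\<in>?P. sqrt (real (card ?B) * card (?A \<beta>)) * ?\<Phi>)"
      proof (intro add_mono sum_mono)
        have "D A (B - ?B) * r ^ d \<le> sqrt (real (card A) * card (B - ?B)) * r ^ (16 * card (V - T) + card T)"
          unfolding D_def using cards A B T cst_subset[OF cB] cA by (intro less.hyps) auto
        then show "D A (B - ?B) * r ^ d \<le> sqrt ((real (card B) - card ?B) * card A) * (?\<Phi> * r ^ (15 * card I))"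
          unfolding su(4) using cards by (simp add: of_nat_diff mult.commute)
        fix \<beta>
        have "card (?A \<beta>) \<le> card A" using fin by (intro card_mono) auto
        then have "D (?A \<beta>) ?B * r ^ d \<le> sqrt (real (card (?A \<beta>)) * card ?B) * ?\<Phi>"
          unfolding D_def using cards sub A B su(3,7) cst_ag[OF cB] cst_fibre[OF cA]
          by (intro less.hyps) auto
        then show "D (?A \<beta>) ?B * r ^ d \<le> sqrt (real (card ?B) * card (?A \<beta>)) * ?\<Phi>" by (simp add: mult.commute)
      qed
      also have "\<dots> \<le> sqrt (real (card B) * card A) * (?\<Phi> * r ^ (15 * card I))"
      proof (rule split_real[OF r])
        show "(\<Sum>\<beta>\<in>?P. real (card (?A \<beta>))) = card A" using part[OF A I(1) fin(1) su(5), of "\<lambda>_. 1"] by simp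
      qed (use cards I su r0 in \<open>auto simp: less_imp_le\<close>)
      finally show ?thesis unfolding su(4) D_def by (simp add: mult.commute)
    qed
  qed
qed

lemma rectangle_bound:
  fixes h :: "('v \<Rightarrow> real) \<Rightarrow> real"
  assumes h0: "\<And>z. z \<in> Z \<Longrightarrow> 0 \<le> h z" and c: "0 \<le> c" "c \<le> 1" and \<eta>: "\<eta> \<le> 1"
    and H: "\<And>T \<rho>. T \<subseteq> V \<Longrightarrow> card T < d \<Longrightarrow> \<rho> \<in> Z \<Longrightarrow> c \<le> avg (ag T \<rho> Z) h"
    and A: "A \<subseteq> X" and B: "B \<subseteq> X"
  shows "(\<Sum>x\<in>A. \<Sum>y\<in>B. (1 - \<eta>) * c - h (G x y)) \<le> (real (card X))\<^sup>2 / r ^ d"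
proof -
  have "(\<Sum>x\<in>A. \<Sum>y\<in>B. (1 - \<eta>) * c - h (G x y)) * r ^ d \<le> sqrt (real (card A) * card B) * r ^ (16 * card (V - {}) + card ({} :: 'v set))"
    using A B by (intro rectangle[OF h0 c \<eta> H]) (auto simp: cst_def)
  also have "\<dots> = sqrt (real (card A) * card B) * card X" by (simp only: card_X) simp
  also have "\<dots> \<le> real (card X) * real (card X)"
  proof (rule mult_right_mono)
    have "real (card A) * card B \<le> card X * card X" unfolding of_nat_mult using A B by (intro mult_mono of_nat_mono card_mono) auto
    then show "sqrt (real (card A) * card B) \<le> card X" by (intro real_le_lsqrt) (auto simp: power2_eq_square)
  qed simp
  finally show ?thesis using r by (simp add: pos_le_divide_eq power2_eq_square)
qed

end

text \<open>Each node cuts one side in two, so the rejected inputs of a tree form at most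
  \<open>2 ^ depth t\<close> disjoint rectangles.\<close>

lemma tree_sum_le:
  fixes w :: "point \<Rightarrow> point \<Rightarrow> real"
  assumes "\<And>A B. A \<subseteq> C \<Longrightarrow> B \<subseteq> C \<Longrightarrow> (\<Sum>x\<in>A. \<Sum>y\<in>B. w x y) \<le> K" and K: "0 \<le> K" and C: "finite C"
    and "A \<subseteq> C" "B \<subseteq> C"
  shows "(\<Sum>x\<in>A. \<Sum>y\<in>B. if run t x y then 0 else w x y) \<le> 2 ^ depth t * K"
  using assms(4,5)
proof (induction t arbitrary: A B)
  case (Out b)
  then show ?case using assms(1) K by (cases b) auto
next
  case (Alice a t0 t1)
  have fin: "finite A" using Alice.prems C finite_subset by blast
  let ?m = "max (depth t0) (depth t1)"
  have "(\<Sum>x\<in>A. \<Sum>y\<in>B. if run (Alice a t0 t1) x y then 0 else w x y)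
      = (\<Sum>x\<in>{x \<in> A. a x}. \<Sum>y\<in>B. if run (Alice a t0 t1) x y then 0 else w x y) + (\<Sum>x\<in>{x \<in> A. \<not> a x}. \<Sum>y\<in>B. if run (Alice a t0 t1) x y then 0 else w x y)"
    using fin by (subst sum.union_disjoint[symmetric]) (auto intro!: sum.cong)
  also have "(\<Sum>x\<in>{x \<in> A. a x}. \<Sum>y\<in>B. if run (Alice a t0 t1) x y then 0 else w x y) = (\<Sum>x\<in>{x \<in> A. a x}. \<Sum>y\<in>B. if run t1 x y then 0 else w x y)"
    by (intro sum.cong refl) auto
  also have "(\<Sum>x\<in>{x \<in> A. \<not> a x}. \<Sum>y\<in>B. if run (Alice a t0 t1) x y then 0 else w x y) = (\<Sum>x\<in>{x \<in> A. \<not> a x}. \<Sum>y\<in>B. if run t0 x y then 0 else w x y)"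
    by (intro sum.cong refl) auto
  also have "(\<Sum>x\<in>{x \<in> A. a x}. \<Sum>y\<in>B. if run t1 x y then 0 else w x y) \<le> 2 ^ depth t1 * K"
    using Alice.prems by (intro Alice.IH) auto
  also have "\<dots> \<le> 2 ^ ?m * K" using K by (intro mult_right_mono power_increasing) auto
  also have "(\<Sum>x\<in>{x \<in> A. \<not> a x}. \<Sum>y\<in>B. if run t0 x y then 0 else w x y) \<le> 2 ^ depth t0 * K"
    using Alice.prems by (intro Alice.IH) auto
  also have "\<dots> \<le> 2 ^ ?m * K" using K by (intro mult_right_mono power_increasing) auto
  finally show ?case by (simp add: mult_ac)
next
  case (Bob b t0 t1)
  have fin: "finite B" using Bob.prems C finite_subset by blast
  let ?m = "max (depth t0) (depth t1)"
  have "(\<Sum>x\<in>A. \<Sum>y\<in>B. if run (Bob b t0 t1) x y then 0 else w x y)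
      = (\<Sum>x\<in>A. \<Sum>y\<in>{y \<in> B. b y}. if run (Bob b t0 t1) x y then 0 else w x y) + (\<Sum>x\<in>A. \<Sum>y\<in>{y \<in> B. \<not> b y}. if run (Bob b t0 t1) x y then 0 else w x y)"
    unfolding sum.distrib[symmetric]
    using fin by (intro sum.cong refl) (subst sum.union_disjoint[symmetric], auto intro!: sum.cong)
  also have "(\<Sum>x\<in>A. \<Sum>y\<in>{y \<in> B. b y}. if run (Bob b t0 t1) x y then 0 else w x y) = (\<Sum>x\<in>A. \<Sum>y\<in>{y \<in> B. b y}. if run t1 x y then 0 else w x y)"
    by (intro sum.cong refl) auto
  also have "(\<Sum>x\<in>A. \<Sum>y\<in>{y \<in> B. \<not> b y}. if run (Bob b t0 t1) x y then 0 else w x y) = (\<Sum>x\<in>A. \<Sum>y\<in>{y \<in> B. \<not> b y}. if run t0 x y then 0 else w x y)"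
    by (intro sum.cong refl) auto
  also have "(\<Sum>x\<in>A. \<Sum>y\<in>{y \<in> B. b y}. if run t1 x y then 0 else w x y) \<le> 2 ^ depth t1 * K"
    using Bob.prems by (intro Bob.IH) auto
  also have "\<dots> \<le> 2 ^ ?m * K" using K by (intro mult_right_mono power_increasing) auto
  also have "(\<Sum>x\<in>A. \<Sum>y\<in>{y \<in> B. \<not> b y}. if run t0 x y then 0 else w x y) \<le> 2 ^ depth t0 * K"
    using Bob.prems by (intro Bob.IH) auto
  also have "\<dots> \<le> 2 ^ ?m * K" using K by (intro mult_right_mono power_increasing) auto
  finally show ?case by (simp add: mult_ac)
qed

section \<open>Sign strings as lists of layers, and the form as a path\<close>

lemma avg_Times: "avg (A \<times> B) F = avg A (\<lambda>a. avg B (\<lambda>b. F (a, b)))"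
proof -
  have "sum F (A \<times> B) = (\<Sum>a\<in>A. \<Sum>b\<in>B. F (a, b))" by (simp add: sum.cartesian_product)
  then show ?thesis by (simp add: avg_def card_cartesian_product sum_divide_distrib mult.commute)
qed

lemma avg_PiE_insert:
  assumes "p \<notin> S"
  shows "avg (PiE (insert p S) A) F = avg (PiE S A) (\<lambda>w. avg (A p) (\<lambda>z. F (w(p := z))))"
proof -
  have "bij_betw (\<lambda>(y, g). g(p := y)) (A p \<times> PiE S A) (PiE (insert p S) A)"
    unfolding bij_betw_def PiE_insert_eq using inj_combinator[OF assms, of A] by simp
  from avg_bij[OF this, of F]
  have "avg (PiE (insert p S) A) F = avg (A p \<times> PiE S A) (\<lambda>a. F (case a of (y, g) \<Rightarrow> g(p := y)))" by simp
  then show ?thesis by (simp add: avg_Times) (rule avg_swap)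
qed

lemma avl_PiE:
  "distinct ps \<Longrightarrow> avl (map A ps) f = avg (PiE (set ps) A) (\<lambda>w. f (map w ps))"
proof (induction ps arbitrary: f)
  case (Cons p ps)
  have "map (w(p := z)) ps = map w ps" for w z using Cons.prems by (intro map_cong) auto
  then show ?case using Cons by (simp add: avg_PiE_insert)
qed simp

definition lay :: "nat \<Rightarrow> (nat \<times> nat \<Rightarrow> real) \<Rightarrow> nat \<Rightarrow> nat \<Rightarrow> real" where
  "lay n z p = (\<lambda>i\<in>{..<n}. z (p, i))"

abbreviation sgns :: "nat \<Rightarrow> nat \<Rightarrow> (nat \<times> nat \<Rightarrow> real) set" where
  "sgns m n \<equiv> ({..<m} \<times> {..<n}) \<rightarrow>\<^sub>E {-1, 1}"

lemma lay_cb: "z \<in> sgns m n \<Longrightarrow> p < m \<Longrightarrow> lay n z p \<in> cb n"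
  unfolding lay_def cb_def by (intro PiE_I) (auto dest: PiE_mem)

lemma bij_layers:
  assumes \<rho>: "\<rho> \<in> sgns m n" and T: "T \<subseteq> {..<m} \<times> {..<n}"
  shows "bij_betw (\<lambda>z. \<lambda>p\<in>{..<m}. lay n z p) (ag T \<rho> (sgns m n)) (\<Pi>\<^sub>E p\<in>{..<m}. cyl n {i. (p, i) \<in> T} (lay n \<rho> p))"
proof (rule bij_betw_byWitness[where f' = "\<lambda>w. \<lambda>(p, i)\<in>{..<m} \<times> {..<n}. w p i"])
  show "\<forall>z\<in>ag T \<rho> (sgns m n). (\<lambda>(p, i)\<in>{..<m} \<times> {..<n}. (\<lambda>p\<in>{..<m}. lay n z p) p i) = z"
  proof
    fix z assume "z \<in> ag T \<rho> (sgns m n)"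
    then have z: "z \<in> sgns m n" by (simp add: ag_def)
    show "(\<lambda>(p, i)\<in>{..<m} \<times> {..<n}. (\<lambda>p\<in>{..<m}. lay n z p) p i) = z"
    proof
      fix v :: "nat \<times> nat"
      show "(\<lambda>(p, i)\<in>{..<m} \<times> {..<n}. (\<lambda>p\<in>{..<m}. lay n z p) p i) v = z v"
        using PiE_arb[OF z, of v] by (cases v) (auto simp: lay_def)
    qed
  qed
  show "\<forall>w\<in>\<Pi>\<^sub>E p\<in>{..<m}. cyl n {i. (p, i) \<in> T} (lay n \<rho> p). (\<lambda>p\<in>{..<m}. lay n (\<lambda>(p, i)\<in>{..<m} \<times> {..<n}. w p i) p) = w"
  proof
    fix w assume w: "w \<in> (\<Pi>\<^sub>E p\<in>{..<m}. cyl n {i. (p, i) \<in> T} (lay n \<rho> p))"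
    have wp: "w p \<in> cb n" if "p < m" for p
      using PiE_mem[OF w, of p] cyl_subset[OF lay_cb[OF \<rho> that]] that by auto
    show "(\<lambda>p\<in>{..<m}. lay n (\<lambda>(p, i)\<in>{..<m} \<times> {..<n}. w p i) p) = w"
    proof
      fix p
      show "(\<lambda>p\<in>{..<m}. lay n (\<lambda>(p, i)\<in>{..<m} \<times> {..<n}. w p i) p) p = w p"
      proof (cases "p < m")
        case True
        have "lay n (\<lambda>(p, i)\<in>{..<m} \<times> {..<n}. w p i) p i = w p i" for i
          using wp[OF True] True PiE_arb[of "w p" "{..<n}" "\<lambda>_. {-1, 1}" i] by (auto simp: lay_def cb_def)
        then show ?thesis using True by auto
      next
        case False
        then show ?thesis using PiE_arb[OF w, of p] by simp
      qed
    qed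
  qed
  show "(\<lambda>z. \<lambda>p\<in>{..<m}. lay n z p) ` ag T \<rho> (sgns m n) \<subseteq> (\<Pi>\<^sub>E p\<in>{..<m}. cyl n {i. (p, i) \<in> T} (lay n \<rho> p))"
  proof clarify
    fix z assume z: "z \<in> ag T \<rho> (sgns m n)"
    show "(\<lambda>p\<in>{..<m}. lay n z p) \<in> (\<Pi>\<^sub>E p\<in>{..<m}. cyl n {i. (p, i) \<in> T} (lay n \<rho> p))"
    proof (intro PiE_I)
      fix p assume p: "p \<in> {..<m}"
      then have "lay n z p \<in> cb n" using z by (intro lay_cb) (auto simp: ag_def)
      then show "(\<lambda>p\<in>{..<m}. lay n z p) p \<in> cyl n {i. (p, i) \<in> T} (lay n \<rho> p)"
        using p z lay_cb[OF \<rho>, of p] by (auto simp: cyl_eq ag_def lay_def)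
    qed simp
  qed
  show "(\<lambda>w. \<lambda>(p, i)\<in>{..<m} \<times> {..<n}. w p i) ` (\<Pi>\<^sub>E p\<in>{..<m}. cyl n {i. (p, i) \<in> T} (lay n \<rho> p)) \<subseteq> ag T \<rho> (sgns m n)"
  proof clarify
    fix w assume w: "w \<in> (\<Pi>\<^sub>E p\<in>{..<m}. cyl n {i. (p, i) \<in> T} (lay n \<rho> p))"
    have wp: "w p \<in> cb n" "\<And>i. i < n \<Longrightarrow> (p, i) \<in> T \<Longrightarrow> w p i = \<rho> (p, i)" if "p < m" for p
    proof -
      have wc: "w p \<in> cyl n {i. (p, i) \<in> T} (lay n \<rho> p)" using PiE_mem[OF w, of p] that by simp
      show "w p \<in> cb n" using wc unfolding cyl_eq[OF lay_cb[OF \<rho> that]] by simp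
      show "w p i = \<rho> (p, i)" if "i < n" "(p, i) \<in> T" for i
        using wc that unfolding cyl_eq[OF lay_cb[OF \<rho> \<open>p < m\<close>]] by (simp add: lay_def)
    qed
    have "(\<lambda>(p, i)\<in>{..<m} \<times> {..<n}. w p i) \<in> sgns m n"
    proof (intro PiE_I)
      fix v :: "nat \<times> nat" assume "v \<in> {..<m} \<times> {..<n}"
      then show "(\<lambda>(p, i)\<in>{..<m} \<times> {..<n}. w p i) v \<in> {-1, 1}"
        using cb_values[OF wp(1), of "fst v" "snd v"] by (cases v) auto
    qed simp
    then show "(\<lambda>(p, i)\<in>{..<m} \<times> {..<n}. w p i) \<in> ag T \<rho> (sgns m n)"
      using wp(2) T unfolding ag_def by (intro CollectI conjI ballI) auto
  qed
qed

lemma avg_layers: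
  assumes "\<rho> \<in> sgns m n" "T \<subseteq> {..<m} \<times> {..<n}" "distinct ps" "set ps = {..<m}"
  shows "avg (ag T \<rho> (sgns m n)) (\<lambda>z. f (map (lay n z) ps)) = avl (map (\<lambda>p. cyl n {i. (p, i) \<in> T} (lay n \<rho> p)) ps) f"
proof -
  have "map (\<lambda>p\<in>{..<m}. lay n z p) ps = map (lay n z) ps" for z using assms(4) by (intro map_cong) auto
  then have "avg (ag T \<rho> (sgns m n)) (\<lambda>z. f (map (lay n z) ps)) = avg (\<Pi>\<^sub>E p\<in>{..<m}. cyl n {i. (p, i) \<in> T} (lay n \<rho> p)) (\<lambda>w. f (map w ps))"
    using avg_bij[OF bij_layers[OF assms(1,2)], of "\<lambda>w. f (map w ps)"] by (simp only:)
  then show ?thesis by (simp only: avl_PiE[OF assms(3)] assms(4))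
qed

text \<open>Position \<open>k\<close> of the path is the middle layer; the other layers are listed outwards from it.\<close>

definition ord :: "nat \<Rightarrow> nat list" where
  "ord k = k # rev [0..<k] @ [Suc k..<2 * k + 1]"

lemma ord: "distinct (ord k)" "set (ord k) = {..<2 * k + 1}" "length (ord k) = 2 * k + 1"
  by (auto simp: ord_def)

context forr
begin

definition "hh k z = dens n M k (map (lay n z) (ord k))"
definition "ph k z = phi n M k (map (lay n z) (ord k))"

lemma hh_nonneg: "z \<in> sgns (2 * k + 1) n \<Longrightarrow> 0 \<le> hh k z"
  unfolding hh_def using ord(2)[of k] lay_cb[of z "2 * k + 1" n] by (intro dens_nonneg) (auto simp: ord_def)

lemma avg_sgns: "avg (sgns (2 * k + 1) n) (\<lambda>z. f (map (lay n z) (ord k))) = avl (cubes (2 * k + 1)) f"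
proof -
  let ?\<rho> = "\<lambda>v\<in>{..<2 * k + 1} \<times> {..<n}. 1 :: real"
  have \<rho>: "?\<rho> \<in> sgns (2 * k + 1) n" by auto
  have "map (\<lambda>p. cyl n {i. (p, i) \<in> {}} (lay n ?\<rho> p)) (ord k) = map (\<lambda>_. cb n) (ord k)"
    by (intro map_cong) (auto simp: cyl_def cb_def)
  also have "\<dots> = cubes (2 * k + 1)" by (simp add: map_replicate_const ord(3))
  finally show ?thesis using avg_layers[OF \<rho> _ ord(1) ord(2), of "{}" f] by (simp add: ag_def)
qed

lemma avg_hh: "avg (sgns (2 * k + 1) n) (hh k) = 1"
  unfolding hh_def avg_sgns by (rule avl_dens_1)

lemma avg_hh_ph: "avg (sgns (2 * k + 1) n) (\<lambda>z. hh k z * (ph k z - cc ^ (2 * k))\<^sup>2) \<le> 2 ^ (k + 3) / n"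
  unfolding hh_def ph_def avg_sgns[of k "\<lambda>zs. dens n M k zs * (phi n M k zs - cc ^ (2 * k))\<^sup>2"] by (rule phi_dens)

lemma avg_ph: "0 < k \<Longrightarrow> avg (sgns (2 * k + 1) n) (\<lambda>z. (ph k z)\<^sup>2) \<le> 1 / n"
  unfolding ph_def avg_sgns[of k "\<lambda>zs. (phi n M k zs)\<^sup>2"] by (rule phi_uniform)

text \<open>A fixing of \<open>card T \<le> d\<close> signs in total fixes at most \<open>d\<close>
  in each layer, so every minor met along the path is covered.\<close>

lemma avg_hh_subcube:
  assumes k: "0 < k" and T: "T \<subseteq> {..<2 * k + 1} \<times> {..<n}" "card T \<le> d" and \<rho>: "\<rho> \<in> sgns (2 * k + 1) n"
    and \<sigma>: "0 < \<sigma>" "\<sigma> \<le> 1"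
    and minors: "\<And>T T'. T \<subseteq> {..<n} \<Longrightarrow> T' \<subseteq> {..<n} \<Longrightarrow> card T \<le> d \<Longrightarrow> card T' \<le> d \<Longrightarrow> minor_le M T T' \<sigma>"
  shows "1 - 2 * sqrt (6 * ((6 * \<sigma>\<^sup>2) ^ k * n)) \<le> avg (ag T \<rho> (sgns (2 * k + 1) n)) (hh k)"
proof -
  define X where "X p = ({i. (p, i) \<in> T}, lay n \<rho> p)" for p
  have X: "fst (X p) \<subseteq> {..<n} \<and> snd (X p) \<in> cb n \<and> card (fst (X p)) \<le> d" if "p < 2 * k + 1" for p
  proof -
    have "finite T" using T(1) by (rule finite_subset) auto
    moreover have "Pair p ` {i. (p, i) \<in> T} \<subseteq> T" by auto
    ultimately have "card (Pair p ` {i. (p, i) \<in> T}) \<le> card T" by (rule card_mono)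
    then have "card {i. (p, i) \<in> T} \<le> card T" by (subst (asm) card_image) (auto simp: inj_on_def)
    then show ?thesis using T lay_cb[OF \<rho> that] by (auto simp: X_def)
  qed
  have "avg (ag T \<rho> (sgns (2 * k + 1) n)) (hh k) = avl (map (\<lambda>p. cyl n {i. (p, i) \<in> T} (lay n \<rho> p)) (ord k)) (dens n M k)"
    unfolding hh_def by (rule avg_layers[OF \<rho> T(1) ord(1,2)])
  also have "map (\<lambda>p. cyl n {i. (p, i) \<in> T} (lay n \<rho> p)) (ord k)
      = cyl n (fst (X k)) (snd (X k)) # map (\<lambda>x. cyl n (fst x) (snd x)) (map X (rev [0..<k]) @ map X [Suc k..<2 * k + 1])"
    by (simp add: ord_def X_def del: upt_Suc)
  finally have eq: "avg (ag T \<rho> (sgns (2 * k + 1) n)) (hh k)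
      = avl (cyl n (fst (X k)) (snd (X k)) # map (\<lambda>x. cyl n (fst x) (snd x)) (map X (rev [0..<k]) @ map X [Suc k..<2 * k + 1])) (dens n M k)" .
  show ?thesis unfolding eq
  proof (rule dens_subcube[where d = d])
    fix y assume "y \<in> set (map X (rev [0..<k])) \<union> set (map X [Suc k..<2 * k + 1])"
    then have "y \<in> X ` ({0..<k} \<union> {Suc k..<2 * k + 1})" by (simp add: image_Un del: upt_Suc)
    then obtain p where "p \<in> {0..<k} \<union> {Suc k..<2 * k + 1}" "y = X p" by (rule imageE)
    then have "p < 2 * k + 1" "y = X p" by auto
    then show "fst y \<subseteq> {..<n} \<and> snd y \<in> cb n \<and> card (fst y) \<le> d" using X by blast
  qed (use X[of k] k \<sigma> minors in \<open>auto simp del: upt_Suc\<close>)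
qed

text \<open>The path vector read from layer 0 upwards, in the order in which the quantum protocol
  produces it; \<open>lvec\<close> is read outwards from the middle.\<close>

primrec pa :: "(nat \<times> nat \<Rightarrow> real) \<Rightarrow> nat \<Rightarrow> nat \<Rightarrow> real" where
  "pa z 0 j = 1"
| "pa z (Suc p) j = (\<Sum>s<n. M s j * (z (p, s) * pa z p s))"

lemma lvec_pa: "j < n \<Longrightarrow> lvec n M (map (lay n z) (rev [0..<p])) j = pa z p j"
proof (induction p arbitrary: j)
  case (Suc p)
  have "lvec n M (map (lay n z) (rev [0..<Suc p])) j = (\<Sum>i<n. M j i * (lay n z p i * lvec n M (map (lay n z) (rev [0..<p])) i))"
    by simp
  also have "\<dots> = (\<Sum>i<n. M i j * (z (p, i) * pa z p i))"
  proof (rule sum.cong[OF refl])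
    fix i assume "i \<in> {..<n}"
    show "M j i * (lay n z p i * lvec n M (map (lay n z) (rev [0..<p])) i) = M i j * (z (p, i) * pa z p i)"
    proof -
      have l: "lay n z p i = z (p, i)" using \<open>i \<in> {..<n}\<close> by (simp add: lay_def)
      have ih: "lvec n M (map (lay n z) (rev [0..<p])) i = pa z p i" using \<open>i \<in> {..<n}\<close> by (intro Suc.IH) simp
      show ?thesis by (simp only: l ih M_sym[of j i])
    qed
  qed
  finally show ?case by simp
qed simp

text \<open>The cut of the form can be moved: exchanging two sums shifts one copy of
  \<open>M\<close> from the right half to the left, until the cut is at the last layer.\<close>

lemma ph_path: "ph k z = (\<Sum>i<n. z (2 * k, i) * pa z (2 * k) i) / n"
proof -
  have "p \<le> 2 * k \<Longrightarrow> (\<Sum>i<n. lay n z p i * pa z p i * lvec n M (map (lay n z) [Suc p..<2 * k + 1]) i) = (\<Sum>i<n. z (2 * k, i) * pa z (2 * k) i)" for p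
  proof (induction rule: inc_induct)
    case base
    then show ?case by (simp add: lay_def)
  next
    case (step p)
    have "[Suc p..<2 * k + 1] = Suc p # [Suc (Suc p)..<2 * k + 1]" using step by (simp add: upt_conv_Cons)
    then have "(\<Sum>i<n. lay n z p i * pa z p i * lvec n M (map (lay n z) [Suc p..<2 * k + 1]) i)
        = (\<Sum>i<n. \<Sum>j<n. lay n z p i * pa z p i * (M i j * (lay n z (Suc p) j * lvec n M (map (lay n z) [Suc (Suc p)..<2 * k + 1]) j)))"
      by (simp only: list.map lvec.simps sum_distrib_left)
    also have "\<dots> = (\<Sum>j<n. \<Sum>i<n. lay n z p i * pa z p i * (M i j * (lay n z (Suc p) j * lvec n M (map (lay n z) [Suc (Suc p)..<2 * k + 1]) j)))"
      by (rule sum.swap)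
    also have "\<dots> = (\<Sum>j<n. lay n z (Suc p) j * pa z (Suc p) j * lvec n M (map (lay n z) [Suc (Suc p)..<2 * k + 1]) j)"
    proof (rule sum.cong[OF refl])
      fix j
      have "(\<Sum>i<n. lay n z p i * pa z p i * (M i j * (lay n z (Suc p) j * l))) = lay n z (Suc p) j * pa z (Suc p) j * l" for l
        unfolding pa.simps sum_distrib_left sum_distrib_right by (intro sum.cong) (auto simp: lay_def)
      then show "(\<Sum>i<n. lay n z p i * pa z p i * (M i j * (lay n z (Suc p) j * lvec n M (map (lay n z) [Suc (Suc p)..<2 * k + 1]) j)))
        = lay n z (Suc p) j * pa z (Suc p) j * lvec n M (map (lay n z) [Suc (Suc p)..<2 * k + 1]) j" .
    qed
    finally show ?case using step by simp
  qed
  from this[of k] have "(\<Sum>i<n. lay n z k i * lvec n M (map (lay n z) (rev [0..<k])) i * lvec n M (map (lay n z) [Suc k..<2 * k + 1]) i) = (\<Sum>i<n. z (2 * k, i) * pa z (2 * k) i)"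
    by (simp add: lvec_pa del: upt_Suc)
  then show ?thesis by (simp add: ph_def phi_def ord_def del: upt_Suc)
qed

end

section \<open>Quantum protocols built from real involutions\<close>

definition ip :: "'a set \<Rightarrow> ('a \<Rightarrow> real) \<Rightarrow> ('a \<Rightarrow> real) \<Rightarrow> real" where
  "ip J a b = (\<Sum>l\<in>J. a l * b l)"

definition dl :: "'a \<Rightarrow> 'a \<Rightarrow> real" where
  "dl l = (\<lambda>m. if m = l then 1 else 0)"

lemma ip_commute: "ip J a b = ip J b a"
  by (simp add: ip_def mult.commute)

lemma ip_dl: "finite J \<Longrightarrow> l \<in> J \<Longrightarrow> ip J (dl l) a = a l"
  by (simp add: ip_def dl_def if_distrib[of "\<lambda>t. t * _"] sum.delta cong: if_cong)

lemma ip_diff: "ip J a (\<lambda>l. b l - c l) = ip J a b - ip J a c"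
  by (simp add: ip_def right_diff_distrib sum_subtractf)

lemma ip_sum: "ip J a (\<lambda>l. \<Sum>s\<in>K. b s l * c s) = (\<Sum>s\<in>K. ip J a (b s) * c s)"
proof -
  have "ip J a (\<lambda>l. \<Sum>s\<in>K. b s l * c s) = (\<Sum>l\<in>J. \<Sum>s\<in>K. a l * b s l * c s)"
    by (simp add: ip_def sum_distrib_left mult.assoc)
  also have "\<dots> = (\<Sum>s\<in>K. \<Sum>l\<in>J. a l * b s l * c s)" by (rule sum.swap)
  finally show ?thesis by (simp add: ip_def sum_distrib_right)
qed

text \<open>A symmetric involution is orthogonal and its own inverse, so a list of such operations
  is undone by its reversal.\<close>

definition invo :: "'a set \<Rightarrow> (('a \<Rightarrow> real) \<Rightarrow> 'a \<Rightarrow> real) \<Rightarrow> bool" where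
  "invo J f \<longleftrightarrow> (\<forall>a b. ip J (f a) b = ip J a (f b)) \<and> (\<forall>a. f (f a) = a)"

lemma invoD: "invo J f \<Longrightarrow> ip J (f a) b = ip J a (f b)" "invo J f \<Longrightarrow> f (f a) = a"
  by (simp_all add: invo_def)

lemma invo_symm:
  assumes "finite J" "invo J f" "l \<in> J" "m \<in> J"
  shows "f (dl l) m = f (dl m) l"
  using invoD(1)[OF assms(2), of "dl m" "dl l"] ip_dl[OF assms(1,3), of "f (dl m)"] ip_dl[OF assms(1,4), of "f (dl l)"]
  by (simp add: ip_commute)

lemma invo_expand:
  assumes "finite J" "invo J f" "l \<in> J"
  shows "f a l = (\<Sum>m\<in>J. f (dl m) l * a m)"
proof -
  have "f a l = ip J (f (dl l)) a" using ip_dl[OF assms(1,3), of "f a"] invoD(1)[OF assms(2), of "dl l" a] by simp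
  also have "\<dots> = (\<Sum>m\<in>J. f (dl m) l * a m)"
    unfolding ip_def by (intro sum.cong refl) (simp add: invo_symm[OF assms])
  finally show ?thesis .
qed

text \<open>For pairwise orthogonal \<open>d s\<close> of squared norm 2 this is the reflection that
  negates them. If each \<open>d s\<close> is a difference of two orthogonal unit vectors, it
  exchanges the two.\<close>

definition rfl :: "'a set \<Rightarrow> 's set \<Rightarrow> ('s \<Rightarrow> 'a \<Rightarrow> real) \<Rightarrow> ('a \<Rightarrow> real) \<Rightarrow> 'a \<Rightarrow> real" where
  "rfl J K d \<psi> = (\<lambda>l. \<psi> l - (\<Sum>s\<in>K. d s l * ip J (d s) \<psi>))"

lemma invo_rfl:
  assumes K: "finite K" and d: "\<And>s t. s \<in> K \<Longrightarrow> t \<in> K \<Longrightarrow> ip J (d s) (d t) = (if s = t then 2 else 0)"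
  shows "invo J (rfl J K d)"
  unfolding invo_def
proof (intro conjI allI)
  have e: "ip J b (rfl J K d a) = ip J b a - (\<Sum>s\<in>K. ip J b (d s) * ip J (d s) a)" for a b
    unfolding rfl_def ip_diff ip_sum ..
  show "ip J (rfl J K d a) b = ip J a (rfl J K d b)" for a b
    unfolding ip_commute[of J "rfl J K d a" b] e ip_commute[of J b a]
    by (simp add: ip_commute[of J b] ip_commute[of J _ a] mult.commute)
  fix a
  have "ip J (d s) (rfl J K d a) = - ip J (d s) a" if s: "s \<in> K" for s
  proof -
    have "(\<Sum>t\<in>K. ip J (d s) (d t) * ip J (d t) a) = (\<Sum>t\<in>K. if s = t then 2 * ip J (d t) a else 0)"
      using d[OF s] by (intro sum.cong) auto
    also have "\<dots> = 2 * ip J (d s) a" using K s by simp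
    finally show ?thesis unfolding e by simp
  qed
  then have "(\<Sum>s\<in>K. d s l * ip J (d s) (rfl J K d a)) = - (\<Sum>s\<in>K. d s l * ip J (d s) a)" for l
    by (simp add: sum_negf)
  then show "rfl J K d (rfl J K d a) = a" unfolding rfl_def[of J K d "rfl J K d a"] by (simp add: rfl_def)
qed

definition dsg :: "('a \<Rightarrow> real) \<Rightarrow> ('a \<Rightarrow> real) \<Rightarrow> 'a \<Rightarrow> real" where
  "dsg s \<psi> = (\<lambda>l. s l * \<psi> l)"

lemma invo_dsg: "(\<And>l. s l = 1 \<or> s l = -1) \<Longrightarrow> invo J (dsg s)"
  unfolding invo_def
proof (intro conjI allI)
  assume s: "\<And>l. s l = 1 \<or> s l = -1"
  show "ip J (dsg s a) b = ip J a (dsg s b)" for a b by (simp add: ip_def dsg_def mult_ac)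
  have "s l * (s l * a l) = a l" for a l using s[of l] by auto
  then show "dsg s (dsg s a) = a" for a by (intro ext) (simp only: dsg_def)
qed

definition flip :: "'a \<Rightarrow> ('a \<Rightarrow> real) \<Rightarrow> 'a \<Rightarrow> real" where
  "flip m = dsg (\<lambda>l. if l = m then -1 else 1)"

lemma invo_flip: "invo J (flip m)"
  unfolding flip_def by (rule invo_dsg) simp

lemma ip_flip:
  assumes "finite J" "m \<in> J"
  shows "ip J v (flip m \<psi>) = ip J v \<psi> - 2 * (v m * \<psi> m)"
proof -
  have "flip m \<psi> = (\<lambda>l. \<psi> l - 2 * \<psi> m * dl m l)" by (auto simp: flip_def dsg_def dl_def)
  then have "ip J v (flip m \<psi>) = ip J v \<psi> - 2 * \<psi> m * ip J v (dl m)"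
    by (simp only: ip_diff) (simp add: ip_def sum_distrib_left mult_ac)
  then show ?thesis using ip_dl[OF assms, of v] by (simp add: ip_commute[of J v])
qed

text \<open>The flag is true for an operation of Alice, which depends on \<open>x\<close>, and false
  for one of Bob.\<close>

type_synonym 'a qop = "bool \<times> (point \<Rightarrow> ('a \<Rightarrow> real) \<Rightarrow> 'a \<Rightarrow> real)"

definition opf :: "point \<Rightarrow> point \<Rightarrow> 'a qop \<Rightarrow> ('a \<Rightarrow> real) \<Rightarrow> 'a \<Rightarrow> real" where
  "opf x y p = snd p (if fst p then x else y)"

definition ev :: "point \<Rightarrow> point \<Rightarrow> 'a qop list \<Rightarrow> ('a \<Rightarrow> real) \<Rightarrow> 'a \<Rightarrow> real" where
  "ev x y ops = fold (opf x y) ops"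

lemma ev_Nil [simp]: "ev x y [] \<psi> = \<psi>" and ev_Cons [simp]: "ev x y (p # ps) \<psi> = ev x y ps (opf x y p \<psi>)"
  and ev_append: "ev x y (ps @ qs) \<psi> = ev x y qs (ev x y ps \<psi>)"
  by (simp_all add: ev_def)

definition good :: "'a set \<Rightarrow> 'a qop list \<Rightarrow> bool" where
  "good J ops \<longleftrightarrow> (\<forall>p\<in>set ops. \<forall>x. invo J (snd p x))"

lemma good_opf: "good J (p # ps) \<Longrightarrow> invo J (opf x y p)"
  by (simp add: good_def opf_def)

lemma ip_ev: "good J ops \<Longrightarrow> ip J (ev x y ops a) b = ip J a (ev x y (rev ops) b)"
proof (induction ops arbitrary: a)
  case (Cons p ps)
  then have "ip J (ev x y (p # ps) a) b = ip J (opf x y p a) (ev x y (rev ps) b)" by (simp add: good_def)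
  then show ?case using invoD(1)[OF good_opf[OF Cons.prems]] by (simp add: ev_append)
qed simp

lemma ev_rev: "good J ops \<Longrightarrow> ev x y (rev ops) (ev x y ops a) = a"
proof (induction ops arbitrary: a)
  case (Cons p ps)
  then have "ev x y (rev ps) (ev x y ps (opf x y p a)) = opf x y p a" by (simp add: good_def)
  then show ?case using invoD(2)[OF good_opf[OF Cons.prems]] by (simp add: ev_append)
qed simp

lemma good_rev [simp]: "good J (rev ops) \<longleftrightarrow> good J ops"
  and good_append [simp]: "good J (ops @ ops') \<longleftrightarrow> good J ops \<and> good J ops'"
  by (auto simp: good_def)

lemma ip_ev_ev: "good J ops \<Longrightarrow> ip J (ev x y ops a) (ev x y ops a) = ip J a a"
  by (simp add: ip_ev ev_rev)

text \<open>Each round flips the accepting label and then reflects at the prepared state, the latter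
  by conjugating the flip of the start label with \<open>W\<close>.\<close>

definition amp :: "'a \<Rightarrow> 'a \<Rightarrow> 'a qop list \<Rightarrow> nat \<Rightarrow> 'a qop list" where
  "amp st ac W j = W @ concat (replicate j ([(False, \<lambda>_. flip ac)] @ rev W @ [(False, \<lambda>_. flip st)] @ W))"

lemma good_amp: "good J W \<Longrightarrow> good J (amp st ac W j)"
  using invo_flip by (fastforce simp: good_def amp_def)

lemma length_amp: "length (amp st ac W j) = length W + j * (2 * length W + 2)"
  by (simp add: amp_def length_concat sum_list_replicate)

text \<open>It suffices to follow the amplitude at \<open>ac\<close> and the inner product with the
  prepared state: \<open>step\<close> is a closed recursion for the two, solved by the addition
  formulas.\<close>

lemma amplification:
  assumes J: "finite J" "st \<in> J" "ac \<in> J" and W: "good J W"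
    and \<theta>: "ev x y W (dl st) ac = sin \<theta>"
  shows "ev x y (amp st ac W j) (dl st) ac = (-1) ^ j * sin ((2 * j + 1) * \<theta>)"
proof -
  define \<psi>0 where "\<psi>0 = ev x y W (dl st)"
  let ?it = "[(False, \<lambda>_. flip ac)] @ rev W @ [(False, \<lambda>_. flip st)] @ W"
  have n0: "ip J \<psi>0 \<psi>0 = 1" unfolding \<psi>0_def ip_ev_ev[OF W] using ip_dl[OF J(1,2)] by (simp add: dl_def)
  have step: "ip J v (ev x y ?it \<psi>) = ip J v \<psi> - 2 * (v ac * \<psi> ac) - 2 * (ip J \<psi>0 v * (ip J \<psi>0 \<psi> - 2 * (\<psi>0 ac * \<psi> ac)))" for v \<psi>
  proof -
    define \<omega> where "\<omega> = flip ac \<psi>"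
    have "ip J v (ev x y ?it \<psi>) = ip J (ev x y (rev W) v) (flip st (ev x y (rev W) \<omega>))"
      using ip_ev[of J "rev W" x y v] W by (simp add: ev_append opf_def \<omega>_def)
    moreover have "ip J (ev x y (rev W) v) (ev x y (rev W) \<omega>) = ip J v \<omega>"
      using ip_ev[of J "rev W" x y v] ev_rev[of J "rev W" x y \<omega>] W by simp
    moreover have "ev x y (rev W) u st = ip J \<psi>0 u" for u
      using ip_ev[OF W, of x y "dl st" u] ip_dl[OF J(1,2)] by (simp add: \<psi>0_def)
    moreover have "ip J u \<omega> = ip J u \<psi> - 2 * (u ac * \<psi> ac)" for u unfolding \<omega>_def by (rule ip_flip[OF J(1,3)])
    ultimately show ?thesis unfolding ip_flip[OF J(1,2)] by simp
  qed
  have pow: "ev x y (concat (replicate j ops)) \<psi> = (ev x y ops ^^ j) \<psi>" for j ops and \<psi> :: "'a \<Rightarrow> real"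
    by (induction j arbitrary: \<psi>) (simp_all add: ev_append funpow_swap1)
  have "((ev x y ?it ^^ j) \<psi>0) ac = (-1) ^ j * sin ((2 * j + 1) * \<theta>) \<and> ip J \<psi>0 ((ev x y ?it ^^ j) \<psi>0) = (-1) ^ j * cos (2 * j * \<theta>)"
  proof (induction j)
    case 0
    then show ?case using n0 \<theta> by (simp add: \<psi>0_def)
  next
    case (Suc j)
    define \<psi> where "\<psi> = (ev x y ?it ^^ j) \<psi>0"
    let ?s = "sin ((2 * j + 1) * \<theta>)" and ?c = "cos (2 * j * \<theta>)"
    have IH: "\<psi> ac = (-1) ^ j * ?s" "ip J \<psi>0 \<psi> = (-1) ^ j * ?c" using Suc unfolding \<psi>_def by blast+
    have p0: "\<psi>0 ac = sin \<theta>" using \<theta> by (simp add: \<psi>0_def)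
    have trig: "?c - 2 * (sin \<theta> * ?s) = cos ((2 * j + 2) * \<theta>)" "- ?s - 2 * (sin \<theta> * cos ((2 * j + 2) * \<theta>)) = - sin ((2 * j + 3) * \<theta>)"
    proof -
      let ?u = "(2 * j + 1) * \<theta>" and ?w = "(2 * j + 2) * \<theta>"
      have a: "2 * j * \<theta> = ?u - \<theta>" "?w = ?u + \<theta>" "?u = ?w - \<theta>" "(2 * j + 3) * \<theta> = ?w + \<theta>" by (simp_all add: algebra_simps)
      show "?c - 2 * (sin \<theta> * ?s) = cos ?w" unfolding a(2) unfolding a(1) cos_add cos_diff by simp
      show "- ?s - 2 * (sin \<theta> * cos ?w) = - sin ((2 * j + 3) * \<theta>)" unfolding a(4) unfolding a(3) sin_add sin_diff by simp
    qed
    have "ip J (dl ac) (ev x y ?it \<psi>) = \<psi> ac - 2 * \<psi> ac - 2 * (sin \<theta> * (ip J \<psi>0 \<psi> - 2 * (sin \<theta> * \<psi> ac)))"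
      unfolding step ip_dl[OF J(1,3)] ip_commute[of J \<psi>0 "dl ac"] p0 by (simp add: dl_def)
    also have "\<dots> = (-1) ^ j * (- ?s - 2 * (sin \<theta> * (?c - 2 * (sin \<theta> * ?s))))" unfolding IH by (simp add: algebra_simps)
    also have "\<dots> = (-1) ^ Suc j * sin ((2 * Suc j + 1) * \<theta>)" unfolding trig by (simp add: algebra_simps)
    finally have 1: "ev x y ?it \<psi> ac = (-1) ^ Suc j * sin ((2 * Suc j + 1) * \<theta>)" using ip_dl[OF J(1,3)] by simp
    have "ip J \<psi>0 (ev x y ?it \<psi>) = ip J \<psi>0 \<psi> - 2 * (sin \<theta> * \<psi> ac) - 2 * (ip J \<psi>0 \<psi> - 2 * (sin \<theta> * \<psi> ac))"
      unfolding step n0 p0 by simp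
    also have "\<dots> = (-1) ^ j * (- (?c - 2 * (sin \<theta> * ?s)))" unfolding IH by (simp add: algebra_simps)
    also have "\<dots> = (-1) ^ Suc j * cos (2 * Suc j * \<theta>)" unfolding trig by (simp add: algebra_simps)
    finally have 2: "ip J \<psi>0 (ev x y ?it \<psi>) = (-1) ^ Suc j * cos (2 * Suc j * \<theta>)" .
    show ?case using 1 2 by (simp only: funpow.simps o_apply \<psi>_def)
  qed
  then have "((ev x y ?it ^^ j) \<psi>0) ac = (-1) ^ j * sin ((2 * j + 1) * \<theta>)" by (rule conjunct1)
  then show ?thesis unfolding amp_def ev_append pow \<psi>0_def by (simp add: add.commute)
qed

section \<open>Realisation on qubits\<close>

lemma tensor_one_right: "A \<otimes>\<^sub>m 1\<^sub>m 1 = A"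
  by (intro eq_matI) (auto simp: tensor_mat_def)

locale embedding =
  fixes J :: "'a set" and \<iota> :: "'a \<Rightarrow> nat" and nq :: nat
  assumes finJ: "finite J" and inj: "inj_on \<iota> J" and im: "\<iota> ` J \<subseteq> {..<2 ^ nq}"
begin

abbreviation "\<kappa> \<equiv> inv_into J \<iota>"
abbreviation "D \<equiv> (2 :: nat) ^ nq"

lemma \<kappa>: "l \<in> J \<Longrightarrow> \<kappa> (\<iota> l) = l"
  using inj by simp

definition cv :: "('a \<Rightarrow> real) \<Rightarrow> complex vec" where
  "cv \<psi> = vec D (\<lambda>i. if i \<in> \<iota> ` J then complex_of_real (\<psi> (\<kappa> i)) else 0)"

text \<open>The identity on basis states that carry no label makes the matrix unitary.\<close>

definition mt :: "(('a \<Rightarrow> real) \<Rightarrow> 'a \<Rightarrow> real) \<Rightarrow> complex mat" where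
  "mt f = mat D D (\<lambda>(i, j). if i \<in> \<iota> ` J \<and> j \<in> \<iota> ` J then complex_of_real (f (dl (\<kappa> j)) (\<kappa> i)) else if i = j then 1 else 0)"

lemma sum_D:
  fixes F :: "nat \<Rightarrow> 'b :: comm_monoid_add"
  assumes "\<And>i. i \<notin> \<iota> ` J \<Longrightarrow> F i = 0"
  shows "(\<Sum>i\<in>{0..<D}. F i) = (\<Sum>l\<in>J. F (\<iota> l))"
proof -
  have "(\<Sum>i\<in>{0..<D}. F i) = (\<Sum>i\<in>\<iota> ` J. F i)"
    using im assms by (intro sum.mono_neutral_right) auto
  then show ?thesis by (simp add: sum.reindex[OF inj])
qed

lemma mt_cv:
  assumes f: "invo J f"
  shows "mt f *\<^sub>v cv \<psi> = cv (f \<psi>)"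
proof (intro eq_vecI)
  fix i assume "i < dim_vec (cv (f \<psi>))"
  then have i: "i < D" by (simp add: cv_def)
  have "(mt f *\<^sub>v cv \<psi>) $ i = (\<Sum>j\<in>{0..<D}. mt f $$ (i, j) * cv \<psi> $ j)"
    using i by (simp add: mt_def cv_def scalar_prod_def)
  also have "\<dots> = (\<Sum>j\<in>{0..<D}. if j \<in> \<iota> ` J then mt f $$ (i, j) * complex_of_real (\<psi> (\<kappa> j)) else 0)"
    by (intro sum.cong) (auto simp: cv_def)
  also have "\<dots> = (\<Sum>l\<in>J. mt f $$ (i, \<iota> l) * complex_of_real (\<psi> l))"
    by (subst sum_D) (auto simp: \<kappa> intro!: sum.cong)
  also have "\<dots> = cv (f \<psi>) $ i"
  proof (cases "i \<in> \<iota> ` J")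
    case True
    then obtain m where m: "m \<in> J" "i = \<iota> m" by auto
    have "(\<Sum>l\<in>J. mt f $$ (i, \<iota> l) * complex_of_real (\<psi> l)) = (\<Sum>l\<in>J. complex_of_real (f (dl l) m * \<psi> l))"
      using m i im by (intro sum.cong refl) (auto simp: mt_def \<kappa>)
    then show ?thesis using i m invo_expand[OF finJ f m(1), of \<psi>] by (simp add: cv_def \<kappa>)
  next
    case False
    have "(\<Sum>l\<in>J. mt f $$ (i, \<iota> l) * complex_of_real (\<psi> l)) = 0"
    proof (intro sum.neutral ballI)
      fix l assume "l \<in> J"
      then have "\<iota> l < D" "i \<noteq> \<iota> l" using False im by auto
      then show "mt f $$ (i, \<iota> l) * complex_of_real (\<psi> l) = 0" using False i by (simp add: mt_def)
    qed
    then show ?thesis using False i by (simp add: cv_def)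
  qed
  finally show "(mt f *\<^sub>v cv \<psi>) $ i = cv (f \<psi>) $ i" .
qed (simp add: mt_def cv_def)

lemma mt_unitary:
  assumes f: "invo J f"
  shows "mt f \<in> unitary_mats D"
proof -
  have sym: "mt f $$ (i, j) = mt f $$ (j, i)" "cnj (mt f $$ (i, j)) = mt f $$ (i, j)" if "i < D" "j < D" for i j
    using that invo_symm[OF finJ f, of "\<kappa> i" "\<kappa> j"] inv_into_into[of _ \<iota> J] by (auto simp: mt_def)
  have adj: "mat_adjoint (mt f) = mt f"
  proof (intro eq_matI)
    fix i j assume "i < dim_row (mt f)" "j < dim_col (mt f)"
    then have ij: "i < D" "j < D" by (auto simp: mt_def)
    then have "mat_adjoint (mt f) $$ (i, j) = cnj (mt f $$ (j, i))"
      by (simp add: mat_adjoint_def mat_of_rows_def mt_def)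
    then show "mat_adjoint (mt f) $$ (i, j) = mt f $$ (i, j)" using sym ij by metis
  qed (auto simp: mt_def mat_adjoint_def)
  have "mt f * mt f = 1\<^sub>m D"
  proof (intro eq_matI)
    fix i j assume "i < dim_row (1\<^sub>m D :: complex mat)" "j < dim_col (1\<^sub>m D :: complex mat)"
    then have i: "i < D" and j: "j < D" by auto
    have e: "(mt f * mt f) $$ (i, j) = (\<Sum>l\<in>{0..<D}. mt f $$ (i, l) * mt f $$ (l, j))"
      using i j by (simp add: mt_def scalar_prod_def)
    show "(mt f * mt f) $$ (i, j) = 1\<^sub>m D $$ (i, j)"
    proof (cases "j \<in> \<iota> ` J")
      case True
      then obtain m where m: "m \<in> J" "j = \<iota> m" by auto
      have "(mt f * mt f) $$ (i, j) = (mt f *\<^sub>v cv (f (dl m))) $ i"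
      proof -
        have "(mt f *\<^sub>v cv (f (dl m))) $ i = (\<Sum>l\<in>{0..<D}. mt f $$ (i, l) * cv (f (dl m)) $ l)"
          using i by (simp add: mt_def cv_def scalar_prod_def)
        also have "\<dots> = (\<Sum>l\<in>{0..<D}. mt f $$ (i, l) * mt f $$ (l, j))"
          using m j True by (intro sum.cong refl) (auto simp: mt_def cv_def \<kappa>)
        finally show ?thesis using e by simp
      qed
      also have "\<dots> = cv (dl m) $ i" by (simp add: mt_cv[OF f] invoD(2)[OF f])
      also have "\<dots> = 1\<^sub>m D $$ (i, j)" using i j m inv_into_into[of i \<iota> J] by (auto simp: cv_def dl_def \<kappa> f_inv_into_f)
      finally show ?thesis .
    next
      case False
      have "(\<Sum>l\<in>{0..<D}. mt f $$ (i, l) * mt f $$ (l, j)) = (\<Sum>l\<in>{0..<D}. if l = j then mt f $$ (i, l) else 0)"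
        using False j by (intro sum.cong) (auto simp: mt_def)
      also have "\<dots> = 1\<^sub>m D $$ (i, j)" using False i j by (simp add: mt_def)
      finally show ?thesis using e by simp
    qed
  qed (auto simp: mt_def)
  then show ?thesis unfolding unitary_mats_def by (simp add: adj) (simp add: mt_def)
qed

text \<open>In every operation all qubits go to Bob and return, so that each one begins and ends
  with Alice holding everything.\<close>

definition mv :: "'a qop \<Rightarrow> qmove list" where
  "mv p = (if fst p then [Alice_move (\<lambda>x. mt (snd p x)) nq, Bob_move (\<lambda>_. 1\<^sub>m D) nq]
     else [Alice_move (\<lambda>_. 1\<^sub>m D) nq, Bob_move (\<lambda>y. mt (snd p y)) nq])"

abbreviation "mvs ops \<equiv> concat (map mv ops)"

lemma one_unitary: "1\<^sub>m d \<in> unitary_mats d"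
  using invol_mat_unitary[of d id] by (simp add: invol_mat_def one_mat_def[symmetric])

lemma qvalid_mvs: "good J ops \<Longrightarrow> qvalid nq nq (mvs ops)"
  by (induction ops) (auto simp: mv_def good_def mt_unitary one_unitary)

lemma qcost_mvs: "qcost (mvs ops) = 2 * nq * length ops"
  by (induction ops) (auto simp: mv_def qcost_def)

lemma qrun_mvs: "good J ops \<Longrightarrow> qrun nq nq (mvs ops) x y (cv \<psi>) = cv (ev x y ops \<psi>)"
proof (induction ops arbitrary: \<psi>)
  case (Cons p ps)
  have c: "1\<^sub>m D *\<^sub>v cv \<psi> = cv \<psi>" for \<psi> by (intro one_mult_mat_vec carrier_vecI) (simp add: cv_def)
  have "invo J (snd p z)" for z using Cons.prems by (simp add: good_def)
  moreover have "good J ps" using Cons.prems by (simp add: good_def)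
  ultimately show ?case using Cons.IH
    by (simp add: mv_def opf_def tensor_one_left[unfolded One_nat_def] tensor_one_right[unfolded One_nat_def] mt_cv c)
qed simp

lemma qoutput_mvs:
  assumes ops: "good J ops" and st: "st \<in> J" "\<iota> st = 0" and ac: "ac \<in> J" and bits: "\<And>l. l \<in> J \<Longrightarrow> bit (\<iota> l) j \<longleftrightarrow> l = ac"
  shows "qoutput_prob nq nq (mvs ops) j x y True = (ev x y ops (dl st) ac)\<^sup>2"
    "qoutput_prob nq nq (mvs ops) j x y False = 1 - (ev x y ops (dl st) ac)\<^sup>2"
proof -
  define \<psi> where "\<psi> = ev x y ops (dl st)"
  have "unit_vec D 0 = cv (dl st)"
  proof (intro eq_vecI)
    fix i assume "i < dim_vec (cv (dl st))"
    then have i: "i < D" by (simp add: cv_def)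
    show "unit_vec D 0 $ i = cv (dl st) $ i"
    proof (cases "i \<in> \<iota> ` J")
      case True
      then obtain l where l: "l \<in> J" "i = \<iota> l" by auto
      have "\<iota> l = 0 \<longleftrightarrow> l = st" using inj_onD[OF inj _ l(1) st(1)] st(2) by auto
      then show ?thesis using i l by (simp add: cv_def dl_def \<kappa>)
    next
      case False
      then have "i \<noteq> 0" using st by (metis imageI)
      then show ?thesis using False i by (simp add: cv_def)
    qed
  qed (simp add: cv_def)
  then have run: "qrun nq nq (mvs ops) x y (unit_vec D 0) = cv \<psi>" by (simp add: qrun_mvs[OF ops] \<psi>_def)
  have p: "qoutput_prob nq nq (mvs ops) j x y v = (\<Sum>l\<in>J. if (l = ac) = v then (\<psi> l)\<^sup>2 else 0)" for v
  proof -
    have "qoutput_prob nq nq (mvs ops) j x y v = (\<Sum>i\<in>{0..<D}. if bit i j = v then (cmod (cv \<psi> $ i))\<^sup>2 else 0)"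
      unfolding qoutput_prob_def run by (rule sum.mono_neutral_cong_left) auto
    also have "\<dots> = (\<Sum>i\<in>{0..<D}. if i \<in> \<iota> ` J \<and> bit i j = v then (\<psi> (\<kappa> i))\<^sup>2 else 0)"
      by (intro sum.cong) (auto simp: cv_def)
    also have "\<dots> = (\<Sum>l\<in>J. if (l = ac) = v then (\<psi> l)\<^sup>2 else 0)"
      by (subst sum_D) (auto simp: \<kappa> bits intro!: sum.cong)
    finally show ?thesis .
  qed
  show t: "qoutput_prob nq nq (mvs ops) j x y True = (ev x y ops (dl st) ac)\<^sup>2"
    unfolding p using finJ ac by (simp add: \<psi>_def)
  have "qoutput_prob nq nq (mvs ops) j x y False + qoutput_prob nq nq (mvs ops) j x y True = (\<Sum>l\<in>J. (\<psi> l)\<^sup>2)"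
    unfolding p sum.distrib[symmetric] by (intro sum.cong) auto
  also have "\<dots> = ip J \<psi> \<psi>" by (simp add: ip_def power2_eq_square)
  also have "\<dots> = 1" unfolding \<psi>_def ip_ev_ev[OF ops] using ip_dl[OF finJ st(1)] by (simp add: dl_def)
  finally show "qoutput_prob nq nq (mvs ops) j x y False = 1 - (ev x y ops (dl st) ac)\<^sup>2" using t by simp
qed

end

text \<open>\<open>Dat p i c\<close> is position \<open>i\<close> of layer \<open>p\<close> together
  with the content \<open>c\<close> of Alice's block there. \<open>Gar p i\<close> receives what is
  lost because \<open>M\<close> is a contraction and not orthogonal.\<close>

datatype 'q lab = St | Dat nat nat 'q | Gar nat nat | Acc

definition labs :: "nat \<Rightarrow> nat \<Rightarrow> 'q set \<Rightarrow> 'q lab set" where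
  "labs n k Q = {St, Acc} \<union> (\<lambda>(p, i, c). Dat p i c) ` ({..<2 * k + 1} \<times> {..<n} \<times> Q) \<union> (\<lambda>(p, i). Gar p i) ` ({..<2 * k} \<times> {..<n})"

lemma finite_labs: "finite Q \<Longrightarrow> finite (labs n k Q)"
  by (auto simp: labs_def)

lemma sum_labs:
  fixes F :: "'q lab \<Rightarrow> real"
  assumes Q: "finite Q" and X: "\<And>v. X v \<in> Q" and F: "\<And>p i c. c \<noteq> X (p, i) \<Longrightarrow> F (Dat p i c) = 0"
  shows "(\<Sum>l\<in>labs n k Q. F l) = F St + F Acc + (\<Sum>p<2 * k + 1. \<Sum>i<n. F (Dat p i (X (p, i)))) + (\<Sum>p<2 * k. \<Sum>i<n. F (Gar p i))"
proof -
  let ?D = "(\<lambda>(p, i, c). Dat p i c) ` ({..<2 * k + 1} \<times> {..<n} \<times> Q)" and ?G = "(\<lambda>(p, i). Gar p i) ` ({..<2 * k} \<times> {..<n})"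
  have inj: "inj_on (\<lambda>(p, i, c). Dat p i c) ({..<2 * k + 1} \<times> {..<n} \<times> Q)" "inj_on (\<lambda>(p, i). Gar p i) ({..<2 * k} \<times> {..<n})"
    by (auto simp: inj_on_def)
  have "(\<Sum>l\<in>labs n k Q. F l) = (\<Sum>l\<in>{St, Acc} \<union> ?D. F l) + (\<Sum>l\<in>?G. F l)"
    unfolding labs_def using Q by (intro sum.union_disjoint) auto
  also have "(\<Sum>l\<in>{St, Acc} \<union> ?D. F l) = (\<Sum>l\<in>{St, Acc}. F l) + (\<Sum>l\<in>?D. F l)"
    using Q by (intro sum.union_disjoint) auto
  also have "(\<Sum>l\<in>?D. F l) = (\<Sum>p<2 * k + 1. \<Sum>i<n. \<Sum>c\<in>Q. F (Dat p i c))"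
    unfolding sum.reindex[OF inj(1)] by (simp add: sum.cartesian_product case_prod_beta)
  also have "\<dots> = (\<Sum>p<2 * k + 1. \<Sum>i<n. F (Dat p i (X (p, i))))"
  proof (intro sum.cong refl)
    fix p i
    have "(\<Sum>c\<in>Q. F (Dat p i c)) = (\<Sum>c\<in>Q. if c = X (p, i) then F (Dat p i (X (p, i))) else 0)"
      using F by (intro sum.cong) auto
    then show "(\<Sum>c\<in>Q. F (Dat p i c)) = F (Dat p i (X (p, i)))" using Q X by simp
  qed
  also have "(\<Sum>l\<in>?G. F l) = (\<Sum>p<2 * k. \<Sum>i<n. F (Gar p i))"
    unfolding sum.reindex[OF inj(2)] by (simp add: sum.cartesian_product case_prod_beta)
  finally show ?thesis by simp
qed

lemma sum_two:
  fixes f g :: "nat \<Rightarrow> real"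
  assumes "p < 2 * k"
  shows "(\<Sum>p'<2 * k + 1. if p' = p then a else if p' = Suc p then b else 0) = a + b"
proof -
  have "(\<Sum>p'<2 * k + 1. if p' = p then a else if p' = Suc p then b else 0) = (\<Sum>p'<2 * k + 1. (if p' = p then a else 0) + (if p' = Suc p then b else 0))"
    by (intro sum.cong) auto
  also have "\<dots> = a + b" unfolding sum.distrib using assms by simp
  finally show ?thesis .
qed

text \<open>The start label gets 0, the accepting one \<open>2 ^ h\<close>, and the others the
  numbers between, so the top bit alone signals acceptance.\<close>

lemma ex_embedding:
  assumes J: "finite J" "st \<in> J" "ac \<in> J" "st \<noteq> ac" and card: "card J \<le> Suc (2 ^ h)"
  shows "\<exists>\<iota>. embedding J \<iota> (Suc h) \<and> \<iota> st = (0 :: nat) \<and> (\<forall>l\<in>J. bit (\<iota> l) h \<longleftrightarrow> l = ac)"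
proof -
  let ?K = "J - {st, ac}"
  have "finite ?K" using J by simp
  then obtain f where f: "bij_betw f ?K {0..<card ?K}" using ex_bij_betw_finite_nat by blast
  have cK: "Suc (card ?K) \<le> 2 ^ h"
    using J card card_Diff_subset[of "{st, ac}" J] card_mono[of J "{st, ac}"] by simp
  define \<iota> where "\<iota> l = (if l = st then 0 else if l = ac then 2 ^ h else Suc (f l))" for l
  have fl: "Suc (f l) < 2 ^ h" if "l \<in> ?K" for l
  proof -
    have "f l \<in> {0..<card ?K}" using bij_betwE[OF f] that by blast
    then show ?thesis using cK by simp
  qed
  have cases: "l = st \<or> l = ac \<or> l \<in> ?K" if "l \<in> J" for l using that by auto
  have "inj_on \<iota> J"
  proof (rule inj_onI)
    fix l m assume lm: "l \<in> J" "m \<in> J" "\<iota> l = \<iota> m"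
    have "f l = f m \<Longrightarrow> l \<in> ?K \<Longrightarrow> m \<in> ?K \<Longrightarrow> l = m" using f by (auto simp: bij_betw_def dest: inj_onD)
    then show "l = m" using cases[OF lm(1)] cases[OF lm(2)] lm(3) fl[of l] fl[of m] J(4) by (auto simp: \<iota>_def split: if_splits)
  qed
  moreover have "\<iota> l < 2 ^ Suc h" if "l \<in> J" for l using cases[OF that] fl[of l] by (auto simp: \<iota>_def)
  ultimately have "embedding J \<iota> (Suc h)" using J by unfold_locales auto
  moreover have "bit (\<iota> l) h \<longleftrightarrow> l = ac" if "l \<in> J" for l
    using cases[OF that] fl[of l] J(4) by (auto simp: \<iota>_def bit_iff_odd)
  moreover have "\<iota> st = 0" by (simp add: \<iota>_def)
  ultimately show ?thesis by blast
qed

context forr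
begin

text \<open>The rows of \<open>M\<close> extended by the rows of \<open>L\<close> are orthonormal:
  an isometric dilation of the contraction.\<close>

lemma complement:
  "\<exists>L. \<forall>i<n. \<forall>j<n. (\<Sum>l<n. L i l * L j l) = (if i = j then 1 else 0) - (\<Sum>l<n. M i l * M j l)"
proof (rule psd_gram)
  show "(if i = j then 1 else 0) - (\<Sum>l<n. M i l * M j l) = (if j = i then 1 else 0) - (\<Sum>l<n. M j l * M i l)" for i j
    by (simp add: mult.commute)
  fix y :: "nat \<Rightarrow> real"
  have "(\<Sum>i<n. \<Sum>j<n. y i * ((if i = j then 1 else 0) - (\<Sum>l<n. M i l * M j l)) * y j)
      = (\<Sum>i<n. \<Sum>j<n. if i = j then y i * y j else 0) - (\<Sum>i<n. \<Sum>j<n. \<Sum>l<n. y i * M i l * (y j * M j l))"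
    unfolding sum_subtractf[symmetric] by (intro sum.cong refl) (simp add: algebra_simps sum_distrib_left)
  also have "(\<Sum>i<n. \<Sum>j<n. if i = j then y i * y j else 0) = (\<Sum>i<n. (y i)\<^sup>2)"
    by (simp add: power2_eq_square)
  also have "(\<Sum>i<n. \<Sum>j<n. \<Sum>l<n. y i * M i l * (y j * M j l)) = (\<Sum>l<n. (\<Sum>i<n. M l i * y i)\<^sup>2)"
  proof -
    have "(\<Sum>i<n. \<Sum>j<n. \<Sum>l<n. y i * M i l * (y j * M j l)) = (\<Sum>i<n. \<Sum>l<n. \<Sum>j<n. y i * M i l * (y j * M j l))"
      by (intro sum.cong refl sum.swap)
    also have "\<dots> = (\<Sum>l<n. \<Sum>i<n. \<Sum>j<n. y i * M i l * (y j * M j l))" by (rule sum.swap)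
    also have "\<dots> = (\<Sum>l<n. (\<Sum>i<n. y i * M i l)\<^sup>2)" by (simp add: power2_eq_square sum_product)
    also have "\<dots> = (\<Sum>l<n. (\<Sum>i<n. M l i * y i)\<^sup>2)"
      by (intro sum.cong refl arg_cong[where f = "\<lambda>t. t\<^sup>2"]) (simp add: M_sym mult.commute)
    finally show ?thesis .
  qed
  finally show "0 \<le> (\<Sum>i<n. \<Sum>j<n. y i * ((if i = j then 1 else 0) - (\<Sum>l<n. M i l * M j l)) * y j)"
    using minor_le_norm[OF contr, of y] by simp
qed

text \<open>Since Alice's block content is part of the label, Bob can apply the gadget sign as a
  diagonal operation without knowing \<open>x\<close>. A reflection of Alice then carries layer
  \<open>p\<close> through \<open>M\<close> to the next layer and replaces the content by the new
  block.\<close>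

theorem quantum_protocol:
  fixes Q :: "'q set" and g :: "'q \<Rightarrow> 'q \<Rightarrow> real" and X Y :: "point \<Rightarrow> nat \<times> nat \<Rightarrow> 'q"
  assumes Q: "finite Q" and X: "\<And>x v. X x v \<in> Q" and g: "\<And>a c. g a c = 1 \<or> g a c = -1"
    and h: "(2 * k + 1) * n * card Q + 2 * k * n + 1 \<le> 2 ^ h"
  shows "\<exists>mvs. qvalid (Suc h) (Suc h) mvs \<and> qcost mvs = 2 * Suc h * ((4 * k + 3) + j * (8 * k + 8)) \<and>
    (\<forall>x y. qoutput_prob (Suc h) (Suc h) mvs h x y True = (sin ((2 * j + 1) * arcsin (ph k (\<lambda>v. g (X x v) (Y y v)))))\<^sup>2 \<and>
      qoutput_prob (Suc h) (Suc h) mvs h x y False = 1 - (sin ((2 * j + 1) * arcsin (ph k (\<lambda>v. g (X x v) (Y y v)))))\<^sup>2)"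
proof -
  obtain L where L: "\<And>i j. i < n \<Longrightarrow> j < n \<Longrightarrow> (\<Sum>l<n. L i l * L j l) = (if i = j then 1 else 0) - (\<Sum>l<n. M i l * M j l)"
    using complement by blast
  define J where "J = labs n k Q"
  have finJ: "finite J" and stJ: "St \<in> J" and acJ: "Acc \<in> J" using finite_labs[OF Q] by (auto simp: J_def labs_def)
  \<comment> \<open>The reflection in \<open>d0\<close> exchanges the start label with the uniform
    state of layer 0; \<open>dF\<close> does the same for the accepting label and the last
    layer.\<close>
  define d0 where "d0 x l = (case l of St \<Rightarrow> 1 | Dat p i c \<Rightarrow> if p = 0 \<and> c = X x (p, i) then - (1 / sqrt n) else 0 | _ \<Rightarrow> 0)" for x and l :: "'q lab"
  define dF where "dF x l = (case l of Acc \<Rightarrow> 1 | Dat p i c \<Rightarrow> if p = 2 * k \<and> c = X x (p, i) then - (1 / sqrt n) else 0 | _ \<Rightarrow> 0)" for x and l :: "'q lab"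
  \<comment> \<open>A basis state of layer \<open>p\<close> minus its isometric image in the next
    layer and the garbage. By the choice of \<open>L\<close> these vectors are orthogonal with
    squared norm 2.\<close>
  define d where "d x p s l = (case l of Dat p' i c \<Rightarrow> (if c = X x (p', i) then (if p' = p then (if i = s then 1 else 0) else if p' = Suc p then - M s i else 0) else 0)
    | Gar p' i \<Rightarrow> (if p' = p then - L s i else 0) | _ \<Rightarrow> 0)" for x p s and l :: "'q lab"
  have ip0: "ip J (d0 x) \<psi> = \<psi> St - (\<Sum>i<n. \<psi> (Dat 0 i (X x (0, i)))) / sqrt n" for x \<psi>
  proof -
    have "ip J (d0 x) \<psi> = \<psi> St + (\<Sum>p<2 * k + 1. \<Sum>i<n. if p = 0 then - (1 / sqrt n) * \<psi> (Dat 0 i (X x (0, i))) else 0)"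
      unfolding ip_def J_def by (subst sum_labs[OF Q, of "X x"]) (auto simp: X d0_def intro!: sum.cong)
    also have "(\<Sum>p<2 * k + 1. \<Sum>i<n. if p = 0 then - (1 / sqrt n) * \<psi> (Dat 0 i (X x (0, i))) else 0)
        = (\<Sum>p<2 * k + 1. if p = 0 then (\<Sum>i<n. - (1 / sqrt n) * \<psi> (Dat 0 i (X x (0, i)))) else 0)" by (intro sum.cong) auto
    also have "\<dots> = (\<Sum>i<n. - (1 / sqrt n) * \<psi> (Dat 0 i (X x (0, i))))" by simp
    finally show ?thesis by (simp add: sum_negf sum_divide_distrib)
  qed
  have ipF: "ip J (dF x) \<psi> = \<psi> Acc - (\<Sum>i<n. \<psi> (Dat (2 * k) i (X x (2 * k, i)))) / sqrt n" for x \<psi>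
  proof -
    have "ip J (dF x) \<psi> = \<psi> Acc + (\<Sum>p<2 * k + 1. \<Sum>i<n. if p = 2 * k then - (1 / sqrt n) * \<psi> (Dat (2 * k) i (X x (2 * k, i))) else 0)"
      unfolding ip_def J_def by (subst sum_labs[OF Q, of "X x"]) (auto simp: X dF_def intro!: sum.cong)
    also have "(\<Sum>p<2 * k + 1. \<Sum>i<n. if p = 2 * k then - (1 / sqrt n) * \<psi> (Dat (2 * k) i (X x (2 * k, i))) else 0)
        = (\<Sum>p<2 * k + 1. if p = 2 * k then (\<Sum>i<n. - (1 / sqrt n) * \<psi> (Dat (2 * k) i (X x (2 * k, i)))) else 0)" by (intro sum.cong) auto
    also have "\<dots> = (\<Sum>i<n. - (1 / sqrt n) * \<psi> (Dat (2 * k) i (X x (2 * k, i))))" by simp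
    finally show ?thesis by (simp add: sum_negf sum_divide_distrib)
  qed
  have ipd: "ip J (d x p s) \<psi> = \<psi> (Dat p s (X x (p, s))) - (\<Sum>i<n. M s i * \<psi> (Dat (Suc p) i (X x (Suc p, i)))) - (\<Sum>i<n. L s i * \<psi> (Gar p i))"
    if p: "p < 2 * k" and s: "s < n" for x p s \<psi>
  proof -
    have "ip J (d x p s) \<psi> = (\<Sum>p'<2 * k + 1. \<Sum>i<n. (if p' = p then (if i = s then 1 else 0) else if p' = Suc p then - M s i else 0) * \<psi> (Dat p' i (X x (p', i))))
        + (\<Sum>p'<2 * k. \<Sum>i<n. (if p' = p then - L s i else 0) * \<psi> (Gar p' i))"
      unfolding ip_def J_def by (subst sum_labs[OF Q, of "X x"]) (auto simp: X d_def)
    also have "(\<Sum>p'<2 * k + 1. \<Sum>i<n. (if p' = p then (if i = s then 1 else 0) else if p' = Suc p then - M s i else 0) * \<psi> (Dat p' i (X x (p', i))))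
        = (\<Sum>p'<2 * k + 1. if p' = p then (\<Sum>i<n. if i = s then \<psi> (Dat p i (X x (p, i))) else 0) else if p' = Suc p then (\<Sum>i<n. - M s i * \<psi> (Dat (Suc p) i (X x (Suc p, i)))) else 0)"
    proof (rule sum.cong[OF refl])
      fix p'
      consider "p' = p" | "p' = Suc p" | "p' \<noteq> p" "p' \<noteq> Suc p" by blast
      then show "(\<Sum>i<n. (if p' = p then (if i = s then 1 else 0) else if p' = Suc p then - M s i else 0) * \<psi> (Dat p' i (X x (p', i))))
        = (if p' = p then (\<Sum>i<n. if i = s then \<psi> (Dat p i (X x (p, i))) else 0) else if p' = Suc p then (\<Sum>i<n. - M s i * \<psi> (Dat (Suc p) i (X x (Suc p, i)))) else 0)"
      proof cases
        case 1
        show ?thesis unfolding 1 if_P[OF refl] by (intro sum.cong) auto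
      qed auto
    qed
    also have "\<dots> = \<psi> (Dat p s (X x (p, s))) + (\<Sum>i<n. - M s i * \<psi> (Dat (Suc p) i (X x (Suc p, i))))"
      unfolding sum_two[OF p] using s by simp
    also have "(\<Sum>p'<2 * k. \<Sum>i<n. (if p' = p then - L s i else 0) * \<psi> (Gar p' i)) = (\<Sum>p'<2 * k. if p' = p then (\<Sum>i<n. - L s i * \<psi> (Gar p i)) else 0)"
      by (intro sum.cong refl) auto
    also have "\<dots> = (\<Sum>i<n. - L s i * \<psi> (Gar p i))" using p by simp
    finally show ?thesis by (simp add: sum_negf)
  qed
  define A0 :: "'q lab qop" where "A0 = (True, \<lambda>x. rfl J {()} (\<lambda>_. d0 x))"
  define AF :: "'q lab qop" where "AF = (True, \<lambda>x. rfl J {()} (\<lambda>_. dF x))"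
  define AR :: "nat \<Rightarrow> 'q lab qop" where "AR p = (True, \<lambda>x. rfl J {..<n} (d x p))" for p
  define B :: "'q lab qop" where "B = (False, \<lambda>y. dsg (\<lambda>l. case l of Dat p i c \<Rightarrow> g c (Y y (p, i)) | _ \<Rightarrow> 1))"
  have sq: "sqrt n * sqrt n = n" "sqrt n \<noteq> 0" using n by auto
  have goodA: "invo J (snd A0 x)" "invo J (snd AF x)" "invo J (snd B x)" for x
  proof -
    show "invo J (snd A0 x)" unfolding A0_def snd_conv
      by (rule invo_rfl) (use sq in \<open>auto simp: ip0 d0_def\<close>)
    show "invo J (snd AF x)" unfolding AF_def snd_conv
      by (rule invo_rfl) (use sq in \<open>auto simp: ipF dF_def\<close>)
    show "invo J (snd B x)" unfolding B_def snd_conv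
      by (rule invo_dsg) (use g in \<open>auto split: lab.split\<close>)
  qed
  have goodR: "invo J (snd (AR p) x)" if p: "p < 2 * k" for p x
    unfolding AR_def snd_conv
  proof (rule invo_rfl)
    fix s t assume st: "s \<in> {..<n}" "t \<in> {..<n}"
    have "ip J (d x p s) (d x p t) = (if s = t then 1 else 0) + (\<Sum>i<n. M s i * M t i) + (\<Sum>i<n. L s i * L t i)"
      using st by (subst ipd[OF p]) (auto simp: d_def sum_negf)
    then show "ip J (d x p s) (d x p t) = (if s = t then 2 else 0)" using st L[of s t] by simp
  qed simp
  define Wp where "Wp p = A0 # concat (map (\<lambda>p. [B, AR p]) [0..<p])" for p
  define W where "W = Wp (2 * k) @ [B, AF]"
  have goodW: "good J W" using goodA goodR by (auto simp: good_def W_def Wp_def)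
  have lenW: "length W = 4 * k + 3"
    by (simp add: W_def Wp_def length_concat comp_def sum_list_triv)
  define z where "z x y v = g (X x v) (Y y v)" for x y v
  \<comment> \<open>The states not yet reached have amplitude 0, so a reflection merely transports
    amplitude forwards.\<close>
  have inv: "p \<le> 2 * k \<Longrightarrow> (\<forall>i<n. ev x y (Wp p) (dl St) (Dat p i (X x (p, i))) = pa (z x y) p i / sqrt n) \<and>
      (\<forall>p'>p. \<forall>i c. ev x y (Wp p) (dl St) (Dat p' i c) = 0) \<and> (\<forall>p'\<ge>p. \<forall>i. ev x y (Wp p) (dl St) (Gar p' i) = 0) \<and> ev x y (Wp p) (dl St) Acc = 0" for p x y
  proof (induction p)
    case 0
    have "ip J (d0 x) (dl St) = 1" unfolding ip0 by (simp add: dl_def)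
    then have "ev x y (Wp 0) (dl St) = (\<lambda>l. dl St l - d0 x l)"
      by (simp add: Wp_def A0_def opf_def rfl_def)
    then show ?case by (simp add: dl_def d0_def)
  next
    case (Suc p)
    define \<psi> where "\<psi> = ev x y (Wp p) (dl St)"
    define \<psi>1 where "\<psi>1 = opf x y B \<psi>"
    have p: "p < 2 * k" using Suc.prems by simp
    have IH: "\<And>i. i < n \<Longrightarrow> \<psi> (Dat p i (X x (p, i))) = pa (z x y) p i / sqrt n" "\<And>p' i c. p < p' \<Longrightarrow> \<psi> (Dat p' i c) = 0"
        "\<And>p' i. p \<le> p' \<Longrightarrow> \<psi> (Gar p' i) = 0" "\<psi> Acc = 0"
      using Suc unfolding \<psi>_def by simp_all
    have \<psi>1: "\<And>i. i < n \<Longrightarrow> \<psi>1 (Dat p i (X x (p, i))) = z x y (p, i) * (pa (z x y) p i / sqrt n)" "\<And>p' i c. p < p' \<Longrightarrow> \<psi>1 (Dat p' i c) = 0"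
        "\<And>p' i. p \<le> p' \<Longrightarrow> \<psi>1 (Gar p' i) = 0" "\<psi>1 Acc = 0"
      using IH by (simp_all add: \<psi>1_def B_def opf_def dsg_def z_def)
    have c: "ip J (d x p s) \<psi>1 = z x y (p, s) * (pa (z x y) p s / sqrt n)" if "s < n" for s
      unfolding ipd[OF p that] using \<psi>1 that by simp
    have eq: "ev x y (Wp (Suc p)) (dl St) = (\<lambda>l. \<psi>1 l - (\<Sum>s<n. d x p s l * (z x y (p, s) * (pa (z x y) p s / sqrt n))))"
    proof -
      have "ev x y (Wp (Suc p)) (dl St) = opf x y (AR p) \<psi>1"
        by (simp add: Wp_def ev_append \<psi>_def \<psi>1_def)
      also have "\<dots> = (\<lambda>l. \<psi>1 l - (\<Sum>s<n. d x p s l * ip J (d x p s) \<psi>1))" by (simp add: AR_def opf_def rfl_def)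
      also have "\<dots> = (\<lambda>l. \<psi>1 l - (\<Sum>s<n. d x p s l * (z x y (p, s) * (pa (z x y) p s / sqrt n))))"
        using c by (intro ext arg_cong2[where f = "(-)"] refl sum.cong) auto
      finally show ?thesis .
    qed
    show ?case unfolding eq
    proof (intro conjI allI impI)
      fix i assume "i < n"
      then show "\<psi>1 (Dat (Suc p) i (X x (Suc p, i))) - (\<Sum>s<n. d x p s (Dat (Suc p) i (X x (Suc p, i))) * (z x y (p, s) * (pa (z x y) p s / sqrt n))) = pa (z x y) (Suc p) i / sqrt n"
        by (simp add: \<psi>1 d_def sum_negf sum_divide_distrib)
    qed (auto simp: \<psi>1 d_def)
  qed
  have phi: "ev x y W (dl St) Acc = ph k (z x y)" for x y
  proof -
    define \<psi> where "\<psi> = ev x y (Wp (2 * k)) (dl St)"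
    define \<psi>1 where "\<psi>1 = opf x y B \<psi>"
    have \<psi>1: "\<And>i. i < n \<Longrightarrow> \<psi>1 (Dat (2 * k) i (X x (2 * k, i))) = z x y (2 * k, i) * (pa (z x y) (2 * k) i / sqrt n)" "\<psi>1 Acc = 0"
      using inv[of "2 * k" x y] by (simp_all add: \<psi>_def \<psi>1_def B_def opf_def dsg_def z_def)
    have "ip J (dF x) \<psi>1 = - ((\<Sum>i<n. z x y (2 * k, i) * (pa (z x y) (2 * k) i / sqrt n)) / sqrt n)"
      unfolding ipF using \<psi>1 by simp
    also have "\<dots> = - ph k (z x y)" unfolding ph_path using sq by (simp add: sum_divide_distrib mult.assoc)
    finally have "opf x y AF \<psi>1 Acc = ph k (z x y)" using \<psi>1 by (simp add: AF_def opf_def rfl_def dF_def)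
    then show ?thesis by (simp add: W_def ev_append \<psi>_def \<psi>1_def)
  qed
  \<comment> \<open>An amplitude of a unit vector; this is what makes \<open>arcsin\<close>
    meaningful below.\<close>
  have le1: "\<bar>ph k (z x y)\<bar> \<le> 1" for x y
  proof -
    have "(ev x y W (dl St) Acc)\<^sup>2 \<le> (\<Sum>l\<in>J. (ev x y W (dl St) l)\<^sup>2)" using finJ acJ by (intro member_le_sum) auto
    also have "\<dots> = 1" using ip_ev_ev[OF goodW, of x y "dl St"] ip_dl[OF finJ stJ, of "dl St"] by (simp add: ip_def power2_eq_square dl_def)
    finally show ?thesis unfolding phi by (simp add: abs_square_le_1)
  qed
  let ?D = "(\<lambda>(p, i, c). Dat p i c) ` ({..<2 * k + 1} \<times> {..<n} \<times> Q)" and ?G = "(\<lambda>(p, i). Gar p i :: 'q lab) ` ({..<2 * k} \<times> {..<n})"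
  have "card J \<le> card ({St, Acc} \<union> ?D) + card ?G" unfolding J_def labs_def by (rule card_Un_le)
  moreover have "card ({St, Acc} \<union> ?D) \<le> card {St, Acc :: 'q lab} + card ?D" by (rule card_Un_le)
  moreover have c2: "card {St, Acc :: 'q lab} = 2" by simp
  moreover have "card ?D \<le> card ({..<2 * k + 1} \<times> {..<n} \<times> Q)" by (rule card_image_le) (use Q in auto)
  moreover have "card ?G \<le> card ({..<2 * k} \<times> {..<n})" by (rule card_image_le) auto
  ultimately have "card J \<le> 2 + (2 * k + 1) * n * card Q + 2 * k * n"
    unfolding card_cartesian_product card_lessThan c2 mult.assoc by linarith
  \<comment> \<open>Two special labels against a summand 1 in \<open>h\<close>: one of them occupies
    the basis state \<open>2 ^ h\<close>.\<close>
  then have "card J \<le> Suc (2 ^ h)" using h by simp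
  then obtain \<iota> where \<iota>: "embedding J \<iota> (Suc h)" "\<iota> St = 0" "\<And>l. l \<in> J \<Longrightarrow> bit (\<iota> l) h \<longleftrightarrow> l = Acc"
    using ex_embedding[OF finJ stJ acJ] by (metis lab.distinct(5))
  interpret embedding J \<iota> "Suc h" by (rule \<iota>(1))
  let ?P = "amp St Acc W j"
  have gP: "good J ?P" by (rule good_amp[OF goodW])
  have out: "(ev x y ?P (dl St) Acc)\<^sup>2 = (sin ((2 * real j + 1) * arcsin (ph k (z x y))))\<^sup>2" for x y
    using amplification[OF finJ stJ acJ goodW, of x y "arcsin (ph k (z x y))" j] le1[of x y]
    by (simp add: phi power_mult_distrib abs_le_iff add: add.commute flip: power_mult)
  have zf: "z x y = (\<lambda>v. g (X x v) (Y y v))" for x y by (simp add: z_def fun_eq_iff)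
  note qo = qoutput_mvs[OF gP stJ \<iota>(2) acJ \<iota>(3), unfolded out zf]
  show ?thesis
  proof (intro exI[of _ "mvs ?P"] conjI allI)
    show "qvalid (Suc h) (Suc h) (mvs ?P)" by (rule qvalid_mvs[OF gP])
    show "qcost (mvs ?P) = 2 * Suc h * ((4 * k + 3) + j * (8 * k + 8))"
      unfolding qcost_mvs length_amp lenW by (simp add: algebra_simps)
  qed (rule qo; assumption)+
qed

end

section \<open>The gadget and amplification\<close>

lemma finite_cube [simp]: "finite (cube b)"
  unfolding cube_def by (intro finite_PiE) auto

lemma card_cube: "card (cube b) = 2 ^ b"
  by (simp add: cube_def card_PiE numeral_2_eq_2)

text \<open>The inner product modulo 2 as a sign, with -1 read as the bit 1: Sylvester's Hadamard
  matrix.\<close>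

definition ipg :: "nat \<Rightarrow> point \<Rightarrow> point \<Rightarrow> real" where
  "ipg b a c = (\<Prod>j<b. if a j = -1 \<and> c j = -1 then -1 else 1)"

lemma ipg_pm: "ipg b a c = 1 \<or> ipg b a c = -1"
proof (induction b)
  case (Suc b)
  then show ?case unfolding ipg_def by auto
qed (simp add: ipg_def)

text \<open>The sum factors over the coordinates, and a coordinate where the rows differ contributes
  1 - 1 = 0.\<close>

lemma ipg_orth:
  assumes a: "a \<in> cube b" "a' \<in> cube b" "a \<noteq> a'"
  shows "(\<Sum>c\<in>cube b. ipg b a c * ipg b a' c) = 0"
proof -
  obtain j where j: "j < b" "a j \<noteq> a' j"
    using a PiE_ext[of a "{..<b}" "\<lambda>_. {-1, 1}" a'] unfolding cube_def by (metis lessThan_iff)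
  let ?f = "\<lambda>j s :: int. (if a j = -1 \<and> s = -1 then -1 else 1) * (if a' j = -1 \<and> s = -1 then -1 else 1 :: real)"
  have "(\<Sum>c\<in>cube b. ipg b a c * ipg b a' c) = (\<Sum>c\<in>cube b. \<Prod>j<b. ?f j (c j))"
    by (simp add: ipg_def prod.distrib)
  also have "\<dots> = (\<Prod>j<b. \<Sum>s\<in>{-1, 1}. ?f j s)"
    unfolding cube_def by (rule prod_sum_PiE[symmetric]) auto
  also have "\<dots> = 0"
  proof (rule prod_zero)
    have "a j \<in> {-1, 1}" "a' j \<in> {-1, 1}" using a j(1) by (auto simp: cube_def dest: PiE_mem)
    then have "(\<Sum>s\<in>{-1, 1}. ?f j s) = 0" using j(2) by auto
    then show "\<exists>j\<in>{..<b}. (\<Sum>s\<in>{-1, 1}. ?f j s) = 0" using j(1) by blast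
  qed simp
  finally show ?thesis .
qed

text \<open>Entries other than -1 are read as 1, so that a block lies in the cube for every
  \<open>x\<close>: the unitaries of a protocol must be defined at all points.\<close>

definition blk :: "nat \<Rightarrow> nat \<Rightarrow> point \<Rightarrow> nat \<times> nat \<Rightarrow> point" where
  "blk n b x = (\<lambda>(p, i). \<lambda>j\<in>{..<b}. if x ((p * n + i) * b + j) = -1 then -1 else 1)"

lemma blk_cube: "blk n b x v \<in> cube b"
  unfolding blk_def cube_def by (cases v) auto

text \<open>Injectivity decomposes a position as \<open>(p * n + i) * b + j\<close>; surjectivity
  follows by counting.\<close>

lemma blk_bij:
  "bij_betw (\<lambda>x. \<lambda>v\<in>{..<m} \<times> {..<n}. blk n b x v) (cube (m * n * b)) ({..<m} \<times> {..<n} \<rightarrow>\<^sub>E cube b)"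
proof -
  let ?e = "\<lambda>x. \<lambda>v\<in>{..<m} \<times> {..<n}. blk n b x v" and ?X = "{..<m} \<times> {..<n} \<rightarrow>\<^sub>E cube b"
  have inj: "inj_on ?e (cube (m * n * b))"
  proof (rule inj_onI)
    fix x x' assume x: "x \<in> cube (m * n * b)" "x' \<in> cube (m * n * b)" and e: "?e x = ?e x'"
    show "x = x'"
    proof (rule PiE_ext[OF x[unfolded cube_def]])
      fix t assume t: "t \<in> {..<m * n * b}"
      define q j where "q = t div b" and "j = t mod b"
      define p i where "p = q div n" and "i = q mod n"
      have b: "0 < b" and n: "0 < n" using t by (auto intro: Nat.gr0I)
      have lt: "j < b" "i < n" using b n by (auto simp: j_def i_def)
      have "q < m * n" using t by (auto simp: q_def intro: less_mult_imp_div_less)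
      then have p: "p < m" by (auto simp: p_def intro: less_mult_imp_div_less)
      have "t = (p * n + i) * b + j" by (simp add: p_def i_def q_def j_def)
      moreover have "blk n b x (p, i) j = blk n b x' (p, i) j"
        using fun_cong[OF e, of "(p, i)"] p lt by simp
      ultimately have "x t = -1 \<longleftrightarrow> x' t = -1" using lt by (simp add: blk_def split: if_splits)
      moreover have "x t \<in> {-1, 1}" "x' t \<in> {-1, 1}" using x t by (auto simp: cube_def dest: PiE_mem)
      ultimately show "x t = x' t" by auto
    qed
  qed
  have sub: "?e ` cube (m * n * b) \<subseteq> ?X" using blk_cube by auto
  have "card ?X = 2 ^ (m * n * b)"
    by (simp add: card_PiE card_cube card_cartesian_product power_mult[symmetric] mult.commute)
  then have "card (?e ` cube (m * n * b)) = card ?X" by (simp add: card_image[OF inj] card_cube)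
  then have "?e ` cube (m * n * b) = ?X" using sub by (intro card_subset_eq finite_PiE) auto
  then show ?thesis using inj by (simp add: bij_betw_def)
qed

lemma amplified_lipschitz:
  fixes u v :: real
  assumes "\<bar>u\<bar> \<le> 1 / 2" "\<bar>v\<bar> \<le> 1 / 2"
  shows "\<bar>sin ((2 * real j + 1) * arcsin u) - sin ((2 * real j + 1) * arcsin v)\<bar> \<le> 2 * (2 * real j + 1) * \<bar>u - v\<bar>"
proof -
  let ?f = "\<lambda>u. sin ((2 * real j + 1) * arcsin u)" and ?f' = "\<lambda>u. cos ((2 * real j + 1) * arcsin u) * ((2 * real j + 1) * inverse (sqrt (1 - u\<^sup>2)))"
  have d: "(?f has_field_derivative ?f' t) (at t within {-1/2..1/2})" if "t \<in> {-1/2..1/2}" for t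
  proof -
    have "-1 < t" "t < 1" using that by auto
    then have "(arcsin has_field_derivative inverse (sqrt (1 - t\<^sup>2))) (at t)" by (rule DERIV_arcsin)
    from DERIV_fun_sin[OF DERIV_cmult[OF this, of "2 * real j + 1"]]
    show ?thesis by (rule has_field_derivative_at_within)
  qed
  have b: "norm (?f' t) \<le> 2 * (2 * real j + 1)" if "t \<in> {-1/2..1/2}" for t
  proof -
    have "\<bar>t\<bar> \<le> 1 / 2" using that by auto
    then have "t\<^sup>2 \<le> (1 / 2)\<^sup>2" by (metis abs_ge_zero power2_abs power_mono)
    then have "(1 / 2)\<^sup>2 \<le> 1 - t\<^sup>2" by (simp add: power2_eq_square)
    then have s: "1 / 2 \<le> sqrt (1 - t\<^sup>2)" by (rule real_le_rsqrt)
    then have "inverse (sqrt (1 - t\<^sup>2)) \<le> 2" using le_imp_inverse_le[OF s] by simp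
    moreover have i0: "0 \<le> inverse (sqrt (1 - t\<^sup>2))"
      unfolding inverse_nonnegative_iff_nonnegative using s by linarith
    ultimately have "\<bar>cos ((2 * real j + 1) * arcsin t)\<bar> * ((2 * real j + 1) * inverse (sqrt (1 - t\<^sup>2))) \<le> 1 * ((2 * real j + 1) * 2)"
      by (intro mult_mono) auto
    then show ?thesis
      unfolding real_norm_def abs_mult[of "cos _"] abs_of_nonneg[OF mult_nonneg_nonneg[OF _ i0, of "2 * real j + 1"], simplified] by (simp add: mult_ac)
  qed
  have "norm (?f u - ?f v) \<le> 2 * (2 * real j + 1) * norm (u - v)"
    by (rule field_differentiable_bound[OF _ d b]) (use assms in auto)
  then show ?thesis by simp
qed

text \<open>With \<theta> = \<open>arcsin a\<close> and \<open>j\<close> the integer part of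
  \<open>pi / (4 * \<theta>)\<close>, the angle \<open>(2 * j + 1) * \<theta>\<close> is within
  \<theta> of \<open>pi / 2\<close>, so its sine is at least \<open>cos \<theta>\<close>, hence at
  least 0.96. By \<open>amplified_lipschitz\<close> the chosen radius moves the amplitude by at most
  1/8.\<close>

lemma amplification_choice:
  fixes a :: real
  assumes a: "0 < a" "a \<le> 1 / 4"
  shows "\<exists>j :: nat. j \<le> 1 / a \<and>
    (\<forall>u. \<bar>u\<bar> \<le> 1 / (16 * (2 * real j + 1)) \<longrightarrow> (sin ((2 * real j + 1) * arcsin u))\<^sup>2 \<le> 1 / 3) \<and>
    (\<forall>u. \<bar>u - a\<bar> \<le> 1 / (16 * (2 * real j + 1)) \<longrightarrow> 2 / 3 \<le> (sin ((2 * real j + 1) * arcsin u))\<^sup>2)"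
proof -
  define \<theta> where "\<theta> = arcsin a"
  have s\<theta>: "sin \<theta> = a" using a by (simp add: \<theta>_def)
  have \<theta>: "0 < \<theta>" "\<theta> \<le> pi / 2"
    using a arcsin_less_arcsin[of 0 a] arcsin_bounded[of a] by (auto simp: \<theta>_def)
  have a\<theta>: "a \<le> \<theta>" using sin_x_le_x[of \<theta>] \<theta> s\<theta> by simp
  define j where "j = nat \<lfloor>pi / (4 * \<theta>)\<rfloor>"
  have j: "real j \<le> pi / (4 * \<theta>)" "pi / (4 * \<theta>) < real j + 1"
    using \<theta> pi_gt_zero by (simp_all add: j_def of_nat_nat)
  have "pi / (4 * \<theta>) \<le> 1 / a"
  proof -
    have "pi / (4 * \<theta>) \<le> 4 / (4 * \<theta>)" using \<theta> pi_less_4 by (intro divide_right_mono) auto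
    also have "\<dots> \<le> 1 / a" using \<theta> a a\<theta> by (simp add: frac_le)
    finally show ?thesis .
  qed
  then have ja: "real j \<le> 1 / a" using j by linarith
  define u0 where "u0 = (2 * real j + 1) * \<theta> - pi / 2"
  have "real j * (4 * \<theta>) \<le> pi" "pi < (real j + 1) * (4 * \<theta>)" using j \<theta> by (simp_all add: pos_le_divide_eq pos_divide_less_eq)
  then have u0: "\<bar>u0\<bar> \<le> \<theta>" by (simp add: u0_def algebra_simps abs_le_iff)
  have "sin ((2 * real j + 1) * \<theta>) = cos \<bar>u0\<bar>"
  proof -
    have "sin (u0 + pi / 2) = cos u0" by (simp add: sin_add)
    then show ?thesis by (simp add: u0_def)
  qed
  also have "\<dots> \<ge> cos \<theta>" using u0 \<theta> by (intro cos_monotone_0_pi_le) auto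
  finally have "cos \<theta> \<le> sin ((2 * real j + 1) * \<theta>)" .
  moreover have "96 / 100 \<le> cos \<theta>"
  proof -
    have "a\<^sup>2 \<le> (1 / 4)\<^sup>2" using a by (intro power_mono) auto
    then have "(96 / 100)\<^sup>2 \<le> 1 - a\<^sup>2" by (simp add: power2_eq_square)
    then have "96 / 100 \<le> sqrt (1 - a\<^sup>2)" by (rule real_le_rsqrt)
    then show ?thesis using a by (simp add: \<theta>_def cos_arcsin)
  qed
  ultimately have big: "96 / 100 \<le> sin ((2 * real j + 1) * arcsin a)" by (simp add: \<theta>_def)
  let ?r = "1 / (16 * (2 * real j + 1))"
  have r: "?r \<le> 1 / 16" "2 * (2 * real j + 1) * ?r = 1 / 8" by (simp_all add: field_simps)
  have near: "\<bar>sin ((2 * real j + 1) * arcsin u) - sin ((2 * real j + 1) * arcsin v)\<bar> \<le> 1 / 8"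
    if "\<bar>u - v\<bar> \<le> ?r" "\<bar>v\<bar> \<le> 1 / 4" for u v
  proof -
    have "\<bar>u\<bar> \<le> 1 / 2" "\<bar>v\<bar> \<le> 1 / 2" using that r(1) by linarith+
    then have "\<bar>sin ((2 * real j + 1) * arcsin u) - sin ((2 * real j + 1) * arcsin v)\<bar> \<le> 2 * (2 * real j + 1) * \<bar>u - v\<bar>"
      by (rule amplified_lipschitz)
    also have "\<dots> \<le> 2 * (2 * real j + 1) * ?r" using that by (intro mult_left_mono) auto
    finally show ?thesis unfolding r(2) .
  qed
  show ?thesis
  proof (intro exI[of _ j] conjI allI impI ja)
    fix u assume "\<bar>u\<bar> \<le> ?r"
    then have "\<bar>sin ((2 * real j + 1) * arcsin u)\<bar> \<le> 1 / 8" using near[of u 0] by simp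
    then have "\<bar>sin ((2 * real j + 1) * arcsin u)\<bar>\<^sup>2 \<le> (1 / 8)\<^sup>2" by (intro power_mono) auto
    then show "(sin ((2 * real j + 1) * arcsin u))\<^sup>2 \<le> 1 / 3" by (simp add: power2_eq_square)
  next
    fix u assume "\<bar>u - a\<bar> \<le> ?r"
    then have "\<bar>sin ((2 * real j + 1) * arcsin u) - sin ((2 * real j + 1) * arcsin a)\<bar> \<le> 1 / 8"
      by (rule near) (use a in auto)
    \<comment> \<open>0.96 - 0.125 exceeds 0.83, whose square still exceeds 2/3.\<close>
    then have "83 / 100 \<le> sin ((2 * real j + 1) * arcsin u)" using big by linarith
    then have "(83 / 100)\<^sup>2 \<le> (sin ((2 * real j + 1) * arcsin u))\<^sup>2" by (intro power_mono) auto
    then show "2 / 3 \<le> (sin ((2 * real j + 1) * arcsin u))\<^sup>2" by (simp add: power2_eq_square)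
  qed
qed

lemma protocol_sum_le:
  fixes w :: "point \<Rightarrow> point \<Rightarrow> real" and R :: "Defs.tree pmf"
  assumes w: "\<And>A B. A \<subseteq> C \<Longrightarrow> B \<subseteq> C \<Longrightarrow> (\<Sum>x\<in>A. \<Sum>y\<in>B. w x y) \<le> K" and K: "0 \<le> K" and C: "finite C"
    and depth: "\<And>t. t \<in> set_pmf R \<Longrightarrow> depth t \<le> c"
  shows "(\<Sum>x\<in>C. \<Sum>y\<in>C. w x y * pmf (map_pmf (\<lambda>t. run t x y) R) False) \<le> 2 ^ c * K"
proof -
  let ?f = "\<lambda>t. \<Sum>x\<in>C. \<Sum>y\<in>C. w x y * indicator {t. \<not> run t x y} t"
  have int: "integrable (measure_pmf R) (\<lambda>t. w x y * indicator {t. \<not> run t x y} t)" for x y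
    by (rule measure_pmf.integrable_const_bound[of _ "\<bar>w x y\<bar>"]) (auto simp: indicator_def)
  have "(\<Sum>x\<in>C. \<Sum>y\<in>C. w x y * pmf (map_pmf (\<lambda>t. run t x y) R) False) = measure_pmf.expectation R ?f"
  proof -
    have "measure_pmf.expectation R (\<lambda>t. w x y * indicator {t. \<not> run t x y} t) = w x y * pmf (map_pmf (\<lambda>t. run t x y) R) False" for x y
    proof -
      have "(\<lambda>t. run t x y) -` {False} = {t. \<not> run t x y}" by auto
      then show ?thesis by (simp add: pmf_map)
    qed
    note e = this
    have "measure_pmf.expectation R ?f = (\<Sum>x\<in>C. measure_pmf.expectation R (\<lambda>t. \<Sum>y\<in>C. w x y * indicator {t. \<not> run t x y} t))"
      by (intro Bochner_Integration.integral_sum Bochner_Integration.integrable_sum int)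
    also have "\<dots> = (\<Sum>x\<in>C. \<Sum>y\<in>C. measure_pmf.expectation R (\<lambda>t. w x y * indicator {t. \<not> run t x y} t))"
      by (intro sum.cong refl Bochner_Integration.integral_sum int)
    finally show ?thesis by (simp only: e)
  qed
  also have "\<dots> \<le> 2 ^ c * K"
  proof (rule measure_pmf.integral_le_const)
    show "integrable (measure_pmf R) ?f" using int by (intro Bochner_Integration.integrable_sum)
    show "AE t in measure_pmf R. ?f t \<le> 2 ^ c * K"
    proof (rule AE_pmfI)
      fix t assume t: "t \<in> set_pmf R"
      have "?f t = (\<Sum>x\<in>C. \<Sum>y\<in>C. if run t x y then 0 else w x y)" by (intro sum.cong refl) simp
      also have "\<dots> \<le> 2 ^ depth t * K" by (rule tree_sum_le[OF w K C]) auto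
      also have "\<dots> \<le> 2 ^ c * K" using depth[OF t] K by (intro mult_right_mono power_increasing) auto
      finally show "?f t \<le> 2 ^ c * K" .
    qed
  qed
  finally show ?thesis .
qed

section \<open>The separation\<close>

context forr
begin

lemma ph_cong: "(\<And>p i. p < 2 * k + 1 \<Longrightarrow> i < n \<Longrightarrow> z (p, i) = z' (p, i)) \<Longrightarrow> ph k z = ph k z'"
proof -
  assume a: "\<And>p i. p < 2 * k + 1 \<Longrightarrow> i < n \<Longrightarrow> z (p, i) = z' (p, i)"
  have "map (lay n z) (ord k) = map (lay n z') (ord k)"
  proof (rule map_cong[OF refl])
    fix p assume "p \<in> set (ord k)"
    then have "p < 2 * k + 1" by (simp add: ord(2))
    then show "lay n z p = lay n z' p" unfolding lay_def by (intro restrict_ext a) auto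
  qed
  then show ?thesis by (simp only: ph_def)
qed

text \<open>A corruption argument with the weights \<open>(1 - \<eta>) * c0 - H\<close>. A correct
  protocol rejects most uniform inputs and few inputs weighted by \<open>H\<close>, so its weighted
  rejection is a constant fraction of \<open>K\<close>, while each of the \<open>2 ^ c\<close>
  rectangles of a tree contributes at most \<open>K / r ^ d\<close>.\<close>

theorem separation:
  fixes P d h j k :: nat and \<sigma> \<tau> :: real
  assumes k: "0 < k" and P: "0 < P" and \<sigma>: "0 < \<sigma>" "\<sigma> \<le> 1" and \<tau>: "0 < \<tau>"
    and minors: "\<And>T T'. T \<subseteq> {..<n} \<Longrightarrow> T' \<subseteq> {..<n} \<Longrightarrow> card T \<le> d \<Longrightarrow> card T' \<le> d \<Longrightarrow> minor_le M T T' \<sigma>"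
    and h: "(2 * k + 1) * n * 2 ^ (16 * P) + 2 * k * n + 1 \<le> 2 ^ h"
    and lo: "\<And>u. \<bar>u\<bar> \<le> \<tau> \<Longrightarrow> (sin ((2 * real j + 1) * arcsin u))\<^sup>2 \<le> 1 / 3"
    and hi: "\<And>u. \<bar>u - cc ^ (2 * k)\<bar> \<le> \<tau> \<Longrightarrow> 2 / 3 \<le> (sin ((2 * real j + 1) * arcsin u))\<^sup>2"
    and e1: "(1 + 1 / (2 ^ P) ^ 4) ^ ((2 * k + 1) * n) - 1 \<le> (1 / 100 :: real)"
    and e2: "2 * sqrt (6 * ((6 * \<sigma>\<^sup>2) ^ k * n)) \<le> 1 / 100"
    and e3: "2 ^ (k + 4) / (\<tau>\<^sup>2 * n) \<le> 1 / 100"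
  shows "\<exists>F. Q_cc (1 / 3) ((2 * k + 1) * n * (16 * P)) F \<le> 2 * Suc h * ((4 * k + 3) + j * (8 * k + 8)) \<and>
    P * d \<le> R_cc (1 / 3) ((2 * k + 1) * n * (16 * P)) F + 3"
proof -
  define b where "b = 16 * P"
  define V where "V = {..<2 * k + 1} \<times> {..<n}"
  define N where "N = (2 * k + 1) * n * b"
  define pr where "pr u = (sin ((2 * real j + 1) * arcsin u))\<^sup>2" for u
  define z where "z x y v = ipg b (blk n b x v) (blk n b y v)" for x y v
  \<comment> \<open>The promise is read off the acceptance probability of the quantum protocol,
    which is therefore correct by construction. Concentration of \<open>ph\<close> shows later that
    both values cover most of their distribution.\<close>
  define F where "F x y = (if 2 / 3 \<le> pr (ph k (z x y)) then Some True else if pr (ph k (z x y)) \<le> 1 / 3 then Some False else None)" for x y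
  have "\<exists>mvs. qvalid (Suc h) (Suc h) mvs \<and> qcost mvs = 2 * Suc h * ((4 * k + 3) + j * (8 * k + 8)) \<and>
    (\<forall>x y. qoutput_prob (Suc h) (Suc h) mvs h x y True = pr (ph k (\<lambda>v. ipg b (blk n b x v) (blk n b y v))) \<and>
      qoutput_prob (Suc h) (Suc h) mvs h x y False = 1 - pr (ph k (\<lambda>v. ipg b (blk n b x v) (blk n b y v))))"
    unfolding pr_def
    by (rule quantum_protocol[OF finite_cube[of b] blk_cube ipg_pm]) (use h in \<open>simp add: card_cube b_def\<close>)
  then obtain mvs where mvs: "qvalid (Suc h) (Suc h) mvs" "qcost mvs = 2 * Suc h * ((4 * k + 3) + j * (8 * k + 8))"
      "\<And>x y. qoutput_prob (Suc h) (Suc h) mvs h x y True = pr (ph k (z x y))" "\<And>x y. qoutput_prob (Suc h) (Suc h) mvs h x y False = 1 - pr (ph k (z x y))"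
    unfolding z_def by blast
  have comp: "computes N (1 / 3) F (qoutput_prob (Suc h) (Suc h) mvs h)"
    unfolding computes_def
  proof (intro ballI allI impI)
    fix x y v assume "F x y = Some v"
    then show "1 - 1 / 3 \<le> qoutput_prob (Suc h) (Suc h) mvs h x y v"
      by (cases v) (auto simp: F_def mvs(3,4) split: if_splits)
  qed
  have Q: "Q_cc (1 / 3) N F \<le> 2 * Suc h * ((4 * k + 3) + j * (8 * k + 8))"
    unfolding Q_cc_def
    by (intro cInf_lower CollectI, rule exI[of _ "Suc h"], rule exI[of _ "Suc h"], rule exI[of _ mvs], rule exI[of _ h])
      (use comp mvs(1,2) in simp_all)
  define r where "r = (2 :: real) ^ P"
  have r2: "2 \<le> r" unfolding r_def using P power_increasing[of 1 P "2 :: real"] by simp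
  interpret lifting V "cube b" "ipg b" r
  proof
    show "real (card (cube b)) = r ^ 16" by (simp add: card_cube r_def b_def mult.commute flip: power_mult)
  qed (use r2 in \<open>auto simp: V_def ipg_pm ipg_orth\<close>)
  let ?X = "V \<rightarrow>\<^sub>E cube b" and ?Z = "V \<rightarrow>\<^sub>E {-1, 1 :: real}"
  have sg: "sgns (2 * k + 1) n = ?Z" by (simp add: V_def)
  define e where "e = (\<lambda>x. \<lambda>v\<in>V. blk n b x v)"
  have bij: "bij_betw e (cube N) ?X" unfolding e_def N_def V_def by (rule blk_bij)
  have eX: "e ` A \<subseteq> ?X" if "A \<subseteq> cube N" for A using bij_betw_imp_surj_on[OF bij] image_mono[OF that, of e] by (simp only:)
  have se: "(\<Sum>x\<in>A. f (e x)) = (\<Sum>x\<in>e ` A. f x)" if "A \<subseteq> cube N" for A and f :: "_ \<Rightarrow> real"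
    using inj_on_subset[OF bij_betw_imp_inj_on[OF bij] that] by (simp add: sum.reindex)
  have phG: "ph k (z x y) = ph k (G (e x) (e y))" for x y
  proof (rule ph_cong)
    fix p i assume "p < 2 * k + 1" "i < n"
    then have "(p, i) \<in> V" by (simp add: V_def)
    then show "z x y (p, i) = G (e x) (e y) (p, i)" by (simp add: z_def G_def e_def)
  qed
  define K where "K = (real (card ?X))\<^sup>2"
  have K0: "0 < K" unfolding K_def card_X using r2 by simp
  have cardC: "(real (card (cube N)))\<^sup>2 = K" unfolding K_def using bij_betw_same_card[OF bij] by simp
  have \<eta>: "\<eta> \<le> 1 / 100"
  proof -
    have "card V = (2 * k + 1) * n" by (simp add: V_def card_cartesian_product)
    then have "\<eta> = (1 + 1 / r ^ 4) ^ ((2 * k + 1) * n) - 1" by (simp only: \<eta>_def)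
    also have "\<dots> \<le> 1 / 100" using e1 by (simp only: r_def)
    finally show ?thesis .
  qed
  have avgZ: "(\<Sum>x\<in>cube N. \<Sum>y\<in>cube N. \<Psi> (G (e x) (e y))) \<le> K * (101 / 100) * avg ?Z \<Psi>" if "\<And>z. z \<in> ?Z \<Longrightarrow> 0 \<le> \<Psi> z" for \<Psi>
  proof -
    have a0: "0 \<le> avg ?Z \<Psi>" by (rule avg_nonneg) (rule that)
    have "(\<Sum>x\<in>cube N. \<Sum>y\<in>cube N. \<Psi> (G (e x) (e y))) = (\<Sum>x\<in>?X. \<Sum>y\<in>?X. \<Psi> (G x y))"
      using bij by (simp add: se[OF order_refl, of "\<lambda>y. \<Psi> (G _ y)"] se[OF order_refl, of "\<lambda>x. \<Sum>y\<in>_. \<Psi> (G x y)"] bij_betw_def)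
    also have "\<dots> \<le> K * avg ?Z \<Psi> + K * \<eta> * avg ?Z \<Psi>"
    proof -
      have "\<bar>(\<Sum>x\<in>?X. \<Sum>y\<in>?X. \<Psi> (G x y)) - K * avg ?Z \<Psi>\<bar> \<le> K * \<eta> * avg ?Z \<Psi>"
        unfolding K_def by (rule sum_X) (rule that)
      then show ?thesis by linarith
    qed
    also have "\<dots> \<le> K * avg ?Z \<Psi> + K * (1 / 100) * avg ?Z \<Psi>" using \<eta> K0 a0 by (intro add_left_mono mult_right_mono mult_left_mono) auto
    finally show ?thesis by (simp add: algebra_simps)
  qed
  have h0: "0 \<le> hh k z" if "z \<in> ?Z" for z using hh_nonneg[of z k] that sg by simp
  define c0 where "c0 = 1 - 2 * sqrt (6 * ((6 * \<sigma>\<^sup>2) ^ k * n))"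
  have c0: "99 / 100 \<le> c0" "c0 \<le> 1" using e2 by (auto simp: c0_def)
  have rect: "(\<Sum>x\<in>A. \<Sum>y\<in>B. (1 - \<eta>) * c0 - hh k (G (e x) (e y))) \<le> K / r ^ d" if AB: "A \<subseteq> cube N" "B \<subseteq> cube N" for A B
  proof -
    have "(\<Sum>x\<in>A. \<Sum>y\<in>B. (1 - \<eta>) * c0 - hh k (G (e x) (e y))) = (\<Sum>x\<in>e ` A. \<Sum>y\<in>e ` B. (1 - \<eta>) * c0 - hh k (G x y))"
      by (simp only: se[OF AB(2), of "\<lambda>y. (1 - \<eta>) * c0 - hh k (G _ y)"] se[OF AB(1), of "\<lambda>x. \<Sum>y\<in>_. (1 - \<eta>) * c0 - hh k (G x y)"])
    also have "\<dots> \<le> (real (card ?X))\<^sup>2 / r ^ d"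
    proof (rule rectangle_bound[where h = "hh k", OF _ _ c0(2) _ _ eX[OF AB(1)] eX[OF AB(2)]])
      fix T \<rho> assume "T \<subseteq> V" "card T < d" "\<rho> \<in> ?Z"
      then show "c0 \<le> avg (ag T \<rho> ?Z) (hh k)"
        using avg_hh_subcube[OF k _ _ _ \<sigma> minors, of T d \<rho>] sg by (simp add: c0_def V_def)
    qed (use c0 \<eta> h0 in auto)
    finally show ?thesis by (simp add: K_def)
  qed
  obtain R where R: "\<And>t. t \<in> set_pmf R \<Longrightarrow> depth t \<le> R_cc (1 / 3) N F" "computes N (1 / 3) F (\<lambda>x y v. pmf (map_pmf (\<lambda>t. run t x y) R) v)"
    using R_cc_attained[of "1 / 3" N F] by auto
  define c where "c = R_cc (1 / 3) N F"
  define rej where "rej x y = pmf (map_pmf (\<lambda>t. run t x y) R) False" for x y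
  have rej: "0 \<le> rej x y" "rej x y \<le> 1" for x y by (auto simp: rej_def pmf_le_1)
  have tot: "pmf (map_pmf (\<lambda>t. run t x y) R) True = 1 - rej x y" for x y
  proof -
    have "(\<Sum>v\<in>UNIV. pmf (map_pmf (\<lambda>t. run t x y) R) v) = 1" by (rule sum_pmf_eq_1) auto
    then show ?thesis by (simp add: rej_def UNIV_bool)
  qed
  have rejF: "F x y = Some False \<Longrightarrow> 2 / 3 \<le> rej x y" "F x y = Some True \<Longrightarrow> rej x y \<le> 1 / 3" if "x \<in> cube N" "y \<in> cube N" for x y
    using R(2)[unfolded computes_def, rule_format, OF that] tot[of x y] by (fastforce simp: rej_def)+
  define \<phi>1 where "\<phi>1 = cc ^ (2 * k)"
  define u where "u x y = ph k (G (e x) (e y))" for x y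
  define H where "H x y = hh k (G (e x) (e y))" for x y
  have H0: "0 \<le> H x y" if "x \<in> cube N" "y \<in> cube N" for x y
    unfolding H_def using that bij by (intro h0 G_Z) (auto simp: bij_betw_def)
  have \<tau>2: "0 < \<tau>\<^sup>2" using \<tau> by simp
  \<comment> \<open>Chebyshev's inequality in pointwise form: outside the window the quotient is at
    least 1 and the trivial bounds on \<open>rej\<close> suffice.\<close>
  have cheb: "1 \<le> t\<^sup>2 / \<tau>\<^sup>2" if "\<not> \<bar>t\<bar> \<le> \<tau>" for t
  proof -
    have "\<tau>\<^sup>2 \<le> \<bar>t\<bar>\<^sup>2" using that \<tau> by (intro power_mono) auto
    then show ?thesis using \<tau>2 by simp
  qed
  have low: "2 / 3 - (u x y)\<^sup>2 / \<tau>\<^sup>2 \<le> rej x y" if xy: "x \<in> cube N" "y \<in> cube N" for x y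
  proof (cases "\<bar>u x y\<bar> \<le> \<tau>")
    case True
    then have "F x y = Some False" using lo[OF True] by (simp add: F_def pr_def phG u_def)
    then show ?thesis using rejF(1)[OF xy] divide_nonneg_pos[OF zero_le_power2 \<tau>2, of "u x y"] by linarith
  next
    case False
    then show ?thesis using cheb[OF False] rej(1)[of x y] by linarith
  qed
  have high: "H x y * rej x y \<le> 1 / 3 * H x y + H x y * (u x y - \<phi>1)\<^sup>2 / \<tau>\<^sup>2" if xy: "x \<in> cube N" "y \<in> cube N" for x y
  proof -
    have "rej x y \<le> 1 / 3 + (u x y - \<phi>1)\<^sup>2 / \<tau>\<^sup>2"
    proof (cases "\<bar>u x y - \<phi>1\<bar> \<le> \<tau>")
      case True
      then have "F x y = Some True" using hi[of "u x y"] by (simp add: F_def pr_def phG u_def \<phi>1_def)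
      then show ?thesis using rejF(2)[OF xy] divide_nonneg_pos[OF zero_le_power2 \<tau>2, of "u x y - \<phi>1"] by linarith
    next
      case False
      then show ?thesis using cheb[OF False] rej(2)[of x y] by linarith
    qed
    then have "H x y * rej x y \<le> H x y * (1 / 3 + (u x y - \<phi>1)\<^sup>2 / \<tau>\<^sup>2)" using H0[OF xy] by (rule mult_left_mono)
    then show ?thesis by (simp add: algebra_simps)
  qed
  let ?S = "\<lambda>f. \<Sum>x\<in>cube N. \<Sum>y\<in>cube N. f x y :: real"
  have SX: "?S (\<lambda>x y. t) = K * t" for t using cardC by (simp add: power2_eq_square)
  have small: "1 / (\<tau>\<^sup>2 * n) \<le> 1 / 1600" "2 ^ (k + 3) / (\<tau>\<^sup>2 * n) \<le> 1 / 200"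
  proof -
    have pos: "0 < \<tau>\<^sup>2 * n" using \<tau>2 n by simp
    have "(2 :: real) ^ 4 \<le> 2 ^ (k + 4)" by (rule power_increasing) auto
    then have "16 / (\<tau>\<^sup>2 * n) \<le> 2 ^ (k + 4) / (\<tau>\<^sup>2 * n)" using pos by (intro divide_right_mono) auto
    then have "16 / (\<tau>\<^sup>2 * n) \<le> 1 / 100" using e3 by (rule order_trans)
    moreover have "16 / (\<tau>\<^sup>2 * n) = 16 * (1 / (\<tau>\<^sup>2 * n))" by simp
    ultimately show "1 / (\<tau>\<^sup>2 * n) \<le> 1 / 1600" by linarith
    have "2 * (2 ^ (k + 3) / (\<tau>\<^sup>2 * n)) = 2 ^ (k + 4) / (\<tau>\<^sup>2 * n)" by (simp add: power_add)
    then show "2 ^ (k + 3) / (\<tau>\<^sup>2 * n) \<le> 1 / 200" using e3 by linarith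
  qed
  have s1: "?S (\<lambda>x y. (u x y)\<^sup>2 / \<tau>\<^sup>2) \<le> K * (1 / 100)"
  proof -
    have "?S (\<lambda>x y. (u x y)\<^sup>2 / \<tau>\<^sup>2) = ?S (\<lambda>x y. (u x y)\<^sup>2) / \<tau>\<^sup>2" by (simp add: sum_divide_distrib)
    also have "\<dots> \<le> K * (101 / 100) * (1 / n) / \<tau>\<^sup>2"
    proof (rule divide_right_mono)
      have "?S (\<lambda>x y. (u x y)\<^sup>2) \<le> K * (101 / 100) * avg ?Z (\<lambda>z. (ph k z)\<^sup>2)"
        unfolding u_def by (rule avgZ[of "\<lambda>z. (ph k z)\<^sup>2"]) simp
      also have "\<dots> \<le> K * (101 / 100) * (1 / n)"
        using avg_ph[OF k] K0 unfolding sg by (intro mult_left_mono) auto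
      finally show "?S (\<lambda>x y. (u x y)\<^sup>2) \<le> K * (101 / 100) * (1 / n)" .
    qed (use \<tau>2 in simp)
    also have "\<dots> = K * (101 / 100 * (1 / (\<tau>\<^sup>2 * n)))" by simp
    also have "\<dots> \<le> K * (1 / 100)"
      by (rule mult_left_mono) (use small(1) K0 in linarith)+
    finally show ?thesis .
  qed
  have s2: "?S H \<le> K * (101 / 100)"
    using avgZ[of "hh k"] h0 avg_hh[of k] unfolding sg H_def by simp
  have s3: "?S (\<lambda>x y. H x y * (u x y - \<phi>1)\<^sup>2 / \<tau>\<^sup>2) \<le> K * (1 / 100)"
  proof -
    have "?S (\<lambda>x y. H x y * (u x y - \<phi>1)\<^sup>2 / \<tau>\<^sup>2) = ?S (\<lambda>x y. H x y * (u x y - \<phi>1)\<^sup>2) / \<tau>\<^sup>2" by (simp add: sum_divide_distrib)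
    also have "\<dots> \<le> K * (101 / 100) * (2 ^ (k + 3) / n) / \<tau>\<^sup>2"
    proof (rule divide_right_mono)
      have "?S (\<lambda>x y. H x y * (u x y - \<phi>1)\<^sup>2) \<le> K * (101 / 100) * avg ?Z (\<lambda>z. hh k z * (ph k z - \<phi>1)\<^sup>2)"
        unfolding u_def H_def by (rule avgZ[of "\<lambda>z. hh k z * (ph k z - \<phi>1)\<^sup>2"]) (simp add: h0)
      also have "\<dots> \<le> K * (101 / 100) * (2 ^ (k + 3) / n)"
        using avg_hh_ph[of k] K0 unfolding sg \<phi>1_def by (intro mult_left_mono) auto
      finally show "?S (\<lambda>x y. H x y * (u x y - \<phi>1)\<^sup>2) \<le> K * (101 / 100) * (2 ^ (k + 3) / n)" .
    qed (use \<tau>2 in simp)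
    also have "\<dots> = K * (101 / 100 * (2 ^ (k + 3) / (\<tau>\<^sup>2 * n)))" by (simp add: mult_ac)
    also have "\<dots> \<le> K * (1 / 100)"
      by (rule mult_left_mono) (use small(2) K0 in linarith)+
    finally show ?thesis .
  qed
  have main: "?S (\<lambda>x y. ((1 - \<eta>) * c0 - H x y) * rej x y) \<le> 2 ^ c * (K / r ^ d)"
    unfolding rej_def H_def c_def
    by (rule protocol_sum_le[OF rect _ finite_cube R(1)]) (use K0 r2 in auto)
  have "K * (2 / 3 - 1 / 100) \<le> ?S (\<lambda>x y. 2 / 3) - ?S (\<lambda>x y. (u x y)\<^sup>2 / \<tau>\<^sup>2)" unfolding SX using s1 by (simp add: algebra_simps)
  also have "\<dots> = ?S (\<lambda>x y. 2 / 3 - (u x y)\<^sup>2 / \<tau>\<^sup>2)" by (simp add: sum_subtractf)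
  also have "\<dots> \<le> ?S rej" by (intro sum_mono low)
  finally have a1: "K * (2 / 3 - 1 / 100) \<le> ?S rej" .
  have "?S (\<lambda>x y. H x y * rej x y) \<le> ?S (\<lambda>x y. 1 / 3 * H x y + H x y * (u x y - \<phi>1)\<^sup>2 / \<tau>\<^sup>2)" by (intro sum_mono high)
  also have "\<dots> = 1 / 3 * ?S H + ?S (\<lambda>x y. H x y * (u x y - \<phi>1)\<^sup>2 / \<tau>\<^sup>2)" by (simp add: sum.distrib sum_distrib_left)
  also have "\<dots> \<le> 1 / 3 * (K * (101 / 100)) + K * (1 / 100)" using s2 s3 by linarith
  finally have a2: "?S (\<lambda>x y. H x y * rej x y) \<le> 1 / 3 * (K * (101 / 100)) + K * (1 / 100)" .
  have q: "98 / 100 \<le> (1 - \<eta>) * c0"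
  proof -
    have "99 / 100 * (99 / 100) \<le> (1 - \<eta>) * c0" using \<eta> c0 by (intro mult_mono) auto
    then show ?thesis by simp
  qed
  have "98 / 100 * (K * (2 / 3 - 1 / 100)) \<le> (1 - \<eta>) * c0 * ?S rej" using q a1 K0 by (intro mult_mono) auto
  \<comment> \<open>0.98 * (2/3 - 0.01) is about 0.64, against about 0.35 on the other side. The
    generous 1/8 produces the summand 3 in the conclusion.\<close>
  then have "K * (1 / 8) \<le> (1 - \<eta>) * c0 * ?S rej - ?S (\<lambda>x y. H x y * rej x y)" using a2 K0 by simp
  also have "\<dots> = ?S (\<lambda>x y. ((1 - \<eta>) * c0 - H x y) * rej x y)"
    by (simp add: left_diff_distrib sum_subtractf sum_distrib_left)
  also note main
  finally have "K * (1 / 8) \<le> K * (2 ^ c / r ^ d)" by (simp add: mult_ac)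
  then have "1 / 8 \<le> 2 ^ c / r ^ d" using K0 by (simp only: mult_le_cancel_left_pos)
  then have "r ^ d \<le> 2 ^ (c + 3)" using r2 by (simp add: pos_le_divide_eq power_add)
  then have "(2 :: real) ^ (P * d) \<le> 2 ^ (c + 3)" by (simp add: r_def power_mult)
  then have "P * d \<le> c + 3" by simp
  then show ?thesis using Q by (intro exI[of _ F]) (simp add: c_def N_def b_def)
qed

end

lemma minor_le_scale:
  assumes "minor_le S T T' s" "0 \<le> x"
  shows "minor_le (\<lambda>i j. x * S i j) T T' (x * s)"
  unfolding minor_le_def
proof (intro allI)
  fix a b :: "nat \<Rightarrow> real"
  have "(\<Sum>i\<in>T. \<Sum>j\<in>T'. a i * (x * S i j) * b j) = x * (\<Sum>i\<in>T. \<Sum>j\<in>T'. a i * S i j * b j)"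
    by (simp add: sum_distrib_left mult_ac)
  moreover have "\<bar>\<Sum>i\<in>T. \<Sum>j\<in>T'. a i * S i j * b j\<bar> \<le> s * sqrt (\<Sum>i\<in>T. (a i)\<^sup>2) * sqrt (\<Sum>j\<in>T'. (b j)\<^sup>2)"
    using assms(1) unfolding minor_le_def by blast
  ultimately show "\<bar>\<Sum>i\<in>T. \<Sum>j\<in>T'. a i * (x * S i j) * b j\<bar> \<le> x * s * sqrt (\<Sum>i\<in>T. (a i)\<^sup>2) * sqrt (\<Sum>j\<in>T'. (b j)\<^sup>2)"
    using mult_left_mono[OF _ assms(2)] assms(2) by (simp add: abs_mult mult.assoc)
qed

lemma (in forr) cc_le: "cc \<le> n * x\<^sup>2"
  unfolding cc_def using mu_bounds by (intro mult_left_mono) auto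

text \<open>Everything is tied to \<open>P\<close>: width \<open>2 ^ P\<close>, blocks of
  \<open>16 * P\<close> bits and \<open>r = 2 ^ P\<close>. The number 676 is the square of 26 in
  \<open>sign_matrix_exists\<close>, so \<open>x\<^sup>2 * n\<close> is 1/676 and \<open>J\<close>
  bounds the inverse planted value independently of \<open>P\<close>.\<close>

lemma separation_instance:
  fixes \<delta> J :: real and k P :: nat
  assumes \<delta>: "0 < \<delta>" "\<delta> \<le> 1 / 4" and k: "2 \<le> k * \<delta>" and P: "4 \<le> P" and J: "J = 1 / (exp (-1) / 676) ^ (2 * k)"
    and e1: "exp ((2 * real k + 1) * 2 ^ P / (2 ^ P) ^ 4) - 1 \<le> (1 / 100 :: real)"
    and e2: "(6 * (1 + real P * ln 2)) ^ k / 2 ^ P \<le> 1 / 240000"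
    and e2': "6 * (1 + real P * ln 2) * 2 powr (- (real P * \<delta>)) \<le> 1"
    and e3: "2 ^ (k + 4) / ((1 / (16 * (2 * J + 1)))\<^sup>2 * 2 ^ P) \<le> 1 / 100"
  shows "\<exists>F. real (Q_cc (1 / 3) ((2 * k + 1) * 2 ^ P * (16 * P)) F) \<le> 2 * (17 * real P + 4 * k + 3) * ((4 * k + 3) + J * (8 * k + 8)) \<and>
    2 powr (P * (1 - \<delta>)) / 2 \<le> real (R_cc (1 / 3) ((2 * k + 1) * 2 ^ P * (16 * P)) F)"
proof -
  define n :: nat where "n = 2 ^ P"
  have n: "0 < n" "real n = 2 ^ P" by (simp_all add: n_def)
  note nP = n(2)
  have npow: "real n powr t = 2 powr (P * t)" for t :: real by (simp add: n powr_powr flip: powr_realpow)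
  have lnn: "ln (real n) = P * ln 2" by (simp add: n ln_realpow)
  have k0: "0 < k" using k by (intro gr0I) auto
  define d where "d = nat \<lfloor>real n powr (1 - \<delta>)\<rfloor>"
  \<comment> \<open>With this size, rounding down to \<open>d\<close> costs at most a factor
    2.\<close>
  have big: "8 \<le> real n powr (1 - \<delta>)"
  proof -
    have "4 * (3 / 4) \<le> real P * (1 - \<delta>)" using P \<delta> by (intro mult_mono) auto
    then have "(2 :: real) powr 3 \<le> 2 powr (P * (1 - \<delta>))" by (intro powr_mono) auto
    then show ?thesis by (simp add: npow)
  qed
  then have d: "real d \<le> real n powr (1 - \<delta>)" "real n powr (1 - \<delta>) < real d + 1" by (simp_all add: d_def of_nat_nat)
  then have d1: "1 \<le> d" using big by linarith
  \<comment> \<open>The bound of \<open>sign_matrix_exists\<close> for small minors, scaled by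
    \<open>x\<close>; the factors 26 cancel.\<close>
  define \<sigma> where "\<sigma> = sqrt (d * (1 + ln n) / n)"
  define s where "s = (1 + real P * ln 2) * 2 powr (- (real P * \<delta>))"
  have l0: "0 \<le> real P * ln 2" by simp
  have \<sigma>2: "0 < \<sigma>\<^sup>2" "\<sigma>\<^sup>2 \<le> s" and \<sigma>0: "0 < \<sigma>"
  proof -
    have pos: "0 < d * (1 + ln n) / n" using d1 n l0 by (simp add: lnn add_pos_nonneg)
    then show "0 < \<sigma>" by (simp add: \<sigma>_def)
    then show "0 < \<sigma>\<^sup>2" by simp
    have "\<sigma>\<^sup>2 = d * (1 + ln n) / n" using pos by (simp add: \<sigma>_def)
    also have "\<dots> \<le> real n powr (1 - \<delta>) * (1 + ln n) / n" using d(1) l0 n by (intro divide_right_mono mult_right_mono) (auto simp: lnn)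
    also have "\<dots> = (1 + ln n) * (real n powr (1 - \<delta>) / real n powr 1)" using n by simp
    also have "\<dots> = s" unfolding powr_diff[symmetric] npow lnn s_def by (simp add: algebra_simps)
    finally show "\<sigma>\<^sup>2 \<le> s" .
  qed
  have "6 * s \<le> 1" unfolding s_def using e2' by (simp only: mult.assoc)
  then have "\<sigma>\<^sup>2 \<le> 1\<^sup>2" using \<sigma>2 by simp
  then have \<sigma>1: "\<sigma> \<le> 1" by (rule power2_le_imp_le) simp
  \<comment> \<open>As \<open>k * \<delta> \<ge> 2\<close>, the powers of
    \<open>2 powr (- (real P * \<delta>))\<close> give the inverse square of \<open>n\<close>. One
    factor absorbs \<open>n\<close>, the other beats the logarithms.\<close>
  have dec: "(6 * \<sigma>\<^sup>2) ^ k * n \<le> 1 / 240000"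
  proof -
    have "(6 * \<sigma>\<^sup>2) ^ k \<le> (6 * s) ^ k" using \<sigma>2 by (intro power_mono) auto
    also have "\<dots> = (6 * (1 + real P * ln 2)) ^ k * (2 powr (- (real P * \<delta>))) ^ k" by (simp only: s_def power_mult_distrib mult.assoc)
    also have "(2 powr (- (real P * \<delta>))) ^ k = 2 powr (- (real P * (k * \<delta>)))"
      by (simp add: powr_powr mult_ac flip: powr_realpow)
    also have "(6 * (1 + real P * ln 2)) ^ k * 2 powr (- (real P * (k * \<delta>))) \<le> (6 * (1 + real P * ln 2)) ^ k * 2 powr (- (real P * 2))"
      using k l0 by (intro mult_left_mono powr_mono) (auto intro!: mult_left_mono)
    also have "2 powr (- (real P * 2)) = 1 / (2 ^ P * 2 ^ P)"
      unfolding mult_2_right powr_minus powr_add by (simp add: powr_realpow divide_inverse)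
    finally have "(6 * \<sigma>\<^sup>2) ^ k * n \<le> (6 * (1 + real P * ln 2)) ^ k * (1 / (2 ^ P * 2 ^ P)) * n" by (rule mult_right_mono) simp
    also have "\<dots> = (6 * (1 + real P * ln 2)) ^ k / 2 ^ P" by (simp add: n)
    finally show ?thesis using e2 by linarith
  qed
  have "0 < d" using d1 by simp
  from sign_matrix_exists[OF n(1) this] obtain S where
    SS: "(\<forall>i j. S i j = S j i) \<and> (\<forall>i j. S i j = 1 \<or> S i j = (-1 :: real)) \<and> minor_le S {..<n} {..<n} (26 * sqrt n) \<and>
      (\<forall>T T'. T \<subseteq> {..<n} \<longrightarrow> T' \<subseteq> {..<n} \<longrightarrow> card T \<le> d \<longrightarrow> card T' \<le> d \<longrightarrow> minor_le S T T' (26 * sqrt (d * (1 + ln n))))"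
    by (elim exE)
  note SM = SS[THEN conjunct1, rule_format] SS[THEN conjunct2, THEN conjunct1, rule_format]
    SS[THEN conjunct2, THEN conjunct2, THEN conjunct1] SS[THEN conjunct2, THEN conjunct2, THEN conjunct2, rule_format]
  define x where "x = 1 / (26 * sqrt n)"
  define M where "M i j = x * S i j" for i j
  have x0: "0 < x" using n by (simp add: x_def)
  have xn: "x\<^sup>2 * n = 1 / 676" using n by (simp add: x_def power_divide power_mult_distrib)
  have M: "minor_le M {..<n} {..<n} (x * (26 * sqrt n))"
    unfolding M_def by (rule minor_le_scale[OF SM(3)]) (use x0 in simp)
  interpret forr n M S x
  proof unfold_locales
    have "x * (26 * sqrt n) = 1" using n by (simp add: x_def)
    then show "minor_le M {..<n} {..<n} 1" using M by (simp only:)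
    show "M i j = x * S i j" for i j by (simp only: M_def)
    show "S i j = 1 \<or> S i j = -1" for i j by (rule SM(2))
    show "S i j = S j i" for i j by (rule SM(1))
    show "0 < x" "0 < n" by (fact x0, fact n(1))
    show "17 * x\<^sup>2 * n \<le> 1" using xn by simp
  qed
  have minors: "minor_le M T T' \<sigma>" if "T \<subseteq> {..<n}" "T' \<subseteq> {..<n}" "card T \<le> d" "card T' \<le> d" for T T'
  proof -
    have "minor_le M T T' (x * (26 * sqrt (d * (1 + ln n))))" unfolding M_def by (rule minor_le_scale[OF SM(4)[OF that]]) (use x0 in simp)
    moreover have "x * (26 * sqrt (d * (1 + ln n))) = \<sigma>" by (simp add: x_def \<sigma>_def real_sqrt_divide)
    ultimately show ?thesis by simp
  qed
  define a where "a = cc ^ (2 * k)"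
  have cb: "0 < cc" "exp (-1) / 676 \<le> cc" "cc \<le> 1 / 676"
  proof -
    have xn': "n * x\<^sup>2 = 1 / 676" using xn by (simp only: mult.commute)
    show "0 < cc" by (rule cc_bounds(1))
    show "exp (-1) / 676 \<le> cc" using cc_bounds(3) unfolding xn by simp
    show "cc \<le> 1 / 676" using cc_le unfolding xn' .
  qed
  have a0: "0 < a" using cb by (simp add: a_def)
  have a1: "a \<le> 1 / 4"
  proof -
    have "cc ^ (2 * k) \<le> cc ^ 1" using cb k0 by (intro power_decreasing) auto
    then show ?thesis using cb(3) by (simp add: a_def)
  qed
  have aJ: "1 / a \<le> J" unfolding J a_def using cb by (intro divide_left_mono power_mono mult_pos_pos zero_less_power) auto
  obtain j :: nat where j: "j \<le> 1 / a" "\<And>u. \<bar>u\<bar> \<le> 1 / (16 * (2 * real j + 1)) \<Longrightarrow> (sin ((2 * real j + 1) * arcsin u))\<^sup>2 \<le> 1 / 3"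
      "\<And>u. \<bar>u - a\<bar> \<le> 1 / (16 * (2 * real j + 1)) \<Longrightarrow> 2 / 3 \<le> (sin ((2 * real j + 1) * arcsin u))\<^sup>2"
    using amplification_choice[OF a0 a1] by blast
  have jJ: "real j \<le> J" using j(1) aJ by linarith
  \<comment> \<open>There are at most \<open>(4 * k + 2) * 2 ^ (17 * P)\<close> labels, with
    \<open>4 * k + 2\<close> bounded by its power of 2: 16 parts of the exponent are block content,
    one is the position.\<close>
  let ?\<tau> = "1 / (16 * (2 * real j + 1))" and ?h = "17 * P + 4 * k + 2"
  have "\<exists>F. Q_cc (1 / 3) ((2 * k + 1) * n * (16 * P)) F \<le> 2 * Suc ?h * ((4 * k + 3) + j * (8 * k + 8)) \<and>
    P * d \<le> R_cc (1 / 3) ((2 * k + 1) * n * (16 * P)) F + 3"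
  proof (rule separation[OF k0 _ \<sigma>0 \<sigma>1 _ minors])
    show "0 < P" using P by simp
    show "0 < ?\<tau>" by simp
    show "(2 * k + 1) * n * 2 ^ (16 * P) + 2 * k * n + 1 \<le> 2 ^ ?h"
    proof -
      have e: "n * 2 ^ (16 * P) = 2 ^ (17 * P)" by (simp add: n_def flip: power_add)
      have "n \<le> 2 ^ (17 * P)" "1 \<le> (2 :: nat) ^ (17 * P)" by (simp_all add: n_def)
      then have "(2 * k + 1) * (n * 2 ^ (16 * P)) + 2 * k * n + 1 \<le> (2 * k + 1) * 2 ^ (17 * P) + 2 * k * 2 ^ (17 * P) + 2 ^ (17 * P)"
        unfolding e by (intro add_mono mult_left_mono) auto
      also have "\<dots> = (4 * k + 2) * 2 ^ (17 * P)" by (simp add: algebra_simps)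
      also have "\<dots> \<le> 2 ^ (4 * k + 2) * 2 ^ (17 * P)" using less_exp[of "4 * k + 2"] by (intro mult_right_mono) auto
      also have "\<dots> = 2 ^ ?h" unfolding power_add[symmetric] by (rule arg_cong[where f = "power 2"]) simp
      finally show ?thesis by (simp only: mult.assoc)
    qed
    show "(1 + 1 / (2 ^ P) ^ 4) ^ ((2 * k + 1) * n) - 1 \<le> (1 / 100 :: real)"
    proof -
      have "(1 + 1 / (2 ^ P) ^ 4 :: real) ^ ((2 * k + 1) * n) \<le> exp (1 / (2 ^ P) ^ 4) ^ ((2 * k + 1) * n)"
        by (intro power_mono exp_ge_add_one_self) auto
      also have "\<dots> = exp ((2 * real k + 1) * 2 ^ P / (2 ^ P) ^ 4)" by (simp add: nP algebra_simps add_divide_distrib flip: exp_of_nat_mult)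
      finally show ?thesis using e1 by linarith
    qed
    show "2 * sqrt (6 * ((6 * \<sigma>\<^sup>2) ^ k * n)) \<le> 1 / 100"
    proof -
      have "6 * ((6 * \<sigma>\<^sup>2) ^ k * n) \<le> (1 / 200)\<^sup>2" using dec by (simp add: power2_eq_square)
      then have "sqrt (6 * ((6 * \<sigma>\<^sup>2) ^ k * n)) \<le> 1 / 200" by (rule real_le_lsqrt[rotated]) simp
      then show ?thesis by simp
    qed
    show "2 ^ (k + 4) / (?\<tau>\<^sup>2 * n) \<le> 1 / 100"
    proof -
      have "1 / (16 * (2 * J + 1)) \<le> ?\<tau>" using jJ by (intro divide_left_mono mult_pos_pos) auto
      then have "(1 / (16 * (2 * J + 1)))\<^sup>2 \<le> ?\<tau>\<^sup>2" using jJ by (intro power_mono) auto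
      then have "(1 / (16 * (2 * J + 1)))\<^sup>2 * 2 ^ P \<le> ?\<tau>\<^sup>2 * n" unfolding nP by (intro mult_right_mono) auto
      moreover have "0 < (1 / (16 * (2 * J + 1)))\<^sup>2 * 2 ^ P" using jJ by (intro mult_pos_pos) auto
      ultimately have "2 ^ (k + 4) / (?\<tau>\<^sup>2 * n) \<le> 2 ^ (k + 4) / ((1 / (16 * (2 * J + 1)))\<^sup>2 * 2 ^ P)"
        by (intro divide_left_mono mult_pos_pos) (auto simp: n)
      then show ?thesis using e3 by linarith
    qed
  qed (use j(2,3) in \<open>simp_all only: a_def\<close>)
  then obtain F where F: "Q_cc (1 / 3) ((2 * k + 1) * n * (16 * P)) F \<le> 2 * Suc ?h * ((4 * k + 3) + j * (8 * k + 8))"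
    "P * d \<le> R_cc (1 / 3) ((2 * k + 1) * n * (16 * P)) F + 3" by blast
  have "real (Q_cc (1 / 3) ((2 * k + 1) * n * (16 * P)) F) \<le> real (2 * Suc ?h * ((4 * k + 3) + j * (8 * k + 8)))"
    using F(1) by (rule of_nat_mono)
  also have "\<dots> = 2 * (17 * real P + 4 * k + 3) * ((4 * k + 3) + real j * (8 * k + 8))" by (simp add: algebra_simps)
  also have "\<dots> \<le> 2 * (17 * real P + 4 * k + 3) * ((4 * k + 3) + J * (8 * k + 8))"
    using jJ by (intro mult_left_mono add_left_mono mult_right_mono) auto
  finally have 1: "real (Q_cc (1 / 3) ((2 * k + 1) * n * (16 * P)) F) \<le> 2 * (17 * real P + 4 * k + 3) * ((4 * k + 3) + J * (8 * k + 8))" .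
  \<comment> \<open>As \<open>d\<close> is at least 1, the surplus \<open>3 * d\<close> absorbs the
    additive 3.\<close>
  have "4 * d \<le> P * d" using P by (intro mult_right_mono) auto
  then have "d \<le> R_cc (1 / 3) ((2 * k + 1) * n * (16 * P)) F" using F(2) d1 by linarith
  then have "real d \<le> real (R_cc (1 / 3) ((2 * k + 1) * n * (16 * P)) F)" by (rule of_nat_mono)
  then have 2: "2 powr (P * (1 - \<delta>)) / 2 \<le> real (R_cc (1 / 3) ((2 * k + 1) * n * (16 * P)) F)"
    using d(2) big unfolding npow by linarith
  show ?thesis using 1 2 unfolding n_def by blast
qed

theorem theorem1p5:
  fixes \<epsilon> :: real
  assumes "\<epsilon> > 0"
  shows "\<exists>(S :: nat set) (F :: nat \<Rightarrow> partial_fun).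
    infinite S \<and>
    (\<lambda>N. real (Q_cc (1/3) N (F N))) \<in> O[inf sequentially (principal S)](\<lambda>N. ln (real N)) \<and>
    (\<lambda>N. real (R_cc (1/3) N (F N))) \<in> \<Omega>[inf sequentially (principal S)](\<lambda>N. real N powr (1 - \<epsilon>))"
proof -
  \<comment> \<open>One \<delta> is lost in the choice of \<open>d\<close>, the other pays for the
    factor \<open>A * P\<close> by which \<open>N\<close> exceeds \<open>2 ^ P\<close>.\<close>
  define \<delta> where "\<delta> = min \<epsilon> (1 / 2) / 2"
  have \<delta>: "0 < \<delta>" "\<delta> \<le> 1 / 4" "2 * \<delta> \<le> \<epsilon>" using assms by (auto simp: \<delta>_def)
  define k where "k = nat \<lceil>2 / \<delta>\<rceil>"
  have "2 / \<delta> \<le> real k" unfolding k_def by linarith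
  then have k: "2 \<le> k * \<delta>" using \<delta>(1) by (simp add: pos_divide_le_eq)
  define J :: real where "J = 1 / (exp (-1) / 676) ^ (2 * k)"
  have J0: "0 < J" by (simp add: J_def)
  define A where "A = real (16 * (2 * k + 1))"
  define \<tau> where "\<tau> = (1 / (16 * (2 * J + 1)))\<^sup>2"
  have \<tau>0: "0 < \<tau>" using J0 by (simp add: \<tau>_def)
  have ev1: "\<forall>\<^sub>F P in sequentially. exp ((2 * real k + 1) * 2 ^ P / (2 ^ P) ^ 4) - 1 \<le> (1 / 100 :: real)"
    by real_asymp
  have ev2: "\<forall>\<^sub>F P in sequentially. (6 * (1 + real P * ln 2)) ^ k / 2 ^ P \<le> 1 / 240000"
  proof -
    have "(\<lambda>P. (6 * (1 + real P * ln 2)) ^ k / 2 ^ P) \<longlonglongrightarrow> 0" by real_asymp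
    then have "\<forall>\<^sub>F P in sequentially. (6 * (1 + real P * ln 2)) ^ k / 2 ^ P < 1 / 240000" by (rule order_tendstoD) simp
    then show ?thesis by eventually_elim simp
  qed
  have ev3: "\<forall>\<^sub>F P in sequentially. 6 * (1 + real P * ln 2) * 2 powr (- (real P * \<delta>)) \<le> 1"
    using \<delta>(1) by real_asymp
  have ev4: "\<forall>\<^sub>F P in sequentially. 2 ^ (k + 4) / (\<tau> * 2 ^ P) \<le> 1 / 100"
  proof -
    have "(\<lambda>P. 2 ^ (k + 4) / \<tau> * (1 / 2) ^ P) \<longlonglongrightarrow> 2 ^ (k + 4) / \<tau> * 0"
      by (intro tendsto_mult tendsto_const LIMSEQ_realpow_zero) auto
    then have "\<forall>\<^sub>F P in sequentially. 2 ^ (k + 4) / \<tau> * (1 / 2) ^ P < 1 / 100" by (rule order_tendstoD) simp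
    then show ?thesis by eventually_elim (simp add: power_divide)
  qed
  have ev5: "\<forall>\<^sub>F P in sequentially. A * real P \<le> 2 powr (real P * \<delta>)"
    using \<delta>(1) by real_asymp
  obtain P0 where P0: "\<And>P. P0 \<le> P \<Longrightarrow> exp ((2 * real k + 1) * 2 ^ P / (2 ^ P) ^ 4) - 1 \<le> (1 / 100 :: real) \<and>
      (6 * (1 + real P * ln 2)) ^ k / 2 ^ P \<le> 1 / 240000 \<and> 6 * (1 + real P * ln 2) * 2 powr (- (real P * \<delta>)) \<le> 1 \<and>
      2 ^ (k + 4) / (\<tau> * 2 ^ P) \<le> 1 / 100 \<and> A * real P \<le> 2 powr (real P * \<delta>) \<and> 4 \<le> P"
    using eventually_conj[OF ev1 eventually_conj[OF ev2 eventually_conj[OF ev3 eventually_conj[OF ev4 eventually_conj[OF ev5 eventually_ge_at_top[of 4]]]]]]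
    unfolding eventually_sequentially by blast
  define NN :: "nat \<Rightarrow> nat" where "NN P = (2 * k + 1) * 2 ^ P * (16 * P)" for P
  \<comment> \<open>The input lengths realised by large \<open>P\<close>; all asymptotic statements
    are taken along them.\<close>
  define S where "S = NN ` {P0..}"
  define B where "B = (4 * real k + 3) + J * (8 * k + 8)"
  have B0: "0 \<le> B" using J0 by (simp add: B_def)
  define C where "C = 2 * (20 + 4 * real k) * B / ln 2"
  have NNge: "P \<le> NN P" "2 ^ P \<le> NN P" if "1 \<le> P" for P
  proof -
    have "1 * 1 * P \<le> (2 * k + 1) * 2 ^ P * (16 * P)" by (intro mult_mono) auto
    then show "P \<le> NN P" by (simp add: NN_def)
    have "1 * 2 ^ P * 1 \<le> (2 * k + 1) * 2 ^ P * (16 * P)" using that by (intro mult_mono) auto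
    then show "2 ^ P \<le> NN P" by (simp add: NN_def)
  qed
  have inf: "infinite S"
    unfolding infinite_nat_iff_unbounded
  proof
    fix m
    have "m < NN (m + P0 + 1)" using NNge(1)[of "m + P0 + 1"] by simp
    then show "\<exists>N>m. N \<in> S" by (intro exI[of _ "NN (m + P0 + 1)"]) (auto simp: S_def)
  qed
  have "\<forall>N\<in>S. \<exists>F. real (Q_cc (1/3) N F) \<le> C * ln (real N) \<and> 1 / 2 * real N powr (1 - \<epsilon>) \<le> real (R_cc (1/3) N F) \<and> 1 \<le> N"
  proof
    fix N assume "N \<in> S"
    then obtain P where P: "P0 \<le> P" "N = NN P" by (auto simp: S_def)
    note p = P0[OF P(1)]
    then have P4: "4 \<le> P" by blast
    have "\<exists>F. real (Q_cc (1 / 3) N F) \<le> 2 * (17 * real P + 4 * k + 3) * ((4 * k + 3) + J * (8 * k + 8)) \<and>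
        2 powr (P * (1 - \<delta>)) / 2 \<le> real (R_cc (1 / 3) N F)"
      unfolding P(2) NN_def
      by (rule separation_instance[OF \<delta>(1,2) k P4 J_def]) (use p in \<open>simp_all add: \<tau>_def\<close>)
    then obtain F where F: "real (Q_cc (1 / 3) N F) \<le> 2 * (17 * real P + 4 * k + 3) * ((4 * k + 3) + J * (8 * k + 8))"
        "2 powr (P * (1 - \<delta>)) / 2 \<le> real (R_cc (1 / 3) N F)" by blast
    have N2: "2 ^ P \<le> N" using NNge(2)[of P] P4 P(2) by simp
    have N1: "1 \<le> N" using N2 by (meson le_trans one_le_numeral one_le_power)
    have "real P * ln 2 = ln (2 ^ P)" by (simp add: ln_realpow)
    also have "\<dots> \<le> ln (real N)" using N2 N1 of_nat_mono[OF N2] by (simp add: ln_le_cancel_iff)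
    finally have PN: "real P * ln 2 \<le> ln (real N)" .
    have "real (Q_cc (1 / 3) N F) \<le> 2 * (17 * real P + 4 * k + 3) * B" using F(1) by (simp add: B_def)
    also have "\<dots> \<le> 2 * ((20 + 4 * real k) * P) * B"
    proof (intro mult_right_mono mult_left_mono B0)
      have "real k * 1 \<le> real k * real P" using P4 by (intro mult_left_mono) auto
      then show "17 * real P + 4 * k + 3 \<le> (20 + 4 * real k) * P" using P4 by (simp add: algebra_simps)
    qed simp
    also have "\<dots> = C * (real P * ln 2)" by (simp add: C_def)
    also have "\<dots> \<le> C * ln (real N)" using PN B0 by (intro mult_left_mono) (auto simp: C_def)
    finally have 1: "real (Q_cc (1 / 3) N F) \<le> C * ln (real N)" .
    have AP: "1 \<le> A * P" using mult_mono[of 1 A 1 "real P"] P4 by (simp add: A_def)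
    have Neq: "real N = A * P * 2 ^ P" by (simp add: P(2) NN_def A_def algebra_simps)
    have "real N powr (1 - \<epsilon>) \<le> real N powr (1 - 2 * \<delta>)" using N1 \<delta>(3) by (intro powr_mono) auto
    also have "\<dots> = (A * P) powr (1 - 2 * \<delta>) * 2 powr (P * (1 - 2 * \<delta>))"
      using AP by (simp add: Neq powr_mult powr_powr flip: powr_realpow)
    also have "\<dots> \<le> (A * P) powr 1 * 2 powr (P * (1 - 2 * \<delta>))" using AP \<delta> by (intro mult_right_mono powr_mono) auto
    also have "\<dots> \<le> 2 powr (P * \<delta>) * 2 powr (P * (1 - 2 * \<delta>))" using AP p by (intro mult_right_mono) auto
    also have "\<dots> = 2 powr (P * (1 - \<delta>))" by (simp add: algebra_simps flip: powr_add)
    finally have 2: "1 / 2 * real N powr (1 - \<epsilon>) \<le> real (R_cc (1 / 3) N F)" using F(2) by linarith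
    show "\<exists>F. real (Q_cc (1/3) N F) \<le> C * ln (real N) \<and> 1 / 2 * real N powr (1 - \<epsilon>) \<le> real (R_cc (1/3) N F) \<and> 1 \<le> N"
      using 1 2 N1 by blast
  qed
  then obtain F where F: "\<forall>N\<in>S. real (Q_cc (1/3) N (F N)) \<le> C * ln (real N) \<and> 1 / 2 * real N powr (1 - \<epsilon>) \<le> real (R_cc (1/3) N (F N)) \<and> 1 \<le> N"
    unfolding bchoice_iff by blast
  have "(\<lambda>N. real (Q_cc (1/3) N (F N))) \<in> O[inf sequentially (principal S)](\<lambda>N. ln (real N))"
  proof (rule bigoI[of _ C])
    show "\<forall>\<^sub>F N in inf sequentially (principal S). norm (real (Q_cc (1/3) N (F N))) \<le> C * norm (ln (real N))"
      unfolding eventually_inf_principal using F by (intro always_eventually) auto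
  qed
  moreover have "(\<lambda>N. real (R_cc (1/3) N (F N))) \<in> \<Omega>[inf sequentially (principal S)](\<lambda>N. real N powr (1 - \<epsilon>))"
  proof (rule landau_omega.bigI[of "1 / 2"])
    show "\<forall>\<^sub>F N in inf sequentially (principal S). norm (real (R_cc (1/3) N (F N))) \<ge> 1 / 2 * norm (real N powr (1 - \<epsilon>))"
      unfolding eventually_inf_principal using F by (intro always_eventually) auto
  qed simp
  ultimately show ?thesis using inf by blast
qed

end
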